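(* Let $T\in(0,\infty)$, let $\nu$ satisfy (H0) and let $\Omega$ and the spatial semigroup $e^{\mathcal L}$ satisfy (H1') (both conditions are stated in the context). Let $f\in L^\infty((0,T)\times\Omega)$ and $\phi\in L^\infty((-\infty,0)\times\Omega)$. Define $u$ on $(0,T)\times\Omega$ by the Feynman–Kac formula $$u(t,x)=\mathbf E\left[\phi\left(t-S^\nu_{\tau_0(t)},B^x_{S^\nu_{\tau_0(t)}}\right)\mathbf 1_{\{\tau_0(t)<\tau_0(\tau_\Omega(x))\}}\right]+\mathbf E\left[\int_0^{\tau_0(t)\wedge\tau_0(\tau_\Omega(x))}f\left(t-S^\nu_s,B^x_{S^\nu_s}\right)ds\right],$$ and $u=\phi$ on $(-\infty,0)\times\Omega$. Then $u$ is a weak solution to the problem $$H^\nu u=-f\ \text{ in }(0,T]\times\Omega,\qquad u=\phi\ \text{ in }(-\infty,0]\times\Omega,$$ that is, $u\in L^\infty((-\infty,T)\times\Omega)$, $u=\phi$ a.e. on $(-\infty,0)\times\Omega$, and $$\int_{-\infty}^T\int_\Omega u(t,x)\,H^{\nu,*}\varphi(t,x)\,dx\,dt=-\int_0^T\int_\Omega f(t,x)\varphi(t,x)\,dx\,dt$$ for every $\varphi$ of the form $\varphi(t,x)=p(t)q(x)$ with $p\in C^1_c(0,T)$ and $q\in\operatorname{Dom}(\mathcal L)$.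
   Context: **Function spaces.** For $E\subset\mathbb R^d$, $C_\infty(E)$ is the Banach space (sup norm) of continuous real functions on the one-point compactification $E\cup\{\partial\}$ vanishing at $\partial$ (continuous functions on $E$ vanishing at infinity). $C^1_c(0,T)$ is the set of $C^1$ functions $p:\mathbb R\to\mathbb R$ with compact support in $(0,T)$. A Feller semigroup is a strongly continuous contraction semigroup on such a space preserving non-negative functions. **(H0).** $\nu:(0,\infty)\to[0,\infty)$ is continuous with $\int_0^\infty(r\wedge1)\nu(r)\,dr<\infty$ and $\int_0^\infty\nu(r)\,dr=\infty$. **(H1').** $\Omega\subset\mathbb R^d$ is bounded and open, and $\{e^{r\mathcal L}\}_{r\ge0}$ is a Feller semigroup on $X=C_\infty(E)$, where $E=\Omega$ or $E=\overline\Omega$, with generator $(\mathcal L,\operatorname{Dom}(\mathcal L))$, $\operatorname{Dom}(\mathcal L)\subset X$, such that for each $r>0$ and each $x\in E$ the operator $e^{r\mathcal L}$ has a density $y\mapsto p^\Omega_r(x,y)$ with respect to Lebesgue measure, and $$\int_\Omega e^{r\mathcal L}v(x)\,w(x)\,dx=\int_\Omega v(x)\,e^{r\mathcal L}w(x)\,dx\quad\text{for all }v,w\in X,\ r>0.$$ **Processes.** $B^x$ is the càdlàg Feller process on $E$ with semigroup $e^{\mathcal L}$ started at $x$; $\tau_\Omega(x)$ is its life time (after which it stays in the cemetery $\partial$). $S^\nu$ is the Lévy subordinator, independent of $B$, with $\log\mathbf E[e^{-kS^\nu_r}]=r\int_0^\infty(e^{-ks}-1)\nu(s)\,ds$ for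 $r,k>0$. $\tau_0(t)=\inf\{r>0:S^\nu_r>t\}$ for $t>0$, and $\tau_0(\infty)=\infty$. If $E=\overline\Omega$, functions given on $\Omega$ are extended by $0$ to $\partial\Omega$ in the spatial variable when evaluated along $B$. **Operators.** $H^\nu u(t,x)=\int_0^\infty\big((e^{r\mathcal L}u(t-r,\cdot))(x)-u(t,x)\big)\nu(r)\,dr$ and $$H^{\nu,*}\varphi(t,x)=\int_0^\infty\big((e^{r\mathcal L}\varphi(t+r,\cdot))(x)-\varphi(t,x)\big)\nu(r)\,dr .$$ *)

theory Defs
  imports "HOL-Probability.Probability"
begin

subsection \<open>Function spaces\<close>

text \<open>The one-point compactification of \<open>E\<close>; \<^term>\<open>None\<close> is the cemetery.\<close>

abbreviation compactification :: "'a::euclidean_space set \<Rightarrow> 'a option topology" where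
  "compactification E \<equiv> Alexandroff_compactification (top_of_set E)"

definition at_cemetery0 :: "('a \<Rightarrow> real) \<Rightarrow> 'a option \<Rightarrow> real" where
  "at_cemetery0 v z = (case z of None \<Rightarrow> 0 | Some x \<Rightarrow> v x)"

text \<open>Functions on \<open>E\<close> are represented by total functions that are \<open>0\<close> off \<open>E\<close>, so that an element
  of the space is determined by its values on \<open>E\<close> and its norm is the supremum over the whole type.\<close>

definition C_infty :: "'a::euclidean_space set \<Rightarrow> ('a \<Rightarrow> real) set" where
  "C_infty E = {v. (\<forall>x. x \<notin> E \<longrightarrow> v x = 0) \<and>
     continuous_map (compactification E) euclideanreal (at_cemetery0 v)}"

definition sup_norm :: "('a \<Rightarrow> real) \<Rightarrow> real" where
  "sup_norm v = (SUP x. \<bar>v x\<bar>)"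

definition C1c :: "real \<Rightarrow> (real \<Rightarrow> real) set" where
  "C1c T = {p. p C1_differentiable_on UNIV \<and>
     compact (closure {t. p t \<noteq> 0}) \<and> closure {t. p t \<noteq> 0} \<subseteq> {0<..<T}}"

definition L_infty :: "(real \<times> 'a::euclidean_space) set \<Rightarrow> (real \<Rightarrow> 'a \<Rightarrow> real) set" where
  "L_infty A = {g. set_borel_measurable lebesgue A (case_prod g) \<and>
     (\<exists>C. AE (t, x) in lebesgue. (t, x) \<in> A \<longrightarrow> \<bar>g t x\<bar> \<le> C)}"


subsection \<open>Feller semigroups and the standing assumptions\<close>

definition feller_semigroup ::
  "'a::euclidean_space set \<Rightarrow> (real \<Rightarrow> ('a \<Rightarrow> real) \<Rightarrow> ('a \<Rightarrow> real)) \<Rightarrow> bool" where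
  "feller_semigroup E P \<longleftrightarrow>
     (\<forall>r\<ge>0. \<forall>v\<in>C_infty E. P r v \<in> C_infty E) \<and>
     (\<forall>r\<ge>0. \<forall>v\<in>C_infty E. \<forall>w\<in>C_infty E. \<forall>a b.
        P r (\<lambda>x. a * v x + b * w x) = (\<lambda>x. a * P r v x + b * P r w x)) \<and>
     (\<forall>v\<in>C_infty E. P 0 v = v) \<and>
     (\<forall>r\<ge>0. \<forall>s\<ge>0. \<forall>v\<in>C_infty E. P (r + s) v = P r (P s v)) \<and>
     (\<forall>v\<in>C_infty E. ((\<lambda>r. sup_norm (\<lambda>x. P r v x - v x)) \<longlongrightarrow> 0) (at_right 0)) \<and>
     (\<forall>r\<ge>0. \<forall>v\<in>C_infty E. sup_norm (P r v) \<le> sup_norm v) \<and>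
     (\<forall>r\<ge>0. \<forall>v\<in>C_infty E. (\<forall>x. 0 \<le> v x) \<longrightarrow> (\<forall>x. 0 \<le> P r v x))"

text \<open>The graph of the generator.\<close>

definition generator ::
  "'a::euclidean_space set \<Rightarrow> (real \<Rightarrow> ('a \<Rightarrow> real) \<Rightarrow> ('a \<Rightarrow> real)) \<Rightarrow>
   ('a \<Rightarrow> real) \<Rightarrow> ('a \<Rightarrow> real) \<Rightarrow> bool" where
  "generator E P v g \<longleftrightarrow> v \<in> C_infty E \<and> g \<in> C_infty E \<and>
     ((\<lambda>r. sup_norm (\<lambda>x. (P r v x - v x) / r - g x)) \<longlongrightarrow> 0) (at_right 0)"

definition Dom ::
  "'a::euclidean_space set \<Rightarrow> (real \<Rightarrow> ('a \<Rightarrow> real) \<Rightarrow> ('a \<Rightarrow> real)) \<Rightarrow> ('a \<Rightarrow> real) set" where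
  "Dom E P = {v. \<exists>g. generator E P v g}"

definition H0 :: "(real \<Rightarrow> real) \<Rightarrow> bool" where
  "H0 \<nu> \<longleftrightarrow> continuous_on {0<..} \<nu> \<and> (\<forall>r>0. 0 \<le> \<nu> r) \<and>
     (\<integral>\<^sup>+r\<in>{0<..}. ennreal (min r 1 * \<nu> r) \<partial>lborel) < \<infinity> \<and>
     (\<integral>\<^sup>+r\<in>{0<..}. ennreal (\<nu> r) \<partial>lborel) = \<infinity>"

text \<open>If \<open>E\<close> is the closure of \<open>\<Omega>\<close>, the density may charge the boundary of \<open>\<Omega>\<close>, which is not assumed
  to be a null set; a density that lives on \<open>\<Omega>\<close> is the special case in which it vanishes there.\<close>

definition H1' ::
  "'a::euclidean_space set \<Rightarrow> 'a set \<Rightarrow> (real \<Rightarrow> ('a \<Rightarrow> real) \<Rightarrow> ('a \<Rightarrow> real)) \<Rightarrow> bool" where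
  "H1' \<Omega> E P \<longleftrightarrow> bounded \<Omega> \<and> open \<Omega> \<and> (E = \<Omega> \<or> E = closure \<Omega>) \<and> feller_semigroup E P \<and>
     (\<forall>r>0. \<forall>x\<in>E. \<exists>p. (\<forall>y. 0 \<le> p y) \<and> set_integrable lborel E p \<and>
        (\<forall>v\<in>C_infty E. P r v x = (LBINT y:E. p y * v y))) \<and>
     (\<forall>r>0. \<forall>v\<in>C_infty E. \<forall>w\<in>C_infty E.
        (LBINT x:\<Omega>. P r v x * w x) = (LBINT x:\<Omega>. v x * P r w x))"


subsection \<open>Processes\<close>

definition borel_compactification :: "'a::euclidean_space set \<Rightarrow> 'a option measure" where
  "borel_compactification E =
     sigma (topspace (compactification E)) {U. openin (compactification E) U}"

definition natural_filtration ::
  "'w measure \<Rightarrow> 'b measure \<Rightarrow> (real \<Rightarrow> 'w \<Rightarrow> 'b) \<Rightarrow> real \<Rightarrow> 'w measure" where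
  "natural_filtration M N Y t =
     sigma (space M) {Y s -` A \<inter> space M |s A. 0 \<le> s \<and> s \<le> t \<and> A \<in> sets N}"

definition feller_process ::
  "'w measure \<Rightarrow> 'a::euclidean_space set \<Rightarrow> (real \<Rightarrow> ('a \<Rightarrow> real) \<Rightarrow> ('a \<Rightarrow> real)) \<Rightarrow> 'a \<Rightarrow>
   (real \<Rightarrow> 'w \<Rightarrow> 'a option) \<Rightarrow> bool" where
  "feller_process M E P x Y \<longleftrightarrow>
     (\<forall>t\<ge>0. Y t \<in> measurable M (borel_compactification E)) \<and>
     (AE \<omega> in M. Y 0 \<omega> = Some x) \<and>
     (\<forall>\<omega>\<in>space M. \<forall>t\<ge>0. limitin (compactification E) (\<lambda>s. Y s \<omega>) (Y t \<omega>) (at_right t)) \<and>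
     (\<forall>\<omega>\<in>space M. \<forall>t>0. \<exists>l. limitin (compactification E) (\<lambda>s. Y s \<omega>) l (at_left t)) \<and>
     (\<forall>\<omega>\<in>space M. \<forall>s\<ge>0. \<forall>t\<ge>s. Y s \<omega> = None \<longrightarrow> Y t \<omega> = None) \<and>
     (\<forall>s\<ge>0. \<forall>t\<ge>0. \<forall>v\<in>C_infty E.
        AE \<omega> in M.
          real_cond_exp M (natural_filtration M (borel_compactification E) Y t)
            (\<lambda>\<omega>'. at_cemetery0 v (Y (t + s) \<omega>')) \<omega>
          = at_cemetery0 (P s v) (Y t \<omega>))"

definition lifetime :: "(real \<Rightarrow> 'a option) \<Rightarrow> ereal" where
  "lifetime b = Inf (ereal ` {t. 0 \<le> t \<and> b t = None})"

definition levy_subordinator ::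
  "'w measure \<Rightarrow> (real \<Rightarrow> real) \<Rightarrow> (real \<Rightarrow> 'w \<Rightarrow> real) \<Rightarrow> bool" where
  "levy_subordinator M \<nu> S \<longleftrightarrow>
     (\<forall>r\<ge>0. S r \<in> borel_measurable M) \<and>
     (AE \<omega> in M. S 0 \<omega> = 0) \<and>
     (\<forall>(t :: nat \<Rightarrow> real) n. 0 \<le> t 0 \<and> mono t \<longrightarrow>
        prob_space.indep_vars M (\<lambda>_. borel) (\<lambda>i \<omega>. S (t (Suc i)) \<omega> - S (t i) \<omega>) {..<n}) \<and>
     (\<forall>s\<ge>0. \<forall>r\<ge>0. distr M borel (\<lambda>\<omega>. S (s + r) \<omega> - S s \<omega>) = distr M borel (S r)) \<and>
     (\<forall>\<omega>\<in>space M. \<forall>r\<ge>0. continuous (at_right r) (\<lambda>s. S s \<omega>)) \<and>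
     (\<forall>\<omega>\<in>space M. mono_on {0..} (\<lambda>r. S r \<omega>)) \<and>
     (\<forall>r>0. \<forall>k>0. ln (\<integral>\<omega>. exp (- k * S r \<omega>) \<partial>M)
        = r * (LBINT s:{0<..}. (exp (- k * s) - 1) * \<nu> s))"

text \<open>The infimum of the empty set is \<open>\<infinity>\<close>; in particular the value at \<open>t = \<infinity>\<close> is \<open>\<infinity>\<close>.\<close>

definition tau0 :: "(real \<Rightarrow> real) \<Rightarrow> ereal \<Rightarrow> ereal" where
  "tau0 \<sigma> t = Inf (ereal ` {r. 0 < r \<and> t < ereal (\<sigma> r)})"

definition independent_processes ::
  "'w measure \<Rightarrow> 'b measure \<Rightarrow> (real \<Rightarrow> 'w \<Rightarrow> 'b) \<Rightarrow> 'c measure \<Rightarrow> (real \<Rightarrow> 'w \<Rightarrow> 'c) \<Rightarrow> bool" where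
  "independent_processes M N Y K Z \<longleftrightarrow>
     prob_space.indep_set M
       (sets (vimage_algebra (space M) (\<lambda>\<omega>. \<lambda>t\<in>{0..}. Y t \<omega>) (Pi\<^sub>M {0..} (\<lambda>_. N))))
       (sets (vimage_algebra (space M) (\<lambda>\<omega>. \<lambda>t\<in>{0..}. Z t \<omega>) (Pi\<^sub>M {0..} (\<lambda>_. K))))"


subsection \<open>The Feynman--Kac formula and weak solutions\<close>

text \<open>A function given on \<open>D\<close>, extended by \<open>0\<close> (in particular to the boundary of \<open>\<Omega>\<close> and to the
  cemetery).\<close>

definition along ::
  "(real \<times> 'a) set \<Rightarrow> (real \<Rightarrow> 'a \<Rightarrow> real) \<Rightarrow> real \<Rightarrow> 'a option \<Rightarrow> real" where
  "along D g t z = (case z of None \<Rightarrow> 0 | Some y \<Rightarrow> if (t, y) \<in> D then g t y else 0)"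

text \<open>The data \<open>f\<close> and \<open>\<phi>\<close> are only Lebesgue measurable, so their compositions with the processes
  are measurable only up to null sets. Expectations are therefore taken with respect to the
  completion of \<open>M\<close>; for \<open>M\<close>-measurable integrands this changes nothing.

  \<open>tau0 (\<lambda>r. S r \<omega>) t\<close> is almost surely finite, so the value of \<^const>\<open>real_of_ereal\<close> at \<open>\<infinity>\<close> is
  irrelevant.\<close>

definition feynman_kac ::
  "'w measure \<Rightarrow> real \<Rightarrow> 'a set \<Rightarrow> ('a \<Rightarrow> real \<Rightarrow> 'w \<Rightarrow> 'a option) \<Rightarrow> (real \<Rightarrow> 'w \<Rightarrow> real) \<Rightarrow>
   (real \<Rightarrow> 'a \<Rightarrow> real) \<Rightarrow> (real \<Rightarrow> 'a \<Rightarrow> real) \<Rightarrow> real \<Rightarrow> 'a \<Rightarrow> real" where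
  "feynman_kac M T \<Omega> B S f \<phi> t x =
     (\<integral>\<omega>. (let \<tau> = tau0 (\<lambda>r. S r \<omega>) (ereal t);
               \<tau>\<^sub>\<Omega> = tau0 (\<lambda>r. S r \<omega>) (lifetime (\<lambda>r. B x r \<omega>));
               s = S (real_of_ereal \<tau>) \<omega>
           in along ({..<0} \<times> \<Omega>) \<phi> (t - s) (B x s \<omega>) * of_bool (\<tau> < \<tau>\<^sub>\<Omega>)) \<partial>completion M)
     + (\<integral>\<omega>. (let \<tau> = tau0 (\<lambda>r. S r \<omega>) (ereal t);
                 \<tau>\<^sub>\<Omega> = tau0 (\<lambda>r. S r \<omega>) (lifetime (\<lambda>r. B x r \<omega>))
             in LINT s:{s. 0 < s \<and> ereal s < min \<tau> \<tau>\<^sub>\<Omega>}|lebesgue.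
                  along ({0<..<T} \<times> \<Omega>) f (t - S s \<omega>) (B x (S s \<omega>) \<omega>)) \<partial>completion M)"

definition H_star ::
  "(real \<Rightarrow> real) \<Rightarrow> (real \<Rightarrow> ('a \<Rightarrow> real) \<Rightarrow> ('a \<Rightarrow> real)) \<Rightarrow> (real \<Rightarrow> 'a \<Rightarrow> real) \<Rightarrow>
   real \<Rightarrow> 'a \<Rightarrow> real" where
  "H_star \<nu> P \<psi> t x = (LBINT r:{0<..}. (P r (\<psi> (t + r)) x - \<psi> t x) * \<nu> r)"

text \<open>The integral identity of a weak solution presupposes that its integrals exist; since
  non-integrable functions have Bochner integral \<open>0\<close>, this is made explicit for the integral that
  defines \<^const>\<open>H_star\<close> and for the left-hand side. On the right-hand side it is automatic.\<close>

definition weak_solution ::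
  "real \<Rightarrow> (real \<Rightarrow> real) \<Rightarrow> 'a::euclidean_space set \<Rightarrow> 'a set \<Rightarrow>
   (real \<Rightarrow> ('a \<Rightarrow> real) \<Rightarrow> ('a \<Rightarrow> real)) \<Rightarrow> (real \<Rightarrow> 'a \<Rightarrow> real) \<Rightarrow> (real \<Rightarrow> 'a \<Rightarrow> real) \<Rightarrow>
   (real \<Rightarrow> 'a \<Rightarrow> real) \<Rightarrow> bool" where
  "weak_solution T \<nu> \<Omega> E P f \<phi> u \<longleftrightarrow>
     u \<in> L_infty ({..<T} \<times> \<Omega>) \<and>
     (AE (t, x) in lebesgue. (t, x) \<in> {..<0} \<times> \<Omega> \<longrightarrow> u t x = \<phi> t x) \<and>
     (\<forall>p\<in>C1c T. \<forall>q\<in>Dom E P.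
        let \<psi> = (\<lambda>t x. p t * q x) in
          (\<forall>t<T. \<forall>x\<in>\<Omega>.
             set_integrable lborel {0<..} (\<lambda>r. (P r (\<psi> (t + r)) x - \<psi> t x) * \<nu> r)) \<and>
          set_integrable lebesgue ({..<T} \<times> \<Omega>) (\<lambda>(t, x). u t x * H_star \<nu> P \<psi> t x) \<and>
          (LINT t:{..<T}|lebesgue. LINT x:\<Omega>|lebesgue. u t x * H_star \<nu> P \<psi> t x)
            = - (LINT t:{0<..<T}|lebesgue. LINT x:\<Omega>|lebesgue. f t x * \<psi> t x))"

end

theory Submission
  imports Defs
begin

text \<open>Let \<open>U\<close> be the potential measure of \<open>S\<close>, let \<open>D t\<close> be the first value of \<open>S\<close> beyond \<open>t\<close>, and let \<open>\<kappa>\<close>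
  be the transition kernel of the spatial semigroup. Since functions are extended by \<open>0\<close> to the
  cemetery, the indicator in the Feynman--Kac formula is redundant, and independence gives, for
  almost every \<open>(t, x)\<close>,
  \<open>u(t, x) = E[\<integral> \<phi>(t - D t, z) \<kappa>(D t, x, dz)] + \<integral>\<integral> f(t - y, z) \<kappa>(y, x, dz) U(dy)\<close>.
  The symmetry of \<open>\<kappa>\<close> moves it onto \<open>H_star \<nu> P \<psi>\<close>, so that for fixed \<open>x\<close> only the orbit \<open>y \<mapsto> P y q x\<close>
  enters, and the weak identity becomes a statement about functions of time. That statement follows from
  the compensation formula
  \<open>\<integral> E[G(t, D t)] dt = \<integral>\<integral>\<integral> [z \<le> t < z + r] G(t, z + r) dt \<nu>(r) dr U(dz)\<close>,
  whose two sides, as measures in \<open>(t, D t)\<close>, have the same bivariate Laplace transform; the special case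
  \<open>G(t, y) = F' t\<close> says that \<open>U\<close> inverts the generator of \<open>S\<close>. By symmetry the
  kernels do not charge null sets of space-time, so \<open>f\<close> and \<open>\<phi>\<close> may be replaced by Borel versions.\<close>

subsection \<open>Finite measures determined by open sets and by rectangles\<close>

text \<open>The subordinator is known only through its increments and its Laplace exponent, so its
  jumps are not at hand as a point process and the compensation formula cannot be read off from
  them. What can be computed is the law of (t, D t) along the grids of mesh 1/(n+1): each grid cell
  contributes a product of Laplace transforms of two increments, the cells form a geometric series,
  and in the limit the transform is (\<open>psi\<close> (a+b) - \<open>psi\<close> b) / (a
  \<open>psi\<close> (a+b)). The factor 1 / \<open>psi\<close> (a+b) is the transform of the
  potential measure, the other factor comes from the jump sizes. Two further obstacles shape the
  proof. The spatial densities are given separately for each time and starting point, so joint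
  measurability of the kernels, and their symmetry for Borel functions, have to be recovered from
  the action on continuous functions. And the history is merely bounded on an infinite time
  interval; its pairing with the test function is integrable because p vanishes at negative
  times.\<close>

lemma finite_measure_eqI_open:
  fixes \<mu> \<mu>' :: "'b::topological_space measure"
  assumes sets: "sets \<mu> = sets borel" "sets \<mu>' = sets borel"
    and fin: "emeasure \<mu> UNIV \<noteq> \<infinity>"
    and eq: "\<And>A. open A \<Longrightarrow> emeasure \<mu> A = emeasure \<mu>' A"
  shows "\<mu> = \<mu>'"
proof (rule measure_eqI_generator_eq[where E = "{S. open S}" and \<Omega> = UNIV and A = "\<lambda>_. UNIV"])
  show "Int_stable {S::'b set. open S}" by (auto simp: Int_stable_def)
  show "sets \<mu> = sigma_sets UNIV {S. open S}" "sets \<mu>' = sigma_sets UNIV {S. open S}"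
    using sets by (auto simp: borel_def)
qed (use eq fin in auto)

text \<open>Agreement is extended from open to Borel sets one side of the rectangle at a time: with
  one side fixed, both sides of the equation are finite measures in the other side, and open sets
  determine these.\<close>

lemma finite_measure_eqI_rectangles:
  fixes \<mu> \<mu>' :: "('b::topological_space \<times> 'c::topological_space) measure"
  assumes sets: "sets \<mu> = sets (borel \<Otimes>\<^sub>M borel)" "sets \<mu>' = sets (borel \<Otimes>\<^sub>M borel)"
    and fin: "emeasure \<mu> UNIV \<noteq> \<infinity>"
    and eq: "\<And>A B. open A \<Longrightarrow> open B \<Longrightarrow> emeasure \<mu> (A \<times> B) = emeasure \<mu>' (A \<times> B)"
  shows "\<mu> = \<mu>'"
proof -
  have m1: "fst \<in> measurable \<mu> borel" "fst \<in> measurable \<mu>' borel"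
    "snd \<in> measurable \<mu> borel" "snd \<in> measurable \<mu>' borel"
    using sets by (auto cong: measurable_cong_sets)
  have sp: "space \<mu> = UNIV" "space \<mu>' = UNIV"
    using sets[THEN sets_eq_imp_space_eq] by (auto simp: space_pair_measure)
  have fin_le: "emeasure \<mu> C \<noteq> \<infinity>" for C
    using fin emeasure_space[of \<mu> C] sp by (auto simp: top_unique)
  have step1: "emeasure \<mu> (A \<times> B) = emeasure \<mu>' (A \<times> B)" if A: "open A" and B: "B \<in> sets borel" for A B
  proof -
    have AU: "A \<times> UNIV \<in> sets (borel \<Otimes>\<^sub>M borel)" using A by auto
    \<comment> \<open>Restricting to a strip and projecting turns
      \<open>C \<mapsto> \<mu> (A \<times> C)\<close> into a measure.\<close>
    define N N' where "N = distr (density \<mu> (indicator (A \<times> UNIV))) borel snd"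
      and "N' = distr (density \<mu>' (indicator (A \<times> UNIV))) borel snd"
    have N: "emeasure N C = emeasure \<mu> (A \<times> C)" "emeasure N' C = emeasure \<mu>' (A \<times> C)"
      if C: "C \<in> sets borel" for C
    proof -
      have e: "snd -` C = (UNIV :: 'b set) \<times> C" by auto
      have c: "UNIV \<times> C \<in> sets (borel \<Otimes>\<^sub>M borel)" using C by auto
      have i: "A \<times> UNIV \<inter> UNIV \<times> C = A \<times> C" by auto
      show "emeasure N C = emeasure \<mu> (A \<times> C)" "emeasure N' C = emeasure \<mu>' (A \<times> C)"
        unfolding N_def N'_def using C sp m1 i sets
        by (simp_all add: emeasure_distr e c AU emeasure_restricted)
    qed
    have "N = N'"
    proof (rule finite_measure_eqI_open)
      show "emeasure N UNIV \<noteq> \<infinity>" using N(1)[of UNIV] fin_le by simp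
    qed (simp_all only: N borel_open eq[OF A], simp_all add: N_def N'_def)
    with N B show ?thesis by metis
  qed
  have step2: "emeasure \<mu> (A \<times> B) = emeasure \<mu>' (A \<times> B)"
    if A: "A \<in> sets borel" and B: "B \<in> sets borel" for A B
  proof -
    have AU: "UNIV \<times> B \<in> sets (borel \<Otimes>\<^sub>M borel)" using B by auto
    define N N' where "N = distr (density \<mu> (indicator (UNIV \<times> B))) borel fst"
      and "N' = distr (density \<mu>' (indicator (UNIV \<times> B))) borel fst"
    have N: "emeasure N C = emeasure \<mu> (C \<times> B)" "emeasure N' C = emeasure \<mu>' (C \<times> B)"
      if C: "C \<in> sets borel" for C
    proof -
      have e: "fst -` C = C \<times> (UNIV :: 'c set)" by auto
      have c: "C \<times> UNIV \<in> sets (borel \<Otimes>\<^sub>M borel)" using C by auto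
      have i: "UNIV \<times> B \<inter> C \<times> UNIV = C \<times> B" by auto
      show "emeasure N C = emeasure \<mu> (C \<times> B)" "emeasure N' C = emeasure \<mu>' (C \<times> B)"
        unfolding N_def N'_def using C sp m1 i sets
        by (simp_all add: emeasure_distr e c AU emeasure_restricted)
    qed
    have "N = N'"
    proof (rule finite_measure_eqI_open)
      show "emeasure N UNIV \<noteq> \<infinity>" using N(1)[of UNIV] fin_le by simp
    qed (simp_all only: N borel_open step1[OF _ B], simp_all add: N_def N'_def)
    with N A show ?thesis by metis
  qed
  show ?thesis
  proof (rule measure_eqI_generator_eq[where \<Omega> = UNIV and A = "\<lambda>_. UNIV"])
    show "Int_stable {a \<times> b | a b. a \<in> sets (borel :: 'b measure) \<and> b \<in> sets (borel :: 'c measure)}"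
      by (rule Int_stable_pair_measure_generator)
    show "sets \<mu> = sigma_sets UNIV {a \<times> b | a b. a \<in> sets (borel :: 'b measure) \<and> b \<in> sets (borel :: 'c measure)}"
      "sets \<mu>' = sigma_sets UNIV {a \<times> b | a b. a \<in> sets (borel :: 'b measure) \<and> b \<in> sets (borel :: 'c measure)}"
      using sets by (simp_all add: sets_pair_measure)
    show "range (\<lambda>_::nat. UNIV) \<subseteq> {a \<times> b | a b. a \<in> sets (borel :: 'b measure) \<and> b \<in> sets (borel :: 'c measure)}"
      by (auto intro!: exI[of _ UNIV])
  qed (use step2 fin in auto)
qed

subsection \<open>Right-continuous processes\<close>

text \<open>The least multiple of 1/(n+1) strictly above r. Strictness matters because the filter
  \<open>at_right r\<close> excludes r itself.\<close>

definition right_approx :: "nat \<Rightarrow> real \<Rightarrow> real" where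
  "right_approx n r = (of_int \<lfloor>real (Suc n) * r\<rfloor> + 1) / real (Suc n)"

lemma right_approx_gt: "r < right_approx n r"
proof -
  have "real (Suc n) * r < of_int \<lfloor>real (Suc n) * r\<rfloor> + 1" by linarith
  then show ?thesis unfolding right_approx_def by (simp add: field_simps)
qed

lemma right_approx_le: "right_approx n r \<le> r + 1 / real (Suc n)"
proof -
  have "of_int \<lfloor>real (Suc n) * r\<rfloor> \<le> real (Suc n) * r" by linarith
  then have "right_approx n r \<le> (real (Suc n) * r + 1) / real (Suc n)"
    unfolding right_approx_def by (intro divide_right_mono add_right_mono) auto
  also have "\<dots> = r + 1 / real (Suc n)" by (simp add: field_simps)
  finally show ?thesis .
qed

lemma filterlim_at_right_squeeze:
  fixes d :: "nat \<Rightarrow> real"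
  assumes "\<And>n. r < d n" "\<And>n. d n \<le> r + 1 / real (Suc n)"
  shows "filterlim d (at_right r) sequentially"
proof -
  have "(\<lambda>n. r + 1 / real (Suc n)) \<longlonglongrightarrow> r + 0"
    by (intro tendsto_intros LIMSEQ_Suc[OF lim_1_over_n])
  then have "d \<longlonglongrightarrow> r"
    by (intro tendsto_sandwich[where f="\<lambda>_. r" and g=d and h="\<lambda>n. r + 1 / real (Suc n)"])
       (use assms in \<open>auto intro!: always_eventually less_imp_le\<close>)
  then show ?thesis
    unfolding filterlim_at using assms by (auto intro: always_eventually)
qed

lemma filterlim_right_approx: "filterlim (\<lambda>n. right_approx n r) (at_right r) sequentially"
  by (rule filterlim_at_right_squeeze) (rule right_approx_gt right_approx_le)+

text \<open>At the times \<open>right_approx n\<close> only countably many random variables are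
  involved, so the approximations are jointly measurable, and right-continuity passes to the limit.
  The cut \<open>max 0\<close> lets the time variable range over the whole line.\<close>

lemma borel_measurable_right_continuous:
  fixes X :: "real \<Rightarrow> 'w \<Rightarrow> real"
  assumes X: "\<And>r. 0 \<le> r \<Longrightarrow> X r \<in> borel_measurable M"
    and rc: "\<And>\<omega> r. \<omega> \<in> space M \<Longrightarrow> 0 \<le> r \<Longrightarrow> ((\<lambda>s. X s \<omega>) \<longlongrightarrow> X r \<omega>) (at_right r)"
  shows "(\<lambda>(r, \<omega>). X (max 0 r) \<omega>) \<in> borel_measurable (borel \<Otimes>\<^sub>M M)"
proof (rule borel_measurable_LIMSEQ_real)
  fix n
  have "(\<lambda>z. X (max 0 ((of_int j + 1) / real (Suc n))) (snd z)) \<in> borel_measurable (borel \<Otimes>\<^sub>M M)" for j :: int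
    using X[of "max 0 ((of_int j + 1) / real (Suc n))"] by measurable
  from measurable_compose_countable[where f="\<lambda>j z. X (max 0 ((of_int j + 1) / real (Suc n))) (snd z)", OF this,
      where g="\<lambda>z. \<lfloor>real (Suc n) * max 0 (fst z)\<rfloor>"]
  have "(\<lambda>z. X (max 0 (right_approx n (max 0 (fst z)))) (snd z)) \<in> borel_measurable (borel \<Otimes>\<^sub>M M)"
    unfolding right_approx_def by measurable
  then show "(\<lambda>z. X (max 0 (right_approx n (max 0 (fst z)))) (snd z)) \<in> borel_measurable (borel \<Otimes>\<^sub>M M)" .
next
  fix z :: "real \<times> 'w" assume z: "z \<in> space (borel \<Otimes>\<^sub>M M)"
  obtain r \<omega> where [simp]: "z = (r, \<omega>)" by force
  have "\<omega> \<in> space M" using z by (auto simp: space_pair_measure)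
  then have "(\<lambda>n. X (right_approx n (max 0 r)) \<omega>) \<longlonglongrightarrow> X (max 0 r) \<omega>"
    by (intro filterlim_compose[OF rc filterlim_right_approx]) auto
  moreover have "max 0 (right_approx n (max 0 r)) = right_approx n (max 0 r)" for n
    using right_approx_gt[of "max 0 r" n] by auto
  ultimately show "(\<lambda>n. X (max 0 (right_approx n (max 0 (fst z)))) (snd z)) \<longlonglongrightarrow> (case z of (r, \<omega>) \<Rightarrow> X (max 0 r) \<omega>)"
    by simp
qed

subsection \<open>Completions\<close>

text \<open>Here f carries no measurability of its own; this is the form in which compositions of
  Lebesgue measurable data with the processes are integrated.\<close>

lemma
  fixes g :: "'b \<Rightarrow> real"
  assumes AE: "AE x in M. f x = g x" and g: "g \<in> borel_measurable M"
  shows borel_measurable_completion_AE: "f \<in> borel_measurable (completion M)"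
    and integral_completion_AE: "integral\<^sup>L (completion M) f = integral\<^sup>L M g"
    and integrable_completion_AE: "integrable (completion M) f \<longleftrightarrow> integrable M g"
proof -
  have g': "g \<in> borel_measurable (completion M)" by (rule measurable_completion[OF g])
  have AE': "AE x in completion M. f x = g x" using AE by (rule AE_completion)
  show f: "f \<in> borel_measurable (completion M)"
  proof (rule measurableI)
    fix A :: "real set" assume A: "A \<in> sets borel"
    \<comment> \<open>The set where f and g differ is contained in a null set, so each of its
      subsets is measurable for the completion.\<close>
    have "Measurable.pred (completion M) (\<lambda>x. f x \<in> A \<and> f x \<noteq> g x)"
      by (rule sets_completion_AE) (use AE in auto)
    moreover have "Measurable.pred (completion M) (\<lambda>x. f x \<noteq> g x)"
      by (rule sets_completion_AE) (use AE in auto)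
    moreover have "Measurable.pred (completion M) (\<lambda>x. g x \<in> A)" using A g' by measurable
    ultimately have "Measurable.pred (completion M) (\<lambda>x. (f x \<in> A \<and> f x \<noteq> g x) \<or> (g x \<in> A \<and> \<not> f x \<noteq> g x))"
      by measurable
    also have "(\<lambda>x. (f x \<in> A \<and> f x \<noteq> g x) \<or> (g x \<in> A \<and> \<not> f x \<noteq> g x)) = (\<lambda>x. f x \<in> A)" by auto
    finally show "f -` A \<inter> space (completion M) \<in> sets (completion M)"
      by (simp add: pred_def vimage_def Int_def conj_commute)
  qed auto
  show "integral\<^sup>L (completion M) f = integral\<^sup>L M g"
    using integral_cong_AE[OF f g' AE'] integral_completion[OF g] by simp
  show "integrable (completion M) f \<longleftrightarrow> integrable M g"
    using integrable_cong_AE[OF f g' AE'] integrable_completion[OF g] by simp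
qed

subsection \<open>Uniqueness of bivariate Laplace transforms\<close>

text \<open>Polynomials in two variables. The inductive form reduces equality of integrals to
  monomials, while closure under products, proved below, supplies the algebra needed for
  Stone--Weierstrass.\<close>

inductive_set bipoly :: "(real \<times> real \<Rightarrow> real) set" where
  monomial: "(\<lambda>z. c * fst z ^ i * snd z ^ j) \<in> bipoly"
| add: "f \<in> bipoly \<Longrightarrow> g \<in> bipoly \<Longrightarrow> (\<lambda>z. f z + g z) \<in> bipoly"

lemma bipoly_continuous: "f \<in> bipoly \<Longrightarrow> continuous_on A f"
  by (induction rule: bipoly.induct) (auto intro!: continuous_intros)

lemma bipoly_mult:
  assumes "f \<in> bipoly" "g \<in> bipoly" shows "(\<lambda>z. f z * g z) \<in> bipoly"
  using assms(1)
proof (induction rule: bipoly.induct)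
  case (monomial c i j)
  show ?case using assms(2)
  proof (induction rule: bipoly.induct)
    case (monomial c' i' j')
    have "(\<lambda>z. (c * c') * fst z ^ (i + i') * snd z ^ (j + j')) \<in> bipoly" by (rule bipoly.monomial)
    then show ?case by (simp add: power_add mult_ac)
  next
    case (add f g)
    show ?case using bipoly.add[OF add.IH] by (simp add: algebra_simps)
  qed
next
  case (add f1 f2)
  show ?case using bipoly.add[OF add.IH] by (simp add: algebra_simps)
qed

lemma bipoly_const: "(\<lambda>_. c) \<in> bipoly"
  using bipoly.monomial[of c 0 0] by simp

lemma function_ring_bipoly: "compact S \<Longrightarrow> function_ring_on bipoly S"
proof
  fix x y :: "real \<times> real" assume "x \<noteq> y"
  then consider "fst x \<noteq> fst y" | "snd x \<noteq> snd y" by (auto simp: prod_eq_iff)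
  then show "\<exists>f\<in>bipoly. f x \<noteq> f y"
  proof cases
    case 1 then show ?thesis using bipoly.monomial[of 1 1 0] by (intro bexI) auto
  next
    case 2 then show ?thesis using bipoly.monomial[of 1 0 1] by (intro bexI) auto
  qed
qed (auto intro: bipoly_continuous bipoly.add bipoly_mult bipoly_const)

text \<open>The case \<open>A = UNIV\<close> is excluded because the distance to the empty set is 0
  by convention, which would make all approximants vanish.\<close>

lemma open_indicator_approx:
  fixes A :: "'b::metric_space set"
  assumes "open A" "A \<noteq> UNIV"
  shows "(\<lambda>n. min 1 (real n * infdist x (- A))) \<longlonglongrightarrow> indicator A x"
proof (cases "x \<in> A")
  case False
  then show ?thesis by (simp add: infdist_zero)
next
  case True
  have "infdist x (- A) > 0"
    using assms True by (auto intro!: infdist_pos_not_in_closed)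
  then have "filterlim (\<lambda>n. infdist x (- A) * real n) at_top sequentially"
    by (rule filterlim_tendsto_pos_mult_at_top[OF tendsto_const _ filterlim_real_sequentially])
  then have "\<forall>\<^sub>F n in sequentially. 1 \<le> real n * infdist x (- A)"
    by (simp add: filterlim_at_top mult.commute)
  then have "\<forall>\<^sub>F n in sequentially. min 1 (real n * infdist x (- A)) = indicator A x"
    by eventually_elim (use True in auto)
  then show ?thesis by (rule tendsto_eventually)
qed

text \<open>By Stone--Weierstrass on the unit square the moments determine the integrals of all
  continuous functions; these in turn approximate indicators of open sets.\<close>

lemma finite_measure_eqI_moments:
  fixes \<mu> \<mu>' :: "(real \<times> real) measure"
  assumes sets: "sets \<mu> = sets borel" "sets \<mu>' = sets borel"
    and "finite_measure \<mu>" "finite_measure \<mu>'"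
    and conc: "AE z in \<mu>. z \<in> {0..1} \<times> {0..1}" "AE z in \<mu>'. z \<in> {0..1} \<times> {0..1}"
    and eq: "\<And>i j. (LINT z|\<mu>. fst z ^ i * snd z ^ j) = (LINT z|\<mu>'. fst z ^ i * snd z ^ j)"
  shows "\<mu> = \<mu>'"
proof -
  let ?K = "{0..1::real} \<times> {0..1::real}"
  interpret m: finite_measure \<mu> by fact
  interpret m': finite_measure \<mu>' by fact
  have meas[measurable_cong]: "sets \<mu> = sets borel" "sets \<mu>' = sets borel" by fact+
  have K: "compact ?K" by (intro compact_Times) auto
  have intg: "integrable \<mu> f" "integrable \<mu>' f" if f: "continuous_on UNIV f" for f :: "real \<times> real \<Rightarrow> real"
  proof -
    have "compact (f ` ?K)" by (intro compact_continuous_image K continuous_on_subset[OF f]) auto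
    then have "\<exists>C. \<forall>x\<in>f ` ?K. norm x \<le> C"
      using compact_imp_bounded bounded_iff by metis
    then obtain C where "\<And>z. z \<in> ?K \<Longrightarrow> norm (f z) \<le> C" by auto
    moreover have "f \<in> borel_measurable borel" using f by (rule borel_measurable_continuous_onI)
    ultimately show "integrable \<mu> f" "integrable \<mu>' f"
      using conc by (auto intro!: m.integrable_const_bound[where B=C] m'.integrable_const_bound[where B=C])
  qed
  have poly: "integral\<^sup>L \<mu> f = integral\<^sup>L \<mu>' f" if "f \<in> bipoly" for f
    using that
  proof induction
    case (monomial c i j)
    show ?case using eq[of i j] by (simp add: mult.assoc)
  next
    case (add f g)
    then show ?case by (simp add: intg bipoly_continuous)
  qed
  have cont: "integral\<^sup>L \<mu> f = integral\<^sup>L \<mu>' f" if f: "continuous_on UNIV f" for f :: "real \<times> real \<Rightarrow> real"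
  proof -
    interpret function_ring_on bipoly ?K by (rule function_ring_bipoly[OF K])
    define c where "c = measure \<mu> (space \<mu>) + measure \<mu>' (space \<mu>')"
    have c: "0 \<le> c" unfolding c_def by simp
    have "\<bar>integral\<^sup>L \<mu> f - integral\<^sup>L \<mu>' f\<bar> \<le> 0 + e" if "e > 0" for e
    proof -
      \<comment> \<open>A uniform error d on the square costs at most d times the total mass c of
        both measures; the summand 1 covers c = 0.\<close>
      define d where "d = e / (c + 1)"
      have d: "d > 0" "d * c \<le> e" using that c by (auto simp: d_def field_simps)
      obtain g where g: "g \<in> bipoly" "\<And>z. z \<in> ?K \<Longrightarrow> \<bar>f z - g z\<bar> < d"
        using Stone_Weierstrass_basic[OF continuous_on_subset[OF f] d(1)] by auto
      have 1: "\<bar>integral\<^sup>L N f - integral\<^sup>L N g\<bar> \<le> d * measure N (space N)"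
        if N: "finite_measure N" "AE z in N. z \<in> ?K" "integrable N f" "integrable N g" for N
      proof -
        interpret finite_measure N by fact
        have "\<bar>integral\<^sup>L N f - integral\<^sup>L N g\<bar> = \<bar>LINT z|N. f z - g z\<bar>" using N by simp
        also have "\<dots> \<le> (LINT z|N. \<bar>f z - g z\<bar>)" by (rule integral_abs_bound)
        also have "\<dots> \<le> (LINT z|N. d)"
          using N g(2) by (intro integral_mono_AE) (auto intro: less_imp_le)
        finally show ?thesis by (simp add: mult.commute)
      qed
      have "\<bar>integral\<^sup>L \<mu> f - integral\<^sup>L \<mu>' f\<bar> \<le> d * measure \<mu> (space \<mu>) + d * measure \<mu>' (space \<mu>')"
        using 1[of \<mu>] 1[of \<mu>'] poly[OF g(1)] conc intg[OF f] intg[OF bipoly_continuous[OF g(1)]]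
          m.finite_measure_axioms m'.finite_measure_axioms by (smt (verit))
      also have "\<dots> \<le> e" using d(2) by (simp add: c_def algebra_simps)
      finally show ?thesis by simp
    qed
    then have "\<bar>integral\<^sup>L \<mu> f - integral\<^sup>L \<mu>' f\<bar> \<le> 0" by (rule field_le_epsilon)
    then show ?thesis by simp
  qed
  have sp: "space \<mu> = UNIV" "space \<mu>' = UNIV" using sets[THEN sets_eq_imp_space_eq] by auto
  show ?thesis
  proof (rule finite_measure_eqI_open[OF sets])
    show "emeasure \<mu> UNIV \<noteq> \<infinity>" using m.emeasure_finite[of UNIV] by simp
    fix A :: "(real \<times> real) set" assume A: "open A"
    have Am: "A \<in> sets borel" using A by auto
    show "emeasure \<mu> A = emeasure \<mu>' A"
    proof (cases "A = UNIV")
      case True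
      have "measure \<mu> UNIV = measure \<mu>' UNIV" using cont[of "\<lambda>_. 1"] sp by simp
      then show ?thesis using True by (simp add: m.emeasure_eq_measure m'.emeasure_eq_measure)
    next
      case False
      have lim: "(\<lambda>n. LINT z|N. min 1 (real n * infdist z (- A))) \<longlonglongrightarrow> measure N A"
        if N: "finite_measure N" "sets N = sets borel" for N
      proof -
        interpret N: finite_measure N by fact
        have [measurable_cong]: "sets N = sets borel" by fact
        have [measurable]: "(\<lambda>z. infdist z (- A)) \<in> borel_measurable borel"
          by (intro borel_measurable_continuous_onI continuous_intros)
        have "(\<lambda>n. LINT z|N. min 1 (real n * infdist z (- A))) \<longlonglongrightarrow> (LINT z|N. indicator A z)"
          using open_indicator_approx[OF A False] Am
          by (intro integral_dominated_convergence[where w="\<lambda>_. 1"])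
             (auto intro!: AE_I2 simp: infdist_nonneg)
        then show ?thesis using Am N by simp
      qed
      have "measure \<mu> A = measure \<mu>' A"
        using lim[OF m.finite_measure_axioms sets(1)] lim[OF m'.finite_measure_axioms sets(2)]
          cont[of "\<lambda>z. min 1 (real n * infdist z (- A))" for n]
        by (simp add: continuous_intros LIMSEQ_unique)
      then show ?thesis by (simp add: m.emeasure_eq_measure m'.emeasure_eq_measure)
    qed
  qed
qed

text \<open>The map (x, y) \<mapsto> (exp (-x), exp (-y)) carries the quadrant into the unit square,
  where the transform at integer points becomes the sequence of moments. The weight exp (-x) makes
  the image finite and shifts the first index by one, whence the range
  \<open>1 \<le> a\<close>.\<close>

lemma measure_eqI_laplace2:
  fixes \<mu> \<mu>' :: "(real \<times> real) measure"
  assumes sets: "sets \<mu> = sets borel" "sets \<mu>' = sets borel"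
    and conc: "AE z in \<mu>. z \<in> {0..} \<times> {0..}" "AE z in \<mu>'. z \<in> {0..} \<times> {0..}"
    and fin: "\<And>a b. 1 \<le> a \<Longrightarrow> 0 \<le> b \<Longrightarrow> (\<integral>\<^sup>+z. ennreal (exp (- a * fst z - b * snd z)) \<partial>\<mu>) < \<infinity>"
    and eq: "\<And>a b. 1 \<le> a \<Longrightarrow> 0 \<le> b \<Longrightarrow>
      (\<integral>\<^sup>+z. ennreal (exp (- a * fst z - b * snd z)) \<partial>\<mu>) = (\<integral>\<^sup>+z. ennreal (exp (- a * fst z - b * snd z)) \<partial>\<mu>')"
  shows "\<mu> = \<mu>'"
proof -
  define h :: "real \<times> real \<Rightarrow> real \<times> real" where "h z = (exp (- fst z), exp (- snd z))" for z
  define w :: "real \<times> real \<Rightarrow> ennreal" where "w z = ennreal (exp (- fst z))" for z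
  define k :: "real \<times> real \<Rightarrow> real \<times> real" where "k z = (- ln (fst z), - ln (snd z))" for z
  have [measurable]: "h \<in> borel \<rightarrow>\<^sub>M borel" "w \<in> borel \<rightarrow>\<^sub>M borel" "k \<in> borel \<rightarrow>\<^sub>M borel"
    unfolding h_def w_def k_def borel_prod[symmetric] by measurable
  define tr where "tr N = distr (density N w) borel h" for N
  \<comment> \<open>The passage to the square loses nothing: \<open>k\<close> inverts
    \<open>h\<close> and the density exp (x) undoes the weight.\<close>
  have recover: "N = density (distr (tr N) borel k) (\<lambda>z. ennreal (exp (fst z)))" if "sets N = sets borel" for N
  proof -
    note [measurable_cong] = that
    have kh: "k (h z) = z" for z unfolding k_def h_def by simp
    have "distr (tr N) borel k = distr (density N w) borel (\<lambda>z. z)"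
      unfolding tr_def by (subst distr_distr) (auto simp: o_def kh)
    also have "\<dots> = density N w" by (rule distr_id2) (simp add: that)
    finally have "density (distr (tr N) borel k) (\<lambda>z. ennreal (exp (fst z)))
      = density (density N w) (\<lambda>z. ennreal (exp (fst z)))" by simp
    also have "\<dots> = density N (\<lambda>z. w z * ennreal (exp (fst z)))"
      by (rule density_density_eq) (simp_all add: w_def measurable_cong_sets[OF that refl], simp_all add: borel_prod[symmetric])
    also have "(\<lambda>z. w z * ennreal (exp (fst z))) = (\<lambda>_. 1)"
      unfolding w_def by (auto simp: ennreal_mult[symmetric] exp_minus_inverse exp_add[symmetric])
    finally show ?thesis by (simp add: density_1)
  qed
  have mom: "(\<integral>\<^sup>+z. ennreal (fst z ^ i * snd z ^ j) \<partial>tr N) =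
      (\<integral>\<^sup>+z. ennreal (exp (- real (Suc i) * fst z - real j * snd z)) \<partial>N)" if "sets N = sets borel" for N i j
  proof -
    note [measurable_cong] = that
    have *: "w z * ennreal (fst (h z) ^ i * snd (h z) ^ j) = ennreal (exp (- real (Suc i) * fst z - real j * snd z))" for z
      unfolding h_def w_def
      by (simp add: ennreal_mult[symmetric] exp_of_nat_mult[symmetric] exp_add[symmetric] exp_diff algebra_simps)
    have "(\<lambda>z. ennreal (fst z ^ i * snd z ^ j)) \<in> borel_measurable borel"
      by (simp add: borel_prod[symmetric])
    then have "(\<integral>\<^sup>+z. ennreal (fst z ^ i * snd z ^ j) \<partial>tr N)
      = (\<integral>\<^sup>+z. w z * ennreal (fst (h z) ^ i * snd (h z) ^ j) \<partial>N)"
      unfolding tr_def by (simp add: nn_integral_distr nn_integral_density)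
    then show ?thesis by (simp only: *)
  qed
  have fint: "finite_measure (tr N)"
    if "sets N = sets borel" "(\<integral>\<^sup>+z. ennreal (exp (- 1 * fst z - 0 * snd z)) \<partial>N) < \<infinity>" for N
    using that mom[of N 0 0] by (intro finite_measureI) (auto simp: tr_def)
  have conct: "AE z in tr N. z \<in> {0..1} \<times> {0..1}"
    if "sets N = sets borel" "AE z in N. z \<in> {0..} \<times> {0..}" for N
  proof -
    note [measurable_cong] = that(1)
    have "{x. x \<in> {0..1::real} \<times> {0..1::real}} \<in> sets borel" by (simp add: borel_prod[symmetric])
    then show ?thesis unfolding tr_def using that(2)
      by (subst AE_distr_iff, simp, simp, subst AE_density) (auto simp: h_def w_def)
  qed
  have "tr \<mu> = tr \<mu>'"
  proof (rule finite_measure_eqI_moments)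
    show "finite_measure (tr \<mu>)" "finite_measure (tr \<mu>')"
      using fint[OF sets(1)] fint[OF sets(2)] fin[of 1 0] eq[of 1 0] by auto
    show "AE z in tr \<mu>. z \<in> {0..1} \<times> {0..1}" "AE z in tr \<mu>'. z \<in> {0..1} \<times> {0..1}"
      using conct[OF sets(1) conc(1)] conct[OF sets(2) conc(2)] by auto
    fix i j
    have nn: "AE z in tr \<mu>. 0 \<le> fst z ^ i * snd z ^ j" "AE z in tr \<mu>'. 0 \<le> fst z ^ i * snd z ^ j"
      using conct[OF sets(1) conc(1)] conct[OF sets(2) conc(2)] by auto
    have [measurable]: "(\<lambda>z. fst z ^ i * snd z ^ j) \<in> borel_measurable (tr N)" for N :: "(real \<times> real) measure"
      unfolding tr_def by (simp add: borel_prod[symmetric])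
    show "(LINT z|tr \<mu>. fst z ^ i * snd z ^ j) = (LINT z|tr \<mu>'. fst z ^ i * snd z ^ j)"
      using nn eq[of "real (Suc i)" "real j"] mom[OF sets(1), of i j] mom[OF sets(2), of i j]
      by (simp add: integral_eq_nn_integral)
  qed (auto simp: tr_def)
  then show ?thesis using recover[OF sets(1)] recover[OF sets(2)] by metis
qed

subsection \<open>Subordinators\<close>

lemma nn_integral_exp_Ico:
  assumes "0 < a" "x \<le> y"
  shows "(\<integral>\<^sup>+t. ennreal (exp (- a * t)) * indicator {x..<y} t \<partial>lborel) = ennreal ((exp (- a * x) - exp (- a * y)) / a)"
proof -
  have "(\<integral>\<^sup>+t. ennreal (exp (- a * t)) * indicator {x..<y} t \<partial>lborel)
    = (\<integral>\<^sup>+t. ennreal (exp (- a * t)) * indicator {x..y} t \<partial>lborel)"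
  proof (rule nn_integral_cong_AE)
    have "AE t in lborel. t \<noteq> y" by (rule AE_lborel_singleton)
    then show "AE t in lborel. ennreal (exp (- a * t)) * indicator {x..<y} t = ennreal (exp (- a * t)) * indicator {x..y} t"
      by eventually_elim (auto split: split_indicator)
  qed
  also have "\<dots> = ennreal (- exp (- a * y) / a - - exp (- a * x) / a)"
    using assms
    by (intro nn_integral_FTC_Icc[where F="\<lambda>t. - exp (- a * t) / a"])
       (auto intro!: derivative_eq_intros)
  finally show ?thesis by (simp add: diff_divide_distrib)
qed

text \<open>A difference quotient at 0, taken along the meshes 1/(n+1) of the grids used for the
  subordinator.\<close>

lemma tendsto_one_minus_exp: "(\<lambda>n. (1 - exp (- (1 / real (Suc n)) * c)) * real (Suc n)) \<longlonglongrightarrow> c"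
proof -
  have "((\<lambda>h. - exp (- h * c)) has_real_derivative c) (at 0)"
    by (auto intro!: derivative_eq_intros)
  then have "((\<lambda>h. (- exp (- h * c) - - exp (- 0 * c)) / (h - 0)) \<longlongrightarrow> c) (at 0)"
    by (simp add: has_field_derivative_iff)
  moreover have "filterlim (\<lambda>n. 1 / real (Suc n)) (at 0) sequentially"
    unfolding filterlim_at using LIMSEQ_Suc[OF lim_1_over_n] by auto
  ultimately have "(\<lambda>n. (- exp (- (1 / real (Suc n)) * c) - - exp (- 0 * c)) / (1 / real (Suc n) - 0)) \<longlonglongrightarrow> c"
    by (rule filterlim_compose)
  then show ?thesis by (simp add: divide_simps mult.commute)
qed

text \<open>The restriction is encoded as a density, so that the measure still lives on the whole
  Borel line and enters product measures without a change of space.\<close>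

definition halfline :: "real measure" where
  "halfline = density lborel (indicator {0<..})"

lemma sets_halfline[simp, measurable_cong]: "sets halfline = sets borel"
  and space_halfline[simp]: "space halfline = UNIV"
  by (simp_all add: halfline_def)

lemma AE_halfline_pos: "AE t in halfline. 0 < t"
  unfolding halfline_def by (subst AE_density) (auto split: split_indicator)

lemma AE_halfline_iff:
  "Measurable.pred borel P \<Longrightarrow> (AE t in halfline. P t) \<longleftrightarrow> (AE t in lborel. 0 < t \<longrightarrow> P t)"
  unfolding halfline_def by (subst AE_density) (auto simp: indicator_def cong: AE_cong)

lemma nn_integral_halfline:
  "f \<in> borel_measurable borel \<Longrightarrow> (\<integral>\<^sup>+t. f t \<partial>halfline) = (\<integral>\<^sup>+t\<in>{0<..}. f t \<partial>lborel)"
  unfolding halfline_def by (subst nn_integral_density) (auto simp: mult.commute)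

lemma integral_halfline:
  fixes f :: "real \<Rightarrow> real"
  assumes "f \<in> borel_measurable borel"
  shows "(LINT t|halfline. f t) = (LBINT t:{0<..}. f t)"
  using assms integral_density[of f lborel "indicator {0<..}"]
  by (simp add: halfline_def ennreal_indicator set_lebesgue_integral_def)

lemma sigma_finite_halfline: "sigma_finite_measure halfline"
proof -
  have "AE t in lborel. (indicator {0<..} t :: ennreal) \<noteq> \<infinity>"
    by (auto simp: indicator_def)
  moreover have "(indicator {0<..} :: real \<Rightarrow> ennreal) \<in> borel_measurable lborel"
    by measurable
  ultimately show ?thesis
    unfolding halfline_def
    using sigma_finite_measure.sigma_finite_iff_density_finite[OF lborel.sigma_finite_measure_axioms,
        of "indicator {0<..}"] lborel.sigma_finite_measure_axioms by blast
qed

interpretation halfline: sigma_finite_measure halfline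
  by (rule sigma_finite_halfline)

section \<open>Laplace exponent and path properties of the subordinator\<close>

locale subordinator = prob_space M for M :: "'w measure" +
  fixes \<nu> :: "real \<Rightarrow> real" and S :: "real \<Rightarrow> 'w \<Rightarrow> real"
  assumes H0: "H0 \<nu>" and levy: "levy_subordinator M \<nu> S"
begin

definition Nu :: "real measure" where
  "Nu = density lborel (\<lambda>r. ennreal (indicator {0<..} r * \<nu> r))"

text \<open>The value at a Borel set A is the expected time that S spends in A.\<close>

definition U :: "real measure" where
  "U = distr (halfline \<Otimes>\<^sub>M M) borel (\<lambda>(s, \<omega>). S (max 0 s) \<omega>)"

text \<open>The Laplace exponent, normalised to be nonnegative: the expectation of exp (-k S r) is
  exp (-r \<open>psi\<close> k).\<close>

definition psi :: "real \<Rightarrow> real" where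
  "psi k = (LINT r|Nu. 1 - exp (- k * r))"

lemma nu_measurable[measurable]: "(\<lambda>r. indicator {0<..} r * \<nu> r) \<in> borel_measurable borel"
  using borel_measurable_continuous_on_indicator[of "{0<..}" \<nu>] H0 by (simp add: H0_def)

lemma nu_nonneg: "0 < r \<Longrightarrow> 0 \<le> \<nu> r"
  using H0 by (simp add: H0_def)

lemma sets_Nu[simp, measurable_cong]: "sets Nu = sets borel"
  and space_Nu[simp]: "space Nu = UNIV"
  by (simp_all add: Nu_def)

lemma AE_Nu_pos: "AE r in Nu. 0 < r"
  unfolding Nu_def by (subst AE_density) (auto split: split_indicator)

lemma nn_integral_Nu:
  assumes "f \<in> borel_measurable borel"
  shows "(\<integral>\<^sup>+r. f r \<partial>Nu) = (\<integral>\<^sup>+r\<in>{0<..}. f r * ennreal (\<nu> r) \<partial>lborel)"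
proof -
  have "(\<integral>\<^sup>+r. f r \<partial>Nu) = (\<integral>\<^sup>+r. ennreal (indicator {0<..} r * \<nu> r) * f r \<partial>lborel)"
    unfolding Nu_def by (rule nn_integral_density) (use assms in measurable)
  also have "\<dots> = (\<integral>\<^sup>+r\<in>{0<..}. f r * ennreal (\<nu> r) \<partial>lborel)"
    by (intro nn_integral_cong) (auto split: split_indicator simp: mult_ac)
  finally show ?thesis .
qed

lemma
  fixes f :: "real \<Rightarrow> real"
  assumes f: "f \<in> borel_measurable borel"
  shows integral_Nu: "(LINT r|Nu. f r) = (LBINT r:{0<..}. f r * \<nu> r)"
    and integrable_Nu: "integrable Nu f \<longleftrightarrow> set_integrable lborel {0<..} (\<lambda>r. f r * \<nu> r)"
proof -
  have nn: "0 \<le> indicator {0<..} r * \<nu> r" for r using nu_nonneg by (auto split: split_indicator)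
  have e: "indicator {0<..} r * \<nu> r * f r = indicator {0<..} r * (f r * \<nu> r)" for r by simp
  show "(LINT r|Nu. f r) = (LBINT r:{0<..}. f r * \<nu> r)"
    unfolding Nu_def set_lebesgue_integral_def using f nn
    by (subst integral_density) (auto simp: e)
  show "integrable Nu f \<longleftrightarrow> set_integrable lborel {0<..} (\<lambda>r. f r * \<nu> r)"
    unfolding Nu_def set_integrable_def using f nn
    by (subst integrable_density) (auto simp: e)
qed

lemma min_Nu_finite: "(\<integral>\<^sup>+r. ennreal (min r 1) \<partial>Nu) < \<infinity>"
proof -
  have "(\<integral>\<^sup>+r. ennreal (min r 1) \<partial>Nu) = (\<integral>\<^sup>+r\<in>{0<..}. ennreal (min r 1 * \<nu> r) \<partial>lborel)"
    using nu_nonneg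
    by (subst nn_integral_Nu) (auto intro!: nn_integral_cong simp: ennreal_mult split: split_indicator)
  then show ?thesis using H0 by (simp add: H0_def)
qed

lemma emeasure_Nu: "emeasure Nu UNIV = \<infinity>"
proof -
  have "emeasure Nu UNIV = (\<integral>\<^sup>+r\<in>{0<..}. ennreal (\<nu> r) \<partial>lborel)"
    using nn_integral_Nu[of "\<lambda>_. 1"] by simp
  then show ?thesis using H0 by (simp add: H0_def)
qed

lemma sigma_finite_Nu: "sigma_finite_measure Nu"
proof -
  have "sigma_finite_measure lborel \<longleftrightarrow> sigma_finite_measure Nu"
    unfolding Nu_def
    using sigma_finite_measure.sigma_finite_iff_density_finite[OF lborel.sigma_finite_measure_axioms, of "\<lambda>r. ennreal (indicator {0<..} r * \<nu> r)"]
    by (simp add: lborel.sigma_finite_measure_axioms)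
  then show ?thesis by (simp add: lborel.sigma_finite_measure_axioms)
qed

sublocale Nu: sigma_finite_measure Nu by (rule sigma_finite_Nu)

lemma integrable_Nu_min: "integrable Nu (\<lambda>r. min r 1)"
proof (rule integrableI_nonneg)
  show "AE r in Nu. 0 \<le> min r 1" using AE_Nu_pos by eventually_elim auto
qed (use min_Nu_finite in auto)

lemma integrable_Nu_bound:
  fixes f :: "real \<Rightarrow> real"
  assumes "f \<in> borel_measurable borel" "\<And>r. 0 < r \<Longrightarrow> \<bar>f r\<bar> \<le> C * min r 1"
  shows "integrable Nu f"
proof (rule Bochner_Integration.integrable_bound[where f="\<lambda>r. C * min r 1"])
  show "AE r in Nu. norm (f r) \<le> norm (C * min r 1)"
    using AE_Nu_pos by eventually_elim (use assms(2) in force)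
qed (use assms(1) integrable_Nu_min in auto)

lemma one_minus_exp_bound:
  fixes k r :: real
  shows "0 \<le> k \<Longrightarrow> 0 < r \<Longrightarrow> \<bar>1 - exp (- k * r)\<bar> \<le> (k + 1) * min r 1"
proof -
  assume k: "0 \<le> k" "0 < r"
  have "1 - exp (- k * r) \<le> k * r" using exp_ge_add_one_self[of "- k * r"] by simp
  moreover have "exp (- k * r) \<le> 1" using k by simp
  moreover have "0 \<le> k * min r 1" using k by simp
  ultimately show ?thesis using k by (auto simp: min_def algebra_simps)
qed

lemma psi_integrable: "0 \<le> k \<Longrightarrow> integrable Nu (\<lambda>r. 1 - exp (- k * r))"
  by (rule integrable_Nu_bound[OF _ one_minus_exp_bound]) auto

lemma psi_0[simp]: "psi 0 = 0" by (simp add: psi_def)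

lemma psi_mono: assumes kl: "0 \<le> k" "k \<le> l" shows "psi k \<le> psi l"
  unfolding psi_def
proof (rule integral_mono_AE)
  show "AE r in Nu. 1 - exp (- k * r) \<le> 1 - exp (- l * r)"
    using AE_Nu_pos by eventually_elim (use kl in \<open>auto intro: mult_right_mono\<close>)
qed (use kl in \<open>auto intro!: psi_integrable[simplified]\<close>)

text \<open>If the integral of the nonnegative function 1 - exp (-k r) were 0, this function would
  vanish \<open>Nu\<close>-almost everywhere; as it is positive for r > 0, \<open>Nu\<close> would
  be the zero measure, contrary to its infinite mass.\<close>

lemma psi_pos: assumes k: "0 < k" shows "0 < psi k"
proof -
  have nn: "AE r in Nu. 0 \<le> 1 - exp (- k * r)" using AE_Nu_pos by eventually_elim (use k in auto)
  have "psi k \<ge> 0" unfolding psi_def by (rule integral_nonneg_AE[OF nn])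
  moreover have "psi k \<noteq> 0"
  proof
    assume "psi k = 0"
    then have "AE r in Nu. 1 - exp (- k * r) = 0"
      unfolding psi_def using integral_nonneg_eq_0_iff_AE[OF psi_integrable nn] k by simp
    then have "AE r in Nu. False" using AE_Nu_pos by eventually_elim (use k in auto)
    then have "UNIV \<in> null_sets Nu" by (subst AE_iff_null_sets) auto
    then show False using emeasure_Nu null_setsD1[of UNIV Nu] by simp
  qed
  ultimately show ?thesis by simp
qed

lemma S_measurable: "0 \<le> r \<Longrightarrow> S r \<in> borel_measurable M"
  and S_0: "AE \<omega> in M. S 0 \<omega> = 0"
  and S_right: "\<omega> \<in> space M \<Longrightarrow> 0 \<le> r \<Longrightarrow> ((\<lambda>s. S s \<omega>) \<longlongrightarrow> S r \<omega>) (at_right r)"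
  and S_mono: "\<omega> \<in> space M \<Longrightarrow> 0 \<le> r \<Longrightarrow> r \<le> s \<Longrightarrow> S r \<omega> \<le> S s \<omega>"
  using levy unfolding levy_subordinator_def continuous_within mono_on_def by auto

lemma S_nonneg: "AE \<omega> in M. \<forall>r\<ge>0. 0 \<le> S r \<omega>"
  using S_0 AE_space by eventually_elim (metis S_mono order_refl)

lemma integrable_exp_S: assumes "0 \<le> r" "0 \<le> k" shows "integrable M (\<lambda>\<omega>. exp (- k * S r \<omega>))"
proof (rule integrable_const_bound[where B=1])
  show "AE \<omega> in M. norm (exp (- k * S r \<omega>)) \<le> 1"
    using S_nonneg by eventually_elim (use assms in auto)
qed (use S_measurable[OF assms(1)] in auto)

text \<open>The hypothesis prescribes only a logarithm, so the expectation has to be shown positive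
  before exponentiating. The boundary cases r = 0 and k = 0 lie outside that hypothesis and are
  treated separately.\<close>

lemma laplace_S:
  assumes "0 \<le> r" "0 \<le> k"
  shows "expectation (\<lambda>\<omega>. exp (- k * S r \<omega>)) = exp (- r * psi k)"
proof (cases "r = 0 \<or> k = 0")
  case True
  have "expectation (\<lambda>\<omega>. exp (- k * S r \<omega>)) = expectation (\<lambda>\<omega>. 1)"
  proof (rule integral_cong_AE)
    show "AE \<omega> in M. exp (- k * S r \<omega>) = 1" using S_0 by eventually_elim (use True in auto)
  qed (use S_measurable[OF assms(1)] in auto)
  then show ?thesis using True by (auto simp: prob_space)
next
  case False
  then have rk: "0 < r" "0 < k" using assms by auto
  have "expectation (\<lambda>\<omega>. exp (- k * S r \<omega>)) > 0"
    using integral_nonneg_eq_0_iff_AE[OF integrable_exp_S[OF assms]]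
    by (intro le_neq_trans integral_nonneg_AE) auto
  moreover have "ln (expectation (\<lambda>\<omega>. exp (- k * S r \<omega>))) = r * (LBINT s:{0<..}. (exp (- k * s) - 1) * \<nu> s)"
    using levy rk unfolding levy_subordinator_def by blast
  moreover have "(LBINT s:{0<..}. (exp (- k * s) - 1) * \<nu> s) = - psi k"
    unfolding psi_def by (subst integral_Nu[symmetric]) (auto simp flip: integral_minus)
  ultimately show ?thesis by (metis exp_ln mult_minus_left mult_minus_right)
qed

text \<open>Exponential Markov inequality: the probability of S m \<le> n is at most exp n * exp (-m
  \<open>psi\<close> 1), which tends to 0 in m because \<open>psi\<close> 1 > 0.\<close>

lemma S_unbounded: "AE \<omega> in M. \<forall>t. \<exists>r>0. t < S r \<omega>"
proof -
  have "AE \<omega> in M. \<exists>m::nat. real n < S (real (Suc m)) \<omega>" for n :: nat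
  proof -
    let ?A = "{\<omega> \<in> space M. \<forall>m::nat. S (real (Suc m)) \<omega> \<le> real n}"
    have [measurable]: "S (real (Suc m)) \<in> borel_measurable M" for m by (rule S_measurable) simp
    have A: "?A \<in> sets M" by measurable
    have le: "measure M ?A \<le> exp (real n) * exp (- real (Suc m) * psi 1)" for m
    proof -
      have "measure M ?A = expectation (indicator ?A)" using A by simp
      also have "\<dots> \<le> expectation (\<lambda>\<omega>. exp (real n) * exp (- 1 * S (real (Suc m)) \<omega>))"
      proof (rule integral_mono)
        show "integrable M (\<lambda>\<omega>. exp (real n) * exp (- 1 * S (real (Suc m)) \<omega>))"
          by (intro integrable_mult_right integrable_exp_S) auto
        show "indicator ?A \<omega> \<le> exp (real n) * exp (- 1 * S (real (Suc m)) \<omega>)" for \<omega>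
          by (auto split: split_indicator simp flip: exp_add)
      qed (use A in \<open>simp add: integrable_indicator_iff emeasure_eq_measure\<close>)
      also have "\<dots> = exp (real n) * exp (- real (Suc m) * psi 1)"
        using laplace_S[of "real (Suc m)" 1] by simp
      finally show ?thesis .
    qed
    have "(\<lambda>m. exp (real n) * exp (- real (Suc m) * psi 1)) \<longlonglongrightarrow> exp (real n) * 0"
    proof (intro tendsto_mult tendsto_const filterlim_compose[OF exp_at_bot])
      have "filterlim (\<lambda>m. psi 1 * real (Suc m)) at_top sequentially"
        using psi_pos[of 1] filterlim_compose[OF filterlim_real_sequentially filterlim_Suc]
        by (intro filterlim_tendsto_pos_mult_at_top[OF tendsto_const]) (auto simp: o_def)
      then show "filterlim (\<lambda>m. - real (Suc m) * psi 1) at_bot sequentially"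
        by (simp add: filterlim_uminus_at_top mult.commute del: of_nat_Suc)
    qed
    then have "measure M ?A \<le> exp (real n) * 0"
      by (rule LIMSEQ_le_const) (use le in auto)
    then have "?A \<in> null_sets M"
      using A by (simp add: null_sets_def emeasure_eq_measure measure_le_0_iff)
    from AE_not_in[OF this] show ?thesis
      using AE_space by eventually_elim (auto simp: not_le)
  qed
  then have "AE \<omega> in M. \<forall>n::nat. \<exists>m::nat. real n < S (real (Suc m)) \<omega>"
    by (simp add: AE_all_countable)
  then show ?thesis
  proof eventually_elim
    case (elim \<omega>)
    show ?case
    proof
      fix t :: real
      obtain n :: nat where "t < real n" using reals_Archimedean2 by blast
      moreover obtain m :: nat where "real n < S (real (Suc m)) \<omega>" using elim by blast
      ultimately show "\<exists>r>0. t < S r \<omega>" by (intro exI[of _ "real (Suc m)"]) auto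
    qed
  qed
qed

text \<open>Collects the almost sure path properties that make the first passage over every level
  finite. Monotonicity and right-continuity hold on all of \<open>space M\<close> by definition of
  the process.\<close>

definition good :: "'w \<Rightarrow> bool" where
  "good \<omega> \<longleftrightarrow> \<omega> \<in> space M \<and> S 0 \<omega> = 0 \<and> (\<forall>t. \<exists>r>0. t < S r \<omega>)"

lemma AE_good: "AE \<omega> in M. good \<omega>"
  using S_0 S_unbounded AE_space by eventually_elim (simp add: good_def)

lemma good_nonneg: "good \<omega> \<Longrightarrow> 0 \<le> r \<Longrightarrow> 0 \<le> S r \<omega>"
  using S_mono[of \<omega> 0 r] by (simp add: good_def)

text \<open>Almost surely the exponent is -(a+b) times the increment over [0, s] minus b times the
  increment over [s, s+h]; independence and stationarity of the increments do the rest.\<close>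

lemma laplace_increment:
  assumes "0 \<le> s" "0 \<le> h" "0 \<le> a" "0 \<le> b"
  shows "expectation (\<lambda>\<omega>. exp (- a * S s \<omega> - b * S (s + h) \<omega>)) = exp (- s * psi (a + b)) * exp (- h * psi b)"
proof -
  \<comment> \<open>Independence of increments is available along monotone sequences, so the two
    intervals are completed by a sequence that is constant from index 2 on.\<close>
  define t :: "nat \<Rightarrow> real" where "t i = (if i = 0 then 0 else if i = 1 then s else s + h)" for i
  have "0 \<le> t 0" "mono t" using assms by (auto simp: t_def mono_def)
  then have "indep_vars (\<lambda>_. borel) (\<lambda>i \<omega>. S (t (Suc i)) \<omega> - S (t i) \<omega>) {..<2}"
    using levy unfolding levy_subordinator_def by blast
  from indep_vars_compose2[OF this, of "\<lambda>i x. exp (- (if i = 0 then a + b else b) * x)" "\<lambda>_. borel"]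
  have ind: "indep_vars (\<lambda>_. borel) (\<lambda>i \<omega>. exp (- (if i = 0 then a + b else b) * (S (t (Suc i)) \<omega> - S (t i) \<omega>))) {..<2}"
    by simp
  have [measurable]: "S s \<in> borel_measurable M" "S (s + h) \<in> borel_measurable M" "S 0 \<in> borel_measurable M" "S h \<in> borel_measurable M"
    using assms by (auto intro: S_measurable)
  have int: "integrable M (\<lambda>\<omega>. exp (- (if i = 0 then a + b else b) * (S (t (Suc i)) \<omega> - S (t i) \<omega>)))" if "i \<in> {..<2}" for i
  proof (rule integrable_const_bound[where B=1])
    have "0 \<le> t i" "t i \<le> t (Suc i)" using assms by (auto simp: t_def)
    show "AE \<omega> in M. norm (exp (- (if i = 0 then a + b else b) * (S (t (Suc i)) \<omega> - S (t i) \<omega>))) \<le> 1"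
    proof (intro AE_I2)
      fix \<omega> assume "\<omega> \<in> space M"
      then have "0 \<le> (if i = 0 then a + b else b) * (S (t (Suc i)) \<omega> - S (t i) \<omega>)"
        using assms S_mono[of \<omega> "t i" "t (Suc i)"] \<open>0 \<le> t i\<close> \<open>t i \<le> t (Suc i)\<close>
        by (intro mult_nonneg_nonneg) auto
      then show "norm (exp (- (if i = 0 then a + b else b) * (S (t (Suc i)) \<omega> - S (t i) \<omega>))) \<le> 1"
        by (simp only: real_norm_def abs_exp_cancel exp_le_one_iff mult_minus_left neg_le_0_iff_le)
    qed
    show "(\<lambda>\<omega>. exp (- (if i = 0 then a + b else b) * (S (t (Suc i)) \<omega> - S (t i) \<omega>))) \<in> borel_measurable M"
    proof -
      have "i = 0 \<or> i = 1" using that by auto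
      then show ?thesis by (elim disjE) (simp_all add: t_def)
    qed
  qed
  have "expectation (\<lambda>\<omega>. exp (- a * S s \<omega> - b * S (s + h) \<omega>))
    = expectation (\<lambda>\<omega>. \<Prod>i<2. exp (- (if i = 0 then a + b else b) * (S (t (Suc i)) \<omega> - S (t i) \<omega>)))"
  proof (rule integral_cong_AE)
    show "AE \<omega> in M. exp (- a * S s \<omega> - b * S (s + h) \<omega>)
      = (\<Prod>i<2. exp (- (if i = 0 then a + b else b) * (S (t (Suc i)) \<omega> - S (t i) \<omega>)))"
      using S_0 by eventually_elim
        (simp add: numeral_2_eq_2 t_def algebra_simps flip: exp_add)
  qed (auto simp: numeral_2_eq_2 t_def)
  also have "\<dots> = (\<Prod>i<2. expectation (\<lambda>\<omega>. exp (- (if i = 0 then a + b else b) * (S (t (Suc i)) \<omega> - S (t i) \<omega>))))"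
    by (rule indep_vars_lebesgue_integral[OF _ ind int]) auto
  also have "\<dots> = expectation (\<lambda>\<omega>. exp (- (a + b) * (S s \<omega> - S 0 \<omega>))) * expectation (\<lambda>\<omega>. exp (- b * (S (s + h) \<omega> - S s \<omega>)))"
    by (simp add: numeral_2_eq_2 t_def mult.commute del: minus_add_distrib)
  also have "expectation (\<lambda>\<omega>. exp (- (a + b) * (S s \<omega> - S 0 \<omega>))) = expectation (\<lambda>\<omega>. exp (- (a + b) * S s \<omega>))"
  proof (rule integral_cong_AE)
    show "AE \<omega> in M. exp (- (a + b) * (S s \<omega> - S 0 \<omega>)) = exp (- (a + b) * S s \<omega>)"
      using S_0 by eventually_elim auto
  qed auto
  also have "expectation (\<lambda>\<omega>. exp (- b * (S (s + h) \<omega> - S s \<omega>))) = expectation (\<lambda>\<omega>. exp (- b * S h \<omega>))"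
  proof -
    have "distr M borel (\<lambda>\<omega>. S (s + h) \<omega> - S s \<omega>) = distr M borel (S h)"
      using levy assms unfolding levy_subordinator_def by blast
    then have "(LINT x|distr M borel (\<lambda>\<omega>. S (s + h) \<omega> - S s \<omega>). exp (- b * x)) = (LINT x|distr M borel (S h). exp (- b * x))"
      by simp
    then show ?thesis by (simp add: integral_distr)
  qed
  finally show ?thesis using laplace_S[of s "a + b"] laplace_S[of h b] assms by simp
qed

end

subsection \<open>The first value beyond a level\<close>

context subordinator
begin

text \<open>The value of S at the right end of the grid cell in which S passes t. On
  \<open>good\<close> paths and for t \<ge> 0 exactly one summand is active; summing over all cells
  avoids a choice of the cell and keeps measurability visible.\<close>

definition disc :: "nat \<Rightarrow> real \<Rightarrow> 'w \<Rightarrow> real" where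
  "disc n t \<omega> = (\<Sum>j. if S (real j / real (Suc n)) \<omega> \<le> t \<and> t < S (real (Suc j) / real (Suc n)) \<omega>
     then S (real (Suc j) / real (Suc n)) \<omega> else 0)"

text \<open>The first value of \<open>S\<close> beyond \<open>t\<close>, as a limit of the corresponding values on the grids
  \<open>\<nat> / (n + 1)\<close>; this form makes it measurable.\<close>

definition overshoot :: "real \<Rightarrow> 'w \<Rightarrow> real" where
  "overshoot t \<omega> = lim (\<lambda>n. disc n t \<omega>)"

text \<open>The measure space N is left open because two of them occur: M itself, and the one
  generated by the paths of S. The latter is what independence from the spatial process
  requires.\<close>

lemma disc_measurable:
  assumes "\<And>r. 0 \<le> r \<Longrightarrow> S r \<in> borel_measurable N"
  shows "(\<lambda>(t, \<omega>). disc n t \<omega>) \<in> borel_measurable (borel \<Otimes>\<^sub>M N)"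
proof -
  have [measurable]: "S (real j / real (Suc n)) \<in> borel_measurable N" for j by (rule assms) simp
  show ?thesis unfolding disc_def split_def by measurable
qed

lemma overshoot_measurable:
  assumes "\<And>r. 0 \<le> r \<Longrightarrow> S r \<in> borel_measurable N"
  shows "(\<lambda>(t, \<omega>). overshoot t \<omega>) \<in> borel_measurable (borel \<Otimes>\<^sub>M N)"
  using disc_measurable[OF assms] unfolding overshoot_def split_def
  by (intro borel_measurable_lim_metric) auto

lemma cell_ex:
  assumes "good \<omega>" "0 \<le> t"
  obtains j where "S (real j / real (Suc n)) \<omega> \<le> t" "t < S (real (Suc j) / real (Suc n)) \<omega>"
proof -
  have sp: "\<omega> \<in> space M" "S 0 \<omega> = 0" using assms by (auto simp: good_def)
  obtain r where r: "0 < r" "t < S r \<omega>" using assms by (auto simp: good_def)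
  obtain m :: nat where m: "r * real (Suc n) < real m" using reals_Archimedean2 by blast
  define P where "P j \<longleftrightarrow> t < S (real (Suc j) / real (Suc n)) \<omega>" for j
  have "r \<le> real (Suc m) / real (Suc n)" using m by (simp add: field_simps)
  then have "S r \<omega> \<le> S (real (Suc m) / real (Suc n)) \<omega>" using r sp by (intro S_mono) auto
  then have "P m" using r by (simp add: P_def)
  then have L: "P (LEAST j. P j)" by (rule LeastI)
  have "S (real (LEAST j. P j) / real (Suc n)) \<omega> \<le> t"
  proof (cases "LEAST j. P j")
    case 0 then show ?thesis using sp assms by simp
  next
    case (Suc i)
    then have "\<not> P i" using not_less_Least[of i P] by simp
    then have "S (real (Suc i) / real (Suc n)) \<omega> \<le> t" by (simp only: P_def not_less)
    then show ?thesis by (simp only: Suc)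
  qed
  with L show thesis using that unfolding P_def by blast
qed

lemma cell_unique:
  assumes \<omega>: "\<omega> \<in> space M"
    and j: "S (real j / real (Suc n)) \<omega> \<le> t" "t < S (real (Suc j) / real (Suc n)) \<omega>"
  shows "S (real i / real (Suc n)) \<omega> \<le> t \<and> t < S (real (Suc i) / real (Suc n)) \<omega> \<longleftrightarrow> i = j"
proof -
  have *: "S (real a / real (Suc n)) \<omega> \<le> S (real b / real (Suc n)) \<omega>" if "a \<le> b" for a b
    using that by (intro S_mono[OF \<omega>] divide_right_mono) auto
  consider "i < j" | "i = j" | "j < i" by linarith
  then show ?thesis
  proof cases
    case 1 then show ?thesis using *[of "Suc i" j] j by auto
  next
    case 3 then show ?thesis using *[of "Suc j" i] j by auto
  qed (use j in auto)
qed

text \<open>Stated for a general value type, since it is applied to reals in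
  \<open>disc_cell\<close> and to extended nonnegative reals in \<open>laplace_disc\<close>.\<close>

lemma suminf_cell:
  fixes g :: "nat \<Rightarrow> 'b :: {t2_space, comm_monoid_add}"
  assumes \<omega>: "\<omega> \<in> space M"
    and j: "S (real j / real (Suc n)) \<omega> \<le> t" "t < S (real (Suc j) / real (Suc n)) \<omega>"
  shows "(\<Sum>i. if S (real i / real (Suc n)) \<omega> \<le> t \<and> t < S (real (Suc i) / real (Suc n)) \<omega> then g i else 0) = g j"
  unfolding cell_unique[OF assms] using sums_single[of j g] by (simp add: sums_iff)

lemma disc_cell:
  assumes "good \<omega>" "0 \<le> t"
  obtains j where "S (real j / real (Suc n)) \<omega> \<le> t" "t < S (real (Suc j) / real (Suc n)) \<omega>"
    "disc n t \<omega> = S (real (Suc j) / real (Suc n)) \<omega>"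
proof -
  obtain j where j: "S (real j / real (Suc n)) \<omega> \<le> t" "t < S (real (Suc j) / real (Suc n)) \<omega>"
    using cell_ex[OF assms] .
  show thesis
    using that[OF j] suminf_cell[OF _ j, where g="\<lambda>j. S (real (Suc j) / real (Suc n)) \<omega>"] assms
    unfolding disc_def good_def by blast
qed

text \<open>The right end points of the active cells lie between the passage time and the passage
  time plus 1/(n+1), so right-continuity of S identifies the limit of the grid values with the value
  of S at the passage time.\<close>

lemma overshoot_eq:
  assumes g: "good \<omega>" and t: "0 \<le> t"
  obtains \<tau> where "0 \<le> \<tau>" "tau0 (\<lambda>r. S r \<omega>) (ereal t) = ereal \<tau>" "overshoot t \<omega> = S \<tau> \<omega>"
    "(\<lambda>n. disc n t \<omega>) \<longlonglongrightarrow> S \<tau> \<omega>"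
proof -
  have sp: "\<omega> \<in> space M" "S 0 \<omega> = 0" using g by (auto simp: good_def)
  define R where "R = {r. 0 < r \<and> t < S r \<omega>}"
  define \<tau> where "\<tau> = Inf R"
  have R: "R \<noteq> {}" "bdd_below R" using g by (auto simp: R_def good_def intro!: bdd_belowI[of _ 0])
  have "tau0 (\<lambda>r. S r \<omega>) (ereal t) = (INF r\<in>R. ereal r)"
    by (simp add: tau0_def R_def)
  then have 1: "tau0 (\<lambda>r. S r \<omega>) (ereal t) = ereal \<tau>"
    using ereal_Inf'[OF R(2,1)] by (simp add: \<tau>_def)
  have 0: "0 \<le> \<tau>" unfolding \<tau>_def by (rule cInf_greatest[OF R(1)]) (auto simp: R_def)
  define J where "J n = (SOME j. S (real j / real (Suc n)) \<omega> \<le> t \<and> t < S (real (Suc j) / real (Suc n)) \<omega>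
      \<and> disc n t \<omega> = S (real (Suc j) / real (Suc n)) \<omega>)" for n
  have J: "S (real (J n) / real (Suc n)) \<omega> \<le> t" "t < S (real (Suc (J n)) / real (Suc n)) \<omega>"
    "disc n t \<omega> = S (real (Suc (J n)) / real (Suc n)) \<omega>" for n
    using someI_ex[of "\<lambda>j. S (real j / real (Suc n)) \<omega> \<le> t \<and> t < S (real (Suc j) / real (Suc n)) \<omega>
      \<and> disc n t \<omega> = S (real (Suc j) / real (Suc n)) \<omega>"] disc_cell[OF g t, of n]
    unfolding J_def by blast+
  define d where "d n = real (Suc (J n)) / real (Suc n)" for n
  have lo: "\<tau> \<le> d n" for n
    unfolding \<tau>_def by (rule cInf_lower[OF _ R(2)]) (use J(2)[of n] in \<open>simp add: R_def d_def\<close>)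
  have hi: "d n \<le> \<tau> + 1 / real (Suc n)" for n
  proof -
    have "real (J n) / real (Suc n) \<le> \<tau>"
      unfolding \<tau>_def
    proof (rule cInf_greatest[OF R(1)])
      fix r assume r: "r \<in> R"
      show "real (J n) / real (Suc n) \<le> r"
      proof (rule ccontr)
        assume "\<not> ?thesis"
        then have "S r \<omega> \<le> S (real (J n) / real (Suc n)) \<omega>"
          using r sp by (intro S_mono) (auto simp: R_def)
        then show False using r J(1)[of n] by (simp add: R_def)
      qed
    qed
    then show ?thesis by (simp add: d_def add_divide_distrib)
  qed
  have "(\<lambda>n. \<tau> + 1 / real (Suc n)) \<longlonglongrightarrow> \<tau> + 0"
    by (intro tendsto_intros LIMSEQ_Suc[OF lim_1_over_n])
  then have "d \<longlonglongrightarrow> \<tau>"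
    by (intro tendsto_sandwich[where f="\<lambda>_. \<tau>" and g=d and h="\<lambda>n. \<tau> + 1 / real (Suc n)"])
       (use lo hi in \<open>auto intro!: always_eventually\<close>)
  \<comment> \<open>The grid points may coincide with \<tau>, so continuity within the closed
    half-line is used instead of the limit along \<open>at_right\<close>.\<close>
  moreover have "continuous (at \<tau> within {\<tau>..}) (\<lambda>s. S s \<omega>)"
    using S_right[OF sp(1) 0] by (simp add: continuous_within at_within_Ici_at_right)
  ultimately have "(\<lambda>n. S (d n) \<omega>) \<longlonglongrightarrow> S \<tau> \<omega>"
    using continuous_within_tendsto_compose'[of \<tau> "{\<tau>..}" "\<lambda>s. S s \<omega>" d] lo by auto
  then have 2: "(\<lambda>n. disc n t \<omega>) \<longlonglongrightarrow> S \<tau> \<omega>" by (simp add: J(3) d_def)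
  show thesis using that[OF 0 1 limI[OF 2, folded overshoot_def] 2] .
qed

lemma disc_tendsto: "good \<omega> \<Longrightarrow> 0 \<le> t \<Longrightarrow> (\<lambda>n. disc n t \<omega>) \<longlonglongrightarrow> overshoot t \<omega>"
  by (metis overshoot_eq)

lemma disc_gt: "good \<omega> \<Longrightarrow> 0 \<le> t \<Longrightarrow> t < disc n t \<omega>"
  by (metis disc_cell)

lemma overshoot_ge: "good \<omega> \<Longrightarrow> 0 \<le> t \<Longrightarrow> t \<le> overshoot t \<omega>"
  by (rule LIMSEQ_le_const[OF disc_tendsto]) (auto intro: less_imp_le disc_gt)

sublocale hM: pair_sigma_finite halfline M ..
sublocale lM: pair_sigma_finite lborel M ..

lemma disc_measurable1[measurable (raw)]:
  "g \<in> borel_measurable N \<Longrightarrow> h \<in> N \<rightarrow>\<^sub>M M \<Longrightarrow> (\<lambda>z. disc n (g z) (h z)) \<in> borel_measurable N"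
  using measurable_compose[OF measurable_Pair disc_measurable[OF S_measurable]] by simp

lemma overshoot_measurable1[measurable (raw)]:
  "g \<in> borel_measurable N \<Longrightarrow> h \<in> N \<rightarrow>\<^sub>M M \<Longrightarrow> (\<lambda>z. overshoot (g z) (h z)) \<in> borel_measurable N"
  using measurable_compose[OF measurable_Pair overshoot_measurable[OF S_measurable]] by simp

lemma ennreal_exp_cell:
  fixes a b x y :: real
  assumes a: "0 < a" and le: "x \<le> y"
  shows "ennreal (exp (- b * y)) * ennreal ((exp (- a * x) - exp (- a * y)) / a)
    = ennreal ((exp (- a * x - b * y) - exp (- (a + b) * y)) / a)"
proof -
  have "exp (- b * y) * ((exp (- a * x) - exp (- a * y)) / a)
    = (exp (- b * y) * exp (- a * x) - exp (- b * y) * exp (- a * y)) / a"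
    by (simp only: times_divide_eq_right right_diff_distrib)
  also have "\<dots> = (exp (- a * x - b * y) - exp (- (a + b) * y)) / a"
    unfolding exp_add[symmetric] by (simp add: algebra_simps)
  finally show ?thesis
    using assms by (subst ennreal_mult[symmetric]) auto
qed

text \<open>The integrand is the integral of exp (-a t - b S (s+h)) over the levels t that S passes
  between the times s and s+h.\<close>

lemma laplace_cell:
  assumes s: "0 \<le> s" and h: "0 \<le> h" and a: "0 < a" and b: "0 \<le> b"
  shows "(\<integral>\<^sup>+\<omega>. ennreal ((exp (- a * S s \<omega> - b * S (s + h) \<omega>) - exp (- (a + b) * S (s + h) \<omega>)) / a) \<partial>M)
    = ennreal ((exp (- s * psi (a + b)) * exp (- h * psi b) - exp (- (s + h) * psi (a + b))) / a)"
proof -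
  have [measurable]: "S s \<in> borel_measurable M" "S (s + h) \<in> borel_measurable M"
    using s h by (auto intro: S_measurable)
  have 1: "integrable M (\<lambda>\<omega>. exp (- a * S s \<omega> - b * S (s + h) \<omega>))"
  proof (rule integrable_const_bound[where B=1])
    show "AE \<omega> in M. norm (exp (- a * S s \<omega> - b * S (s + h) \<omega>)) \<le> 1"
      using S_nonneg
    proof eventually_elim
      case (elim \<omega>)
      have "0 \<le> a * S s \<omega>" "0 \<le> b * S (s + h) \<omega>" using elim a b s h by auto
      then show ?case by simp
    qed
  qed simp
  have 2: "integrable M (\<lambda>\<omega>. exp (- (a + b) * S (s + h) \<omega>))"
    using s h a b by (intro integrable_exp_S) auto
  have "(\<integral>\<^sup>+\<omega>. ennreal ((exp (- a * S s \<omega> - b * S (s + h) \<omega>) - exp (- (a + b) * S (s + h) \<omega>)) / a) \<partial>M)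
    = ennreal (expectation (\<lambda>\<omega>. (exp (- a * S s \<omega> - b * S (s + h) \<omega>) - exp (- (a + b) * S (s + h) \<omega>)) / a))"
  proof (rule nn_integral_eq_integral)
    show "AE \<omega> in M. 0 \<le> (exp (- a * S s \<omega> - b * S (s + h) \<omega>) - exp (- (a + b) * S (s + h) \<omega>)) / a"
      using AE_space
    proof eventually_elim
      case (elim \<omega>)
      have "a * S s \<omega> \<le> a * S (s + h) \<omega>" using elim a s h by (intro mult_left_mono S_mono) auto
      then show ?case using a by (simp add: algebra_simps)
    qed
  qed (intro integrable_divide Bochner_Integration.integrable_diff 1 2)
  also have "expectation (\<lambda>\<omega>. (exp (- a * S s \<omega> - b * S (s + h) \<omega>) - exp (- (a + b) * S (s + h) \<omega>)) / a)
    = (exp (- s * psi (a + b)) * exp (- h * psi b) - exp (- (s + h) * psi (a + b))) / a"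
    using laplace_increment[of s h a b] laplace_S[of "s + h" "a + b"] a b s h
    by (simp only: integral_divide_zero Bochner_Integration.integral_diff[OF 1 2] less_imp_le add_nonneg_nonneg)
  finally show ?thesis .
qed

text \<open>Cell j contributes (\<alpha> - \<beta>) / a times the j-th power of \<beta>: starting
  the cell later only inserts further factors of \<beta>, one for each preceding increment. The sum
  over the cells is a geometric series, convergent because \<open>psi\<close> (a+b) > 0.\<close>

lemma laplace_disc:
  fixes n :: nat
  assumes a: "0 < a" and b: "0 \<le> b"
  defines "\<alpha> \<equiv> exp (- (1 / real (Suc n)) * psi b)" and "\<beta> \<equiv> exp (- (1 / real (Suc n)) * psi (a + b))"
  shows "(\<integral>\<^sup>+t. \<integral>\<^sup>+\<omega>. ennreal (exp (- a * t - b * disc n t \<omega>)) \<partial>M \<partial>halfline) = ennreal ((\<alpha> - \<beta>) / (a * (1 - \<beta>)))"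
proof -
  let ?h = "1 / real (Suc n)"
  have [measurable]: "S (real j / real (Suc n)) \<in> borel_measurable M" for j by (rule S_measurable) simp
  define F where "F j t \<omega> = (if S (real j / real (Suc n)) \<omega> \<le> t \<and> t < S (real (Suc j) / real (Suc n)) \<omega>
    then ennreal (exp (- a * t)) * ennreal (exp (- b * S (real (Suc j) / real (Suc n)) \<omega>)) else 0)" for j t \<omega>
  have [measurable]: "(\<lambda>z. F j (g z) (h z)) \<in> borel_measurable N"
    if [measurable]: "g \<in> borel_measurable N" "h \<in> N \<rightarrow>\<^sub>M M"
    for j g h and N :: "'b measure"
    unfolding F_def by measurable
  have \<beta>: "0 < \<beta>" "\<beta> < 1" using psi_pos[of "a + b"] a b by (auto simp: \<beta>_def)
  have \<alpha>\<beta>: "\<beta> \<le> \<alpha>" using psi_mono[of b "a + b"] a b by (simp add: \<alpha>_def \<beta>_def divide_right_mono)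
  have cell: "(\<integral>\<^sup>+\<omega>. \<integral>\<^sup>+t. F j t \<omega> \<partial>lborel \<partial>M) = ennreal ((\<alpha> - \<beta>) / a * \<beta> ^ j)" for j
  proof -
    let ?s = "real j / real (Suc n)"
    have e: "real (Suc j) / real (Suc n) = ?s + ?h" by (simp add: add_divide_distrib)
    have "(\<integral>\<^sup>+\<omega>. \<integral>\<^sup>+t. F j t \<omega> \<partial>lborel \<partial>M)
      = (\<integral>\<^sup>+\<omega>. ennreal ((exp (- a * S ?s \<omega> - b * S (?s + ?h) \<omega>) - exp (- (a + b) * S (?s + ?h) \<omega>)) / a) \<partial>M)"
    proof (rule nn_integral_cong)
      fix \<omega> assume \<omega>: "\<omega> \<in> space M"
      have le: "S ?s \<omega> \<le> S (?s + ?h) \<omega>" using \<omega> by (intro S_mono) auto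
      have "(\<integral>\<^sup>+t. F j t \<omega> \<partial>lborel) = (\<integral>\<^sup>+t. ennreal (exp (- b * S (?s + ?h) \<omega>)) *
          (ennreal (exp (- a * t)) * indicator {S ?s \<omega>..<S (?s + ?h) \<omega>} t) \<partial>lborel)"
        unfolding F_def e by (intro nn_integral_cong) (auto simp: mult_ac)
      also have "\<dots> = ennreal (exp (- b * S (?s + ?h) \<omega>)) *
          ennreal ((exp (- a * S ?s \<omega>) - exp (- a * S (?s + ?h) \<omega>)) / a)"
        using nn_integral_exp_Ico[OF a le] by (subst nn_integral_cmult) auto
      also have "\<dots> = ennreal ((exp (- a * S ?s \<omega> - b * S (?s + ?h) \<omega>) - exp (- (a + b) * S (?s + ?h) \<omega>)) / a)"
        by (rule ennreal_exp_cell[OF a le])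
      finally show "(\<integral>\<^sup>+t. F j t \<omega> \<partial>lborel) = \<dots>" .
    qed
    also have "\<dots> = ennreal ((exp (- ?s * psi (a + b)) * exp (- ?h * psi b) - exp (- (?s + ?h) * psi (a + b))) / a)"
      by (rule laplace_cell[OF _ _ a b]) auto
    also have "exp (- ?s * psi (a + b)) = \<beta> ^ j"
      unfolding \<beta>_def exp_of_nat_mult[symmetric] by simp
    also have "exp (- (?s + ?h) * psi (a + b)) = \<beta> ^ j * \<beta>"
      unfolding \<beta>_def exp_of_nat_mult[symmetric] exp_add[symmetric] by (simp add: algebra_simps)
    also have "(\<beta> ^ j * exp (- ?h * psi b) - \<beta> ^ j * \<beta>) / a = (\<alpha> - \<beta>) / a * \<beta> ^ j"
      unfolding \<alpha>_def by (simp add: algebra_simps)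
    finally show ?thesis .
  qed
  have "(\<integral>\<^sup>+t. \<integral>\<^sup>+\<omega>. ennreal (exp (- a * t - b * disc n t \<omega>)) \<partial>M \<partial>halfline)
    = (\<integral>\<^sup>+t\<in>{0<..}. (\<integral>\<^sup>+\<omega>. ennreal (exp (- a * t - b * disc n t \<omega>)) \<partial>M) \<partial>lborel)"
    by (rule nn_integral_halfline) measurable
  \<comment> \<open>The integral may be extended to the whole line: S is almost surely nonnegative,
    so no cell is active at a negative level. The single level 0 is discarded as a null set.\<close>
  also have "\<dots> = (\<integral>\<^sup>+t. \<integral>\<^sup>+\<omega>. (\<Sum>j. F j t \<omega>) \<partial>M \<partial>lborel)"
  proof (rule nn_integral_cong_AE)
    have "AE t in lborel. t \<noteq> (0::real)" by (rule AE_lborel_singleton)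
    then show "AE t in lborel. (\<integral>\<^sup>+\<omega>. ennreal (exp (- a * t - b * disc n t \<omega>)) \<partial>M) * indicator {0<..} t
      = (\<integral>\<^sup>+\<omega>. (\<Sum>j. F j t \<omega>) \<partial>M)"
    proof eventually_elim
      case (elim t)
      show ?case
      proof (cases "t < 0")
        case True
        have "AE \<omega> in M. (\<Sum>j. F j t \<omega>) = 0"
          using AE_good
        proof eventually_elim
          case (elim \<omega>)
          have "F j t \<omega> = 0" for j using good_nonneg[OF elim, of "real j / real (Suc n)"] True by (auto simp: F_def)
          then show ?case by simp
        qed
        then have "(\<integral>\<^sup>+\<omega>. (\<Sum>j. F j t \<omega>) \<partial>M) = (\<integral>\<^sup>+\<omega>. 0 \<partial>M)" by (rule nn_integral_cong_AE)
        then show ?thesis using True by simp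
      next
        case False
        then have t: "0 < t" using elim by simp
        have "AE \<omega> in M. ennreal (exp (- a * t - b * disc n t \<omega>)) = (\<Sum>j. F j t \<omega>)"
          using AE_good
        proof eventually_elim
          case (elim \<omega>)
          then obtain j where j: "S (real j / real (Suc n)) \<omega> \<le> t" "t < S (real (Suc j) / real (Suc n)) \<omega>"
            "disc n t \<omega> = S (real (Suc j) / real (Suc n)) \<omega>"
            using disc_cell[of \<omega> t n] t by auto
          have "(\<Sum>j. F j t \<omega>) = ennreal (exp (- a * t)) * ennreal (exp (- b * S (real (Suc j) / real (Suc n)) \<omega>))"
            unfolding F_def using elim j(1,2) by (intro suminf_cell) (auto simp: good_def)
          then show ?case using j(3) by (simp add: ennreal_mult[symmetric] exp_diff exp_minus field_simps)
        qed
        from nn_integral_cong_AE[OF this] show ?thesis using t by simp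
      qed
    qed
  qed
  also have "\<dots> = (\<integral>\<^sup>+\<omega>. \<integral>\<^sup>+t. (\<Sum>j. F j t \<omega>) \<partial>lborel \<partial>M)"
    by (rule lM.Fubini'[symmetric]) (simp add: split_def)
  also have "\<dots> = (\<integral>\<^sup>+\<omega>. (\<Sum>j. \<integral>\<^sup>+t. F j t \<omega> \<partial>lborel) \<partial>M)"
    by (intro nn_integral_cong nn_integral_suminf) measurable
  also have "\<dots> = (\<Sum>j. \<integral>\<^sup>+\<omega>. \<integral>\<^sup>+t. F j t \<omega> \<partial>lborel \<partial>M)"
    by (intro nn_integral_suminf) measurable
  also have "\<dots> = (\<Sum>j. ennreal ((\<alpha> - \<beta>) / a * \<beta> ^ j))" by (simp add: cell)
  also have "\<dots> = ennreal ((\<alpha> - \<beta>) / a * (1 / (1 - \<beta>)))"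
  proof (rule suminf_ennreal_eq)
    show "(\<lambda>j. (\<alpha> - \<beta>) / a * \<beta> ^ j) sums ((\<alpha> - \<beta>) / a * (1 / (1 - \<beta>)))"
      using \<beta> by (intro sums_mult geometric_sums) auto
  qed (use \<alpha>\<beta> \<beta> a in auto)
  finally show ?thesis by simp
qed

end

subsection \<open>The potential measure and the compensation formula\<close>

context pair_sigma_finite
begin

lemma AE_pair_fst:
  assumes "AE x in M1. P x" shows "AE z in M1 \<Otimes>\<^sub>M M2. P (fst z)"
proof -
  obtain N where N: "{x \<in> space M1. \<not> P x} \<subseteq> N" "N \<in> null_sets M1"
    using assms by (elim AE_E) (auto simp: null_sets_def)
  then have "N \<times> space M2 \<in> null_sets (M1 \<Otimes>\<^sub>M M2)"
    by (auto simp: null_sets_def M2.emeasure_pair_measure_Times)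
  then show ?thesis by (rule AE_I') (use N in \<open>auto simp: space_pair_measure\<close>)
qed

lemma AE_pair_snd:
  assumes "AE y in M2. P y" shows "AE z in M1 \<Otimes>\<^sub>M M2. P (snd z)"
proof -
  obtain N where N: "{x \<in> space M2. \<not> P x} \<subseteq> N" "N \<in> null_sets M2"
    using assms by (elim AE_E) (auto simp: null_sets_def)
  then have "space M1 \<times> N \<in> null_sets (M1 \<Otimes>\<^sub>M M2)"
    by (auto simp: null_sets_def M2.emeasure_pair_measure_Times)
  then show ?thesis by (rule AE_I') (use N in \<open>auto simp: space_pair_measure\<close>)
qed

end

text \<open>N is recovered from a finite measure by the reciprocal density, which takes finite
  values. For the potential measure the density exp (-y) will serve.\<close>

lemma sigma_finite_from_finite_density:
  assumes f: "f \<in> borel_measurable N" "\<And>x. 0 < f x"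
    and fin: "(\<integral>\<^sup>+x. ennreal (f x) \<partial>N) < \<infinity>"
  shows "sigma_finite_measure N"
proof -
  have "finite_measure (density N (\<lambda>x. ennreal (f x)))"
    using f fin by (intro finite_measureI) (auto simp: emeasure_density cong: nn_integral_cong)
  then interpret D: finite_measure "density N (\<lambda>x. ennreal (f x))" .
  have "density (density N (\<lambda>x. ennreal (f x))) (\<lambda>x. ennreal (1 / f x)) = density N (\<lambda>x. ennreal (f x) * ennreal (1 / f x))"
    using f by (intro density_density_eq) auto
  also have "\<dots> = density N (\<lambda>_. 1)"
    using f(2) by (intro arg_cong[where f="density N"] ext) (simp add: ennreal_mult[symmetric] less_imp_le less_imp_neq[symmetric])
  finally have "N = density (density N (\<lambda>x. ennreal (f x))) (\<lambda>x. ennreal (1 / f x))" by (simp add: density_1)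
  moreover have "sigma_finite_measure (density (density N (\<lambda>x. ennreal (f x))) (\<lambda>x. ennreal (1 / f x)))"
    using D.sigma_finite_iff_density_finite[of "\<lambda>x. ennreal (1 / f x)"] f D.sigma_finite_measure_axioms by simp
  ultimately show ?thesis by simp
qed

lemma nn_integral_halfline_exp:
  assumes "0 < (a::real)" shows "(\<integral>\<^sup>+t. ennreal (exp (- a * t)) \<partial>halfline) = ennreal (1 / a)"
proof -
  have "(\<integral>\<^sup>+t. ennreal (exp (- a * t)) \<partial>halfline) = (\<integral>\<^sup>+t\<in>{0<..}. ennreal (exp (- a * t)) \<partial>lborel)"
    by (rule nn_integral_halfline) measurable
  also have "\<dots> = (\<integral>\<^sup>+t. ennreal (exp (- a * t)) * indicator {0..} t \<partial>lborel)"
  proof (rule nn_integral_cong_AE)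
    have "AE t in lborel. t \<noteq> (0::real)" by (rule AE_lborel_singleton)
    then show "AE t in lborel. ennreal (exp (- a * t)) * indicator {0<..} t = ennreal (exp (- a * t)) * indicator {0..} t"
      by eventually_elim (auto split: split_indicator)
  qed
  also have "\<dots> = ennreal (0 - - exp (- a * 0) / a)"
  proof (rule nn_integral_FTC_atLeast)
    show "DERIV (\<lambda>t. - exp (- a * t) / a) t :> exp (- a * t)" for t
      using assms by (auto intro!: derivative_eq_intros)
    have "filterlim (\<lambda>t. a * t) at_top at_top"
      by (rule filterlim_tendsto_pos_mult_at_top[OF tendsto_const assms filterlim_ident])
    then have "filterlim (\<lambda>t. - a * t) at_bot at_top" by (simp add: filterlim_uminus_at_top)
    then have "((\<lambda>t. - exp (- a * t) / a) \<longlongrightarrow> - 0 / a) at_top"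
      by (intro tendsto_intros filterlim_compose[OF exp_at_bot]) (use assms in auto)
    then show "((\<lambda>t. - exp (- a * t) / a) \<longlongrightarrow> 0) at_top" by simp
  qed auto
  finally show ?thesis by simp
qed

section \<open>Laplace transforms of the potential measure and of the first value beyond a
  level\<close>

context subordinator
begin

lemma nn_integral_psi_diff:
  assumes a: "0 < a" and b: "0 \<le> b"
  shows "(\<integral>\<^sup>+r. ennreal ((exp (- b * r) - exp (- (a + b) * r)) / a) \<partial>Nu) = ennreal ((psi (a + b) - psi b) / a)"
proof -
  have i: "integrable Nu (\<lambda>r. 1 - exp (- b * r))" "integrable Nu (\<lambda>r. 1 - exp (- (a + b) * r))"
    using psi_integrable[of b] psi_integrable[of "a + b"] a b by auto
  have e: "(exp (- b * r) - exp (- (a + b) * r)) / a = ((1 - exp (- (a + b) * r)) - (1 - exp (- b * r))) / a" for r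
    by simp
  have "(\<integral>\<^sup>+r. ennreal ((exp (- b * r) - exp (- (a + b) * r)) / a) \<partial>Nu)
    = ennreal (LINT r|Nu. ((1 - exp (- (a + b) * r)) - (1 - exp (- b * r))) / a)"
    unfolding e
  proof (rule nn_integral_eq_integral)
    show "AE r in Nu. 0 \<le> ((1 - exp (- (a + b) * r)) - (1 - exp (- b * r))) / a"
      using AE_Nu_pos
    proof eventually_elim
      case (elim r)
      have "b * r \<le> (a + b) * r" using elim a by (intro mult_right_mono) auto
      then have "exp (- (a + b) * r) \<le> exp (- b * r)"
        by (simp only: exp_le_cancel_iff mult_minus_left neg_le_iff_le)
      then show ?case using a by (intro divide_nonneg_pos) linarith+
    qed
  qed (intro integrable_divide Bochner_Integration.integrable_diff i)
  also have "(LINT r|Nu. ((1 - exp (- (a + b) * r)) - (1 - exp (- b * r))) / a) = (psi (a + b) - psi b) / a"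
    unfolding psi_def by (simp only: integral_divide_zero Bochner_Integration.integral_diff[OF i(2,1)])
  finally show ?thesis .
qed

lemma S_measurable_pair: "(\<lambda>(s, \<omega>). S (max 0 s) \<omega>) \<in> borel_measurable (borel \<Otimes>\<^sub>M M)"
  by (rule borel_measurable_right_continuous[OF S_measurable S_right])

lemma S_measurable1[measurable (raw)]:
  "g \<in> borel_measurable N \<Longrightarrow> h \<in> N \<rightarrow>\<^sub>M M \<Longrightarrow> (\<lambda>z. S (max 0 (g z)) (h z)) \<in> borel_measurable N"
  using measurable_compose[OF measurable_Pair S_measurable_pair] by simp

lemma sets_U[simp, measurable_cong]: "sets U = sets borel" and space_U[simp]: "space U = UNIV"
  by (simp_all add: U_def)

lemma nn_integral_U:
  assumes [measurable]: "f \<in> borel_measurable borel"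
  shows "(\<integral>\<^sup>+y. f y \<partial>U) = (\<integral>\<^sup>+s. \<integral>\<^sup>+\<omega>. f (S (max 0 s) \<omega>) \<partial>M \<partial>halfline)"
proof -
  have "(\<integral>\<^sup>+y. f y \<partial>U) = (\<integral>\<^sup>+z. f (S (max 0 (fst z)) (snd z)) \<partial>(halfline \<Otimes>\<^sub>M M))"
    unfolding U_def split_def by (subst nn_integral_distr) auto
  then show ?thesis by (subst (asm) nn_integral_fst[symmetric]) auto
qed

lemma AE_U_nonneg: "AE y in U. 0 \<le> y"
proof -
  have "AE z in halfline \<Otimes>\<^sub>M M. 0 \<le> S (max 0 (fst z)) (snd z)"
    using hM.AE_pair_snd[OF S_nonneg] by eventually_elim auto
  then show ?thesis unfolding U_def split_def by (subst AE_distr_iff) auto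
qed

text \<open>The expectation of exp (-k S s) is exp (-s \<open>psi\<close> k), whose integral over s
  > 0 is 1 / \<open>psi\<close> k.\<close>

lemma laplace_U:
  assumes k: "0 < k" shows "(\<integral>\<^sup>+y. ennreal (exp (- k * y)) \<partial>U) = ennreal (1 / psi k)"
proof -
  have "(\<integral>\<^sup>+y. ennreal (exp (- k * y)) \<partial>U) = (\<integral>\<^sup>+s. \<integral>\<^sup>+\<omega>. ennreal (exp (- k * S (max 0 s) \<omega>)) \<partial>M \<partial>halfline)"
    by (rule nn_integral_U) measurable
  also have "\<dots> = (\<integral>\<^sup>+s. ennreal (exp (- psi k * s)) \<partial>halfline)"
  proof (rule nn_integral_cong_AE)
    show "AE s in halfline. (\<integral>\<^sup>+\<omega>. ennreal (exp (- k * S (max 0 s) \<omega>)) \<partial>M) = ennreal (exp (- psi k * s))"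
      using AE_halfline_pos
    proof eventually_elim
      case (elim s)
      then have "max 0 s = s" by simp
      then show ?case
        using laplace_S[of s k] integrable_exp_S[of s k] elim k
        by (simp add: nn_integral_eq_integral mult.commute)
    qed
  qed
  also have "\<dots> = ennreal (1 / psi k)" by (rule nn_integral_halfline_exp[OF psi_pos[OF k]])
  finally show ?thesis .
qed

lemma sigma_finite_U: "sigma_finite_measure U"
  by (rule sigma_finite_from_finite_density[where f="\<lambda>y. exp (- 1 * y)"])
     (use laplace_U[of 1] in \<open>auto simp del: mult_minus1\<close>)

sublocale U: sigma_finite_measure U by (rule sigma_finite_U)

text \<open>Limit of \<open>laplace_disc\<close> as the mesh tends to 0, dominated by exp (-a
  t).\<close>

lemma laplace_overshoot:
  assumes a: "0 < a" and b: "0 \<le> b"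
  shows "(\<integral>\<^sup>+t. \<integral>\<^sup>+\<omega>. ennreal (exp (- a * t - b * overshoot t \<omega>)) \<partial>M \<partial>halfline)
    = ennreal ((psi (a + b) - psi b) / (a * psi (a + b)))"
proof -
  have fst: "(\<integral>\<^sup>+t. \<integral>\<^sup>+\<omega>. ennreal (exp (- a * t - b * g t \<omega>)) \<partial>M \<partial>halfline)
    = (\<integral>\<^sup>+z. ennreal (exp (- a * fst z - b * g (fst z) (snd z))) \<partial>(halfline \<Otimes>\<^sub>M M))"
    if [measurable]: "(\<lambda>z. g (fst z) (snd z)) \<in> borel_measurable (borel \<Otimes>\<^sub>M M)" for g
    using nn_integral_fst[of "\<lambda>z. ennreal (exp (- a * fst z - b * g (fst z) (snd z)))" halfline] by simp
  have lim1: "(\<lambda>n. \<integral>\<^sup>+z. ennreal (exp (- a * fst z - b * disc n (fst z) (snd z))) \<partial>(halfline \<Otimes>\<^sub>M M))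
    \<longlonglongrightarrow> (\<integral>\<^sup>+z. ennreal (exp (- a * fst z - b * overshoot (fst z) (snd z))) \<partial>(halfline \<Otimes>\<^sub>M M))"
  proof (rule nn_integral_dominated_convergence[where w="\<lambda>z. ennreal (exp (- a * fst z))"])
    have pos: "AE z in halfline \<Otimes>\<^sub>M M. 0 < fst z \<and> good (snd z)"
      using hM.AE_pair_fst[OF AE_halfline_pos] hM.AE_pair_snd[OF AE_good] by eventually_elim auto
    show "AE z in halfline \<Otimes>\<^sub>M M. ennreal (exp (- a * fst z - b * disc n (fst z) (snd z))) \<le> ennreal (exp (- a * fst z))" for n
      using pos
    proof eventually_elim
      case (elim z)
      have "0 \<le> b * disc n (fst z) (snd z)" using disc_gt[of "snd z" "fst z" n] elim b by auto
      then show ?case by simp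
    qed
    show "AE z in halfline \<Otimes>\<^sub>M M. (\<lambda>n. ennreal (exp (- a * fst z - b * disc n (fst z) (snd z))))
      \<longlonglongrightarrow> ennreal (exp (- a * fst z - b * overshoot (fst z) (snd z)))"
      using pos by eventually_elim (intro tendsto_intros disc_tendsto, auto)
    have "(\<integral>\<^sup>+z. ennreal (exp (- a * fst z)) \<partial>(halfline \<Otimes>\<^sub>M M)) = (\<integral>\<^sup>+t. \<integral>\<^sup>+\<omega>. ennreal (exp (- a * t)) \<partial>M \<partial>halfline)"
      by (subst nn_integral_fst[symmetric]) auto
    then show "(\<integral>\<^sup>+z. ennreal (exp (- a * fst z)) \<partial>(halfline \<Otimes>\<^sub>M M)) < \<infinity>"
      using nn_integral_halfline_exp[OF a] by (simp add: emeasure_space_1)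
  qed auto
  define \<alpha> where "\<alpha> n = exp (- (1 / real (Suc n)) * psi b)" for n
  define \<beta> where "\<beta> n = exp (- (1 / real (Suc n)) * psi (a + b))" for n
  have ab: "0 < a + b" using a b by simp
  \<comment> \<open>Numerator and denominator are divided by the mesh, so that each becomes built
    from the convergent quotients of \<open>tendsto_one_minus_exp\<close>.\<close>
  have "(\<lambda>n. ((1 - \<beta> n) * real (Suc n) - (1 - \<alpha> n) * real (Suc n)) / (a * ((1 - \<beta> n) * real (Suc n))))
    \<longlonglongrightarrow> (psi (a + b) - psi b) / (a * psi (a + b))"
    unfolding \<alpha>_def \<beta>_def
    by (intro tendsto_intros tendsto_one_minus_exp) (use a psi_pos[OF ab] in auto)
  moreover have "((1 - \<beta> n) * real (Suc n) - (1 - \<alpha> n) * real (Suc n)) / (a * ((1 - \<beta> n) * real (Suc n)))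
    = (\<alpha> n - \<beta> n) / (a * (1 - \<beta> n))" for n
  proof -
    have "((1 - \<beta> n) * real (Suc n) - (1 - \<alpha> n) * real (Suc n)) = (\<alpha> n - \<beta> n) * real (Suc n)"
      by (simp only: left_diff_distrib[symmetric]) simp
    moreover have "a * ((1 - \<beta> n) * real (Suc n)) = (a * (1 - \<beta> n)) * real (Suc n)" by simp
    ultimately show ?thesis
      by (metis mult_divide_mult_cancel_right of_nat_eq_0_iff nat.distinct(1))
  qed
  ultimately have lim2: "(\<lambda>n. ennreal ((\<alpha> n - \<beta> n) / (a * (1 - \<beta> n)))) \<longlonglongrightarrow> ennreal ((psi (a + b) - psi b) / (a * psi (a + b)))"
    by (intro tendsto_ennrealI) simp
  have "(\<integral>\<^sup>+z. ennreal (exp (- a * fst z - b * disc n (fst z) (snd z))) \<partial>(halfline \<Otimes>\<^sub>M M))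
    = ennreal ((\<alpha> n - \<beta> n) / (a * (1 - \<beta> n)))" for n
    using laplace_disc[OF a b, of n] fst[of "disc n"] by (simp add: \<alpha>_def \<beta>_def)
  then have "(\<integral>\<^sup>+z. ennreal (exp (- a * fst z - b * overshoot (fst z) (snd z))) \<partial>(halfline \<Otimes>\<^sub>M M))
    = ennreal ((psi (a + b) - psi b) / (a * psi (a + b)))"
    using LIMSEQ_unique[OF lim1] lim2 by simp
  then show ?thesis using fst[of overshoot] by simp
qed

section \<open>The measure of jumps and the compensation formula\<close>

sublocale Nl: pair_sigma_finite Nu lborel ..

sublocale UNl: pair_sigma_finite U "Nu \<Otimes>\<^sub>M lborel" ..

text \<open>A point \<open>(z, r, t)\<close> stands for a jump of \<open>S\<close> of size \<open>r\<close> from the level \<open>z\<close> that passes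
  the level \<open>t\<close>.\<close>

definition jumps :: "(real \<times> real \<times> real) measure" where
  "jumps = density (U \<Otimes>\<^sub>M (Nu \<Otimes>\<^sub>M lborel)) (\<lambda>(z, r, t). indicator {z..<z + r} t)"

lemma sets_UNl: "sets (U \<Otimes>\<^sub>M (Nu \<Otimes>\<^sub>M lborel)) = sets (borel \<Otimes>\<^sub>M (borel \<Otimes>\<^sub>M borel))"
  by (intro sets_pair_measure_cong) auto

lemma sets_jumps[measurable_cong]: "sets jumps = sets (borel \<Otimes>\<^sub>M (borel \<Otimes>\<^sub>M borel))"
  unfolding jumps_def sets_density by (rule sets_UNl)

lemma jumps_density_measurable[measurable]:
  "(\<lambda>(z, r, t). indicator {z..<z + r} t :: ennreal) \<in> borel_measurable (U \<Otimes>\<^sub>M (Nu \<Otimes>\<^sub>M lborel))"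
proof -
  have "(\<lambda>x. if fst x \<le> snd (snd x) \<and> snd (snd x) < fst x + fst (snd x) then 1 else 0 :: ennreal)
    \<in> borel_measurable (U \<Otimes>\<^sub>M (Nu \<Otimes>\<^sub>M lborel))" by measurable
  also have "(\<lambda>x. if fst x \<le> snd (snd x) \<and> snd (snd x) < fst x + fst (snd x) then 1 else 0 :: ennreal)
    = (\<lambda>(z, r, t). indicator {z..<z + r} t)" by (auto split: split_indicator)
  finally show ?thesis .
qed

lemma nn_integral_jumps:
  assumes [measurable]: "f \<in> borel_measurable (borel \<Otimes>\<^sub>M (borel \<Otimes>\<^sub>M borel))"
  shows "(\<integral>\<^sup>+x. f x \<partial>jumps) = (\<integral>\<^sup>+z. \<integral>\<^sup>+r. \<integral>\<^sup>+t. indicator {z..<z + r} t * f (z, r, t) \<partial>lborel \<partial>Nu \<partial>U)"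
proof -
  have m: "(\<lambda>x. (case x of (z, r, t) \<Rightarrow> indicator {z..<z + r} t) * f x) \<in> borel_measurable (U \<Otimes>\<^sub>M (Nu \<Otimes>\<^sub>M lborel))"
    using jumps_density_measurable assms
    by (intro borel_measurable_times_ennreal) (auto simp: split_def measurable_cong_sets[OF sets_UNl refl])
  have "(\<integral>\<^sup>+x. f x \<partial>jumps) = (\<integral>\<^sup>+x. (case x of (z, r, t) \<Rightarrow> indicator {z..<z + r} t) * f x \<partial>(U \<Otimes>\<^sub>M (Nu \<Otimes>\<^sub>M lborel)))"
    unfolding jumps_def by (rule nn_integral_density) measurable
  also have "\<dots> = (\<integral>\<^sup>+z. \<integral>\<^sup>+y. (case (z, y) of (z, r, t) \<Rightarrow> indicator {z..<z + r} t) * f (z, y) \<partial>(Nu \<Otimes>\<^sub>M lborel) \<partial>U)"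
    by (rule Nl.P.nn_integral_fst[symmetric, OF m])
  also have "\<dots> = (\<integral>\<^sup>+z. \<integral>\<^sup>+r. \<integral>\<^sup>+t. (case (z, r, t) of (z, r, t) \<Rightarrow> indicator {z..<z + r} t) * f (z, r, t) \<partial>lborel \<partial>Nu \<partial>U)"
    by (intro nn_integral_cong lborel.nn_integral_fst[symmetric] measurable_compose_Pair1[OF _ m]) simp
  finally show ?thesis by simp
qed

text \<open>Both sides have the same Laplace transform.\<close>

lemma jumps_overshoot:
  "distr jumps borel (\<lambda>(z, r, t). (t, z + r)) = distr (halfline \<Otimes>\<^sub>M M) borel (\<lambda>(t, \<omega>). (t, overshoot t \<omega>))"
  (is "?J = ?O")
proof -
  have mJ: "(\<lambda>(z, r, t). (t, z + r)) \<in> jumps \<rightarrow>\<^sub>M (borel :: (real \<times> real) measure)"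
    unfolding split_def borel_prod[symmetric] by measurable
  have mO: "(\<lambda>(t, \<omega>). (t, overshoot t \<omega>)) \<in> halfline \<Otimes>\<^sub>M M \<rightarrow>\<^sub>M (borel :: (real \<times> real) measure)"
    unfolding split_def borel_prod[symmetric] by measurable
  have mE: "(\<lambda>z. ennreal (exp (- a * fst z - b * snd z))) \<in> borel_measurable borel" for a b :: real
    unfolding borel_prod[symmetric] by measurable
  \<comment> \<open>The t-integral over [z, z+r) factorises into exp (-(a+b) z) and a function of r.
    The first factor integrates to 1 / \<open>psi\<close> (a+b) against U, the second to
    (\<open>psi\<close> (a+b) - \<open>psi\<close> b) / a against the jump sizes.\<close>
  have lJ: "(\<integral>\<^sup>+z. ennreal (exp (- a * fst z - b * snd z)) \<partial>?J) = ennreal ((psi (a + b) - psi b) / (a * psi (a + b)))"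
    if a: "1 \<le> a" and b: "0 \<le> b" for a b
  proof -
    have a0: "0 < a" and ab: "0 < a + b" using a b by auto
    have "(\<integral>\<^sup>+z. ennreal (exp (- a * fst z - b * snd z)) \<partial>?J)
      = (\<integral>\<^sup>+x. ennreal (exp (- a * snd (snd x) - b * (fst x + fst (snd x)))) \<partial>jumps)"
      using nn_integral_distr[OF mJ, unfolded measurable_distr_eq1, OF mE[of a b]]
      by (simp only: split_def fst_conv snd_conv)
    also have "\<dots> = (\<integral>\<^sup>+z. \<integral>\<^sup>+r. \<integral>\<^sup>+t. indicator {z..<z + r} t * ennreal (exp (- a * t - b * (z + r))) \<partial>lborel \<partial>Nu \<partial>U)"
      by (subst nn_integral_jumps) auto
    also have "\<dots> = (\<integral>\<^sup>+z. \<integral>\<^sup>+r. ennreal (exp (- (a + b) * z)) * ennreal ((exp (- b * r) - exp (- (a + b) * r)) / a) \<partial>Nu \<partial>U)"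
    proof (rule nn_integral_cong, rule nn_integral_cong_AE)
      fix z :: real
      show "AE r in Nu. (\<integral>\<^sup>+t. indicator {z..<z + r} t * ennreal (exp (- a * t - b * (z + r))) \<partial>lborel)
        = ennreal (exp (- (a + b) * z)) * ennreal ((exp (- b * r) - exp (- (a + b) * r)) / a)"
        using AE_Nu_pos
      proof eventually_elim
        case (elim r)
        then have le: "z \<le> z + r" by simp
        have "(\<integral>\<^sup>+t. indicator {z..<z + r} t * ennreal (exp (- a * t - b * (z + r))) \<partial>lborel)
          = (\<integral>\<^sup>+t. ennreal (exp (- b * (z + r))) * (ennreal (exp (- a * t)) * indicator {z..<z + r} t) \<partial>lborel)"
          by (intro nn_integral_cong) (auto split: split_indicator simp: ennreal_mult[symmetric] simp flip: exp_add)
        also have "\<dots> = ennreal (exp (- b * (z + r))) * ennreal ((exp (- a * z) - exp (- a * (z + r))) / a)"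
          using nn_integral_exp_Ico[OF a0 le] by (subst nn_integral_cmult) auto
        also have "\<dots> = ennreal ((exp (- a * z - b * (z + r)) - exp (- (a + b) * (z + r))) / a)"
          by (rule ennreal_exp_cell[OF a0 le])
        also have "(exp (- a * z - b * (z + r)) - exp (- (a + b) * (z + r))) / a
          = exp (- (a + b) * z) * ((exp (- b * r) - exp (- (a + b) * r)) / a)"
          unfolding times_divide_eq_right right_diff_distrib[of "exp (- (a + b) * z)"] exp_add[symmetric]
          by (simp add: algebra_simps)
        also have "ennreal \<dots> = ennreal (exp (- (a + b) * z)) * ennreal ((exp (- b * r) - exp (- (a + b) * r)) / a)"
          by (rule ennreal_mult') simp
        finally show ?case .
      qed
    qed
    also have "\<dots> = (\<integral>\<^sup>+z. ennreal (exp (- (a + b) * z)) * ennreal ((psi (a + b) - psi b) / a) \<partial>U)"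
      by (subst nn_integral_cmult) (simp_all only: nn_integral_psi_diff[OF a0 b], auto)
    also have "\<dots> = ennreal (1 / psi (a + b)) * ennreal ((psi (a + b) - psi b) / a)"
      by (subst nn_integral_multc) (simp_all only: laplace_U[OF ab], auto)
    also have "\<dots> = ennreal ((psi (a + b) - psi b) / (a * psi (a + b)))"
      using psi_pos[OF ab] by (subst ennreal_mult'[symmetric]) (auto simp: mult.commute)
    finally show ?thesis .
  qed
  have lO: "(\<integral>\<^sup>+z. ennreal (exp (- a * fst z - b * snd z)) \<partial>?O) = ennreal ((psi (a + b) - psi b) / (a * psi (a + b)))"
    if a: "1 \<le> a" and b: "0 \<le> b" for a b
  proof -
    have a0: "0 < a" using a by auto
    have "(\<integral>\<^sup>+z. ennreal (exp (- a * fst z - b * snd z)) \<partial>?O)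
      = (\<integral>\<^sup>+x. ennreal (exp (- a * fst x - b * overshoot (fst x) (snd x))) \<partial>(halfline \<Otimes>\<^sub>M M))"
      using nn_integral_distr[OF mO, unfolded measurable_distr_eq1, OF mE[of a b]]
      by (simp only: split_def fst_conv snd_conv)
    also have "\<dots> = (\<integral>\<^sup>+t. \<integral>\<^sup>+\<omega>. ennreal (exp (- a * t - b * overshoot t \<omega>)) \<partial>M \<partial>halfline)"
      by (subst nn_integral_fst[symmetric]) auto
    finally show ?thesis using laplace_overshoot[OF a0 b] by simp
  qed
  have quad: "{z :: real \<times> real. z \<in> {0..} \<times> {0..}} \<in> sets borel"
    by (simp add: borel_prod[symmetric])
  show ?thesis
  proof (rule measure_eqI_laplace2)
    have "AE x in U \<Otimes>\<^sub>M (Nu \<Otimes>\<^sub>M lborel). 0 \<le> fst x \<and> 0 < fst (snd x)"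
      using UNl.AE_pair_fst[OF AE_U_nonneg] UNl.AE_pair_snd[OF Nl.AE_pair_fst[OF AE_Nu_pos]] by eventually_elim auto
    then have "AE x in jumps. (case x of (z, r, t) \<Rightarrow> (t, z + r)) \<in> {0..} \<times> {0..}"
      unfolding jumps_def AE_density[OF jumps_density_measurable]
      by eventually_elim (auto split: split_indicator_asm)
    then show "AE z in ?J. z \<in> {0..} \<times> {0..}"
      by (subst AE_distr_iff[OF mJ]) (use quad in auto)
    have "AE x in halfline \<Otimes>\<^sub>M M. (case x of (t, \<omega>) \<Rightarrow> (t, overshoot t \<omega>)) \<in> {0..} \<times> {0..}"
      using hM.AE_pair_fst[OF AE_halfline_pos] hM.AE_pair_snd[OF AE_good]
    proof eventually_elim
      case (elim x)
      then show ?case using overshoot_ge[of "snd x" "fst x"] by (auto simp: split_def)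
    qed
    then show "AE z in ?O. z \<in> {0..} \<times> {0..}"
      by (subst AE_distr_iff[OF mO]) (use quad in auto)
  qed (use lJ lO in auto)
qed

lemma nn_integral_overshoot:
  assumes [measurable]: "G \<in> borel_measurable (borel \<Otimes>\<^sub>M borel)"
  shows "(\<integral>\<^sup>+t. \<integral>\<^sup>+\<omega>. G (t, overshoot t \<omega>) \<partial>M \<partial>halfline)
    = (\<integral>\<^sup>+z. \<integral>\<^sup>+r. \<integral>\<^sup>+t. indicator {z..<z + r} t * G (t, z + r) \<partial>lborel \<partial>Nu \<partial>U)"
proof -
  have G: "G \<in> borel_measurable borel" using assms by (simp add: borel_prod)
  have "(\<integral>\<^sup>+t. \<integral>\<^sup>+\<omega>. G (t, overshoot t \<omega>) \<partial>M \<partial>halfline)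
    = (\<integral>\<^sup>+x. G (fst x, overshoot (fst x) (snd x)) \<partial>(halfline \<Otimes>\<^sub>M M))"
    by (subst nn_integral_fst[symmetric]) auto
  also have "\<dots> = (\<integral>\<^sup>+x. G x \<partial>distr (halfline \<Otimes>\<^sub>M M) borel (\<lambda>(t, \<omega>). (t, overshoot t \<omega>)))"
    by (subst nn_integral_distr) (auto simp: split_def G borel_prod[symmetric])
  also have "\<dots> = (\<integral>\<^sup>+x. G x \<partial>distr jumps borel (\<lambda>(z, r, t). (t, z + r)))"
    by (simp only: jumps_overshoot)
  also have "\<dots> = (\<integral>\<^sup>+x. G (snd (snd x), fst x + fst (snd x)) \<partial>jumps)"
    by (subst nn_integral_distr) (auto simp: split_def G borel_prod[symmetric])
  also have "\<dots> = (\<integral>\<^sup>+z. \<integral>\<^sup>+r. \<integral>\<^sup>+t. indicator {z..<z + r} t * G (t, z + r) \<partial>lborel \<partial>Nu \<partial>U)"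
    by (subst nn_integral_jumps) auto
  finally show ?thesis .
qed

end

section \<open>Shears of product measures and test functions in time\<close>

lemma borel_measurable_indicator_Ico[measurable (raw)]:
  fixes a b c :: "'b \<Rightarrow> real"
  assumes [measurable]: "a \<in> borel_measurable N" "b \<in> borel_measurable N" "c \<in> borel_measurable N"
  shows "(\<lambda>x. indicator {a x..<b x} (c x) :: real) \<in> borel_measurable N"
proof -
  have "(\<lambda>x. if a x \<le> c x \<and> c x < b x then 1 else 0 :: real) \<in> borel_measurable N" by measurable
  then show ?thesis by (simp add: indicator_def)
qed

text \<open>Fubini: a map that fixes the first coordinate and preserves the measure on every fibre
  preserves the product. It justifies the time shifts by an amount depending on a further variable
  of integration.\<close>

lemma distr_skew:
  assumes "sigma_finite_measure N2"
    and s[measurable]: "(\<lambda>(z, y). s z y) \<in> N1 \<Otimes>\<^sub>M N2 \<rightarrow>\<^sub>M N2"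
    and inv: "\<And>z. z \<in> space N1 \<Longrightarrow> distr N2 N2 (s z) = N2"
  shows "distr (N1 \<Otimes>\<^sub>M N2) (N1 \<Otimes>\<^sub>M N2) (\<lambda>(z, y). (z, s z y)) = N1 \<Otimes>\<^sub>M N2"
proof (rule measure_eqI)
  interpret N2: sigma_finite_measure N2 by fact
  have m: "(\<lambda>(z, y). (z, s z y)) \<in> N1 \<Otimes>\<^sub>M N2 \<rightarrow>\<^sub>M N1 \<Otimes>\<^sub>M N2"
    unfolding split_def by (intro measurable_Pair measurable_fst) (use s in \<open>simp add: split_def\<close>)
  fix A assume "A \<in> sets (distr (N1 \<Otimes>\<^sub>M N2) (N1 \<Otimes>\<^sub>M N2) (\<lambda>(z, y). (z, s z y)))"
  then have A[measurable]: "A \<in> sets (N1 \<Otimes>\<^sub>M N2)" by simp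
  have "emeasure (distr (N1 \<Otimes>\<^sub>M N2) (N1 \<Otimes>\<^sub>M N2) (\<lambda>(z, y). (z, s z y))) A
    = (\<integral>\<^sup>+x. indicator A x \<partial>distr (N1 \<Otimes>\<^sub>M N2) (N1 \<Otimes>\<^sub>M N2) (\<lambda>(z, y). (z, s z y)))"
    by simp
  also have "\<dots> = (\<integral>\<^sup>+x. indicator A (case x of (z, y) \<Rightarrow> (z, s z y)) \<partial>(N1 \<Otimes>\<^sub>M N2))"
    by (rule nn_integral_distr[OF m]) simp
  also have "\<dots> = (\<integral>\<^sup>+z. \<integral>\<^sup>+y. indicator A (z, s z y) \<partial>N2 \<partial>N1)"
    using N2.nn_integral_fst[OF measurable_compose[OF m, of "indicator A" borel]] by simp
  also have "\<dots> = (\<integral>\<^sup>+z. \<integral>\<^sup>+y. indicator A (z, y) \<partial>N2 \<partial>N1)"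
  proof (rule nn_integral_cong)
    fix z assume z: "z \<in> space N1"
    have sz[measurable]: "s z \<in> N2 \<rightarrow>\<^sub>M N2"
      using measurable_compose_Pair1[OF z s] by simp
    have "(\<integral>\<^sup>+y. indicator A (z, y) \<partial>N2) = (\<integral>\<^sup>+y. indicator A (z, y) \<partial>distr N2 N2 (s z))"
      by (simp only: inv[OF z])
    also have "\<dots> = (\<integral>\<^sup>+y. indicator A (z, s z y) \<partial>N2)"
      using z by (intro nn_integral_distr[OF sz]) simp
    finally show "(\<integral>\<^sup>+y. indicator A (z, s z y) \<partial>N2) = (\<integral>\<^sup>+y. indicator A (z, y) \<partial>N2)" ..
  qed
  also have "\<dots> = emeasure (N1 \<Otimes>\<^sub>M N2) A"
    using N2.nn_integral_fst[of "indicator A"] by simp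
  finally show "emeasure (distr (N1 \<Otimes>\<^sub>M N2) (N1 \<Otimes>\<^sub>M N2) (\<lambda>(z, y). (z, s z y))) A = emeasure (N1 \<Otimes>\<^sub>M N2) A" .
qed simp

lemma distr_translate_lborel: "distr lborel lborel (\<lambda>t::real. t + c) = lborel"
  using lborel_distr_plus[of c] by (simp add: add.commute cong: distr_cong)

context
  fixes N :: "real measure"
  assumes N: "sigma_finite_measure N" and sets_N[measurable_cong]: "sets N = sets borel"
begin

lemma distr_shear: "distr (N \<Otimes>\<^sub>M lborel) (N \<Otimes>\<^sub>M lborel) (\<lambda>(r, t). (r, t + c * r)) = N \<Otimes>\<^sub>M lborel"
  by (rule distr_skew) (auto intro: lborel.sigma_finite_measure_axioms distr_translate_lborel)

lemma
  fixes f :: "real \<Rightarrow> real \<Rightarrow> real"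
  assumes f[measurable]: "(\<lambda>(r, t). f r t) \<in> borel_measurable (borel \<Otimes>\<^sub>M borel)"
  shows integral_shear: "(LINT (r, t)|(N \<Otimes>\<^sub>M lborel). f r (t + c * r)) = (LINT (r, t)|(N \<Otimes>\<^sub>M lborel). f r t)"
    and integrable_shear: "integrable (N \<Otimes>\<^sub>M lborel) (\<lambda>(r, t). f r (t + c * r)) \<longleftrightarrow> integrable (N \<Otimes>\<^sub>M lborel) (\<lambda>(r, t). f r t)"
proof -
  have m: "(\<lambda>(r, t). (r, t + c * r)) \<in> N \<Otimes>\<^sub>M lborel \<rightarrow>\<^sub>M N \<Otimes>\<^sub>M lborel" by measurable
  have f': "(\<lambda>(r, t). f r t) \<in> borel_measurable (N \<Otimes>\<^sub>M lborel)" by measurable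
  show "(LINT (r, t)|(N \<Otimes>\<^sub>M lborel). f r (t + c * r)) = (LINT (r, t)|(N \<Otimes>\<^sub>M lborel). f r t)"
    using integral_distr[OF m f'] unfolding distr_shear by (simp add: split_def)
  show "integrable (N \<Otimes>\<^sub>M lborel) (\<lambda>(r, t). f r (t + c * r)) \<longleftrightarrow> integrable (N \<Otimes>\<^sub>M lborel) (\<lambda>(r, t). f r t)"
    using integrable_distr_eq[OF m f'] unfolding distr_shear by (simp add: split_def)
qed

end

text \<open>Both p and its derivative vanish off the compact support, the derivative because the
  complement of the support is open. Bounds on the support are therefore global, and one constant
  serves as supremum and as Lipschitz constant.\<close>

lemma C1c_properties:
  assumes p: "p \<in> C1c T"
  obtains p' C where "\<And>t. (p has_real_derivative p' t) (at t)" "continuous_on UNIV p'"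
    "\<And>t. t \<notin> {0<..<T} \<Longrightarrow> p t = 0" "0 \<le> C" "\<And>t. \<bar>p t\<bar> \<le> C" "\<And>s t. \<bar>p s - p t\<bar> \<le> C * \<bar>s - t\<bar>"
proof -
  define K where "K = closure {t. p t \<noteq> 0}"
  have K: "compact K" "K \<subseteq> {0<..<T}" using p by (auto simp: C1c_def K_def)
  obtain p' where p': "\<And>t. (p has_vector_derivative p' t) (at t)" "continuous_on UNIV p'"
    using p by (auto simp: C1c_def C1_differentiable_on_def)
  have d: "(p has_real_derivative p' t) (at t)" for t
    using p'(1) by (simp add: has_real_derivative_iff_has_vector_derivative)
  have off: "p t = 0" if "t \<notin> K" for t
    using that closure_subset[of "{t. p t \<noteq> 0}"] unfolding K_def by blast
  have off': "p' t = 0" if t: "t \<notin> K" for t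
  proof -
    have o: "open (- K)" using K(1) by (simp add: compact_imp_closed open_Compl)
    have "(p has_real_derivative 0) (at t)"
      by (rule has_field_derivative_transform_within_open[OF DERIV_const[of 0] o]) (use t off in auto)
    with d show ?thesis by (rule DERIV_unique)
  qed
  have cp: "continuous_on UNIV p" using d by (meson DERIV_continuous_on has_field_derivative_at_within)
  have "\<exists>C. \<forall>t\<in>K. \<bar>g t\<bar> \<le> C" if "continuous_on UNIV g" for g :: "real \<Rightarrow> real"
  proof -
    have "compact (g ` K)" by (intro compact_continuous_image K continuous_on_subset[OF that]) auto
    then have "bounded (g ` K)" by (rule compact_imp_bounded)
    then show ?thesis by (auto simp: bounded_iff)
  qed
  from this[OF cp] this[OF p'(2)] obtain C1 C2 where
    C12: "\<And>t. t \<in> K \<Longrightarrow> \<bar>p t\<bar> \<le> C1" "\<And>t. t \<in> K \<Longrightarrow> \<bar>p' t\<bar> \<le> C2" by blast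
  define C where "C = \<bar>C1\<bar> + \<bar>C2\<bar>"
  have C: "\<bar>p t\<bar> \<le> C" "\<bar>p' t\<bar> \<le> C" for t
    using C12[of t] off[of t] off'[of t] by (cases "t \<in> K"; force simp: C_def)+
  have lip: "\<bar>p s - p t\<bar> \<le> C * \<bar>s - t\<bar>" for s t
    using field_differentiable_bound[of UNIV p p' C t s] C(2) d by (auto simp: abs_minus_commute)
  have "0 \<le> C" by (simp add: C_def)
  then show thesis using that[OF d p'(2) _ _ C(1) lip] off K(2) by blast
qed

text \<open>The bound by a multiple of min r 1 is what integrability against the jump measure asks
  for: the Lipschitz estimate handles small r, the supremum large r. The constant depends on
  \<theta> only through K, which later makes it uniform in the spatial point.\<close>

lemma C1c_product_increment:
  assumes p: "p \<in> C1c T" and K: "0 \<le> K"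
  obtains C where "0 \<le> C"
    "\<And>\<theta> t y r. (\<And>y. \<bar>\<theta> y\<bar> \<le> K) \<Longrightarrow> (\<And>y r. \<bar>\<theta> y - \<theta> r\<bar> \<le> K * \<bar>y - r\<bar>) \<Longrightarrow> 0 < r \<Longrightarrow>
      \<bar>p (t + r) * \<theta> (y + r) - p t * \<theta> y\<bar> \<le> C * min r (1::real)"
proof -
  obtain C where C: "0 \<le> C" "\<And>t. \<bar>p t\<bar> \<le> C" "\<And>s t. \<bar>p s - p t\<bar> \<le> C * \<bar>s - t\<bar>"
    using C1c_properties[OF p] by metis
  have "\<bar>p (t + r) * \<theta> (y + r) - p t * \<theta> y\<bar> \<le> 2 * C * K * min r 1"
    if \<theta>: "\<And>y. \<bar>\<theta> y\<bar> \<le> K" "\<And>y r. \<bar>\<theta> y - \<theta> r\<bar> \<le> K * \<bar>y - r\<bar>" and r: "0 < r" for \<theta> t y r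
  proof -
    have "p (t + r) * \<theta> (y + r) - p t * \<theta> y = (p (t + r) - p t) * \<theta> (y + r) + p t * (\<theta> (y + r) - \<theta> y)"
      by (simp add: algebra_simps)
    also have "\<bar>\<dots>\<bar> \<le> \<bar>p (t + r) - p t\<bar> * \<bar>\<theta> (y + r)\<bar> + \<bar>p t\<bar> * \<bar>\<theta> (y + r) - \<theta> y\<bar>"
      by (metis abs_mult abs_triangle_ineq)
    also have "\<dots> \<le> (C * r) * K + C * (K * r)"
      using C(1,2) C(3)[of "t + r" t] \<theta>(1)[of "y + r"] \<theta>(2)[of "y + r" y] r
      by (intro add_mono mult_mono) auto
    finally have 1: "\<bar>p (t + r) * \<theta> (y + r) - p t * \<theta> y\<bar> \<le> 2 * C * K * r" by (simp add: algebra_simps)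
    have "\<bar>p (t + r) * \<theta> (y + r) - p t * \<theta> y\<bar> \<le> \<bar>p (t + r)\<bar> * \<bar>\<theta> (y + r)\<bar> + \<bar>p t\<bar> * \<bar>\<theta> y\<bar>"
      by (metis abs_mult abs_triangle_ineq4)
    also have "\<dots> \<le> C * K + C * K"
      using C \<theta>(1) by (intro add_mono mult_mono) auto
    finally have 2: "\<bar>p (t + r) * \<theta> (y + r) - p t * \<theta> y\<bar> \<le> 2 * C * K * 1" by simp
    show ?thesis using 1 2 by (auto simp: min_def)
  qed
  then show thesis using that[of "2 * C * K"] C(1) K by simp
qed

section \<open>The compensation formula for real-valued functions and the inversion of the
  generator\<close>

context subordinator
begin

lemma
  fixes G :: "real \<times> real \<Rightarrow> real"
  assumes G[measurable]: "G \<in> borel_measurable (borel \<Otimes>\<^sub>M borel)"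
    and fin: "(\<integral>\<^sup>+t. \<integral>\<^sup>+\<omega>. ennreal \<bar>G (t, overshoot t \<omega>)\<bar> \<partial>M \<partial>halfline) < \<infinity>"
  shows "integrable (halfline \<Otimes>\<^sub>M M) (\<lambda>(t, \<omega>). G (t, overshoot t \<omega>))"
    and integrable_jumps: "integrable jumps (\<lambda>(z, r, t). G (t, z + r))"
    and integral_overshoot: "(LINT t|halfline. LINT \<omega>|M. G (t, overshoot t \<omega>)) = (LINT (z, r, t)|jumps. G (t, z + r))"
proof -
  have G': "G \<in> borel_measurable borel" using G by (simp add: borel_prod)
  have mJ: "(\<lambda>(z, r, t). (t, z + r)) \<in> jumps \<rightarrow>\<^sub>M (borel :: (real \<times> real) measure)"
    unfolding split_def borel_prod[symmetric] by measurable
  have mO: "(\<lambda>(t, \<omega>). (t, overshoot t \<omega>)) \<in> halfline \<Otimes>\<^sub>M M \<rightarrow>\<^sub>M (borel :: (real \<times> real) measure)"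
    unfolding split_def borel_prod[symmetric] by measurable
  show 1: "integrable (halfline \<Otimes>\<^sub>M M) (\<lambda>(t, \<omega>). G (t, overshoot t \<omega>))"
  proof (rule integrableI_bounded)
    show "(\<integral>\<^sup>+x. ennreal (norm (case x of (t, \<omega>) \<Rightarrow> G (t, overshoot t \<omega>))) \<partial>(halfline \<Otimes>\<^sub>M M)) < \<infinity>"
      using fin by (subst nn_integral_fst[symmetric]) (auto simp: split_def)
  qed measurable
  show 2: "integrable jumps (\<lambda>(z, r, t). G (t, z + r))"
    using integrable_distr_eq[OF mJ G'] integrable_distr_eq[OF mO G'] 1
    unfolding jumps_overshoot by (simp add: split_def)
  have "(LINT t|halfline. LINT \<omega>|M. G (t, overshoot t \<omega>)) = (LINT x|(halfline \<Otimes>\<^sub>M M). G (fst x, overshoot (fst x) (snd x)))"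
    using hM.integral_fst'[OF 1] by (simp add: split_def)
  also have "\<dots> = (LINT (z, r, t)|jumps. G (t, z + r))"
    using integral_distr[OF mJ G'] integral_distr[OF mO G']
    unfolding jumps_overshoot by (simp add: split_def)
  finally show "(LINT t|halfline. LINT \<omega>|M. G (t, overshoot t \<omega>)) = (LINT (z, r, t)|jumps. G (t, z + r))" .
qed

lemma
  fixes g :: "real \<times> real \<times> real \<Rightarrow> real"
  assumes g: "integrable jumps g"
  shows integrable_jumps_density: "integrable (U \<Otimes>\<^sub>M (Nu \<Otimes>\<^sub>M lborel)) (\<lambda>(z, r, t). indicator {z..<z + r} t * g (z, r, t))"
    and integral_jumps_density: "(LINT x|jumps. g x) = (LINT (z, r, t)|(U \<Otimes>\<^sub>M (Nu \<Otimes>\<^sub>M lborel)). indicator {z..<z + r} t * g (z, r, t))"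
proof -
  have [measurable]: "g \<in> borel_measurable (U \<Otimes>\<^sub>M (Nu \<Otimes>\<^sub>M lborel))"
    using borel_measurable_integrable[OF g] by (simp add: measurable_cong_sets[OF sets_jumps refl] measurable_cong_sets[OF sets_UNl refl])
  have [measurable]: "(\<lambda>(z, r, t). indicator {z..<z + r} t :: real) \<in> borel_measurable (U \<Otimes>\<^sub>M (Nu \<Otimes>\<^sub>M lborel))"
    using measurable_compose[OF jumps_density_measurable, of enn2real borel]
    by (simp add: split_def indicator_def if_distrib[of enn2real] cong: if_cong)
  have d: "jumps = density (U \<Otimes>\<^sub>M (Nu \<Otimes>\<^sub>M lborel)) (\<lambda>x. ennreal (case x of (z, r, t) \<Rightarrow> indicator {z..<z + r} t))"
    unfolding jumps_def by (intro arg_cong[where f="density _"] ext) (auto split: split_indicator)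
  have e: "(\<lambda>(z, r, t). indicator {z..<z + r} t * g (z, r, t)) = (\<lambda>x. (case x of (z, r, t) \<Rightarrow> indicator {z..<z + r} t) *\<^sub>R g x)"
    by auto
  show "integrable (U \<Otimes>\<^sub>M (Nu \<Otimes>\<^sub>M lborel)) (\<lambda>(z, r, t). indicator {z..<z + r} t * g (z, r, t))"
    using g unfolding d e by (subst (asm) integrable_density) auto
  show "(LINT x|jumps. g x) = (LINT (z, r, t)|(U \<Otimes>\<^sub>M (Nu \<Otimes>\<^sub>M lborel)). indicator {z..<z + r} t * g (z, r, t))"
    unfolding d e by (subst integral_density) auto
qed

text \<open>The potential operator inverts the generator of \<open>S\<close>.\<close>

lemma potential_increments:
  fixes F F' :: "real \<Rightarrow> real"
  assumes [measurable]: "F \<in> borel_measurable borel"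
    and F: "\<And>y. 0 \<le> y \<Longrightarrow> (F has_real_derivative F' y) (at y within {0..})"
    and F': "continuous_on {0..} F'"
    and Y: "0 < Y" and F0: "\<And>y. Y \<le> y \<Longrightarrow> F y = 0"
  shows "(LINT z|U. LINT r|Nu. F (z + r) - F z) = - F 0"
proof -
  \<comment> \<open>The derivative is needed as a Borel function on the whole line, so it is cut to
    [0, Y], beyond which F vanishes.\<close>
  define f where "f t = indicator {0..Y} t *\<^sub>R F' t" for t
  have cont: "continuous_on {a..b} F'" if "0 \<le> a" for a b
    using continuous_on_subset[OF F'] that by auto
  have f[measurable]: "f \<in> borel_measurable borel"
    unfolding f_def by (rule borel_measurable_continuous_on_indicator) (auto intro: cont)
  have "compact (F' ` {0..Y})" by (intro compact_continuous_image cont) auto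
  then have "bounded (F' ` {0..Y})" by (rule compact_imp_bounded)
  then obtain C where "\<forall>x\<in>F' ` {0..Y}. norm x \<le> C" unfolding bounded_iff by blast
  have C: "\<bar>F' t\<bar> \<le> \<bar>C\<bar>" if "t \<in> {0..Y}" for t
  proof -
    have "norm (F' t) \<le> C" using \<open>\<forall>x\<in>F' ` {0..Y}. norm x \<le> C\<close> that by blast
    then show ?thesis by simp
  qed
  have FTC: "(LBINT t. indicator {a..b} t *\<^sub>R F' t) = F b - F a" if "0 \<le> a" "a \<le> b" for a b
  proof (rule integral_FTC_atLeastAtMost)
    fix x assume "a \<le> x" "x \<le> b"
    then show "(F has_vector_derivative F' x) (at x within {a..b})"
      using DERIV_subset[OF F[of x], of "{a..b}"] that
      by (auto simp: has_real_derivative_iff_has_vector_derivative)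
  qed (use that in \<open>auto intro: cont\<close>)
  have FTC': "(LINT t|lborel. indicator {z..<z + r} t * f t) = F (z + r) - F z" if z: "0 \<le> z" and r: "0 < r" for z r
  proof -
    \<comment> \<open>Since f is cut at Y, the end points are capped at Y as well; the capping does
      not change the values of F, which is 0 from Y on. Only the single points z + r and Y need to
      be ignored.\<close>
    have "(LINT t|lborel. indicator {z..<z + r} t * f t) = (LBINT t. indicator {min z Y..min (z + r) Y} t *\<^sub>R F' t)"
    proof (rule integral_cong_AE)
      have "AE t in lborel. t \<noteq> z + r" "AE t in lborel. t \<noteq> Y" by (rule AE_lborel_singleton)+
      then show "AE t in lborel. indicator {z..<z + r} t * f t = indicator {min z Y..min (z + r) Y} t *\<^sub>R F' t"
        by eventually_elim (use z r Y in \<open>auto simp: f_def split: split_indicator\<close>)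
      show "(\<lambda>t. indicator {min z Y..min (z + r) Y} t *\<^sub>R F' t) \<in> borel_measurable lborel"
        using borel_measurable_continuous_on_indicator[OF _ cont, of "min z Y" "min (z + r) Y"] z Y by simp
    qed measurable
    also have "\<dots> = F (min (z + r) Y) - F (min z Y)" by (rule FTC) (use z r Y in auto)
    also have "\<dots> = F (z + r) - F z" using F0 by (auto simp: min_def)
    finally show ?thesis .
  qed
  \<comment> \<open>This choice ignores the second coordinate: one side of the formula collapses to
    the integral of the derivative of F, which is -F 0, and the other contains the increments of
    F.\<close>
  let ?G = "\<lambda>x::real \<times> real. f (fst x)"
  have "(\<integral>\<^sup>+t. \<integral>\<^sup>+\<omega>. ennreal \<bar>?G (t, overshoot t \<omega>)\<bar> \<partial>M \<partial>halfline) = (\<integral>\<^sup>+t. ennreal \<bar>f t\<bar> \<partial>halfline)"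
    by (simp add: emeasure_space_1)
  also have "\<dots> = (\<integral>\<^sup>+t\<in>{0<..}. ennreal \<bar>f t\<bar> \<partial>lborel)" by (rule nn_integral_halfline) measurable
  also have "\<dots> \<le> (\<integral>\<^sup>+t. ennreal \<bar>C\<bar> * indicator {0..Y} t \<partial>lborel)"
    using C by (intro nn_integral_mono) (auto simp: f_def split: split_indicator intro: order_trans)
  also have "\<dots> < \<infinity>" using Y by (simp add: nn_integral_cmult_indicator ennreal_mult_less_top)
  finally have fin: "(\<integral>\<^sup>+t. \<integral>\<^sup>+\<omega>. ennreal \<bar>?G (t, overshoot t \<omega>)\<bar> \<partial>M \<partial>halfline) < \<infinity>" .
  have G: "?G \<in> borel_measurable (borel \<Otimes>\<^sub>M borel)" by measurable
  note int = integrable_jumps[OF G fin]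
  have "(LINT t|halfline. LINT \<omega>|M. ?G (t, overshoot t \<omega>)) = (LINT t|halfline. f t)"
    by (simp add: prob_space)
  also have "\<dots> = (LBINT t. indicator {0<..} t * f t)"
    by (subst integral_halfline) (auto simp: set_lebesgue_integral_def)
  also have "\<dots> = (LBINT t. indicator {0..Y} t *\<^sub>R F' t)"
  proof (rule integral_cong_AE)
    have "AE t in lborel. t \<noteq> (0::real)" by (rule AE_lborel_singleton)
    then show "AE t in lborel. indicator {0<..} t * f t = indicator {0..Y} t *\<^sub>R F' t"
      by eventually_elim (auto simp: f_def split: split_indicator)
    show "(\<lambda>t. indicator {0..Y} t *\<^sub>R F' t) \<in> borel_measurable lborel"
      using f by (simp add: f_def[abs_def])
  qed measurable
  also have "\<dots> = - F 0" using FTC[of 0 Y] Y F0[of Y] by simp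
  finally have "- F 0 = (LINT (z, r, t)|jumps. f t)"
    using integral_overshoot[OF G fin] by (simp add: split_def)
  also have "\<dots> = (LINT (z, r, t)|(U \<Otimes>\<^sub>M (Nu \<Otimes>\<^sub>M lborel)). indicator {z..<z + r} t * f t)"
    using integral_jumps_density[OF int] by (simp add: split_def)
  also have "\<dots> = (LINT z|U. LINT y|(Nu \<Otimes>\<^sub>M lborel). indicator {z..<z + fst y} (snd y) * f (snd y))"
    using UNl.integral_fst'[OF integrable_jumps_density[OF int]] by (simp add: split_def)
  also have "\<dots> = (LINT z|U. LINT r|Nu. F (z + r) - F z)"
  proof (rule Bochner_Integration.integral_cong_AE)
    have i2: "AE z in U. integrable (Nu \<Otimes>\<^sub>M lborel) (\<lambda>y. indicator {z..<z + fst y} (snd y) * f (snd y))"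
      using UNl.AE_integrable_fst'[OF integrable_jumps_density[OF int]] by (simp add: split_def)
    then show "AE z in U. (LINT y|(Nu \<Otimes>\<^sub>M lborel). indicator {z..<z + fst y} (snd y) * f (snd y)) = (LINT r|Nu. F (z + r) - F z)"
      using AE_U_nonneg
    proof eventually_elim
      case (elim z)
      have "(LINT y|(Nu \<Otimes>\<^sub>M lborel). indicator {z..<z + fst y} (snd y) * f (snd y))
        = (LINT r|Nu. LINT t|lborel. indicator {z..<z + r} t * f t)"
        using Nl.integral_fst'[OF elim(1)] by simp
      also have "\<dots> = (LINT r|Nu. F (z + r) - F z)"
      proof (rule integral_cong_AE)
        show "AE r in Nu. (LINT t|lborel. indicator {z..<z + r} t * f t) = F (z + r) - F z"
          using AE_Nu_pos by eventually_elim (rule FTC'[OF elim(2)])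
      qed measurable
      finally show ?case .
    qed
  qed measurable
  finally show ?thesis by simp
qed

text \<open>The indicator is dominated by a multiple of exp (-y), whose integral against the
  potential measure is 1 / \<open>psi\<close> 1.\<close>

lemma U_Icc_finite: "emeasure U {0..a} < \<infinity>"
proof -
  have "emeasure U {0..a} = (\<integral>\<^sup>+y. indicator {0..a} y \<partial>U)" by simp
  also have "\<dots> \<le> (\<integral>\<^sup>+y. ennreal (exp \<bar>a\<bar>) * ennreal (exp (- 1 * y)) \<partial>U)"
    by (intro nn_integral_mono) (auto split: split_indicator simp: ennreal_mult[symmetric] simp flip: exp_add)
  also have "\<dots> = ennreal (exp \<bar>a\<bar>) * ennreal (1 / psi 1)"
    using laplace_U[of 1] by (subst nn_integral_cmult) auto
  finally show ?thesis by (auto simp: ennreal_mult_less_top intro: le_less_trans)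
qed

end

subsection \<open>The weak equation along an orbit\<close>

text \<open>Isolates what is needed of an orbit y \<mapsto> P y q x for fixed x. It is a function on
  the whole line, constant for y \<le> 0 in the application, so the derivative is asked for only on
  the closed half-line and there one-sidedly at 0.\<close>

locale test_orbit = subordinator M \<nu> S for M :: "'w measure" and \<nu> S +
  fixes T :: real and p \<theta> \<theta>' :: "real \<Rightarrow> real" and K :: real
  assumes p: "p \<in> C1c T"
    and \<theta>_bound: "\<And>y. \<bar>\<theta> y\<bar> \<le> K"
    and \<theta>_lipschitz: "\<And>y r. \<bar>\<theta> y - \<theta> r\<bar> \<le> K * \<bar>y - r\<bar>"
    and \<theta>_deriv: "\<And>y. 0 \<le> y \<Longrightarrow> (\<theta> has_real_derivative \<theta>' y) (at y within {0..})"
    and \<theta>'_cont: "continuous_on {0..} \<theta>'"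
begin

text \<open>For \<open>\<theta> y = P y q x\<close> this is \<open>P y (H_star \<nu> P \<psi> t) x\<close>, where \<open>\<psi> t x = p t * q x\<close>.\<close>

definition gen :: "real \<Rightarrow> real \<Rightarrow> real" where
  "gen t y = (LINT r|Nu. p (t + r) * \<theta> (y + r) - p t * \<theta> y)"

lemma p_off: "t \<notin> {0<..<T} \<Longrightarrow> p t = 0"
  using C1c_properties[OF p] by metis

lemma p_measurable[measurable]: "p \<in> borel_measurable borel"
proof -
  obtain p' where "\<And>t. (p has_real_derivative p' t) (at t)"
    using C1c_properties[OF p] by metis
  then have "continuous_on UNIV p"
    by (meson DERIV_continuous_on has_field_derivative_at_within)
  then show ?thesis by (rule borel_measurable_continuous_onI)
qed

lemma K_nonneg: "0 \<le> K" using \<theta>_bound[of 0] by linarith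

lemma \<theta>_measurable[measurable]: "\<theta> \<in> borel_measurable borel"
proof (rule borel_measurable_continuous_onI)
  have "K-lipschitz_on UNIV \<theta>"
    using \<theta>_lipschitz K_nonneg by (auto simp: lipschitz_on_def dist_real_def)
  then show "continuous_on UNIV \<theta>" by (rule lipschitz_on_continuous_on)
qed

lemma increment_bound:
  obtains C where "0 \<le> C" "\<And>t y r. 0 < r \<Longrightarrow> \<bar>p (t + r) * \<theta> (y + r) - p t * \<theta> y\<bar> \<le> C * min r 1"
  using C1c_product_increment[OF p K_nonneg] \<theta>_bound \<theta>_lipschitz by metis

lemma gen_integrable: "integrable Nu (\<lambda>r. p (t + r) * \<theta> (y + r) - p t * \<theta> y)"
proof -
  obtain C where "\<And>t y r. 0 < r \<Longrightarrow> \<bar>p (t + r) * \<theta> (y + r) - p t * \<theta> y\<bar> \<le> C * min r 1"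
    using increment_bound by metis
  then show ?thesis by (intro integrable_Nu_bound) auto
qed

lemma gen_bound: obtains C where "0 \<le> C" "\<And>t y. \<bar>gen t y\<bar> \<le> C"
proof -
  obtain C where C: "0 \<le> C" "\<And>t y r. 0 < r \<Longrightarrow> \<bar>p (t + r) * \<theta> (y + r) - p t * \<theta> y\<bar> \<le> C * min r 1"
    using increment_bound by metis
  let ?I = "LINT r|Nu. min r 1"
  have "\<bar>gen t y\<bar> \<le> C * ?I" for t y
  proof -
    have "\<bar>gen t y\<bar> \<le> (LINT r|Nu. \<bar>p (t + r) * \<theta> (y + r) - p t * \<theta> y\<bar>)"
      unfolding gen_def by (rule integral_abs_bound)
    also have "\<dots> \<le> (LINT r|Nu. C * min r 1)"
    proof (rule integral_mono_AE)
      show "AE r in Nu. \<bar>p (t + r) * \<theta> (y + r) - p t * \<theta> y\<bar> \<le> C * min r 1"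
        using AE_Nu_pos by eventually_elim (rule C(2))
    qed (auto intro!: integrable_Nu_min integrable_abs gen_integrable)
    finally show ?thesis by simp
  qed
  moreover have "0 \<le> ?I"
    by (rule integral_nonneg_AE) (use AE_Nu_pos in \<open>eventually_elim, simp\<close>)
  ultimately show thesis using that[of "C * ?I"] C(1) by simp
qed

lemma gen_zero: "T \<le> t \<Longrightarrow> gen t y = 0"
proof -
  assume t: "T \<le> t"
  have "gen t y = (LINT r|Nu. 0)"
    unfolding gen_def
  proof (rule integral_cong_AE)
    show "AE r in Nu. p (t + r) * \<theta> (y + r) - p t * \<theta> y = 0"
      using AE_Nu_pos by eventually_elim (use t p_off in auto)
  qed auto
  then show ?thesis by simp
qed

lemma gen_measurable[measurable (raw)]:
  assumes [measurable]: "g \<in> borel_measurable N" "h \<in> borel_measurable N"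
  shows "(\<lambda>x. gen (g x) (h x)) \<in> borel_measurable N"
  unfolding gen_def by measurable

text \<open>With F z = p (s + z) * \<theta> (w + z), the integral of F (z + r) - F z over the jump
  sizes is \<open>gen\<close> (s + z) (w + z), so the inversion \<open>potential_increments\<close>
  applies.\<close>

lemma potential_gen:
  assumes w: "0 \<le> w" shows "(LINT z|U. gen (s + z) (w + z)) = - (p s * \<theta> w)"
proof -
  obtain p' where p': "\<And>t. (p has_real_derivative p' t) (at t)" "continuous_on UNIV p'"
    using C1c_properties[OF p] by metis
  define F where "F z = p (s + z) * \<theta> (w + z)" for z
  define F' where "F' z = p' (s + z) * \<theta> (w + z) + \<theta>' (w + z) * p (s + z)" for z
  have cp: "continuous_on UNIV p"
    using p'(1) by (meson DERIV_continuous_on has_field_derivative_at_within)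
  have c\<theta>: "continuous_on {0..} \<theta>"
    using \<theta>_deriv by (intro DERIV_continuous_on) auto
  have "(LINT z|U. LINT r|Nu. F (z + r) - F z) = - F 0"
  proof (rule potential_increments)
    fix y :: real assume y: "0 \<le> y"
    have "((\<lambda>z. p (s + z)) has_real_derivative p' (s + y)) (at y within {0..})"
      using p'(1)[of "y + s"] DERIV_shift[of p _ y s]
      by (auto intro: has_field_derivative_at_within simp: add.commute)
    moreover have "(\<theta> \<circ> (\<lambda>z. w + z) has_real_derivative \<theta>' (w + y) * 1) (at y within {0..})"
    proof (rule DERIV_image_chain)
      have "(\<theta> has_real_derivative \<theta>' (w + y)) (at (w + y) within {0..})"
        using \<theta>_deriv[of "w + y"] y w by simp
      then show "(\<theta> has_real_derivative \<theta>' (w + y)) (at (w + y) within (+) w ` {0..})"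
        by (rule DERIV_subset) (use w in auto)
    qed (auto intro!: derivative_eq_intros)
    ultimately show "(F has_real_derivative F' y) (at y within {0..})"
      unfolding F_def[abs_def] F'_def o_def by (auto intro!: derivative_eq_intros simp: algebra_simps)
  next
    have "continuous_on {0..} (\<lambda>z. \<theta> (w + z))" "continuous_on {0..} (\<lambda>z. \<theta>' (w + z))"
      using w by (auto intro!: continuous_on_compose2[OF c\<theta>] continuous_on_compose2[OF \<theta>'_cont] continuous_intros)
    moreover have "continuous_on {0..} (\<lambda>z. p (s + z))" "continuous_on {0..} (\<lambda>z. p' (s + z))"
      by (auto intro!: continuous_on_compose2[OF cp] continuous_on_compose2[OF p'(2)] continuous_intros)
    ultimately show "continuous_on {0..} F'"
      unfolding F'_def[abs_def] by (intro continuous_intros)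
  next
    \<comment> \<open>For z \<ge> T - s the argument of p has left (0, T), so F vanishes; the
      maximum with 1 keeps the bound positive.\<close>
    show "0 < max 1 (T - s)" by simp
    show "F y = 0" if "max 1 (T - s) \<le> y" for y using that p_off by (simp add: F_def)
  qed (simp add: F_def[abs_def])
  then show ?thesis by (simp add: F_def gen_def add.assoc)
qed

sublocale lU: pair_sigma_finite lborel U ..
sublocale Ul: pair_sigma_finite U lborel ..

text \<open>The shift of t by y frees g from y, so the integral over the potential measure meets
  \<open>gen\<close> (t + y) y alone and \<open>potential_gen\<close> evaluates it with w =
  0.\<close>

lemma weak_source:
  assumes g[measurable]: "g \<in> borel_measurable borel" and gb: "\<And>t. \<bar>g t\<bar> \<le> L"
    and g0: "\<And>t. t \<notin> {0<..<T} \<Longrightarrow> g t = 0"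
  shows "(LINT t|halfline. LINT y|U. g (t - y) * gen t y) = - (LINT t|lborel. g t * (p t * \<theta> 0))"
proof -
  obtain C where C: "0 \<le> C" "\<And>t y. \<bar>gen t y\<bar> \<le> C" using gen_bound by blast
  have L: "0 \<le> L" using gb[of 0] by linarith
  \<comment> \<open>For y \<ge> 0 the integrand vanishes unless 0 < t < T and t + y < T, so it lives
    in a square of finite measure.\<close>
  have i: "integrable (U \<Otimes>\<^sub>M lborel) (\<lambda>(y, t). indicator {0..} y * (g t * gen (t + y) y))"
  proof (rule integrableI_bounded)
    have "(\<integral>\<^sup>+x. ennreal (norm (case x of (y, t) \<Rightarrow> indicator {0..} y * (g t * gen (t + y) y))) \<partial>(U \<Otimes>\<^sub>M lborel))
      \<le> (\<integral>\<^sup>+x. ennreal (L * C) * indicator ({0..T} \<times> {0..T}) x \<partial>(U \<Otimes>\<^sub>M lborel))"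
    proof (rule nn_integral_mono)
      fix x :: "real \<times> real"
      obtain y t where [simp]: "x = (y, t)" by force
      show "ennreal (norm (case x of (y, t) \<Rightarrow> indicator {0..} y * (g t * gen (t + y) y)))
        \<le> ennreal (L * C) * indicator ({0..T} \<times> {0..T}) x"
      proof (cases "y \<in> {0..T} \<and> t \<in> {0..T}")
        case True
        have "\<bar>g t * gen (t + y) y\<bar> \<le> L * C"
          unfolding abs_mult using gb[of t] C(2)[of "t + y" y] L by (intro mult_mono) auto
        then show ?thesis using True by (auto intro: ennreal_leI)
      next
        case False
        then have "indicator {0..} y * (g t * gen (t + y) y) = 0"
          using g0[of t] gen_zero[of "t + y" y] by (cases "t \<in> {0<..<T}") (auto split: split_indicator)
        then show ?thesis by (simp only: \<open>x = (y, t)\<close> prod.case norm_zero ennreal_0 zero_le)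
      qed
    qed
    also have "\<dots> = ennreal (L * C) * (emeasure U {0..T} * emeasure lborel {0..T})"
      by (subst nn_integral_cmult_indicator) (auto simp: lborel.emeasure_pair_measure_Times)
    also have "\<dots> < \<infinity>" using U_Icc_finite[of T] by (cases "0 \<le> T") (auto simp: ennreal_mult_less_top)
    finally show "(\<integral>\<^sup>+x. ennreal (norm (case x of (y, t) \<Rightarrow> indicator {0..} y * (g t * gen (t + y) y))) \<partial>(U \<Otimes>\<^sub>M lborel)) < \<infinity>" .
  qed measurable
  \<comment> \<open>The factor equals 1 almost everywhere for the potential measure. Keeping it
    makes ?f vanish pointwise for t \<le> 0, where t - y lies outside (0, T); the half-line may then
    be replaced by the line.\<close>
  let ?f = "\<lambda>y t. indicator {0..} y * (g (t - y) * gen t y)"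
  have f: "(\<lambda>(y, t). ?f y t) \<in> borel_measurable (borel \<Otimes>\<^sub>M borel)" by measurable
  have i': "integrable (U \<Otimes>\<^sub>M lborel) (\<lambda>(y, t). ?f y t)"
    using integrable_shear[OF sigma_finite_U sets_U f, of 1] i by simp
  have "(LINT t|halfline. LINT y|U. g (t - y) * gen t y) = (LINT t|halfline. LINT y|U. ?f y t)"
  proof (rule Bochner_Integration.integral_cong[OF refl], rule integral_cong_AE)
    fix t show "AE y in U. g (t - y) * gen t y = ?f y t" using AE_U_nonneg by eventually_elim auto
  qed measurable
  also have "\<dots> = (LINT t|lborel. LINT y|U. ?f y t)"
  proof -
    have z: "(LINT y|U. ?f y t) = 0" if "t \<le> 0" for t
      using that g0 by (intro integral_eq_zero_AE AE_I2) (auto split: split_indicator)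
    have "(LINT t|halfline. LINT y|U. ?f y t) = (LINT t|lborel. indicator {0<..} t * (LINT y|U. ?f y t))"
      by (subst integral_halfline) (auto simp: set_lebesgue_integral_def)
    also have "\<dots> = (LINT t|lborel. LINT y|U. ?f y t)"
      using z by (intro Bochner_Integration.integral_cong) (auto split: split_indicator)
    finally show ?thesis .
  qed
  also have "\<dots> = (LINT x|(U \<Otimes>\<^sub>M lborel). (case x of (y, t) \<Rightarrow> ?f y t))"
    by (rule Ul.integral_snd[OF i'])
  also have "\<dots> = (LINT (y, t)|(U \<Otimes>\<^sub>M lborel). indicator {0..} y * (g t * gen (t + y) y))"
    using integral_shear[OF sigma_finite_U sets_U f, of 1] by simp
  also have "\<dots> = (LINT t|lborel. LINT y|U. indicator {0..} y * (g t * gen (t + y) y))"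
    by (rule Ul.integral_snd[symmetric, OF i])
  also have "\<dots> = (LINT t|lborel. g t * - (p t * \<theta> 0))"
  proof (intro Bochner_Integration.integral_cong refl)
    fix t
    have "(LINT y|U. indicator {0..} y * (g t * gen (t + y) y)) = (LINT y|U. g t * gen (t + y) (0 + y))"
    proof (rule integral_cong_AE)
      show "AE y in U. indicator {0..} y * (g t * gen (t + y) y) = g t * gen (t + y) (0 + y)"
        using AE_U_nonneg by eventually_elim auto
    qed measurable
    also have "\<dots> = g t * - (p t * \<theta> 0)"
      unfolding Bochner_Integration.integral_mult_right_zero potential_gen[OF order_refl] by simp
    finally show "(LINT y|U. indicator {0..} y * (g t * gen (t + y) y)) = g t * - (p t * \<theta> 0)" .
  qed
  finally show ?thesis by simp
qed

text \<open>The compensation formula introduces a jump of size r from the level z. After the shift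
  of t by z the potential measure acts on \<open>gen\<close> alone and yields -p t * \<theta> r;
  after a further shift by r the remaining integral over the jump sizes is \<open>gen\<close> t 0,
  because p t = 0 for t < 0.\<close>

lemma weak_history:
  assumes g[measurable]: "g \<in> borel_measurable borel" and gb: "\<And>t. \<bar>g t\<bar> \<le> L"
    and g0: "\<And>t. 0 \<le> t \<Longrightarrow> g t = 0"
  shows "(LINT t|halfline. LINT \<omega>|M. g (t - overshoot t \<omega>) * gen t (overshoot t \<omega>)) = - (LINT t|lborel. g t * gen t 0)"
proof -
  obtain C where C: "0 \<le> C" "\<And>t y. \<bar>gen t y\<bar> \<le> C" using gen_bound by blast
  have L: "0 \<le> L" using gb[of 0] by linarith
  define G where "G x = g (fst x - snd x) * gen (fst x) (snd x)" for x
  have G[measurable]: "G \<in> borel_measurable (borel \<Otimes>\<^sub>M borel)" unfolding G_def by measurable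
  have "(\<integral>\<^sup>+t. \<integral>\<^sup>+\<omega>. ennreal \<bar>G (t, overshoot t \<omega>)\<bar> \<partial>M \<partial>halfline)
    \<le> (\<integral>\<^sup>+t. \<integral>\<^sup>+\<omega>. ennreal (L * C) * indicator {..T} t \<partial>M \<partial>halfline)"
  proof (intro nn_integral_mono)
    fix t \<omega>
    have "\<bar>G (t, overshoot t \<omega>)\<bar> \<le> L * C"
      unfolding G_def abs_mult using gb C(2) L by (intro mult_mono) auto
    then show "ennreal \<bar>G (t, overshoot t \<omega>)\<bar> \<le> ennreal (L * C) * indicator {..T} t"
      using gen_zero[of t] by (auto simp: G_def split: split_indicator intro: ennreal_leI)
  qed
  also have "\<dots> = (\<integral>\<^sup>+t. ennreal (L * C) * indicator {..T} t \<partial>halfline)"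
    by (simp add: emeasure_space_1)
  also have "\<dots> = (\<integral>\<^sup>+t\<in>{0<..}. ennreal (L * C) * indicator {..T} t \<partial>lborel)"
    by (rule nn_integral_halfline) measurable
  also have "\<dots> = (\<integral>\<^sup>+t. ennreal (L * C) * indicator {0<..T} t \<partial>lborel)"
    by (intro nn_integral_cong) (auto split: split_indicator)
  also have "\<dots> < \<infinity>"
    by (cases "0 \<le> T") (auto simp: nn_integral_cmult_indicator ennreal_mult_less_top)
  finally have fin: "(\<integral>\<^sup>+t. \<integral>\<^sup>+\<omega>. ennreal \<bar>G (t, overshoot t \<omega>)\<bar> \<partial>M \<partial>halfline) < \<infinity>" .
  note iJ = integrable_jumps[OF G fin]
  let ?N = "Nu \<Otimes>\<^sub>M lborel"
  define f where "f z y = indicator {z..<z + fst y} (snd y) * G (snd y, z + fst y)" for z and y :: "real \<times> real"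
  \<comment> \<open>This is \<open>f\<close> with t replaced by t + z: the level z has disappeared
    from the indicator and from g.\<close>
  define h where "h z y = indicator {0..<fst y} (snd y) * (g (snd y - fst y) * gen (snd y + z) (fst y + z))" for z and y :: "real \<times> real"
  have f[measurable]: "(\<lambda>(z, y). f z y) \<in> borel_measurable (U \<Otimes>\<^sub>M ?N)" unfolding f_def by measurable
  have if_: "integrable (U \<Otimes>\<^sub>M ?N) (\<lambda>(z, y). f z y)"
    using integrable_jumps_density[OF iJ] by (simp add: f_def split_def)
  have m: "(\<lambda>(z, y). (z, (fst y, snd y + z))) \<in> U \<Otimes>\<^sub>M ?N \<rightarrow>\<^sub>M U \<Otimes>\<^sub>M ?N" by measurable
  have skew: "distr (U \<Otimes>\<^sub>M ?N) (U \<Otimes>\<^sub>M ?N) (\<lambda>(z, y). (z, (fst y, snd y + z))) = U \<Otimes>\<^sub>M ?N"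
  proof (rule distr_skew[where s="\<lambda>z y. (fst y, snd y + z)"])
    fix z :: real
    show "distr ?N ?N (\<lambda>y. (fst y, snd y + z)) = ?N"
      using distr_skew[of lborel "\<lambda>r t. t + z" Nu] lborel.sigma_finite_measure_axioms
      by (simp add: distr_translate_lborel split_def)
  qed (auto intro: Nl.P.sigma_finite_measure_axioms)
  have fh: "f z (fst y, snd y + z) = h z y" for z y
    unfolding f_def h_def G_def by (auto split: split_indicator simp: algebra_simps)
  have ih: "integrable (U \<Otimes>\<^sub>M ?N) (\<lambda>(z, y). h z y)"
    using integrable_distr_eq[OF m f] if_ unfolding skew by (simp add: split_def fh)
  have hint: "(LINT z|U. h z y) = indicator {0..<fst y} (snd y) * (g (snd y - fst y) * - (p (snd y) * \<theta> (fst y)))"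
    if "0 < fst y" for y
    unfolding h_def Bochner_Integration.integral_mult_right_zero potential_gen[OF less_imp_le[OF that]] ..
  define k where "k r t = indicator {..<0} t * (g t * (p (t + r) * \<theta> r))" for r t :: real
  have k[measurable]: "(\<lambda>(r, t). k r t) \<in> borel_measurable (borel \<Otimes>\<^sub>M borel)" unfolding k_def by measurable
  have hk: "AE y in ?N. (LINT z|U. h z y) = - k (fst y) (snd y + (- 1) * fst y)"
    using Nl.AE_pair_fst[OF AE_Nu_pos]
  proof eventually_elim
    case (elim y)
    show ?case using p_off[of "snd y"] unfolding hint[OF elim] k_def by (auto split: split_indicator)
  qed
  have ik0: "integrable ?N (\<lambda>y. k (fst y) (snd y + (- 1) * fst y))"
  proof -
    have "integrable ?N (\<lambda>y. LINT z|U. h z y)" by (rule UNl.integrable_snd[OF ih])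
    then have "integrable ?N (\<lambda>y. - k (fst y) (snd y + (- 1) * fst y))"
      by (rule integrable_cong_AE_imp) (use hk in \<open>auto elim: eventually_mono\<close>)
    then show ?thesis by simp
  qed
  have ik: "integrable ?N (\<lambda>(r, t). k r t)"
    using integrable_shear[OF sigma_finite_Nu sets_Nu k, of "- 1"] ik0 by (simp add: split_def)
  have "(LINT t|halfline. LINT \<omega>|M. g (t - overshoot t \<omega>) * gen t (overshoot t \<omega>))
    = (LINT t|halfline. LINT \<omega>|M. G (t, overshoot t \<omega>))" by (simp add: G_def)
  also have "\<dots> = (LINT (z, r, t)|jumps. G (t, z + r))" by (rule integral_overshoot[OF G fin])
  also have "\<dots> = (LINT (z, y)|(U \<Otimes>\<^sub>M ?N). f z y)"
    using integral_jumps_density[OF iJ] by (simp add: f_def split_def)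
  also have "\<dots> = (LINT (z, y)|(U \<Otimes>\<^sub>M ?N). h z y)"
    using integral_distr[OF m f] unfolding skew by (simp add: split_def fh)
  also have "\<dots> = (LINT y|?N. LINT z|U. h z y)" by (rule UNl.integral_snd[symmetric, OF ih])
  also have "\<dots> = (LINT y|?N. - k (fst y) (snd y + (- 1) * fst y))"
    by (rule integral_cong_AE) (use hk UNl.integrable_snd[OF ih] ik0 in auto)
  also have "\<dots> = - (LINT (r, t)|?N. k r (t + (- 1) * r))" by (simp add: split_def)
  also have "\<dots> = - (LINT (r, t)|?N. k r t)"
    by (simp only: integral_shear[OF sigma_finite_Nu sets_Nu k])
  also have "\<dots> = - (LINT t|lborel. LINT r|Nu. k r t)"
    by (simp only: Nl.integral_snd[OF ik])
  also have "(LINT t|lborel. LINT r|Nu. k r t) = (LINT t|lborel. g t * gen t 0)"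
  proof (intro Bochner_Integration.integral_cong refl)
    fix t
    show "(LINT r|Nu. k r t) = g t * gen t 0"
    proof (cases "t < 0")
      case True
      then have "p t = 0" by (intro p_off) auto
      then show ?thesis using True by (simp add: k_def gen_def)
    qed (simp add: k_def g0)
  qed
  finally show ?thesis .
qed

end

subsection \<open>Feller semigroups\<close>

lemma C_infty_off: "v \<in> C_infty E \<Longrightarrow> x \<notin> E \<Longrightarrow> v x = 0"
  by (simp add: C_infty_def)

lemma C_infty_continuous_map:
  "v \<in> C_infty E \<Longrightarrow> continuous_map (compactification E) euclideanreal (at_cemetery0 v)"
  by (simp add: C_infty_def)

lemma C_infty_continuous_on: assumes "v \<in> C_infty E" shows "continuous_on E v"
proof -
  have "continuous_map (top_of_set E) euclideanreal (at_cemetery0 v \<circ> Some)"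
    by (rule continuous_map_compose[OF continuous_map_Some C_infty_continuous_map[OF assms]])
  also have "at_cemetery0 v \<circ> Some = v" by (auto simp: at_cemetery0_def)
  finally show ?thesis by simp
qed

lemma C_infty_bounded: assumes "v \<in> C_infty E" obtains C where "0 \<le> C" "\<And>x. \<bar>v x\<bar> \<le> C"
proof -
  have "compactin euclideanreal (at_cemetery0 v ` topspace (compactification E))"
    by (rule image_compactin[OF _ C_infty_continuous_map[OF assms]])
       (use compact_space_Alexandroff_compactification[of "top_of_set E"] in \<open>simp add: compact_space_def\<close>)
  then have "bounded (at_cemetery0 v ` topspace (compactification E))"
    by (auto dest: compact_imp_bounded)
  then obtain C where C: "\<And>z. z \<in> topspace (compactification E) \<Longrightarrow> \<bar>at_cemetery0 v z\<bar> \<le> C"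
    by (auto simp: bounded_iff)
  have "\<bar>v x\<bar> \<le> \<bar>C\<bar>" for x
    using C[of "Some x"] C_infty_off[OF assms, of x] by (cases "x \<in> E") (auto simp: at_cemetery0_def)
  then show thesis using that[of "\<bar>C\<bar>"] by auto
qed

lemma C_infty_measurable:
  assumes "v \<in> C_infty E" "E \<in> sets borel" shows "v \<in> borel_measurable borel"
proof -
  have "v = (\<lambda>x. indicator E x *\<^sub>R v x)"
    using C_infty_off[OF assms(1)] by (auto split: split_indicator)
  then show ?thesis
    using borel_measurable_continuous_on_indicator[OF assms(2) C_infty_continuous_on[OF assms(1)]] by simp
qed

text \<open>Compactness of the sets where \<bar>v\<bar> \<ge> e is continuity at the cemetery: the
  neighbourhoods of that point are the complements of closed compact sets.\<close>

lemma C_inftyI: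
  assumes off: "\<And>x. x \<notin> E \<Longrightarrow> v x = 0" and cont: "continuous_on E v"
    and vanish: "\<And>e. 0 < e \<Longrightarrow> compact {x \<in> E. e \<le> \<bar>v x\<bar>}"
  shows "v \<in> C_infty E"
proof -
  have "openin (compactification E) {z \<in> topspace (compactification E). at_cemetery0 v z \<in> U}" if U: "open U" for U
  proof (cases "0 \<in> U")
    case False
    have "{z \<in> topspace (compactification E). at_cemetery0 v z \<in> U} = Some ` {x \<in> E. v x \<in> U}"
      using False by (auto simp: at_cemetery0_def)
    moreover have "openin (top_of_set E) {x \<in> E. v x \<in> U}"
      using continuous_openin_preimage_gen[OF cont U] by (simp add: vimage_def Int_def)
    ultimately show ?thesis by simp
  next
    case True
    then obtain e where e: "0 < e" "ball 0 e \<subseteq> U" using U openE by blast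
    let ?C = "{x \<in> E. v x \<in> - U}" and ?K = "{x \<in> E. e \<le> \<bar>v x\<bar>}"
    have cl: "closedin (top_of_set E) ?C"
      using continuous_closedin_preimage[OF cont, of "- U"] U by (simp add: vimage_def Int_def closed_def)
    have "?C \<subseteq> ?K"
    proof
      fix x assume "x \<in> ?C"
      moreover have "v x \<in> U" if "\<bar>v x\<bar> < e" using e(2) that by auto
      ultimately show "x \<in> ?K" by force
    qed
    then have "?C = ?K \<inter> ?C" by auto
    moreover obtain D where "closed D" "?C = E \<inter> D" using cl by (auto simp: closedin_closed)
    ultimately have "?C = ?K \<inter> D" by auto
    then have "compact ?C" using vanish[OF e(1)] \<open>closed D\<close> by (metis (no_types) compact_Int_closed)
    then have "compactin (top_of_set E) ?C" by (auto simp: compactin_subtopology)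
    moreover have "{z \<in> topspace (compactification E). at_cemetery0 v z \<in> U} = insert None (Some ` (topspace (top_of_set E) - ?C))"
      using True by (auto simp: at_cemetery0_def)
    ultimately show ?thesis using cl unfolding openin_Alexandroff_compactification by blast
  qed
  then have "continuous_map (compactification E) euclideanreal (at_cemetery0 v)"
    unfolding continuous_map_def by (auto simp: Pi_def)
  then show ?thesis using off by (simp add: C_infty_def)
qed

lemma C_infty_lincomb:
  assumes "v \<in> C_infty E" "w \<in> C_infty E"
  shows "(\<lambda>x. a * v x + b * w x) \<in> C_infty E"
proof -
  have "continuous_map (compactification E) euclideanreal (\<lambda>z. a * at_cemetery0 v z + b * at_cemetery0 w z)"
    using assms[THEN C_infty_continuous_map] by (intro continuous_map_add continuous_map_real_mult_left) auto
  moreover have "(\<lambda>z. a * at_cemetery0 v z + b * at_cemetery0 w z) = at_cemetery0 (\<lambda>x. a * v x + b * w x)"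
    by (auto simp: at_cemetery0_def split: option.split)
  ultimately show ?thesis using assms by (auto simp: C_infty_def)
qed

lemma sup_norm_ge: "(\<And>x. \<bar>v x\<bar> \<le> C) \<Longrightarrow> \<bar>v x\<bar> \<le> sup_norm v"
  unfolding sup_norm_def by (rule cSUP_upper) (auto intro!: bdd_aboveI2)

lemma sup_norm_le: "(\<And>x. \<bar>v x\<bar> \<le> C) \<Longrightarrow> sup_norm v \<le> C"
  unfolding sup_norm_def by (rule cSUP_least) auto

lemma C_infty_sup_norm: "v \<in> C_infty E \<Longrightarrow> \<bar>v x\<bar> \<le> sup_norm v"
  using C_infty_bounded[of v E] sup_norm_ge[of v] by metis

section \<open>Consequences of the semigroup axioms and of the shape of E\<close>

locale feller =
  fixes \<Omega> E :: "'a::euclidean_space set" and P :: "real \<Rightarrow> ('a \<Rightarrow> real) \<Rightarrow> 'a \<Rightarrow> real"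
  assumes H1': "H1' \<Omega> E P"
begin

lemma bounded_\<Omega>: "bounded \<Omega>" and open_\<Omega>: "open \<Omega>" and E_cases: "E = \<Omega> \<or> E = closure \<Omega>"
  and semigroup: "feller_semigroup E P"
  using H1' by (auto simp: H1'_def)

lemma \<Omega>_subset: "\<Omega> \<subseteq> E" using E_cases closure_subset by auto

lemma \<Omega>_borel[measurable]: "\<Omega> \<in> sets borel" using open_\<Omega> by simp

lemma E_borel[measurable]: "E \<in> sets borel" using E_cases open_\<Omega> by auto

lemma P_in: "0 \<le> r \<Longrightarrow> v \<in> C_infty E \<Longrightarrow> P r v \<in> C_infty E"
  and P_lincomb: "0 \<le> r \<Longrightarrow> v \<in> C_infty E \<Longrightarrow> w \<in> C_infty E \<Longrightarrow>
    P r (\<lambda>x. a * v x + b * w x) = (\<lambda>x. a * P r v x + b * P r w x)"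
  and P_0: "v \<in> C_infty E \<Longrightarrow> P 0 v = v"
  and P_add: "0 \<le> r \<Longrightarrow> 0 \<le> s \<Longrightarrow> v \<in> C_infty E \<Longrightarrow> P (r + s) v = P r (P s v)"
  and P_continuous: "v \<in> C_infty E \<Longrightarrow> ((\<lambda>r. sup_norm (\<lambda>x. P r v x - v x)) \<longlongrightarrow> 0) (at_right 0)"
  and P_contraction: "0 \<le> r \<Longrightarrow> v \<in> C_infty E \<Longrightarrow> sup_norm (P r v) \<le> sup_norm v"
  using semigroup by (auto simp: feller_semigroup_def)

lemma C_infty_borel[measurable_dest]: "v \<in> C_infty E \<Longrightarrow> v \<in> borel_measurable borel"
  by (rule C_infty_measurable[OF _ E_borel])

lemma P_bound: "0 \<le> r \<Longrightarrow> v \<in> C_infty E \<Longrightarrow> \<bar>P r v x\<bar> \<le> sup_norm v"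
  using C_infty_sup_norm[OF P_in] P_contraction order_trans by blast

lemma C_infty_diff: "v \<in> C_infty E \<Longrightarrow> w \<in> C_infty E \<Longrightarrow> (\<lambda>x. v x - w x) \<in> C_infty E"
  using C_infty_lincomb[of v E w 1 "- 1"] by simp

lemma P_diff: "0 \<le> r \<Longrightarrow> v \<in> C_infty E \<Longrightarrow> w \<in> C_infty E \<Longrightarrow> P r (\<lambda>x. v x - w x) = (\<lambda>x. P r v x - P r w x)"
  using P_lincomb[of r v w 1 "- 1"] by simp

lemma P_time_diff:
  assumes "0 \<le> r" "r \<le> s" "v \<in> C_infty E"
  shows "\<bar>P s v x - P r v x\<bar> \<le> sup_norm (\<lambda>x. P (s - r) v x - v x)"
proof -
  have "P s v x - P r v x = P r (\<lambda>x. P (s - r) v x - v x) x"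
    using P_add[of r "s - r" v] P_diff[of r "P (s - r) v" v] P_in[of "s - r" v] assms by simp
  then show ?thesis using P_bound[OF assms(1) C_infty_diff[OF P_in[of "s - r" v]], of v x] assms by simp
qed

lemma P_time_continuous:
  assumes v: "v \<in> C_infty E"
  shows "continuous_on {0..} (\<lambda>r. P r v x)"
  unfolding continuous_on_iff
proof (intro ballI allI impI)
  fix r e :: real assume r: "r \<in> {0..}" and e: "0 < e"
  have "\<forall>\<^sub>F h in at_right 0. sup_norm (\<lambda>x. P h v x - v x) < e"
    using P_continuous[OF v] e by (rule order_tendstoD)
  then obtain d where d: "0 < d" "\<And>h. 0 < h \<Longrightarrow> h < d \<Longrightarrow> sup_norm (\<lambda>x. P h v x - v x) < e"
    unfolding eventually_at_right_field by auto
  have "dist (P s v x) (P r v x) < e" if "s \<in> {0..}" "dist s r < d" for s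
  proof -
    consider "s = r" | "s < r" | "r < s" by linarith
    then show ?thesis
    proof cases
      case 1 then show ?thesis using e by simp
    next
      case 2
      then show ?thesis using P_time_diff[of s r v x] d(2)[of "r - s"] that r v by (auto simp: dist_real_def)
    next
      case 3
      then show ?thesis using P_time_diff[of r s v x] d(2)[of "s - r"] that r v by (auto simp: dist_real_def)
    qed
  qed
  then show "\<exists>d>0. \<forall>s\<in>{0..}. dist s r < d \<longrightarrow> dist (P s v x) (P r v x) < e" using d(1) by blast
qed

lemma P_right: assumes "v \<in> C_infty E" "0 \<le> r" shows "((\<lambda>s. P s v x) \<longlongrightarrow> P r v x) (at_right r)"
  using P_time_continuous[OF assms(1)] assms(2) unfolding continuous_on_def
  by (auto intro: tendsto_within_subset[of _ _ _ "{0..}"])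

lemma P_measurable: "v \<in> C_infty E \<Longrightarrow> (\<lambda>(r, x). P (max 0 r) v x) \<in> borel_measurable (borel \<Otimes>\<^sub>M borel)"
  by (rule borel_measurable_right_continuous) (auto intro: C_infty_borel P_in P_right)

lemma P_measurable1[measurable (raw)]:
  "v \<in> C_infty E \<Longrightarrow> g \<in> borel_measurable N \<Longrightarrow> h \<in> borel_measurable N \<Longrightarrow>
    (\<lambda>w. P (max 0 (g w)) v (h w)) \<in> borel_measurable N"
  using measurable_compose[OF measurable_Pair P_measurable] by simp

text \<open>The right difference quotient at r, minus its limit, is P r applied to (P h q - q) / h -
  g, so contractivity bounds it uniformly in r. The left quotient at y is a right quotient at a
  nearby s < y, and P s g is close to P y g by strong continuity.\<close>

lemma orbit_deriv:
  assumes g: "generator E P q g" and y: "0 \<le> y"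
  shows "((\<lambda>s. P s q x) has_real_derivative P y g x) (at y within {0..})"
  unfolding has_field_derivative_iff Lim_within
proof (intro allI impI)
  fix e :: real assume e: "0 < e"
  have q: "q \<in> C_infty E" and g': "g \<in> C_infty E"
    and lim: "((\<lambda>r. sup_norm (\<lambda>x. (P r q x - q x) / r - g x)) \<longlongrightarrow> 0) (at_right 0)"
    using g by (auto simp: generator_def)
  have "\<forall>\<^sub>F h in at_right 0. sup_norm (\<lambda>x. P h g x - g x) < e / 2 \<and> sup_norm (\<lambda>x. (P h q x - q x) / h - g x) < e / 2"
    using P_continuous[OF g'] lim e by (intro eventually_conj order_tendstoD(2)[of _ 0]) auto
  then obtain d where d: "0 < d" "\<And>h. 0 < h \<Longrightarrow> h < d \<Longrightarrow> sup_norm (\<lambda>x. P h g x - g x) < e / 2"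
     "\<And>h. 0 < h \<Longrightarrow> h < d \<Longrightarrow> sup_norm (\<lambda>x. (P h q x - q x) / h - g x) < e / 2"
    unfolding eventually_at_right_field by auto
  have quot: "\<bar>(P (r + h) q x - P r q x) / h - P r g x\<bar> < e / 2" if r: "0 \<le> r" and h: "0 < h" "h < d" for r h
  proof -
    define w where "w = (\<lambda>x. 1 / h * (P h q x - q x) + (- 1) * g x)"
    have in1: "(\<lambda>x. P h q x - q x) \<in> C_infty E" using h by (intro C_infty_diff P_in q) auto
    have w: "w \<in> C_infty E" unfolding w_def by (rule C_infty_lincomb[OF in1 g'])
    have "P r w x = 1 / h * (P r (P h q) x - P r q x) + (- 1) * P r g x"
      unfolding w_def P_lincomb[OF r in1 g'] using P_diff[OF r P_in[of h q] q] h q by simp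
    then have "(P (r + h) q x - P r q x) / h - P r g x = P r w x"
      using P_add[of r h q] r h q by simp
    moreover have "\<bar>P r w x\<bar> \<le> sup_norm w" by (rule P_bound[OF r w])
    moreover have "sup_norm w < e / 2" using d(3)[OF h] by (simp add: w_def)
    ultimately show ?thesis by simp
  qed
  have "dist ((P s q x - P y q x) / (s - y)) (P y g x) < e" if s: "s \<in> {0..}" "0 < dist s y" "dist s y < d" for s
  proof (cases "y < s")
    case True
    then show ?thesis using quot[of y "s - y"] y s e by (auto simp: dist_real_def)
  next
    case False
    then have sy: "s < y" using s(2) by auto
    have "\<bar>(P y q x - P s q x) / (y - s) - P s g x\<bar> < e / 2"
      using quot[of s "y - s"] s sy by (auto simp: dist_real_def)
    moreover have "(P s q x - P y q x) / (s - y) = (P y q x - P s q x) / (y - s)"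
      using minus_divide_divide[of "P s q x - P y q x" "s - y"] by simp
    moreover have "\<bar>P y g x - P s g x\<bar> < e / 2"
      using P_time_diff[of s y g x] d(2)[of "y - s"] s sy g' by (auto simp: dist_real_def)
    ultimately show ?thesis unfolding dist_real_def by linarith
  qed
  then show "\<exists>d>0. \<forall>s\<in>{0..}. 0 < dist s y \<and> dist s y < d \<longrightarrow> dist ((P s q x - P y q x) / (s - y)) (P y g x) < e"
    using d(1) by blast
qed

lemma orbit_lipschitz:
  assumes g: "generator E P q g"
  shows "\<bar>P (max 0 y) q x - P (max 0 r) q x\<bar> \<le> sup_norm g * \<bar>y - r\<bar>"
proof -
  have "norm (P (max 0 y) q x - P (max 0 r) q x) \<le> sup_norm g * norm (max 0 y - max 0 r)"
  proof (rule field_differentiable_bound[where S="{0..}" and f="\<lambda>s. P s q x" and f'="\<lambda>s. P s g x"])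
    show "norm (P z g x) \<le> sup_norm g" if "z \<in> {0..}" for z
      using P_bound[of z g x] g that by (auto simp: generator_def)
  qed (auto intro: orbit_deriv[OF g])
  also have "\<dots> \<le> sup_norm g * \<bar>y - r\<bar>"
  proof (rule mult_left_mono)
    show "0 \<le> sup_norm g" using C_infty_sup_norm[of g E x] g by (auto simp: generator_def)
  qed auto
  finally show ?thesis by simp
qed

text \<open>Link from continuous functions to sets: everything known about P on continuous functions
  passes to open sets along these approximants.\<close>

lemma open_approx:
  assumes A: "open A"
  obtains w where "\<And>n. w n \<in> C_infty E" "\<And>n x. 0 \<le> w n x" "\<And>n x. w n x \<le> 1"
    "\<And>x. (\<lambda>n. w n x) \<longlonglongrightarrow> indicator (A \<inter> E) x"
proof -
  have "bounded E" using E_cases bounded_\<Omega> by auto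
  then obtain R where R: "E \<subseteq> ball 0 R" "0 < R"
    by (metis bounded_subset_ballD)
  \<comment> \<open>The ball makes W a proper subset, so that the distance to the complement is not
    degenerate. For \<open>E = \<Omega>\<close> the intersection with \<Omega> keeps the level sets
    closed and inside \<Omega>, hence compact.\<close>
  define W where "W = A \<inter> ball 0 R \<inter> (if E = \<Omega> then \<Omega> else UNIV)"
  have W: "open W" using A open_\<Omega> by (auto simp: W_def)
  have WE: "W \<inter> E = A \<inter> E" using R(1) by (auto simp: W_def)
  have "W \<noteq> UNIV"
  proof
    assume "W = UNIV"
    then have "bounded (UNIV :: 'a set)" by (metis W_def bounded_ball bounded_subset inf.cobounded1 inf.cobounded2)
    then show False by simp
  qed
  note lim = open_indicator_approx[OF W this]
  define w where "w n x = indicator E x * min 1 (real n * infdist x (- W))" for n :: nat and x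
  have cont: "continuous_on UNIV (\<lambda>x. min 1 (real n * infdist x (- W)))" for n :: nat
    by (intro continuous_intros)
  show thesis
  proof (rule that)
    fix n :: nat
    show "w n \<in> C_infty E"
    proof (rule C_inftyI)
      show "continuous_on E (w n)"
        by (rule continuous_on_eq[OF continuous_on_subset[OF cont[of n]]]) (auto simp: w_def)
      fix e :: real assume e: "0 < e"
      let ?L = "{x. e \<le> \<bar>min 1 (real n * infdist x (- W))\<bar>}"
      have L: "closed ?L" by (intro closed_Collect_le continuous_intros)
      have eq: "{x \<in> E. e \<le> \<bar>w n x\<bar>} = E \<inter> ?L" by (auto simp: w_def)
      show "compact {x \<in> E. e \<le> \<bar>w n x\<bar>}"
      proof (cases "E = \<Omega>")
        case True
        have "?L \<subseteq> E"
        proof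
          fix x assume "x \<in> ?L"
          then have "x \<in> W" using e by (cases "x \<in> W") (auto simp: infdist_zero)
          then show "x \<in> E" using True by (simp add: W_def)
        qed
        then have "{x \<in> E. e \<le> \<bar>w n x\<bar>} = ?L" using eq by auto
        moreover have "bounded ?L" using \<open>?L \<subseteq> E\<close> \<open>bounded E\<close> bounded_subset by blast
        ultimately show ?thesis using L by (simp add: compact_eq_bounded_closed)
      next
        case False
        then have "compact E" using E_cases bounded_\<Omega> by (auto simp: compact_closure)
        then show ?thesis unfolding eq using L by (rule compact_Int_closed)
      qed
    qed (simp add: w_def)
    show "0 \<le> w n x" "w n x \<le> 1" for x by (auto simp: w_def infdist_nonneg split: split_indicator)
  next
    fix x
    show "(\<lambda>n. w n x) \<longlonglongrightarrow> indicator (A \<inter> E) x"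
    proof (cases "x \<in> E")
      case True
      then have "indicator (A \<inter> E) x = (indicator W x :: real)" using WE by (auto simp: indicator_def)
      then show ?thesis using lim[of x] True by (simp add: w_def)
    qed (simp add: w_def)
  qed
qed

end

subsection \<open>Transition kernels and their symmetry\<close>

text \<open>Pushing the kernel forward under z \<mapsto> (w, z) makes the integrand independent of
  the parameter, which reduces the claim to integration of a fixed function against a varying
  measure.\<close>

lemma integral_kernel_measurable:
  fixes f :: "'b \<times> 'c \<Rightarrow> real"
  assumes f: "f \<in> borel_measurable (N \<Otimes>\<^sub>M B)" and k: "k \<in> N \<rightarrow>\<^sub>M subprob_algebra B"
  shows "(\<lambda>w. LINT z|k w. f (w, z)) \<in> borel_measurable N"
proof -
  note [measurable] = f k measurable_distr2
  have "(\<lambda>w. integral\<^sup>L (distr (k w) (N \<Otimes>\<^sub>M B) (\<lambda>z. (w, z))) f) \<in> borel_measurable N"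
    by (rule measurable_compose[OF _ integral_measurable_subprob_algebra[OF f]]) measurable
  moreover have "integral\<^sup>L (distr (k w) (N \<Otimes>\<^sub>M B) (\<lambda>z. (w, z))) f = (LINT z|k w. f (w, z))" if "w \<in> space N" for w
  proof -
    have "sets (k w) = sets B" using measurable_space[OF k that] by (simp add: space_subprob_algebra)
    then have "(\<lambda>z. (w, z)) \<in> k w \<rightarrow>\<^sub>M N \<Otimes>\<^sub>M B"
      using that by (simp add: measurable_cong_sets[of "k w" B, OF _ refl])
    then show ?thesis by (rule integral_distr[OF _ f])
  qed
  ultimately show ?thesis by (simp cong: measurable_cong)
qed

context feller
begin

text \<open>The density is only known to exist for each r and x separately; the choice is arbitrary
  and nothing is known about its dependence on them.\<close>

definition dens :: "real \<Rightarrow> 'a \<Rightarrow> 'a \<Rightarrow> real" where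
  "dens r x = (SOME p. (\<forall>y. 0 \<le> p y) \<and> set_integrable lborel E p \<and>
     (\<forall>v\<in>C_infty E. P r v x = (LBINT y:E. p y * v y)))"

text \<open>The conventions, a unit mass for r \<le> 0 and the null measure for x outside E, match P
  at time \<open>max 0 r\<close> and functions vanishing off E, so \<open>integral_kap\<close> holds
  for all r and x.\<close>

definition kap :: "real \<Rightarrow> 'a \<Rightarrow> 'a measure" where
  "kap r x = (if x \<notin> E then null_measure borel else if r \<le> 0 then return borel x
     else density lborel (\<lambda>y. ennreal (indicator E y * dens r x y)))"

lemma dens:
  assumes "0 < r" "x \<in> E"
  shows "0 \<le> dens r x y" "set_integrable lborel E (dens r x)"
    "v \<in> C_infty E \<Longrightarrow> P r v x = (LBINT y:E. dens r x y * v y)"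
proof -
  have "\<exists>p. (\<forall>y. 0 \<le> p y) \<and> set_integrable lborel E p \<and> (\<forall>v\<in>C_infty E. P r v x = (LBINT y:E. p y * v y))"
    using H1' assms unfolding H1'_def by blast
  from someI_ex[OF this, folded dens_def]
  show "0 \<le> dens r x y" "set_integrable lborel E (dens r x)"
    "v \<in> C_infty E \<Longrightarrow> P r v x = (LBINT y:E. dens r x y * v y)" by auto
qed

lemma dens_measurable: "0 < r \<Longrightarrow> x \<in> E \<Longrightarrow> (\<lambda>y. indicator E y * dens r x y) \<in> borel_measurable borel"
  using borel_measurable_integrable[OF dens(2)[unfolded set_integrable_def]] by simp

lemma sets_kap[simp, measurable_cong]: "sets (kap r x) = sets borel" and space_kap[simp]: "space (kap r x) = UNIV"
  by (auto simp: kap_def)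

lemma AE_kap: "AE z in kap r x. z \<in> E"
proof (cases "x \<in> E \<and> 0 < r")
  case True
  then show ?thesis
    unfolding kap_def using dens_measurable[of r x]
    by (auto simp: AE_density split: split_indicator)
next
  case False
  show ?thesis
  proof (cases "x \<in> E")
    case True
    then have e: "kap r x = return borel x" using False by (simp add: kap_def)
    have "Measurable.pred borel (\<lambda>z. z \<in> E)" by measurable
    then show ?thesis unfolding e using True AE_return[of x borel "\<lambda>z. z \<in> E"] by simp
  next
    case False
    have "AE z in null_measure (borel :: 'a measure). z \<in> E" by (rule AE_I[of _ _ UNIV]) auto
    moreover have "kap r x = null_measure borel" using False by (simp add: kap_def)
    ultimately show ?thesis by metis
  qed
qed

lemma finite_kap: "finite_measure (kap r x)"
proof (cases "x \<in> E \<and> 0 < r")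
  case True
  have "(\<integral>\<^sup>+y. ennreal (norm (indicator E y * dens r x y)) \<partial>lborel) < \<infinity>"
    using dens(2)[of r x] True unfolding set_integrable_def by (auto simp: integrable_iff_bounded)
  then show ?thesis
    using True dens(1)[of r x] dens_measurable[of r x]
    by (intro finite_measureI) (auto simp: kap_def emeasure_density)
next
  case False
  then show ?thesis by (intro finite_measureI) (auto simp: kap_def)
qed

lemma integral_kap:
  assumes v: "v \<in> C_infty E" shows "(LINT z|kap r x. v z) = P (max 0 r) v x"
proof (cases "x \<in> E")
  case False
  then have "P (max 0 r) v x = 0" using C_infty_off[OF P_in[OF _ v]] by simp
  then show ?thesis using False
    by (simp add: kap_def integral_eq_zero_null_sets[of UNIV] null_sets_def)
next
  case True
  note [measurable] = C_infty_borel[OF v]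
  show ?thesis
  proof (cases "r \<le> 0")
    case True
    then show ?thesis using \<open>x \<in> E\<close> P_0[OF v] by (simp add: kap_def integral_return)
  next
    case False
    then show ?thesis using \<open>x \<in> E\<close> dens[of r x] v dens_measurable[of r x]
      by (simp add: kap_def integral_density set_lebesgue_integral_def mult.assoc)
  qed
qed

lemma measure_kap_lim:
  assumes A: "open A" and w: "\<And>n. w n \<in> C_infty E" "\<And>n x. 0 \<le> w n x" "\<And>n x. w n x \<le> 1"
    "\<And>x. (\<lambda>n. w n x) \<longlonglongrightarrow> indicator (A \<inter> E) x"
  shows "(\<lambda>n. P (max 0 r) (w n) x) \<longlonglongrightarrow> measure (kap r x) A"
proof -
  interpret finite_measure "kap r x" by (rule finite_kap)
  have [measurable]: "A \<inter> E \<in> sets borel" using A by simp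
  have "(\<lambda>n. LINT z|kap r x. w n z) \<longlonglongrightarrow> (LINT z|kap r x. indicator (A \<inter> E) z)"
    using w C_infty_borel[OF w(1)] A by (intro integral_dominated_convergence[where w="\<lambda>_. 1"]) auto
  moreover have "(LINT z|kap r x. indicator (A \<inter> E) z) = measure (kap r x) (A \<inter> E)" using A by simp
  moreover have "measure (kap r x) (A \<inter> E) = measure (kap r x) A"
  proof (rule finite_measure_eq_AE)
    show "AE z in kap r x. (z \<in> A \<inter> E) = (z \<in> A)" using AE_kap[of r x] by eventually_elim auto
  qed (use A in auto)
  ultimately show ?thesis by (simp add: integral_kap[OF w(1)])
qed

text \<open>Approximants of the indicator of E have norm at most 1; contractivity and a limit bound
  the total mass.\<close>

lemma subprob_kap: "subprob_space (kap r x)"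
proof (rule subprob_spaceI)
  interpret finite_measure "kap r x" by (rule finite_kap)
  obtain w where w: "\<And>n::nat. w n \<in> C_infty E" "\<And>n x. 0 \<le> w n x" "\<And>n x. w n x \<le> 1"
    "\<And>x. (\<lambda>n. w n x) \<longlonglongrightarrow> indicator (UNIV \<inter> E) x"
    using open_approx[OF open_UNIV] by blast
  have "P (max 0 r) (w n) x \<le> 1" for n
  proof -
    have "sup_norm (w n) \<le> 1" by (rule sup_norm_le) (use w(2,3)[of n] in auto)
    moreover have "\<bar>P (max 0 r) (w n) x\<bar> \<le> sup_norm (w n)" by (rule P_bound[OF _ w(1)]) simp
    ultimately show ?thesis by linarith
  qed
  then have "measure (kap r x) UNIV \<le> 1"
    using LIMSEQ_le_const2[OF measure_kap_lim[OF open_UNIV w]] by auto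
  then show "emeasure (kap r x) (space (kap r x)) \<le> 1" by (simp add: emeasure_eq_measure)
qed simp

text \<open>The densities give no joint measurability, but the measure of an open set is a limit of
  P (max 0 r) (w n) x, which is jointly measurable by right-continuity in time.\<close>

lemma kap_measurable: "(\<lambda>(r, x). kap r x) \<in> borel \<Otimes>\<^sub>M borel \<rightarrow>\<^sub>M subprob_algebra borel"
proof -
  have open_case: "(\<lambda>(r, x). emeasure (kap r x) A) \<in> borel_measurable (borel \<Otimes>\<^sub>M borel)" if A: "open A" for A
  proof -
    obtain w where w: "\<And>n::nat. w n \<in> C_infty E" "\<And>n x. 0 \<le> w n x" "\<And>n x. w n x \<le> 1"
      "\<And>x. (\<lambda>n. w n x) \<longlonglongrightarrow> indicator (A \<inter> E) x"
      using open_approx[OF A] by blast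
    have "(\<lambda>z. measure (kap (fst z) (snd z)) A) \<in> borel_measurable (borel \<Otimes>\<^sub>M borel)"
      by (rule borel_measurable_LIMSEQ_real[OF measure_kap_lim[OF A w]]) (use w(1) in measurable)
    then have "(\<lambda>z. ennreal (measure (kap (fst z) (snd z)) A)) \<in> borel_measurable (borel \<Otimes>\<^sub>M borel)"
      by measurable
    then show ?thesis
      by (simp add: split_def finite_measure.emeasure_eq_measure[OF finite_kap])
  qed
  show ?thesis
  proof (rule measurable_subprob_algebra_generated[where G="{S. open S}" and \<Omega>=UNIV])
    show "sets borel = sigma_sets UNIV {S::'a set. open S}" by (simp add: borel_def)
    show "Int_stable {S::'a set. open S}" by (auto simp: Int_stable_def)
  qed (use open_case in \<open>auto simp: split_def subprob_kap\<close>)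
qed

lemma kap_measurable1[measurable (raw)]:
  "g \<in> borel_measurable N \<Longrightarrow> h \<in> borel_measurable N \<Longrightarrow> (\<lambda>w. kap (g w) (h w)) \<in> N \<rightarrow>\<^sub>M subprob_algebra borel"
  using measurable_compose[OF measurable_Pair kap_measurable] by simp

lemma integral_kap_measurable:
  fixes f :: "'b \<times> 'a \<Rightarrow> real"
  assumes "f \<in> borel_measurable (N \<Otimes>\<^sub>M borel)" "g \<in> borel_measurable N" "h \<in> borel_measurable N"
  shows "(\<lambda>w. LINT z|kap (g w) (h w). f (w, z)) \<in> borel_measurable N"
  by (rule integral_kernel_measurable[OF assms(1) kap_measurable1[OF assms(2,3)]])

lemma nn_integral_kap_measurable:
  assumes "f \<in> borel_measurable (N \<Otimes>\<^sub>M borel)" "g \<in> borel_measurable N" "h \<in> borel_measurable N"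
  shows "(\<lambda>w. \<integral>\<^sup>+z. f (w, z) \<partial>kap (g w) (h w)) \<in> borel_measurable N"
  using nn_integral_measurable_subprob_algebra2[OF _ kap_measurable1[OF assms(2,3)], of "\<lambda>w z. f (w, z)"] assms(1)
  by simp

lemma integral_kap_bound:
  fixes f :: "'a \<Rightarrow> real"
  assumes "\<And>z. \<bar>f z\<bar> \<le> C" shows "\<bar>LINT z|kap r x. f z\<bar> \<le> C"
proof -
  interpret subprob_space "kap r x" by (rule subprob_kap)
  have C: "0 \<le> C" using assms[of undefined] by linarith
  show ?thesis
  proof (cases "integrable (kap r x) f")
    case True
    have "\<bar>LINT z|kap r x. f z\<bar> \<le> (LINT z|kap r x. \<bar>f z\<bar>)" by (rule integral_abs_bound)
    also have "\<dots> \<le> (LINT z|kap r x. C)"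
      using True assms by (intro integral_mono) auto
    also have "\<dots> \<le> C" using subprob_measure_le_1[of UNIV] C by (simp add: mult_left_le_one_le)
    finally show ?thesis .
  qed (simp add: not_integrable_integral_eq C)
qed

section \<open>Symmetry of the transition kernels with respect to Lebesgue measure on
  \<Omega>\<close>

definition l\<Omega> :: "'a measure" where "l\<Omega> = density lborel (indicator \<Omega>)"

lemma sets_l\<Omega>[simp, measurable_cong]: "sets l\<Omega> = sets borel" and space_l\<Omega>[simp]: "space l\<Omega> = UNIV"
  by (simp_all add: l\<Omega>_def)

lemma finite_l\<Omega>: "finite_measure l\<Omega>"
proof (rule finite_measureI)
  have "emeasure lborel \<Omega> < \<infinity>" by (rule emeasure_bounded_finite[OF bounded_\<Omega>])
  then show "emeasure l\<Omega> (space l\<Omega>) \<noteq> \<infinity>" by (simp add: l\<Omega>_def emeasure_density)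
qed

sublocale l\<Omega>: finite_measure l\<Omega> by (rule finite_l\<Omega>)

lemma AE_l\<Omega>: "AE x in l\<Omega>. x \<in> \<Omega>"
  unfolding l\<Omega>_def by (subst AE_density) (auto split: split_indicator_asm)

lemma integral_l\<Omega>:
  fixes f :: "'a \<Rightarrow> real"
  assumes "f \<in> borel_measurable borel" shows "(LINT x|l\<Omega>. f x) = (LBINT x:\<Omega>. f x)"
  using assms integral_density[of f lborel "indicator \<Omega>"]
  by (simp add: l\<Omega>_def ennreal_indicator set_lebesgue_integral_def)

lemma P_symmetric:
  assumes r: "0 \<le> r" and v: "v \<in> C_infty E" and w: "w \<in> C_infty E"
  shows "(LINT x|l\<Omega>. P r v x * w x) = (LINT x|l\<Omega>. v x * P r w x)"
proof (cases "r = 0")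
  case True
  then show ?thesis using P_0 v w by simp
next
  case False
  note [measurable] = C_infty_borel[OF v] C_infty_borel[OF w] C_infty_borel[OF P_in[OF r v]] C_infty_borel[OF P_in[OF r w]]
  have "(LBINT x:\<Omega>. P r v x * w x) = (LBINT x:\<Omega>. v x * P r w x)"
    using H1' False r v w unfolding H1'_def by auto
  then show ?thesis by (simp add: integral_l\<Omega>)
qed

text \<open>The measure of pairs (x, z), with x drawn from Lebesgue measure on \<Omega> and z from
  the kernel at x; its primed companion has the coordinates exchanged. Symmetry phrased as equality
  of the two measures covers all bounded or nonnegative Borel functions of the pair.\<close>

definition joint :: "real \<Rightarrow> ('a \<times> 'a) measure" where
  "joint r = l\<Omega> \<bind> (\<lambda>x. distr (kap r x) (borel \<Otimes>\<^sub>M borel) (\<lambda>z. (x, z)))"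

definition joint' :: "real \<Rightarrow> ('a \<times> 'a) measure" where
  "joint' r = l\<Omega> \<bind> (\<lambda>x. distr (kap r x) (borel \<Otimes>\<^sub>M borel) (\<lambda>z. (z, x)))"

lemma joint_kernels:
  "(\<lambda>x. distr (kap r x) (borel \<Otimes>\<^sub>M borel) (\<lambda>z. (x, z))) \<in> l\<Omega> \<rightarrow>\<^sub>M subprob_algebra (borel \<Otimes>\<^sub>M borel)"
  "(\<lambda>x. distr (kap r x) (borel \<Otimes>\<^sub>M borel) (\<lambda>z. (z, x))) \<in> l\<Omega> \<rightarrow>\<^sub>M subprob_algebra (borel \<Otimes>\<^sub>M borel)"
proof -
  note [measurable] = measurable_distr2
  show "(\<lambda>x. distr (kap r x) (borel \<Otimes>\<^sub>M borel) (\<lambda>z. (x, z))) \<in> l\<Omega> \<rightarrow>\<^sub>M subprob_algebra (borel \<Otimes>\<^sub>M borel)"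
    "(\<lambda>x. distr (kap r x) (borel \<Otimes>\<^sub>M borel) (\<lambda>z. (z, x))) \<in> l\<Omega> \<rightarrow>\<^sub>M subprob_algebra (borel \<Otimes>\<^sub>M borel)"
    by measurable
qed

lemma nn_integral_joint:
  assumes F: "F \<in> borel_measurable (borel \<Otimes>\<^sub>M borel)"
  shows "(\<integral>\<^sup>+y. F y \<partial>joint r) = (\<integral>\<^sup>+x. \<integral>\<^sup>+z. F (x, z) \<partial>kap r x \<partial>l\<Omega>)"
    and "(\<integral>\<^sup>+y. F y \<partial>joint' r) = (\<integral>\<^sup>+x. \<integral>\<^sup>+z. F (z, x) \<partial>kap r x \<partial>l\<Omega>)"
  unfolding joint_def joint'_def using F
  by (simp_all add: nn_integral_bind[OF F joint_kernels(1)] nn_integral_bind[OF F joint_kernels(2)] nn_integral_distr)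

lemma integral_joint:
  fixes F :: "'a \<times> 'a \<Rightarrow> real"
  assumes F: "F \<in> borel_measurable (borel \<Otimes>\<^sub>M borel)" and B: "\<And>y. \<bar>F y\<bar> \<le> B"
  shows "(LINT y|joint r. F y) = (LINT x|l\<Omega>. LINT z|kap r x. F (x, z))"
    and "(LINT y|joint' r. F y) = (LINT x|l\<Omega>. LINT z|kap r x. F (z, x))"
proof -
  have le1: "emeasure N (space N) \<le> ennreal 1" if "N \<in> space (subprob_algebra K)" for N :: "'b measure" and K
    using that subprob_space.emeasure_space_le_1[of N] by (simp add: space_subprob_algebra)
  have fin: "finite_measure l\<Omega>" by (rule finite_l\<Omega>)
  show "(LINT y|joint r. F y) = (LINT x|l\<Omega>. LINT z|kap r x. F (x, z))"
    unfolding joint_def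
    by (subst integral_bind[OF F B joint_kernels(1) fin, where B'=1])
       (use F le1[OF measurable_space[OF joint_kernels(1)]] in \<open>auto simp: integral_distr\<close>)
  show "(LINT y|joint' r. F y) = (LINT x|l\<Omega>. LINT z|kap r x. F (z, x))"
    unfolding joint'_def
    by (subst integral_bind[OF F B joint_kernels(2) fin, where B'=1])
       (use F le1[OF measurable_space[OF joint_kernels(2)]] in \<open>auto simp: integral_distr\<close>)
qed

lemma sets_joint: "sets (joint r) = sets (borel \<Otimes>\<^sub>M borel)" "sets (joint' r) = sets (borel \<Otimes>\<^sub>M borel)"
  unfolding joint_def joint'_def by (rule sets_bind; simp)+

text \<open>Symmetry for continuous functions passes to open rectangles by dominated convergence.
  The second coordinate of \<open>joint' r\<close> lies in \<Omega> almost everywhere, so the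
  equality also shows that from almost every x in \<Omega> the kernel puts no mass on the
  boundary.\<close>

lemma joint_symmetric:
  assumes r: "0 \<le> r" shows "joint r = joint' r"
proof (rule finite_measure_eqI_rectangles[OF sets_joint])
  have le1: "emeasure (kap r x) A \<le> 1" for x A
    using subprob_space.subprob_emeasure_le_1[OF subprob_kap] by blast
  have "emeasure (joint r) UNIV = (\<integral>\<^sup>+y. indicator UNIV y \<partial>joint r)"
    using sets_eq_imp_space_eq[OF sets_joint(1)[of r]] by (simp add: space_pair_measure)
  also have "\<dots> = (\<integral>\<^sup>+x. \<integral>\<^sup>+z. indicator UNIV (x, z) \<partial>kap r x \<partial>l\<Omega>)"
    by (rule nn_integral_joint) simp
  also have "\<dots> \<le> (\<integral>\<^sup>+x. 1 \<partial>l\<Omega>)"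
    using le1 by (intro nn_integral_mono) simp
  also have "\<dots> < \<infinity>" by (simp add: l\<Omega>.emeasure_eq_measure)
  finally show "emeasure (joint r) UNIV \<noteq> \<infinity>" by simp
  fix A B :: "'a set" assume A: "open A" and B: "open B"
  obtain w where w: "\<And>n::nat. w n \<in> C_infty E" "\<And>n x. 0 \<le> w n x" "\<And>n x. w n x \<le> 1"
    "\<And>x. (\<lambda>n. w n x) \<longlonglongrightarrow> indicator (A \<inter> E) x"
    using open_approx[OF A] by blast
  obtain v where v: "\<And>n::nat. v n \<in> C_infty E" "\<And>n x. 0 \<le> v n x" "\<And>n x. v n x \<le> 1"
    "\<And>x. (\<lambda>n. v n x) \<longlonglongrightarrow> indicator (B \<inter> E) x"
    using open_approx[OF B] by blast
  have [measurable]: "A \<in> sets borel" "B \<in> sets borel" using A B by auto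
  have AB: "A \<times> B \<in> sets (borel \<Otimes>\<^sub>M borel)" using A B by auto
  note [measurable] = C_infty_borel[OF w(1)] C_infty_borel[OF v(1)] C_infty_borel[OF P_in[OF r w(1)]] C_infty_borel[OF P_in[OF r v(1)]]
  have kl: "(\<lambda>n. P r (w n) x) \<longlonglongrightarrow> measure (kap r x) A" "(\<lambda>n. P r (v n) x) \<longlonglongrightarrow> measure (kap r x) B" for x
    using measure_kap_lim[OF A w] measure_kap_lim[OF B v] r by (metis max_absorb2)+
  have [measurable]: "(\<lambda>x. measure (kap r x) A) \<in> borel_measurable borel"
    by (rule borel_measurable_LIMSEQ_real[where u="\<lambda>n. P r (w n)"], rule kl(1)) measurable
  have [measurable]: "(\<lambda>x. measure (kap r x) B) \<in> borel_measurable borel"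
    by (rule borel_measurable_LIMSEQ_real[where u="\<lambda>n. P r (v n)"], rule kl(2)) measurable
  have Pb: "\<bar>P r (w n) x\<bar> \<le> 1" "\<bar>P r (v n) x\<bar> \<le> 1" for n x
  proof -
    have "sup_norm (w n) \<le> 1" "sup_norm (v n) \<le> 1"
      by (rule sup_norm_le, use w(2,3)[of n] v(2,3)[of n] in auto)+
    then show "\<bar>P r (w n) x\<bar> \<le> 1" "\<bar>P r (v n) x\<bar> \<le> 1"
      using P_bound[OF r w(1)[of n], of x] P_bound[OF r v(1)[of n], of x] by linarith+
  qed
  have wb: "\<bar>w n x\<bar> \<le> 1" "\<bar>v n x\<bar> \<le> 1" for n x using w(2,3) v(2,3) by (auto simp: abs_le_iff intro: order_trans[of _ 0])
  have E: "AE x in l\<Omega>. x \<in> E" using AE_l\<Omega> \<Omega>_subset by auto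
  have prod1: "\<bar>a * b\<bar> \<le> 1" if "\<bar>a\<bar> \<le> 1" "\<bar>b\<bar> \<le> 1" for a b :: real
    using mult_mono[OF that] by (simp add: abs_mult)
  have l1: "(\<lambda>n. LINT x|l\<Omega>. P r (v n) x * w n x) \<longlonglongrightarrow> (LINT x|l\<Omega>. measure (kap r x) B * indicator A x)"
  proof (rule integral_dominated_convergence[where w="\<lambda>_. 1"])
    show "AE x in l\<Omega>. (\<lambda>n. P r (v n) x * w n x) \<longlonglongrightarrow> measure (kap r x) B * indicator A x"
      using E
    proof eventually_elim
      case (elim x)
      then have "(\<lambda>n. w n x) \<longlonglongrightarrow> indicator A x" using w(4)[of x] by (simp add: indicator_def)
      then show ?case by (intro tendsto_mult kl)
    qed
    show "AE x in l\<Omega>. norm (P r (v n) x * w n x) \<le> 1" for n using prod1[OF Pb(2) wb(1)] by simp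
  qed auto
  have l2: "(\<lambda>n. LINT x|l\<Omega>. v n x * P r (w n) x) \<longlonglongrightarrow> (LINT x|l\<Omega>. indicator B x * measure (kap r x) A)"
  proof (rule integral_dominated_convergence[where w="\<lambda>_. 1"])
    show "AE x in l\<Omega>. (\<lambda>n. v n x * P r (w n) x) \<longlonglongrightarrow> indicator B x * measure (kap r x) A"
      using E
    proof eventually_elim
      case (elim x)
      then have "(\<lambda>n. v n x) \<longlonglongrightarrow> indicator B x" using v(4)[of x] by (simp add: indicator_def)
      then show ?case by (intro tendsto_mult kl)
    qed
    show "AE x in l\<Omega>. norm (v n x * P r (w n) x) \<le> 1" for n using prod1[OF wb(2) Pb(1)] by simp
  qed auto
  have sym: "(LINT x|l\<Omega>. measure (kap r x) B * indicator A x) = (LINT x|l\<Omega>. indicator B x * measure (kap r x) A)"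
    using LIMSEQ_unique[OF l1] l2 P_symmetric[OF r v(1) w(1)] by simp
  have m1: "measure (kap r x) C \<le> 1" for x C
    using subprob_space.subprob_measure_le_1[OF subprob_kap] by blast
  have int: "integrable l\<Omega> (\<lambda>x. measure (kap r x) B * indicator A x)" "integrable l\<Omega> (\<lambda>x. measure (kap r x) A * indicator B x)"
    using A B prod1 m1 by (auto intro!: l\<Omega>.integrable_const_bound[where B=1] split: split_indicator)
  have nn: "(\<integral>\<^sup>+x. emeasure (kap r x) B * indicator A x \<partial>l\<Omega>) = ennreal (LINT x|l\<Omega>. measure (kap r x) B * indicator A x)"
    "(\<integral>\<^sup>+x. emeasure (kap r x) A * indicator B x \<partial>l\<Omega>) = ennreal (LINT x|l\<Omega>. measure (kap r x) A * indicator B x)"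
    using int by (auto simp: nn_integral_eq_integral[symmetric] finite_measure.emeasure_eq_measure[OF finite_kap]
        ennreal_mult' ennreal_indicator[symmetric] intro!: nn_integral_cong)
  have "emeasure (joint r) (A \<times> B) = (\<integral>\<^sup>+y. indicator (A \<times> B) y \<partial>joint r)"
    using AB sets_joint by simp
  also have "\<dots> = (\<integral>\<^sup>+x. \<integral>\<^sup>+z. indicator (A \<times> B) (x, z) \<partial>kap r x \<partial>l\<Omega>)"
    by (rule nn_integral_joint) (use AB in simp)
  also have "\<dots> = (\<integral>\<^sup>+x. emeasure (kap r x) B * indicator A x \<partial>l\<Omega>)"
    using B by (intro nn_integral_cong) (auto simp: indicator_times mult.commute nn_integral_cmult)
  finally have e1: "emeasure (joint r) (A \<times> B) = \<dots>" .
  have "emeasure (joint' r) (A \<times> B) = (\<integral>\<^sup>+y. indicator (A \<times> B) y \<partial>joint' r)"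
    using AB sets_joint by simp
  also have "\<dots> = (\<integral>\<^sup>+x. \<integral>\<^sup>+z. indicator (A \<times> B) (z, x) \<partial>kap r x \<partial>l\<Omega>)"
    by (rule nn_integral_joint) (use AB in simp)
  also have "\<dots> = (\<integral>\<^sup>+x. emeasure (kap r x) A * indicator B x \<partial>l\<Omega>)"
    using A by (intro nn_integral_cong) (auto simp: indicator_times mult.commute nn_integral_multc)
  finally have e2: "emeasure (joint' r) (A \<times> B) = \<dots>" .
  show "emeasure (joint r) (A \<times> B) = emeasure (joint' r) (A \<times> B)"
    using sym unfolding e1 e2 nn by (simp add: mult.commute)
qed

lemma kap_symmetric:
  fixes v w :: "'a \<Rightarrow> real"
  assumes r: "0 \<le> r" and [measurable]: "v \<in> borel_measurable borel" "w \<in> borel_measurable borel"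
    and b: "\<And>x. \<bar>v x\<bar> \<le> C" "\<And>x. \<bar>w x\<bar> \<le> D"
  shows "(LINT x|l\<Omega>. (LINT z|kap r x. v z) * w x) = (LINT x|l\<Omega>. v x * (LINT z|kap r x. w z))"
proof -
  let ?F = "\<lambda>y. w (fst y) * v (snd y)"
  have "\<bar>?F y\<bar> \<le> D * C" for y
    unfolding abs_mult using b(2)[of undefined] by (intro mult_mono b) auto
  note * = integral_joint[of ?F, OF _ this]
  have "(LINT x|l\<Omega>. (LINT z|kap r x. v z) * w x) = (LINT y|joint r. ?F y)"
    by (subst *(1)) (auto simp: mult.commute)
  also have "\<dots> = (LINT y|joint' r. ?F y)" by (simp only: joint_symmetric[OF r])
  also have "\<dots> = (LINT x|l\<Omega>. v x * (LINT z|kap r x. w z))"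
    by (subst *(2)) (auto simp: mult.commute)
  finally show ?thesis .
qed

lemma nn_kap_symmetric:
  assumes r: "0 \<le> r" and F: "F \<in> borel_measurable (borel \<Otimes>\<^sub>M borel)"
  shows "(\<integral>\<^sup>+x. \<integral>\<^sup>+z. F (x, z) \<partial>kap r x \<partial>l\<Omega>) = (\<integral>\<^sup>+x. \<integral>\<^sup>+z. F (z, x) \<partial>kap r x \<partial>l\<Omega>)"
  using nn_integral_joint[OF F, of r] joint_symmetric[OF r] by simp

end

subsection \<open>Killed processes at independent random times\<close>

lemma at_cemetery0_simps[simp]: "at_cemetery0 v None = 0" "at_cemetery0 v (Some y) = v y"
  by (simp_all add: at_cemetery0_def)

lemma sets_borel_compactification:
  "space (borel_compactification E) = insert None (Some ` E)"
  "openin (compactification E) U \<Longrightarrow> U \<in> sets (borel_compactification E)"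
proof -
  have *: "{U. openin (compactification E) U} \<subseteq> Pow (topspace (compactification E))"
    by (auto dest!: openin_subset)
  show "space (borel_compactification E) = insert None (Some ` E)"
    unfolding borel_compactification_def space_measure_of[OF *] by simp
  show "openin (compactification E) U \<Longrightarrow> U \<in> sets (borel_compactification E)"
    unfolding borel_compactification_def sets_measure_of[OF *] by simp
qed

lemma at_cemetery0_measurable:
  assumes "v \<in> C_infty E" shows "at_cemetery0 v \<in> borel_measurable (borel_compactification E)"
proof (rule borel_measurableI)
  fix U :: "real set" assume "open U"
  then have "openin (compactification E) {z \<in> topspace (compactification E). at_cemetery0 v z \<in> U}"
    using openin_continuous_map_preimage[OF C_infty_continuous_map[OF assms], of U] by simp
  moreover have "{z \<in> topspace (compactification E). at_cemetery0 v z \<in> U} = at_cemetery0 v -` U \<inter> space (borel_compactification E)"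
    by (auto simp: sets_borel_compactification)
  ultimately show "at_cemetery0 v -` U \<inter> space (borel_compactification E) \<in> sets (borel_compactification E)"
    using sets_borel_compactification(2) by metis
qed

definition path_algebra :: "'w measure \<Rightarrow> 'b measure \<Rightarrow> (real \<Rightarrow> 'w \<Rightarrow> 'b) \<Rightarrow> 'w measure" where
  "path_algebra M N Y = vimage_algebra (space M) (\<lambda>\<omega>. \<lambda>t\<in>{0..}. Y t \<omega>) (Pi\<^sub>M {0..} (\<lambda>_. N))"

lemma space_path_algebra[simp]: "space (path_algebra M N Y) = space M"
  by (simp add: path_algebra_def)

lemma path_algebra_measurable:
  assumes "\<And>t. 0 \<le> t \<Longrightarrow> Y t \<in> M \<rightarrow>\<^sub>M N" and "0 \<le> t"
  shows "Y t \<in> path_algebra M N Y \<rightarrow>\<^sub>M N"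
proof -
  have "(\<lambda>\<omega>. \<lambda>t\<in>{0..}. Y t \<omega>) \<in> path_algebra M N Y \<rightarrow>\<^sub>M Pi\<^sub>M {0..} (\<lambda>_. N)"
    unfolding path_algebra_def
    by (rule measurable_vimage_algebra1) (use assms(1) in \<open>auto simp: space_PiM PiE_def Pi_def dest: measurable_space\<close>)
  from measurable_compose[OF this measurable_component_singleton[of t]] show ?thesis using assms(2) by simp
qed

context prob_space
begin

text \<open>Independence is given for the path sigma-algebras and is inherited by the smaller ones
  generated by Z and X. The extended nonnegative form allows summation over countably many
  events.\<close>

lemma nn_integral_indep_product:
  fixes X Z :: "'a \<Rightarrow> real"
  assumes ind: "independent_processes M K1 Y1 K2 Y2"
    and Z: "Z \<in> borel_measurable (path_algebra M K1 Y1)" and X: "X \<in> borel_measurable (path_algebra M K2 Y2)"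
    and b: "\<And>\<omega>. 0 \<le> X \<omega>" "\<And>\<omega>. X \<omega> \<le> C" "\<And>\<omega>. 0 \<le> Z \<omega>" "\<And>\<omega>. Z \<omega> \<le> D"
  shows "(\<integral>\<^sup>+\<omega>. ennreal (X \<omega> * Z \<omega>) \<partial>M) = (\<integral>\<^sup>+\<omega>. ennreal (X \<omega>) \<partial>M) * ennreal (expectation Z)"
proof -
  let ?F1 = "path_algebra M K1 Y1" and ?F2 = "path_algebra M K2 Y2"
  have iset: "indep_set (sets ?F1) (sets ?F2)"
    using ind by (simp add: independent_processes_def path_algebra_def)
  note ev = indep_setD_ev1[OF iset] indep_setD_ev2[OF iset]
  have sub: "sigma_sets (space M) {f -` A \<inter> space M |A. A \<in> sets borel} \<subseteq> sets F"
    if f: "f \<in> borel_measurable F" and F: "space F = space M" for f :: "'a \<Rightarrow> real" and F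
  proof -
    have "{f -` A \<inter> space M |A. A \<in> sets borel} \<subseteq> sets F" using measurable_sets[OF f] F by auto
    from sets.sigma_sets_subset[OF this] show ?thesis using F by simp
  qed
  have meas: "f \<in> borel_measurable M" if "f \<in> borel_measurable F" "space F = space M" "sets F \<subseteq> events"
    for f :: "'a \<Rightarrow> real" and F
    using that by (auto simp: measurable_def)
  have ZM[measurable]: "Z \<in> borel_measurable M" and XM[measurable]: "X \<in> borel_measurable M"
    using meas[OF Z _ ev(1)] meas[OF X _ ev(2)] by auto
  have "indep_set (sigma_sets (space M) {Z -` A \<inter> space M |A. A \<in> sets borel})
     (sigma_sets (space M) {X -` A \<inter> space M |A. A \<in> sets borel})"
    unfolding indep_sets2_eq
  proof (intro conjI ballI)
    show "sigma_sets (space M) {Z -` A \<inter> space M |A. A \<in> sets borel} \<subseteq> events"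
      "sigma_sets (space M) {X -` A \<inter> space M |A. A \<in> sets borel} \<subseteq> events"
      using sub[OF Z] sub[OF X] ev by simp_all
    fix a b
    assume "a \<in> sigma_sets (space M) {Z -` A \<inter> space M |A. A \<in> sets borel}"
      "b \<in> sigma_sets (space M) {X -` A \<inter> space M |A. A \<in> sets borel}"
    then have "a \<in> sets ?F1" "b \<in> sets ?F2" using sub[OF Z] sub[OF X] by auto
    then show "prob (a \<inter> b) = prob a * prob b" using iset unfolding indep_sets2_eq by blast
  qed
  then have iv: "indep_var borel Z borel X"
    unfolding indep_var_eq by simp
  have i: "integrable M X" "integrable M Z"
  proof -
    show "integrable M X" using b(1,2) by (intro integrable_const_bound[where B=C]) auto
    show "integrable M Z" using b(3,4) by (intro integrable_const_bound[where B=D]) auto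
  qed
  have "(\<integral>\<^sup>+\<omega>. ennreal (X \<omega> * Z \<omega>) \<partial>M) = ennreal (expectation (\<lambda>\<omega>. Z \<omega> * X \<omega>))"
    using b indep_var_integrable[OF iv i(2,1)] by (subst nn_integral_eq_integral) (auto simp: mult.commute)
  also have "expectation (\<lambda>\<omega>. Z \<omega> * X \<omega>) = expectation Z * expectation X"
    by (rule indep_var_lebesgue_integral[OF iv i(2,1)])
  also have "ennreal (expectation Z * expectation X) = (\<integral>\<^sup>+\<omega>. ennreal (X \<omega>) \<partial>M) * ennreal (expectation Z)"
    using b i by (subst nn_integral_eq_integral) (auto simp: ennreal_mult[symmetric] mult.commute)
  finally show ?thesis .
qed

end

section \<open>The spatial process as a pair of survival and position\<close>

locale killed = subordinator M \<nu> S + feller \<Omega> E P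
  for M :: "'w measure" and \<nu> S and \<Omega> E :: "'a::euclidean_space set" and P +
  fixes x :: 'a and Y :: "real \<Rightarrow> 'w \<Rightarrow> 'a option"
  assumes x_in: "x \<in> E" and process: "feller_process M E P x Y"
    and indep: "independent_processes M (borel_compactification E) Y borel S"
begin

lemma Y_measurable: "0 \<le> t \<Longrightarrow> Y t \<in> M \<rightarrow>\<^sub>M borel_compactification E"
  using process by (auto simp: feller_process_def)

lemma Y_range: "0 \<le> t \<Longrightarrow> \<omega> \<in> space M \<Longrightarrow> Y t \<omega> = Some y \<Longrightarrow> y \<in> E"
  using measurable_space[OF Y_measurable, of t \<omega>] by (auto simp: sets_borel_compactification)

lemma Y_limit: "\<omega> \<in> space M \<Longrightarrow> 0 \<le> t \<Longrightarrow> limitin (compactification E) (\<lambda>s. Y s \<omega>) (Y t \<omega>) (at_right t)"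
  using process by (auto simp: feller_process_def)

lemma Y_absorbing: "\<omega> \<in> space M \<Longrightarrow> 0 \<le> s \<Longrightarrow> s \<le> t \<Longrightarrow> Y s \<omega> = None \<Longrightarrow> Y t \<omega> = None"
  using process by (auto simp: feller_process_def)

lemma vY_measurable: "v \<in> C_infty E \<Longrightarrow> 0 \<le> t \<Longrightarrow> (\<lambda>\<omega>. at_cemetery0 v (Y t \<omega>)) \<in> borel_measurable M"
  by (rule measurable_compose[OF Y_measurable at_cemetery0_measurable])

lemma vY_path_measurable:
  "v \<in> C_infty E \<Longrightarrow> 0 \<le> t \<Longrightarrow>
    (\<lambda>\<omega>. at_cemetery0 v (Y t \<omega>)) \<in> borel_measurable (path_algebra M (borel_compactification E) Y)"
  by (rule measurable_compose[OF path_algebra_measurable[OF Y_measurable] at_cemetery0_measurable])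

lemma vY_right:
  assumes "v \<in> C_infty E" "\<omega> \<in> space M" "0 \<le> t"
  shows "((\<lambda>s. at_cemetery0 v (Y s \<omega>)) \<longlongrightarrow> at_cemetery0 v (Y t \<omega>)) (at_right t)"
  using continuous_map_limit[OF C_infty_continuous_map[OF assms(1)] Y_limit[OF assms(2,3)]]
  by (simp add: o_def)

lemma at_cemetery0_bound: "v \<in> C_infty E \<Longrightarrow> \<bar>at_cemetery0 v z\<bar> \<le> sup_norm v"
  using C_infty_sup_norm[of v E] by (cases z) (auto intro: order_trans[OF abs_ge_zero])

text \<open>The Markov property at time 0, where the process sits almost surely at x, integrated
  over M.\<close>

lemma expectation_vY:
  assumes v: "v \<in> C_infty E" and s: "0 \<le> s"
  shows "expectation (\<lambda>\<omega>. at_cemetery0 v (Y s \<omega>)) = P s v x"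
proof -
  let ?F = "natural_filtration M (borel_compactification E) Y 0"
  have gen: "{Y s -` A \<inter> space M |s A. 0 \<le> s \<and> s \<le> 0 \<and> A \<in> sets (borel_compactification E)} \<subseteq> events"
    using measurable_sets[OF Y_measurable] by auto
  then have gen': "{Y s -` A \<inter> space M |s A. 0 \<le> s \<and> s \<le> (0::real) \<and> A \<in> sets (borel_compactification E)} \<subseteq> Pow (space M)"
    using sets.space_closed by blast
  have "subalgebra M ?F"
    unfolding subalgebra_def natural_filtration_def
    using sets.sigma_sets_subset[OF gen] by (simp add: space_measure_of[OF gen'] sets_measure_of[OF gen'])
  then interpret F: finite_measure_subalgebra M ?F
    by (unfold_locales)
  have int: "integrable M (\<lambda>\<omega>. at_cemetery0 v (Y s \<omega>))"
    using at_cemetery0_bound[OF v] vY_measurable[OF v s] by (intro integrable_const_bound[where B="sup_norm v"]) auto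
  have "expectation (\<lambda>\<omega>. at_cemetery0 v (Y s \<omega>)) = expectation (real_cond_exp M ?F (\<lambda>\<omega>'. at_cemetery0 v (Y s \<omega>')))"
    using F.real_cond_exp_int(2)[OF int] by simp
  also have "\<dots> = expectation (\<lambda>_. P s v x)"
  proof (rule integral_cong_AE)
    have "AE \<omega> in M. real_cond_exp M ?F (\<lambda>\<omega>'. at_cemetery0 v (Y (0 + s) \<omega>')) \<omega> = at_cemetery0 (P s v) (Y 0 \<omega>)"
      using process s v unfolding feller_process_def by blast
    moreover have "AE \<omega> in M. Y 0 \<omega> = Some x" using process by (simp add: feller_process_def)
    ultimately show "AE \<omega> in M. real_cond_exp M ?F (\<lambda>\<omega>'. at_cemetery0 v (Y s \<omega>')) \<omega> = P s v x"
      by eventually_elim simp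
  qed (use F.real_cond_exp_int(1)[OF int] in auto)
  finally show ?thesis by (simp add: prob_space)
qed

definition alive :: "real \<Rightarrow> 'w \<Rightarrow> bool" where
  "alive s \<omega> \<longleftrightarrow> Y (max 0 s) \<omega> \<noteq> None"

text \<open>The position after death is an arbitrary point; every use is guarded by
  \<open>alive\<close>. Splitting the state in this way replaces the Borel structure of the
  compactification by that of the underlying vector space.\<close>

definition pos :: "real \<Rightarrow> 'w \<Rightarrow> 'a" where
  "pos s \<omega> = (case Y (max 0 s) \<omega> of None \<Rightarrow> 0 | Some y \<Rightarrow> y)"

lemma vY_pair_measurable:
  "v \<in> C_infty E \<Longrightarrow> (\<lambda>(s, \<omega>). at_cemetery0 v (Y (max 0 s) \<omega>)) \<in> borel_measurable (borel \<Otimes>\<^sub>M M)"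
  by (rule borel_measurable_right_continuous) (auto intro: vY_measurable vY_right)

lemma in_open_lim:
  assumes \<omega>: "\<omega> \<in> space M"
    and w: "\<And>y. (\<lambda>n. w n y) \<longlonglongrightarrow> indicator (A \<inter> E) y"
  shows "(\<lambda>n. at_cemetery0 (w n) (Y (max 0 s) \<omega>)) \<longlonglongrightarrow> of_bool (alive s \<omega> \<and> pos s \<omega> \<in> A)"
proof (cases "Y (max 0 s) \<omega>")
  case (Some y)
  then have "y \<in> E" using Y_range[of "max 0 s" \<omega>] \<omega> by auto
  then show ?thesis using w[of y] Some by (simp add: alive_def pos_def indicator_def)
qed (simp add: alive_def)

text \<open>Composed with a function in \<open>C_infty E\<close>, the process is real-valued and
  right-continuous, hence jointly measurable; the event is a limit of such compositions.\<close>

lemma in_open_measurable: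
  assumes A: "open A"
  shows "Measurable.pred (borel \<Otimes>\<^sub>M M) (\<lambda>(s, \<omega>). alive s \<omega> \<and> pos s \<omega> \<in> A)"
proof -
  obtain w where w: "\<And>n::nat. w n \<in> C_infty E" "\<And>n x. 0 \<le> w n x" "\<And>n x. w n x \<le> 1"
    "\<And>x. (\<lambda>n. w n x) \<longlonglongrightarrow> indicator (A \<inter> E) x"
    using open_approx[OF A] by blast
  have "(\<lambda>z. of_bool (alive (fst z) (snd z) \<and> pos (fst z) (snd z) \<in> A) :: real) \<in> borel_measurable (borel \<Otimes>\<^sub>M M)"
  proof (rule borel_measurable_LIMSEQ_real)
    show "(\<lambda>z. at_cemetery0 (w n) (Y (max 0 (fst z)) (snd z))) \<in> borel_measurable (borel \<Otimes>\<^sub>M M)" for n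
      using vY_pair_measurable[OF w(1)] by (simp add: split_def)
    show "(\<lambda>n. at_cemetery0 (w n) (Y (max 0 (fst z)) (snd z))) \<longlonglongrightarrow> of_bool (alive (fst z) (snd z) \<and> pos (fst z) (snd z) \<in> A)"
      if "z \<in> space (borel \<Otimes>\<^sub>M M)" for z
      by (rule in_open_lim[OF _ w(4)]) (use that in \<open>auto simp: space_pair_measure\<close>)
  qed
  then have "Measurable.pred (borel \<Otimes>\<^sub>M M) (\<lambda>z. (of_bool (alive (fst z) (snd z) \<and> pos (fst z) (snd z) \<in> A) :: real) = 1)"
    by measurable
  then show ?thesis by (simp add: split_def)
qed

lemma alive_measurable: "Measurable.pred (borel \<Otimes>\<^sub>M M) (\<lambda>(s, \<omega>). alive s \<omega>)"
  using in_open_measurable[OF open_UNIV] by simp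

lemma pos_measurable: "(\<lambda>(s, \<omega>). pos s \<omega>) \<in> borel_measurable (borel \<Otimes>\<^sub>M M)"
proof (rule borel_measurableI)
  fix A :: "'a set" assume "open A"
  then have 1: "Measurable.pred (borel \<Otimes>\<^sub>M M) (\<lambda>z. alive (fst z) (snd z) \<and> pos (fst z) (snd z) \<in> A)"
    using in_open_measurable by (simp add: split_def)
  have 2: "Measurable.pred (borel \<Otimes>\<^sub>M M) (\<lambda>z. \<not> alive (fst z) (snd z))"
    using alive_measurable by (simp add: split_def)
  have "Measurable.pred (borel \<Otimes>\<^sub>M M) (\<lambda>z. (alive (fst z) (snd z) \<and> pos (fst z) (snd z) \<in> A) \<or> (\<not> alive (fst z) (snd z) \<and> 0 \<in> A))"
    using 1 2 by measurable
  also have "(\<lambda>z. (alive (fst z) (snd z) \<and> pos (fst z) (snd z) \<in> A) \<or> (\<not> alive (fst z) (snd z) \<and> 0 \<in> A))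
    = (\<lambda>z. pos (fst z) (snd z) \<in> A)"
    by (auto simp: alive_def pos_def split: option.splits)
  finally show "(\<lambda>(s, \<omega>). pos s \<omega>) -` A \<inter> space (borel \<Otimes>\<^sub>M M) \<in> sets (borel \<Otimes>\<^sub>M M)"
    by (simp add: pred_def split_def vimage_def Int_def conj_commute)
qed

lemma alive_measurable1[measurable (raw)]:
  assumes "g \<in> borel_measurable N" "h \<in> N \<rightarrow>\<^sub>M M" shows "Measurable.pred N (\<lambda>z. alive (g z) (h z))"
  using measurable_compose[OF measurable_Pair[OF assms] alive_measurable] by simp

lemma pos_measurable1[measurable (raw)]:
  assumes "g \<in> borel_measurable N" "h \<in> N \<rightarrow>\<^sub>M M" shows "(\<lambda>z. pos (g z) (h z)) \<in> borel_measurable N"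
  using measurable_compose[OF measurable_Pair[OF assms] pos_measurable] by simp

text \<open>A random time \<open>D\<close> that depends on \<open>S\<close> only is approximated from the right by times with
  countably many values, for which independence reduces the claim to fixed times.\<close>

context
  fixes D :: "'w \<Rightarrow> real"
  assumes D: "D \<in> borel_measurable (path_algebra M borel S)" and D_nonneg: "\<And>\<omega>. 0 \<le> D \<omega>"
begin

lemma D_measurable: "D \<in> borel_measurable M"
proof -
  have "sets (path_algebra M borel S) \<subseteq> events"
    using indep indep_setD_ev2 by (auto simp: independent_processes_def path_algebra_def)
  then show ?thesis using D by (auto simp: measurable_def)
qed

lemma random_time_approx:
  fixes g :: "real \<Rightarrow> real"
  assumes v: "v \<in> C_infty E" "\<And>y. 0 \<le> v y" and g[measurable]: "g \<in> borel_measurable borel"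
    and gb: "\<And>s. 0 \<le> g s" "\<And>s. g s \<le> C"
  shows "(\<integral>\<^sup>+\<omega>. ennreal (g (D \<omega>) * at_cemetery0 v (Y (right_approx n (D \<omega>)) \<omega>)) \<partial>M)
    = (\<integral>\<^sup>+\<omega>. ennreal (g (D \<omega>) * P (right_approx n (D \<omega>)) v x) \<partial>M)"
proof -
  note [measurable] = D_measurable
  define t where "t k = real (Suc k) / real (Suc n)" for k
  \<comment> \<open>The events on which the approximating time equals \<open>t k\<close> =
    (k+1)/(n+1); the successor reflects that \<open>right_approx\<close> rounds strictly upwards.
    Each \<open>X k\<close> depends on the path of S alone.\<close>
  define X where "X k \<omega> = g (D \<omega>) * of_bool (\<lfloor>real (Suc n) * D \<omega>\<rfloor> = int k)" for k \<omega>
  have X_path: "X k \<in> borel_measurable (path_algebra M borel S)" for k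
    unfolding X_def using D by measurable
  have [measurable]: "X k \<in> borel_measurable M" for k unfolding X_def by measurable
  have [measurable]: "(\<lambda>\<omega>. at_cemetery0 v (Y (t k) \<omega>)) \<in> borel_measurable M" for k
    by (rule vY_measurable[OF v(1)]) (simp add: t_def)
  have X: "0 \<le> X k \<omega>" "X k \<omega> \<le> C" for k \<omega>
    using gb(1,2)[of "D \<omega>"] by (auto simp: X_def)
  have vpos: "0 \<le> at_cemetery0 v z" for z using v(2) by (cases z) auto
  have vle: "at_cemetery0 v z \<le> sup_norm v" for z using at_cemetery0_bound[OF v(1), of z] by linarith
  have P0: "0 \<le> P (t k) v x" for k
  proof -
    have "0 \<le> (LINT z|kap (t k) x. v z)" using v(2) by (intro Bochner_Integration.integral_nonneg)
    moreover have "max 0 (t k) = t k" by (simp add: t_def)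
    ultimately show ?thesis using integral_kap[OF v(1), of "t k" x] by simp
  qed
  have split: "ennreal (g (D \<omega>) * h (right_approx n (D \<omega>))) = (\<Sum>k. ennreal (X k \<omega> * h (t k)))" for h \<omega>
  proof -
    define k where "k = nat \<lfloor>real (Suc n) * D \<omega>\<rfloor>"
    have k: "\<lfloor>real (Suc n) * D \<omega>\<rfloor> = int k" using D_nonneg[of \<omega>] by (simp add: k_def)
    then have "right_approx n (D \<omega>) = t k" by (simp add: right_approx_def t_def)
    moreover have "(\<Sum>i. ennreal (X i \<omega> * h (t i))) = (\<Sum>i. if i = k then ennreal (g (D \<omega>) * h (t k)) else 0)"
      by (intro suminf_cong) (auto simp: X_def k simp del: of_nat_Suc)
    moreover have "\<dots> = ennreal (g (D \<omega>) * h (t k))" using sums_single[of k "\<lambda>_. ennreal (g (D \<omega>) * h (t k))"] by (simp add: sums_iff)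
    ultimately show ?thesis by simp
  qed
  have "(\<integral>\<^sup>+\<omega>. ennreal (g (D \<omega>) * at_cemetery0 v (Y (right_approx n (D \<omega>)) \<omega>)) \<partial>M)
    = (\<integral>\<^sup>+\<omega>. (\<Sum>k. ennreal (X k \<omega> * at_cemetery0 v (Y (t k) \<omega>))) \<partial>M)"
    by (intro nn_integral_cong split)
  also have "\<dots> = (\<Sum>k. \<integral>\<^sup>+\<omega>. ennreal (X k \<omega> * at_cemetery0 v (Y (t k) \<omega>)) \<partial>M)"
    by (intro nn_integral_suminf) measurable
  also have "\<dots> = (\<Sum>k. \<integral>\<^sup>+\<omega>. ennreal (X k \<omega> * P (t k) v x) \<partial>M)"
  proof (intro suminf_cong)
    fix k
    have "(\<integral>\<^sup>+\<omega>. ennreal (X k \<omega> * at_cemetery0 v (Y (t k) \<omega>)) \<partial>M)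
      = (\<integral>\<^sup>+\<omega>. ennreal (X k \<omega>) \<partial>M) * ennreal (P (t k) v x)"
      using nn_integral_indep_product[OF indep vY_path_measurable[OF v(1), of "t k"] X_path X vpos vle]
        expectation_vY[OF v(1), of "t k"] by (simp add: t_def)
    also have "\<dots> = (\<integral>\<^sup>+\<omega>. ennreal (X k \<omega> * P (t k) v x) \<partial>M)"
      using X P0 by (subst nn_integral_multc[symmetric]) (auto simp: ennreal_mult)
    finally show "(\<integral>\<^sup>+\<omega>. ennreal (X k \<omega> * at_cemetery0 v (Y (t k) \<omega>)) \<partial>M) = \<dots>" .
  qed
  also have "\<dots> = (\<integral>\<^sup>+\<omega>. (\<Sum>k. ennreal (X k \<omega> * P (t k) v x)) \<partial>M)"
    by (intro nn_integral_suminf[symmetric]) measurable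
  also have "\<dots> = (\<integral>\<^sup>+\<omega>. ennreal (g (D \<omega>) * P (right_approx n (D \<omega>)) v x) \<partial>M)"
    by (intro nn_integral_cong split[symmetric])
  finally show ?thesis .
qed

text \<open>Both sides are right-continuous in the time at which process and semigroup are
  evaluated, so the identity for the approximating times survives the limit. The factor g keeps the
  exact time and is not approximated.\<close>

lemma random_time_C_infty:
  fixes g :: "real \<Rightarrow> real"
  assumes v: "v \<in> C_infty E" "\<And>y. 0 \<le> v y" and g[measurable]: "g \<in> borel_measurable borel"
    and gb: "\<And>s. 0 \<le> g s" "\<And>s. g s \<le> C"
  shows "(\<integral>\<^sup>+\<omega>. ennreal (g (D \<omega>) * at_cemetery0 v (Y (D \<omega>) \<omega>)) \<partial>M)
    = (\<integral>\<^sup>+\<omega>. ennreal (g (D \<omega>) * P (D \<omega>) v x) \<partial>M)"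
proof -
  note [measurable] = D_measurable
  have m[simp]: "max 0 (D \<omega>) = D \<omega>" "max 0 (right_approx n (D \<omega>)) = right_approx n (D \<omega>)" for n \<omega>
    using D_nonneg[of \<omega>] right_approx_gt[of "D \<omega>" n] by auto
  have [measurable]: "(\<lambda>\<omega>. right_approx n (D \<omega>)) \<in> borel_measurable M" for n
    unfolding right_approx_def by measurable
  have [measurable]: "(\<lambda>\<omega>. at_cemetery0 v (Y (right_approx n (D \<omega>)) \<omega>)) \<in> borel_measurable M"
    "(\<lambda>\<omega>. at_cemetery0 v (Y (D \<omega>) \<omega>)) \<in> borel_measurable M" for n
    using measurable_compose[OF measurable_Pair vY_pair_measurable[OF v(1)], of "\<lambda>\<omega>. right_approx n (D \<omega>)" M "\<lambda>\<omega>. \<omega>"]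
      measurable_compose[OF measurable_Pair vY_pair_measurable[OF v(1)], of D M "\<lambda>\<omega>. \<omega>"] by simp_all
  have [measurable]: "(\<lambda>\<omega>. P (right_approx n (D \<omega>)) v x) \<in> borel_measurable M" "(\<lambda>\<omega>. P (D \<omega>) v x) \<in> borel_measurable M" for n
    using P_measurable1[OF v(1), of "\<lambda>\<omega>. right_approx n (D \<omega>)" M "\<lambda>_. x"] P_measurable1[OF v(1), of D M "\<lambda>_. x"] by simp_all
  have C: "0 \<le> C" "0 \<le> sup_norm v" using gb[of 0] C_infty_sup_norm[OF v(1), of x] by linarith+
  have le: "g s * a \<le> C * sup_norm v" if "\<bar>a\<bar> \<le> sup_norm v" for s a
    using mult_mono[OF gb(2)[of s], of a "sup_norm v"] that gb(1)[of s] C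
    by (cases "0 \<le> a") (auto intro: order_trans[OF mult_nonneg_nonpos])
  have fin: "(\<integral>\<^sup>+\<omega>. ennreal (C * sup_norm v) \<partial>M) < \<infinity>" by (simp add: emeasure_space_1)
  have l1: "(\<lambda>n. \<integral>\<^sup>+\<omega>. ennreal (g (D \<omega>) * at_cemetery0 v (Y (right_approx n (D \<omega>)) \<omega>)) \<partial>M)
    \<longlonglongrightarrow> (\<integral>\<^sup>+\<omega>. ennreal (g (D \<omega>) * at_cemetery0 v (Y (D \<omega>) \<omega>)) \<partial>M)"
  proof (rule nn_integral_dominated_convergence[OF _ _ _ _ fin])
    show "AE \<omega> in M. (\<lambda>n. ennreal (g (D \<omega>) * at_cemetery0 v (Y (right_approx n (D \<omega>)) \<omega>)))
      \<longlonglongrightarrow> ennreal (g (D \<omega>) * at_cemetery0 v (Y (D \<omega>) \<omega>))"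
      using D_nonneg
      by (intro AE_I2 tendsto_ennrealI tendsto_mult tendsto_const filterlim_compose[OF vY_right[OF v(1)] filterlim_right_approx]) auto
    show "AE \<omega> in M. ennreal (g (D \<omega>) * at_cemetery0 v (Y (right_approx n (D \<omega>)) \<omega>)) \<le> ennreal (C * sup_norm v)" for n
      by (intro AE_I2 ennreal_leI le at_cemetery0_bound v(1))
  qed auto
  have l2: "(\<lambda>n. \<integral>\<^sup>+\<omega>. ennreal (g (D \<omega>) * P (right_approx n (D \<omega>)) v x) \<partial>M)
    \<longlonglongrightarrow> (\<integral>\<^sup>+\<omega>. ennreal (g (D \<omega>) * P (D \<omega>) v x) \<partial>M)"
  proof (rule nn_integral_dominated_convergence[OF _ _ _ _ fin])
    show "AE \<omega> in M. (\<lambda>n. ennreal (g (D \<omega>) * P (right_approx n (D \<omega>)) v x)) \<longlonglongrightarrow> ennreal (g (D \<omega>) * P (D \<omega>) v x)"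
      using D_nonneg
      by (intro AE_I2 tendsto_ennrealI tendsto_mult tendsto_const filterlim_compose[OF P_right[OF v(1)] filterlim_right_approx]) auto
    show "AE \<omega> in M. ennreal (g (D \<omega>) * P (right_approx n (D \<omega>)) v x) \<le> ennreal (C * sup_norm v)" for n
    proof (intro AE_I2 ennreal_leI le P_bound v(1))
      fix \<omega> show "0 \<le> right_approx n (D \<omega>)" using m(2)[of n \<omega>] by (metis max.cobounded1)
    qed
  qed auto
  show ?thesis using LIMSEQ_unique[OF l1] l2 random_time_approx[OF assms] by simp
qed

end

end

section \<open>The joint law of an independent time and the position at that time\<close>

context killed
begin

text \<open>On survival, the pair of time and position has the law obtained by drawing the time and
  then a point from the kernel. The identity for continuous functions extends to open rectangles,
  which determine finite measures.\<close>

lemma random_time_measure: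
  assumes D: "D \<in> borel_measurable (path_algebra M borel S)" and D0: "\<And>\<omega>. 0 \<le> D \<omega>"
  shows "distr (density M (\<lambda>\<omega>. of_bool (alive (D \<omega>) \<omega>))) (borel \<Otimes>\<^sub>M borel) (\<lambda>\<omega>. (D \<omega>, pos (D \<omega>) \<omega>))
    = M \<bind> (\<lambda>\<omega>. distr (kap (D \<omega>) x) (borel \<Otimes>\<^sub>M borel) (\<lambda>z. (D \<omega>, z)))" (is "?L = ?R")
    and "(\<lambda>\<omega>. distr (kap (D \<omega>) x) (borel \<Otimes>\<^sub>M borel) (\<lambda>z. (D \<omega>, z))) \<in> M \<rightarrow>\<^sub>M subprob_algebra (borel \<Otimes>\<^sub>M borel)"
proof -
  note [measurable] = D_measurable[OF D D0]
  show ker: "(\<lambda>\<omega>. distr (kap (D \<omega>) x) (borel \<Otimes>\<^sub>M borel) (\<lambda>z. (D \<omega>, z))) \<in> M \<rightarrow>\<^sub>M subprob_algebra (borel \<Otimes>\<^sub>M borel)"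
  proof (rule measurable_distr2[where L=M and M=borel and N="borel \<Otimes>\<^sub>M borel" and f="\<lambda>\<omega> z. (D \<omega>, z)" and g="\<lambda>\<omega>. kap (D \<omega>) x"])
    show "(\<lambda>(\<omega>, z). (D \<omega>, z)) \<in> M \<Otimes>\<^sub>M borel \<rightarrow>\<^sub>M borel \<Otimes>\<^sub>M borel" by measurable
    show "(\<lambda>\<omega>. kap (D \<omega>) x) \<in> M \<rightarrow>\<^sub>M subprob_algebra borel"
      by (rule kap_measurable1) (use D_measurable[OF D D0] in simp_all)
  qed
  have sL: "sets ?L = sets (borel \<Otimes>\<^sub>M borel)" by simp
  have sR: "sets ?R = sets (borel \<Otimes>\<^sub>M borel)" by (rule sets_bind) (auto simp: not_empty)
  show "?L = ?R"
  proof (rule finite_measure_eqI_rectangles[OF sL sR])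
    have "UNIV \<in> sets (borel \<Otimes>\<^sub>M borel :: (real \<times> 'a) measure)"
      using sets.top[of "borel \<Otimes>\<^sub>M borel :: (real \<times> 'a) measure"] by (simp add: space_pair_measure)
    then have "emeasure ?L UNIV = (\<integral>\<^sup>+\<omega>. of_bool (alive (D \<omega>) \<omega>) \<partial>M)"
      by (subst emeasure_distr) (auto simp: emeasure_density space_pair_measure intro!: nn_integral_cong)
    also have "\<dots> \<le> (\<integral>\<^sup>+\<omega>. 1 \<partial>M)" by (intro nn_integral_mono) auto
    also have "\<dots> < \<infinity>" by (simp add: emeasure_space_1)
    finally show "emeasure ?L UNIV \<noteq> \<infinity>" by simp
    fix I :: "real set" and A :: "'a set" assume I: "open I" and A: "open A"
    then have [measurable]: "I \<in> sets borel" "A \<in> sets borel" by auto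
    obtain w where w: "\<And>n::nat. w n \<in> C_infty E" "\<And>n x. 0 \<le> w n x" "\<And>n x. w n x \<le> 1"
      "\<And>x. (\<lambda>n. w n x) \<longlonglongrightarrow> indicator (A \<inter> E) x"
      using open_approx[OF A] by blast
    have m[simp]: "max 0 (D \<omega>) = D \<omega>" for \<omega> using D0[of \<omega>] by simp
    have [measurable]: "(\<lambda>\<omega>. at_cemetery0 (w n) (Y (D \<omega>) \<omega>)) \<in> borel_measurable M" for n
      using measurable_compose[OF measurable_Pair vY_pair_measurable[OF w(1)], of D M "\<lambda>\<omega>. \<omega>" n] by simp
    have [measurable]: "(\<lambda>\<omega>. P (D \<omega>) (w n) x) \<in> borel_measurable M" for n
      using P_measurable1[OF w(1), of D M "\<lambda>_. x"] by simp
    have [measurable]: "(\<lambda>\<omega>. measure (kap (D \<omega>) x) A) \<in> borel_measurable M"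
      by (rule borel_measurable_LIMSEQ_real[where u="\<lambda>n \<omega>. P (max 0 (D \<omega>)) (w n) x"], rule measure_kap_lim[OF A w]) simp_all
    have le1: "a * b \<le> 1" if "0 \<le> a" "a \<le> 1" "b \<le> 1" for a b :: real
      using mult_mono[OF that(2,3)] that by (cases "0 \<le> b") (auto intro: order_trans[OF mult_nonneg_nonpos])
    have wb: "at_cemetery0 (w n) z \<le> 1" for n z using w(3) by (cases z) auto
    have Pb: "P (D \<omega>) (w n) x \<le> 1" for n \<omega>
    proof -
      have "sup_norm (w n) \<le> 1" by (rule sup_norm_le) (use w(2,3)[of n] in auto)
      then show ?thesis using P_bound[OF D0 w(1), of \<omega> n x] by linarith
    qed
    have fin: "(\<integral>\<^sup>+\<omega>. ennreal 1 \<partial>M) < \<infinity>" by (simp add: emeasure_space_1)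
    have l1: "(\<lambda>n. \<integral>\<^sup>+\<omega>. ennreal (indicator I (D \<omega>) * at_cemetery0 (w n) (Y (D \<omega>) \<omega>)) \<partial>M)
      \<longlonglongrightarrow> (\<integral>\<^sup>+\<omega>. ennreal (indicator I (D \<omega>) * of_bool (alive (D \<omega>) \<omega> \<and> pos (D \<omega>) \<omega> \<in> A)) \<partial>M)"
    proof (rule nn_integral_dominated_convergence[OF _ _ _ _ fin])
      show "AE \<omega> in M. (\<lambda>n. ennreal (indicator I (D \<omega>) * at_cemetery0 (w n) (Y (D \<omega>) \<omega>)))
        \<longlonglongrightarrow> ennreal (indicator I (D \<omega>) * of_bool (alive (D \<omega>) \<omega> \<and> pos (D \<omega>) \<omega> \<in> A))"
        using in_open_lim[OF _ w(4), where s="D \<omega>" and \<omega>=\<omega> for \<omega>]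
        by (intro AE_I2 tendsto_ennrealI tendsto_mult tendsto_const) simp
      show "AE \<omega> in M. ennreal (indicator I (D \<omega>) * at_cemetery0 (w n) (Y (D \<omega>) \<omega>)) \<le> ennreal 1" for n
        by (intro AE_I2 ennreal_leI le1 wb) auto
    qed auto
    have l2: "(\<lambda>n. \<integral>\<^sup>+\<omega>. ennreal (indicator I (D \<omega>) * P (D \<omega>) (w n) x) \<partial>M)
      \<longlonglongrightarrow> (\<integral>\<^sup>+\<omega>. ennreal (indicator I (D \<omega>) * measure (kap (D \<omega>) x) A) \<partial>M)"
    proof (rule nn_integral_dominated_convergence[OF _ _ _ _ fin])
      show "AE \<omega> in M. (\<lambda>n. ennreal (indicator I (D \<omega>) * P (D \<omega>) (w n) x)) \<longlonglongrightarrow> ennreal (indicator I (D \<omega>) * measure (kap (D \<omega>) x) A)"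
        using measure_kap_lim[OF A w, where r="D \<omega>" and x=x for \<omega>]
        by (intro AE_I2 tendsto_ennrealI tendsto_mult tendsto_const) simp
      show "AE \<omega> in M. ennreal (indicator I (D \<omega>) * P (D \<omega>) (w n) x) \<le> ennreal 1" for n
        by (intro AE_I2 ennreal_leI le1 Pb) auto
    qed auto
    have eq: "(\<integral>\<^sup>+\<omega>. ennreal (indicator I (D \<omega>) * of_bool (alive (D \<omega>) \<omega> \<and> pos (D \<omega>) \<omega> \<in> A)) \<partial>M)
      = (\<integral>\<^sup>+\<omega>. ennreal (indicator I (D \<omega>) * measure (kap (D \<omega>) x) A) \<partial>M)"
      using LIMSEQ_unique[OF l1] l2 random_time_C_infty[OF D D0 w(1,2), of "indicator I" 1] by simp
    have IA: "I \<times> A \<in> sets (borel \<Otimes>\<^sub>M borel)" by auto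
    have "emeasure ?L (I \<times> A) = (\<integral>\<^sup>+y. indicator (I \<times> A) y \<partial>?L)" using IA by simp
    also have "\<dots> = (\<integral>\<^sup>+\<omega>. of_bool (alive (D \<omega>) \<omega>) * indicator (I \<times> A) (D \<omega>, pos (D \<omega>) \<omega>) \<partial>M)"
      using IA by (subst nn_integral_distr, simp, simp, subst nn_integral_density) auto
    also have "\<dots> = (\<integral>\<^sup>+\<omega>. ennreal (indicator I (D \<omega>) * of_bool (alive (D \<omega>) \<omega> \<and> pos (D \<omega>) \<omega> \<in> A)) \<partial>M)"
      by (intro nn_integral_cong) (auto split: split_indicator)
    also note eq
    also have "(\<integral>\<^sup>+\<omega>. ennreal (indicator I (D \<omega>) * measure (kap (D \<omega>) x) A) \<partial>M)
      = (\<integral>\<^sup>+\<omega>. \<integral>\<^sup>+z. indicator (I \<times> A) (D \<omega>, z) \<partial>kap (D \<omega>) x \<partial>M)"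
      by (intro nn_integral_cong)
         (auto simp: indicator_times nn_integral_cmult ennreal_mult' ennreal_indicator finite_measure.emeasure_eq_measure[OF finite_kap])
    also have "\<dots> = (\<integral>\<^sup>+y. indicator (I \<times> A) y \<partial>?R)"
    proof -
      have "(\<integral>\<^sup>+z. indicator (I \<times> A) (D \<omega>, z) \<partial>kap (D \<omega>) x)
        = (\<integral>\<^sup>+y. indicator (I \<times> A) y \<partial>distr (kap (D \<omega>) x) (borel \<Otimes>\<^sub>M borel) (\<lambda>z. (D \<omega>, z)))" for \<omega>
        using IA by (intro nn_integral_distr[symmetric]) auto
      then show ?thesis by (simp only: nn_integral_bind[OF borel_measurable_indicator[OF IA] ker])
    qed
    also have "\<dots> = emeasure ?R (I \<times> A)" using IA sR by simp
    finally show "emeasure ?L (I \<times> A) = emeasure ?R (I \<times> A)" .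
  qed
qed

lemma
  assumes D: "D \<in> borel_measurable (path_algebra M borel S)" and D0: "\<And>\<omega>. 0 \<le> D \<omega>"
  shows nn_integral_random_time: "G \<in> borel_measurable (borel \<Otimes>\<^sub>M borel) \<Longrightarrow>
      (\<integral>\<^sup>+\<omega>. of_bool (alive (D \<omega>) \<omega>) * G (D \<omega>, pos (D \<omega>) \<omega>) \<partial>M) = (\<integral>\<^sup>+\<omega>. \<integral>\<^sup>+z. G (D \<omega>, z) \<partial>kap (D \<omega>) x \<partial>M)"
    and integral_random_time: "\<And>H :: real \<times> 'a \<Rightarrow> real. H \<in> borel_measurable (borel \<Otimes>\<^sub>M borel) \<Longrightarrow> (\<And>y. \<bar>H y\<bar> \<le> C) \<Longrightarrow>
      (LINT \<omega>|M. of_bool (alive (D \<omega>) \<omega>) * H (D \<omega>, pos (D \<omega>) \<omega>)) = (LINT \<omega>|M. LINT z|kap (D \<omega>) x. H (D \<omega>, z))"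
proof -
  note [measurable] = D_measurable[OF D D0]
  note ker = random_time_measure(2)[OF D D0]
  note eq = random_time_measure(1)[OF D D0]
  show "(\<integral>\<^sup>+\<omega>. of_bool (alive (D \<omega>) \<omega>) * G (D \<omega>, pos (D \<omega>) \<omega>) \<partial>M) = (\<integral>\<^sup>+\<omega>. \<integral>\<^sup>+z. G (D \<omega>, z) \<partial>kap (D \<omega>) x \<partial>M)"
    if G[measurable]: "G \<in> borel_measurable (borel \<Otimes>\<^sub>M borel)"
  proof -
    have "(\<integral>\<^sup>+\<omega>. of_bool (alive (D \<omega>) \<omega>) * G (D \<omega>, pos (D \<omega>) \<omega>) \<partial>M)
      = (\<integral>\<^sup>+y. G y \<partial>distr (density M (\<lambda>\<omega>. of_bool (alive (D \<omega>) \<omega>))) (borel \<Otimes>\<^sub>M borel) (\<lambda>\<omega>. (D \<omega>, pos (D \<omega>) \<omega>)))"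
      by (subst nn_integral_distr, simp, simp, subst nn_integral_density) auto
    then show ?thesis
      unfolding eq by (simp add: nn_integral_bind[OF G ker] nn_integral_distr)
  qed
  show "(LINT \<omega>|M. of_bool (alive (D \<omega>) \<omega>) * H (D \<omega>, pos (D \<omega>) \<omega>)) = (LINT \<omega>|M. LINT z|kap (D \<omega>) x. H (D \<omega>, z))"
    if H[measurable]: "H \<in> borel_measurable (borel \<Otimes>\<^sub>M borel)" and C: "\<And>y. \<bar>H y\<bar> \<le> C" for H :: "real \<times> 'a \<Rightarrow> real"
  proof -
    have d: "(\<lambda>\<omega>. of_bool (alive (D \<omega>) \<omega>)) = (\<lambda>\<omega>. ennreal (of_bool (alive (D \<omega>) \<omega>)))" by auto
    have "(LINT \<omega>|M. of_bool (alive (D \<omega>) \<omega>) * H (D \<omega>, pos (D \<omega>) \<omega>))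
      = (LINT y|distr (density M (\<lambda>\<omega>. of_bool (alive (D \<omega>) \<omega>))) (borel \<Otimes>\<^sub>M borel) (\<lambda>\<omega>. (D \<omega>, pos (D \<omega>) \<omega>)). H y)"
      unfolding d by (subst integral_distr, simp, simp, subst integral_density) auto
    also have "\<dots> = (LINT \<omega>|M. LINT z|kap (D \<omega>) x. H (D \<omega>, z))"
      unfolding eq
    proof (subst integral_bind[OF H C ker, where B'=1])
      show "finite_measure M" by unfold_locales
      show "AE \<omega> in M. emeasure (distr (kap (D \<omega>) x) (borel \<Otimes>\<^sub>M borel) (\<lambda>z. (D \<omega>, z)))
         (space (distr (kap (D \<omega>) x) (borel \<Otimes>\<^sub>M borel) (\<lambda>z. (D \<omega>, z)))) \<le> ennreal 1"
      proof (rule AE_I2)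
        fix \<omega> assume "\<omega> \<in> space M"
        from measurable_space[OF ker this]
        have "subprob_space (distr (kap (D \<omega>) x) (borel \<Otimes>\<^sub>M borel) (\<lambda>z. (D \<omega>, z)))" by (simp add: space_subprob_algebra)
        from subprob_space.emeasure_space_le_1[OF this]
        show "emeasure (distr (kap (D \<omega>) x) (borel \<Otimes>\<^sub>M borel) (\<lambda>z. (D \<omega>, z)))
         (space (distr (kap (D \<omega>) x) (borel \<Otimes>\<^sub>M borel) (\<lambda>z. (D \<omega>, z)))) \<le> ennreal 1" by simp
      qed
    qed (simp add: integral_distr)
    finally show ?thesis .
  qed
qed

section \<open>The integrands of the Feynman--Kac formula along a path\<close>

lemma S_path_measurable: "0 \<le> r \<Longrightarrow> S r \<in> borel_measurable (path_algebra M borel S)"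
  by (rule path_algebra_measurable[OF S_measurable])

lemma overshoot_path_measurable: "(\<lambda>\<omega>. max 0 (overshoot t \<omega>)) \<in> borel_measurable (path_algebra M borel S)"
proof -
  have "(\<lambda>\<omega>. overshoot t \<omega>) \<in> borel_measurable (path_algebra M borel S)"
    using measurable_compose[OF measurable_Pair1' overshoot_measurable[OF S_path_measurable], of t] by simp
  then show ?thesis by measurable
qed

lemma S_path_measurable': "(\<lambda>\<omega>. max 0 (S (max 0 s) \<omega>)) \<in> borel_measurable (path_algebra M borel S)"
  using S_path_measurable[of "max 0 s"] by measurable

lemma along_eq:
  "0 \<le> s \<Longrightarrow> along Q g t (Y s \<omega>) = (if alive s \<omega> \<and> (t, pos s \<omega>) \<in> Q then g t (pos s \<omega>) else 0)"
  by (auto simp: along_def alive_def pos_def split: option.splits)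

text \<open>E is open in its compactification, so by right-continuity a living process stays alive
  for some further time; that death is absorbing excludes an earlier visit to the cemetery.\<close>

lemma before_lifetime:
  assumes \<omega>: "\<omega> \<in> space M" and s: "0 \<le> s" and Ys: "Y s \<omega> \<noteq> None"
  obtains \<delta> where "0 < \<delta>" "ereal (s + \<delta>) \<le> lifetime (\<lambda>r. Y r \<omega>)"
proof -
  obtain y where y: "Y s \<omega> = Some y" using Ys by auto
  have "openin (compactification E) (Some ` E)" by simp
  moreover have "Y s \<omega> \<in> Some ` E" using y Y_range[OF s \<omega> y] by simp
  ultimately have "\<forall>\<^sub>F r in at_right s. Y r \<omega> \<in> Some ` E"
    using limitinD[OF Y_limit[OF \<omega> s]] by blast
  then obtain b where b: "s < b" "\<And>r. s < r \<Longrightarrow> r < b \<Longrightarrow> Y r \<omega> \<in> Some ` E"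
    unfolding eventually_at_right_field by auto
  have "ereal b \<le> ereal r" if r: "0 \<le> r" "Y r \<omega> = None" for r
  proof (rule ccontr)
    assume "\<not> ?thesis"
    then have "r < b" by simp
    moreover have "s < r" using Y_absorbing[OF \<omega> r(1) _ r(2), of s] Ys by (meson not_le)
    ultimately show False using b(2)[of r] r(2) by auto
  qed
  then have "ereal b \<le> lifetime (\<lambda>r. Y r \<omega>)" unfolding lifetime_def by (auto intro: Inf_greatest)
  then show thesis using that[of "b - s"] b(1) by simp
qed

lemma after_lifetime:
  assumes "\<omega> \<in> space M" "lifetime (\<lambda>r. Y r \<omega>) < ereal s" shows "Y s \<omega> = None"
  using assms(2) Y_absorbing[OF assms(1)] unfolding lifetime_def Inf_less_iff by force

text \<open>Killing makes the indicator in the first term of the Feynman--Kac formula redundant.\<close>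

lemma history_integrand:
  assumes g: "good \<omega>" and t: "0 \<le> t"
  shows "(let \<tau> = tau0 (\<lambda>r. S r \<omega>) (ereal t); \<tau>\<^sub>\<Omega> = tau0 (\<lambda>r. S r \<omega>) (lifetime (\<lambda>r. Y r \<omega>));
      s = S (real_of_ereal \<tau>) \<omega>
    in along Q \<phi> (t - s) (Y s \<omega>) * of_bool (\<tau> < \<tau>\<^sub>\<Omega>)) = along Q \<phi> (t - overshoot t \<omega>) (Y (overshoot t \<omega>) \<omega>)"
proof -
  have \<omega>: "\<omega> \<in> space M" using g by (simp add: good_def)
  obtain \<tau> where \<tau>: "0 \<le> \<tau>" "tau0 (\<lambda>r. S r \<omega>) (ereal t) = ereal \<tau>" "overshoot t \<omega> = S \<tau> \<omega>"
    using overshoot_eq[OF g t] by metis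
  let ?L = "lifetime (\<lambda>r. Y r \<omega>)"
  have "ereal \<tau> < tau0 (\<lambda>r. S r \<omega>) ?L" if alive: "Y (S \<tau> \<omega>) \<omega> \<noteq> None"
  proof -
    obtain \<delta> where \<delta>: "0 < \<delta>" "ereal (S \<tau> \<omega> + \<delta>) \<le> ?L"
      using before_lifetime[OF \<omega> good_nonneg[OF g \<tau>(1)] alive] by blast
    \<comment> \<open>The spatial lifetime exceeds S \<tau> by at least \<delta>, and
      right-continuity keeps S below that margin up to some b > \<tau>. Hence S passes the lifetime
      no earlier than b, which gives the strict inequality.\<close>
    have "\<forall>\<^sub>F r in at_right \<tau>. S r \<omega> < S \<tau> \<omega> + \<delta>"
      using S_right[OF \<omega> \<tau>(1)] \<delta>(1) by (intro order_tendstoD) auto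
    then obtain b where b: "\<tau> < b" "\<And>r. \<tau> < r \<Longrightarrow> r < b \<Longrightarrow> S r \<omega> < S \<tau> \<omega> + \<delta>"
      unfolding eventually_at_right_field by auto
    have "ereal b \<le> ereal r" if r: "0 < r" "?L < ereal (S r \<omega>)" for r
    proof (rule ccontr)
      assume "\<not> ?thesis"
      then have "r < b" by simp
      then have "S r \<omega> < S \<tau> \<omega> + \<delta>"
        using b(2)[of r] S_mono[OF \<omega>, of r \<tau>] r(1) \<delta>(1) by (cases "\<tau> < r") auto
      then have "ereal (S r \<omega>) < ?L" using \<delta>(2) by (metis less_ereal.simps(1) order_less_le_trans)
      with r(2) show False by simp
    qed
    then have "ereal b \<le> tau0 (\<lambda>r. S r \<omega>) ?L" unfolding tau0_def by (auto intro: Inf_greatest)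
    then show ?thesis using b(1) by (metis less_ereal.simps(1) order_less_le_trans)
  qed
  then show ?thesis
    by (cases "Y (S \<tau> \<omega>) \<omega>") (auto simp: \<tau>(2,3) along_def Let_def)
qed

text \<open>Past either passage time the integrand vanishes by itself: the time argument has become
  negative, or the process is dead. This removes the random upper limit from the time
  integral.\<close>

lemma source_off:
  assumes g: "good \<omega>" and s: "0 < s"
    and out: "tau0 (\<lambda>r. S r \<omega>) (ereal t) < ereal s \<or> tau0 (\<lambda>r. S r \<omega>) (lifetime (\<lambda>r. Y r \<omega>)) < ereal s"
  shows "along ({0<..<T} \<times> \<Omega>) f (t - S s \<omega>) (Y (S s \<omega>) \<omega>) = 0"
proof -
  have \<omega>: "\<omega> \<in> space M" using g by (simp add: good_def)
  from out consider r where "0 < r" "r < s" "t < S r \<omega>"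
    | r where "0 < r" "r < s" "lifetime (\<lambda>r. Y r \<omega>) < ereal (S r \<omega>)"
    unfolding tau0_def Inf_less_iff by auto
  then show ?thesis
  proof cases
    case 1
    then have "t < S s \<omega>" using S_mono[OF \<omega>, of r s] by simp
    then show ?thesis by (auto simp: along_def split: option.split)
  next
    case 2
    then have "ereal (S r \<omega>) \<le> ereal (S s \<omega>)" using S_mono[OF \<omega>, of r s] by simp
    with 2(3) have "lifetime (\<lambda>r. Y r \<omega>) < ereal (S s \<omega>)" by (rule order_less_le_trans)
    then show ?thesis using after_lifetime[OF \<omega>] by (simp add: along_def)
  qed
qed

end

subsection \<open>The Feynman--Kac formula in terms of kernels\<close>

locale subordinate_feller = subordinator M \<nu> S + feller \<Omega> E P
  for M :: "'w measure" and \<nu> S and \<Omega> E :: "'a::euclidean_space set" and P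
begin

text \<open>The two terms of the Feynman--Kac formula, in terms of the transition kernels of the spatial
  semigroup.\<close>

definition hist :: "(real \<times> 'a \<Rightarrow> real) \<Rightarrow> real \<Rightarrow> 'a \<Rightarrow> real" where
  "hist \<phi> t x = (LINT \<omega>|M. LINT z|kap (max 0 (overshoot t \<omega>)) x. \<phi> (t - max 0 (overshoot t \<omega>), z))"

definition src :: "(real \<times> 'a \<Rightarrow> real) \<Rightarrow> real \<Rightarrow> 'a \<Rightarrow> real" where
  "src f t x = (LINT y|U. LINT z|kap y x. f (t - y, z))"

lemma integral_U:
  fixes k :: "real \<Rightarrow> real"
  assumes k: "k \<in> borel_measurable borel" and i: "integrable U k"
  shows "(LINT y|U. k y) = (LINT s|halfline. LINT \<omega>|M. k (S (max 0 s) \<omega>))"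
    and "integrable (halfline \<Otimes>\<^sub>M M) (\<lambda>(s, \<omega>). k (S (max 0 s) \<omega>))"
proof -
  have m: "(\<lambda>(s, \<omega>). S (max 0 s) \<omega>) \<in> halfline \<Otimes>\<^sub>M M \<rightarrow>\<^sub>M borel" by measurable
  show i': "integrable (halfline \<Otimes>\<^sub>M M) (\<lambda>(s, \<omega>). k (S (max 0 s) \<omega>))"
    using i unfolding U_def integrable_distr_eq[OF m k] by (simp add: split_def)
  show "(LINT y|U. k y) = (LINT s|halfline. LINT \<omega>|M. k (S (max 0 s) \<omega>))"
    using hM.integral_fst'[OF i'] unfolding U_def integral_distr[OF m k] by (simp add: split_def)
qed

lemma integrable_U_bounded:
  fixes k :: "real \<Rightarrow> real"
  assumes k[measurable]: "k \<in> borel_measurable borel" and b: "\<And>y. 0 \<le> y \<Longrightarrow> \<bar>k y\<bar> \<le> C * indicator {0..a} y"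
  shows "integrable U k"
proof (rule Bochner_Integration.integrable_bound[where f="\<lambda>y. C * indicator {0..a} y"])
  show "integrable U (\<lambda>y. C * indicator {0..a} y)"
    using U_Icc_finite[of a] by (intro integrable_mult_right integrable_real_indicator) auto
  show "AE y in U. norm (k y) \<le> norm (C * indicator {0..a} y)"
    using AE_U_nonneg
  proof eventually_elim
    case (elim y)
    show ?case using b[OF elim] abs_ge_self[of "C * indicator {0..a} y"] by (simp only: real_norm_def)
  qed
qed simp

lemma src_kernel_measurable:
  fixes f :: "real \<times> 'a \<Rightarrow> real"
  assumes [measurable]: "f \<in> borel_measurable (borel \<Otimes>\<^sub>M borel)"
  shows "(\<lambda>y. LINT z|kap y x. f (t - y, z)) \<in> borel_measurable borel"
proof -
  have "(\<lambda>y. f (t - fst y, snd y)) \<in> borel_measurable (borel \<Otimes>\<^sub>M borel)" by measurable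
  from integral_kap_measurable[OF this measurable_ident measurable_const[of x borel]] show ?thesis by simp
qed

end

sublocale killed \<subseteq> subordinate_feller ..

context killed
begin

text \<open>N contains the points where \<phi> and its Borel version disagree. The last hypothesis
  says that the kernel started at this particular (t, x) misses N, so the path is almost surely
  outside N at the relevant moment.\<close>

lemma fk_history:
  fixes \<phi> :: "real \<Rightarrow> 'a \<Rightarrow> real" and \<phi>' :: "real \<times> 'a \<Rightarrow> real"
  assumes t: "0 < t" and \<phi>'[measurable]: "\<phi>' \<in> borel_measurable (borel \<Otimes>\<^sub>M borel)"
    and bound: "\<And>y. \<bar>\<phi>' y\<bar> \<le> C" and off: "\<And>y. y \<notin> {..<0} \<times> \<Omega> \<Longrightarrow> \<phi>' y = 0"
    and N[measurable]: "N \<in> sets (borel \<Otimes>\<^sub>M borel)"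
    and agree: "\<And>s z. (s, z) \<in> {..<0} \<times> \<Omega> \<Longrightarrow> (s, z) \<notin> N \<Longrightarrow> \<phi> s z = \<phi>' (s, z)"
    and null: "(\<integral>\<^sup>+\<omega>. \<integral>\<^sup>+z. indicator N (t - max 0 (overshoot t \<omega>), z) \<partial>kap (max 0 (overshoot t \<omega>)) x \<partial>M) = 0"
  shows "(LINT \<omega>|completion M. (let \<tau> = tau0 (\<lambda>r. S r \<omega>) (ereal t); \<tau>\<^sub>\<Omega> = tau0 (\<lambda>r. S r \<omega>) (lifetime (\<lambda>r. Y r \<omega>));
      s = S (real_of_ereal \<tau>) \<omega>
    in along ({..<0} \<times> \<Omega>) \<phi> (t - s) (Y s \<omega>) * of_bool (\<tau> < \<tau>\<^sub>\<Omega>))) = hist \<phi>' t x"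
proof -
  \<comment> \<open>On paths that are not \<open>good\<close> the value of \<open>overshoot\<close>
    is unspecified; the cut at 0 yields a nonnegative time that is still a function of the path of
    S.\<close>
  define D where "D \<omega> = max 0 (overshoot t \<omega>)" for \<omega>
  have D: "D \<in> borel_measurable (path_algebra M borel S)" and D0: "\<And>\<omega>. 0 \<le> D \<omega>"
    using overshoot_path_measurable[of t] by (simp_all add: D_def[abs_def])
  note [measurable] = D_measurable[OF D D0]
  have "(\<integral>\<^sup>+\<omega>. of_bool (alive (D \<omega>) \<omega>) * indicator N (t - D \<omega>, pos (D \<omega>) \<omega>) \<partial>M) = 0"
    using nn_integral_random_time[OF D D0, of "\<lambda>y. indicator N (t - fst y, snd y)"] null by (simp add: D_def)
  then have "AE \<omega> in M. of_bool (alive (D \<omega>) \<omega>) * indicator N (t - D \<omega>, pos (D \<omega>) \<omega>) = (0 :: ennreal)"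
    by (subst (asm) nn_integral_0_iff_AE) auto
  then have AE: "AE \<omega> in M. (let \<tau> = tau0 (\<lambda>r. S r \<omega>) (ereal t); \<tau>\<^sub>\<Omega> = tau0 (\<lambda>r. S r \<omega>) (lifetime (\<lambda>r. Y r \<omega>));
      s = S (real_of_ereal \<tau>) \<omega>
    in along ({..<0} \<times> \<Omega>) \<phi> (t - s) (Y s \<omega>) * of_bool (\<tau> < \<tau>\<^sub>\<Omega>))
    = of_bool (alive (D \<omega>) \<omega>) * \<phi>' (t - D \<omega>, pos (D \<omega>) \<omega>)"
    using AE_good
  proof eventually_elim
    case (elim \<omega>)
    have e: "overshoot t \<omega> = D \<omega>" using overshoot_ge[OF elim(2), of t] t by (simp add: D_def)
    have "along ({..<0} \<times> \<Omega>) \<phi> (t - D \<omega>) (Y (D \<omega>) \<omega>) = of_bool (alive (D \<omega>) \<omega>) * \<phi>' (t - D \<omega>, pos (D \<omega>) \<omega>)"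
      unfolding along_eq[OF D0] using elim(1) agree[of "t - D \<omega>" "pos (D \<omega>) \<omega>"] off[of "(t - D \<omega>, pos (D \<omega>) \<omega>)"]
      by (auto split: split_indicator_asm)
    then show ?case using history_integrand[OF elim(2), of t "{..<0} \<times> \<Omega>" \<phi>] t e by simp
  qed
  have "(LINT \<omega>|M. of_bool (alive (D \<omega>) \<omega>) * \<phi>' (t - D \<omega>, pos (D \<omega>) \<omega>)) = hist \<phi>' t x"
    using integral_random_time[OF D D0, where H="\<lambda>y. \<phi>' (t - fst y, snd y)" and C=C] bound by (simp add: hist_def D_def)
  then show ?thesis by (subst integral_completion_AE[OF AE]) auto
qed

lemma fk_source_path:
  fixes f :: "real \<Rightarrow> 'a \<Rightarrow> real" and f' :: "real \<times> 'a \<Rightarrow> real"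
  assumes g: "good \<omega>" and f'[measurable]: "f' \<in> borel_measurable (borel \<Otimes>\<^sub>M borel)"
    and off: "\<And>y. y \<notin> {0<..<T} \<times> \<Omega> \<Longrightarrow> f' y = 0"
    and agree: "\<And>s z. (s, z) \<in> {0<..<T} \<times> \<Omega> \<Longrightarrow> (s, z) \<notin> N \<Longrightarrow> f s z = f' (s, z)"
    and N[measurable]: "N \<in> sets (borel \<Otimes>\<^sub>M borel)"
    and ae: "AE s in halfline. alive (max 0 (S (max 0 s) \<omega>)) \<omega> \<longrightarrow>
       (t - max 0 (S (max 0 s) \<omega>), pos (max 0 (S (max 0 s) \<omega>)) \<omega>) \<notin> N"
  shows "(let \<tau> = tau0 (\<lambda>r. S r \<omega>) (ereal t); \<tau>\<^sub>\<Omega> = tau0 (\<lambda>r. S r \<omega>) (lifetime (\<lambda>r. Y r \<omega>))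
      in LINT s:{s. 0 < s \<and> ereal s < min \<tau> \<tau>\<^sub>\<Omega>}|lebesgue. along ({0<..<T} \<times> \<Omega>) f (t - S s \<omega>) (Y (S s \<omega>) \<omega>))
    = (LINT s|halfline. of_bool (alive (max 0 (S (max 0 s) \<omega>)) \<omega>) *
        f' (t - max 0 (S (max 0 s) \<omega>), pos (max 0 (S (max 0 s) \<omega>)) \<omega>))"
proof -
  have \<omega>[measurable]: "\<omega> \<in> space M" using g by (simp add: good_def)
  define D where "D s = max 0 (S (max 0 s) \<omega>)" for s
  define h where "h s = of_bool (alive (D s) \<omega>) * f' (t - D s, pos (D s) \<omega>)" for s
  have [measurable]: "D \<in> borel_measurable borel" unfolding D_def by measurable
  have [measurable]: "h \<in> borel_measurable borel" unfolding h_def by measurable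
  let ?\<tau> = "tau0 (\<lambda>r. S r \<omega>) (ereal t)" and ?\<tau>\<Omega> = "tau0 (\<lambda>r. S r \<omega>) (lifetime (\<lambda>r. Y r \<omega>))"
  let ?A = "{s. 0 < s \<and> ereal s < min ?\<tau> ?\<tau>\<Omega>}"
  let ?al = "\<lambda>s. along ({0<..<T} \<times> \<Omega>) f (t - S s \<omega>) (Y (S s \<omega>) \<omega>)"
  have "AE s in lborel. 0 < s \<longrightarrow> alive (D s) \<omega> \<longrightarrow> (t - D s, pos (D s) \<omega>) \<notin> N"
    using ae unfolding D_def[symmetric] by (subst (asm) AE_halfline_iff) auto
  \<comment> \<open>\<open>source_off\<close> needs s strictly beyond a passage time, so the two end
    points are removed. For an infinite passage time the removed point is irrelevant, since s is
    then never equal to it.\<close>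
  moreover have "AE s in lborel. s \<noteq> real_of_ereal ?\<tau>" "AE s in lborel. s \<noteq> real_of_ereal ?\<tau>\<Omega>"
    by (rule AE_lborel_singleton)+
  ultimately have "AE s in lborel. indicator ?A s *\<^sub>R ?al s = indicator {0<..} s * h s"
  proof eventually_elim
    case (elim s)
    show ?case
    proof (cases "0 < s")
      case True
      have e: "D s = S s \<omega>" using good_nonneg[OF g, of s] True by (simp add: D_def)
      have eq: "?al s = h s"
        unfolding e[symmetric] using elim(1) True agree[of "t - D s" "pos (D s) \<omega>"] off[of "(t - D s, pos (D s) \<omega>)"]
        by (subst along_eq) (auto simp: h_def D_def)
      have "?al s = 0" if "s \<notin> ?A"
      proof (rule source_off[OF g True])
        have "?\<tau> \<le> ereal s \<or> ?\<tau>\<Omega> \<le> ereal s" using that True by (auto simp: not_less)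
        moreover have "?\<tau> \<noteq> ereal s" "?\<tau>\<Omega> \<noteq> ereal s" using elim(2,3) by auto
        ultimately show "?\<tau> < ereal s \<or> ?\<tau>\<Omega> < ereal s" by (auto simp: order_less_le)
      qed
      then show ?thesis using eq True by (auto split: split_indicator)
    qed auto
  qed
  then have "(LINT s:?A|lebesgue. ?al s) = (LINT s|lborel. indicator {0<..} s * h s)"
    unfolding set_lebesgue_integral_def by (rule integral_completion_AE) measurable
  also have "\<dots> = (LINT s|halfline. h s)"
    by (subst integral_halfline) (auto simp: set_lebesgue_integral_def)
  finally show ?thesis by (simp add: Let_def h_def D_def)
qed

text \<open>Exchanging expectation and time integral leaves, for each fixed s, the independent
  random time S s, to which the kernel formula applies; integrating over s produces the potential
  measure.\<close>

lemma fk_source: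
  fixes f :: "real \<Rightarrow> 'a \<Rightarrow> real" and f' :: "real \<times> 'a \<Rightarrow> real"
  assumes f'[measurable]: "f' \<in> borel_measurable (borel \<Otimes>\<^sub>M borel)"
    and bound: "\<And>y. \<bar>f' y\<bar> \<le> C" and off: "\<And>y. y \<notin> {0<..<T} \<times> \<Omega> \<Longrightarrow> f' y = 0"
    and N[measurable]: "N \<in> sets (borel \<Otimes>\<^sub>M borel)"
    and agree: "\<And>s z. (s, z) \<in> {0<..<T} \<times> \<Omega> \<Longrightarrow> (s, z) \<notin> N \<Longrightarrow> f s z = f' (s, z)"
    and null: "(\<integral>\<^sup>+y. \<integral>\<^sup>+z. indicator N (t - y, z) \<partial>kap y x \<partial>U) = 0"
  shows "(LINT \<omega>|completion M. (let \<tau> = tau0 (\<lambda>r. S r \<omega>) (ereal t); \<tau>\<^sub>\<Omega> = tau0 (\<lambda>r. S r \<omega>) (lifetime (\<lambda>r. Y r \<omega>))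
      in LINT s:{s. 0 < s \<and> ereal s < min \<tau> \<tau>\<^sub>\<Omega>}|lebesgue. along ({0<..<T} \<times> \<Omega>) f (t - S s \<omega>) (Y (S s \<omega>) \<omega>)))
    = src f' t x"
proof -
  define D where "D s \<omega> = max 0 (S (max 0 s) \<omega>)" for s \<omega>
  have D: "D s \<in> borel_measurable (path_algebra M borel S)" and D0: "\<And>\<omega>. 0 \<le> D s \<omega>" for s
    using S_path_measurable'[of s] by (simp_all add: D_def[abs_def])
  have [measurable]: "(\<lambda>z. D (g z) (k z)) \<in> borel_measurable L" if [measurable]: "g \<in> borel_measurable L" "k \<in> L \<rightarrow>\<^sub>M M"
    for g k and L :: "'c measure"
    unfolding D_def by measurable
  have DS: "AE \<omega> in M. D s \<omega> = S (max 0 s) \<omega>" for s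
    using S_nonneg by eventually_elim (auto simp: D_def)
  define G where "G s \<omega> = (of_bool (alive (D s \<omega>) \<omega>) * indicator N (t - D s \<omega>, pos (D s \<omega>) \<omega>) :: ennreal)" for s \<omega>
  define h where "h s \<omega> = of_bool (alive (D s \<omega>) \<omega>) * f' (t - D s \<omega>, pos (D s \<omega>) \<omega>)" for s \<omega>
  define k where "k y = (LINT z|kap y x. f' (t - y, z))" for y
  have k[measurable]: "k \<in> borel_measurable borel"
    unfolding k_def by (rule src_kernel_measurable[OF f'])
  have kb: "\<bar>k y\<bar> \<le> C * indicator {0..t} y" if "0 \<le> y" for y
  proof (cases "y \<le> t")
    case True
    then show ?thesis using that integral_kap_bound[of "\<lambda>z. f' (t - y, z)" C y x] bound by (simp add: k_def)
  next
    case False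
    then have "k y = (LINT z|kap y x. 0)" unfolding k_def by (intro Bochner_Integration.integral_cong refl off) auto
    then show ?thesis using False by simp
  qed
  have G[measurable]: "(\<lambda>(s, \<omega>). G s \<omega>) \<in> borel_measurable (borel \<Otimes>\<^sub>M M)" unfolding G_def by measurable
  have h[measurable]: "(\<lambda>(s, \<omega>). h s \<omega>) \<in> borel_measurable (borel \<Otimes>\<^sub>M M)" unfolding h_def by measurable
  have "(\<integral>\<^sup>+s. \<integral>\<^sup>+\<omega>. G s \<omega> \<partial>M \<partial>halfline) = 0"
  proof -
    define c where "c y = (\<integral>\<^sup>+z. indicator N (t - y, z) \<partial>kap y x)" for y
    have [measurable]: "c \<in> borel_measurable borel"
    proof -
      have "(\<lambda>y. indicator N (t - fst y, snd y) :: ennreal) \<in> borel_measurable (borel \<Otimes>\<^sub>M borel)" by measurable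
      from nn_integral_kap_measurable[OF this measurable_ident measurable_const[of x borel]] show ?thesis
        by (simp add: c_def[abs_def])
    qed
    have "(\<integral>\<^sup>+\<omega>. G s \<omega> \<partial>M) = (\<integral>\<^sup>+\<omega>. c (S (max 0 s) \<omega>) \<partial>M)" for s
    proof -
      have "(\<integral>\<^sup>+\<omega>. G s \<omega> \<partial>M) = (\<integral>\<^sup>+\<omega>. c (D s \<omega>) \<partial>M)"
        using nn_integral_random_time[OF D D0, of "\<lambda>y. indicator N (t - fst y, snd y)" s] by (simp add: G_def c_def)
      also have "\<dots> = (\<integral>\<^sup>+\<omega>. c (S (max 0 s) \<omega>) \<partial>M)"
        by (rule nn_integral_cong_AE) (use DS[of s] in \<open>auto elim: eventually_mono\<close>)
      finally show ?thesis .
    qed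
    then have "(\<integral>\<^sup>+s. \<integral>\<^sup>+\<omega>. G s \<omega> \<partial>M \<partial>halfline) = (\<integral>\<^sup>+y. c y \<partial>U)" by (simp add: nn_integral_U)
    then show ?thesis using null by (simp add: c_def)
  qed
  then have "(\<integral>\<^sup>+z. G (fst z) (snd z) \<partial>(halfline \<Otimes>\<^sub>M M)) = 0"
    using nn_integral_fst[of "\<lambda>z. G (fst z) (snd z)" halfline] G by (simp add: split_def)
  then have "AE z in halfline \<Otimes>\<^sub>M M. G (fst z) (snd z) = 0"
    using G by (subst (asm) nn_integral_0_iff_AE) (auto simp: split_def)
  then have "AE s in halfline. AE \<omega> in M. G s \<omega> = 0" using hM.AE_pair by force
  moreover have "{z \<in> space (halfline \<Otimes>\<^sub>M M). G (fst z) (snd z) = 0} \<in> sets (halfline \<Otimes>\<^sub>M M)"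
  proof -
    have [measurable]: "(\<lambda>z. G (fst z) (snd z)) \<in> borel_measurable (halfline \<Otimes>\<^sub>M M)" unfolding G_def by measurable
    show ?thesis by measurable
  qed
  ultimately have "AE \<omega> in M. AE s in halfline. G s \<omega> = 0"
    using hM.AE_commute[of "\<lambda>s \<omega>. G s \<omega> = 0"] by simp
  then have AE: "AE \<omega> in M. (let \<tau> = tau0 (\<lambda>r. S r \<omega>) (ereal t); \<tau>\<^sub>\<Omega> = tau0 (\<lambda>r. S r \<omega>) (lifetime (\<lambda>r. Y r \<omega>))
      in LINT s:{s. 0 < s \<and> ereal s < min \<tau> \<tau>\<^sub>\<Omega>}|lebesgue. along ({0<..<T} \<times> \<Omega>) f (t - S s \<omega>) (Y (S s \<omega>) \<omega>))
    = (LINT s|halfline. h s \<omega>)"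
    using AE_good
  proof eventually_elim
    case (elim \<omega>)
    have "AE s in halfline. alive (D s \<omega>) \<omega> \<longrightarrow> (t - D s \<omega>, pos (D s \<omega>) \<omega>) \<notin> N"
      using elim(1) by eventually_elim (auto simp: G_def split: split_indicator_asm)
    from fk_source_path[OF elim(2) f' off agree N this[unfolded D_def]] show ?case
      unfolding h_def D_def .
  qed
  have i0: "integrable U (\<lambda>y. C * indicator {0..t} y)"
    using U_Icc_finite[of t] by (intro integrable_mult_right integrable_real_indicator) auto
  \<comment> \<open>The integrand vanishes once S exceeds t, so it is dominated by the occupation of
    [0, t], which is finite in mean.\<close>
  have ih: "integrable (halfline \<Otimes>\<^sub>M M) (\<lambda>(s, \<omega>). h s \<omega>)"
  proof (rule Bochner_Integration.integrable_bound[OF integral_U(2)[OF _ i0]])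
    show "AE z in halfline \<Otimes>\<^sub>M M. norm (case z of (s, \<omega>) \<Rightarrow> h s \<omega>) \<le> norm (case z of (s, \<omega>) \<Rightarrow> C * indicator {0..t} (S (max 0 s) \<omega>))"
      using hM.AE_pair_snd[OF S_nonneg]
    proof eventually_elim
      case (elim z)
      obtain s \<omega> where z: "z = (s, \<omega>)" by force
      have "D s \<omega> = S (max 0 s) \<omega>" using elim by (auto simp: z D_def)
      then show ?case
        using bound[of "(t - D s \<omega>, pos (D s \<omega>) \<omega>)"] off[of "(t - D s \<omega>, pos (D s \<omega>) \<omega>)"] D0[of s \<omega>]
        by (cases "D s \<omega> \<le> t") (auto simp: z h_def)
    qed
  qed measurable
  have "(LINT \<omega>|M. LINT s|halfline. h s \<omega>) = (LINT s|halfline. LINT \<omega>|M. h s \<omega>)"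
    by (rule hM.Fubini_integral[OF ih])
  also have "\<dots> = (LINT s|halfline. LINT \<omega>|M. k (S (max 0 s) \<omega>))"
  proof (rule Bochner_Integration.integral_cong[OF refl])
    fix s
    have "(LINT \<omega>|M. h s \<omega>) = (LINT \<omega>|M. k (D s \<omega>))"
      using integral_random_time[OF D D0, where H="\<lambda>y. f' (t - fst y, snd y)" and C=C, of s] bound by (simp add: h_def k_def)
    also have "\<dots> = (LINT \<omega>|M. k (S (max 0 s) \<omega>))"
      by (rule integral_cong_AE) (use DS[of s] in \<open>auto elim: eventually_mono\<close>)
    finally show "(LINT \<omega>|M. h s \<omega>) = (LINT \<omega>|M. k (S (max 0 s) \<omega>))" .
  qed
  also have "\<dots> = src f' t x"
    using integral_U(1)[OF k integrable_U_bounded[OF k kb]] by (simp add: src_def k_def)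
  finally have "(LINT \<omega>|M. LINT s|halfline. h s \<omega>) = src f' t x" .
  then show ?thesis using h by (subst integral_completion_AE[OF AE]) (auto intro: hM.borel_measurable_lebesgue_integral)
qed

end

lemma (in pair_sigma_finite) integrable_rectangle:
  fixes f :: "'a \<Rightarrow> 'b \<Rightarrow> real"
  assumes f: "(\<lambda>(x, y). f x y) \<in> borel_measurable (M1 \<Otimes>\<^sub>M M2)"
    and A: "A \<in> sets M1" "emeasure M1 A < \<infinity>" and B: "B \<in> sets M2" "emeasure M2 B < \<infinity>"
    and b: "AE z in M1 \<Otimes>\<^sub>M M2. \<bar>f (fst z) (snd z)\<bar> \<le> C * indicator (A \<times> B) z"
  shows "integrable (M1 \<Otimes>\<^sub>M M2) (\<lambda>(x, y). f x y)"
proof (rule Bochner_Integration.integrable_bound[OF _ f])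
  have "emeasure (M1 \<Otimes>\<^sub>M M2) (A \<times> B) < \<infinity>"
    using A B by (simp add: M2.emeasure_pair_measure_Times ennreal_mult_less_top)
  then show "integrable (M1 \<Otimes>\<^sub>M M2) (\<lambda>z. C * indicator (A \<times> B) z)"
    using A B by (intro integrable_mult_right integrable_real_indicator) auto
  show "AE z in M1 \<Otimes>\<^sub>M M2. norm (case z of (x, y) \<Rightarrow> f x y) \<le> norm (C * indicator (A \<times> B) z)"
    using b by eventually_elim (auto simp: split_def intro: order_trans[OF _ abs_ge_self])
qed

lemma nn_integral_lborel_shift:
  assumes "c \<in> borel_measurable borel"
  shows "(\<integral>\<^sup>+t. c (t + a) \<partial>lborel) = (\<integral>\<^sup>+t. c t \<partial>(lborel :: real measure))"
  using nn_integral_distr[of "\<lambda>t::real. t + a" lborel lborel c] assms by (simp add: distr_translate_lborel)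

section \<open>Exceptional sets in space-time\<close>

context subordinate_feller
begin

sublocale oU: pair_sigma_finite l\<Omega> U ..
sublocale oM: pair_sigma_finite l\<Omega> M ..
sublocale oh: pair_sigma_finite l\<Omega> halfline ..
sublocale ho: pair_sigma_finite halfline l\<Omega> ..
sublocale ol: pair_sigma_finite l\<Omega> lborel ..
sublocale hU: pair_sigma_finite halfline U ..

lemma l\<Omega>_finite: "emeasure l\<Omega> UNIV < \<infinity>"
  by (simp add: l\<Omega>.emeasure_eq_measure)

text \<open>Null sets of space-time are not charged by the kernels: symmetry moves the kernel from the
  null set to a constant.\<close>

lemma null_kernel_bound:
  assumes r: "0 \<le> r" and N[measurable]: "N \<in> sets (borel \<Otimes>\<^sub>M borel)"
  shows "(\<integral>\<^sup>+x. \<integral>\<^sup>+z. indicator N (s, z) \<partial>kap r x \<partial>l\<Omega>) \<le> (\<integral>\<^sup>+x. indicator N (s, x) \<partial>l\<Omega>)"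
proof -
  have "(\<integral>\<^sup>+x. \<integral>\<^sup>+z. indicator N (s, z) \<partial>kap r x \<partial>l\<Omega>) = (\<integral>\<^sup>+x. \<integral>\<^sup>+z. indicator N (s, x) \<partial>kap r x \<partial>l\<Omega>)"
    using nn_kap_symmetric[OF r, of "\<lambda>y. indicator N (s, snd y)"] by simp
  also have "\<dots> \<le> (\<integral>\<^sup>+x. indicator N (s, x) \<partial>l\<Omega>)"
    using subprob_space.subprob_emeasure_le_1[OF subprob_kap]
    by (intro nn_integral_mono) (auto split: split_indicator)
  finally show ?thesis .
qed

context
  fixes N :: "(real \<times> 'a) set"
  assumes N[measurable]: "N \<in> sets (borel \<Otimes>\<^sub>M borel)"
    and null: "(\<integral>\<^sup>+t. \<integral>\<^sup>+x. indicator N (t, x) \<partial>l\<Omega> \<partial>lborel) = 0"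
begin

lemma null_slices_shift: "(\<integral>\<^sup>+t. \<integral>\<^sup>+x. indicator N (t - a, x) \<partial>l\<Omega> \<partial>lborel) = 0"
  using nn_integral_lborel_shift[of "\<lambda>t. \<integral>\<^sup>+x. indicator N (t, x) \<partial>l\<Omega>" "- a"] null by simp

text \<open>After symmetry only the slice of N at time t - y matters; integrating over t and using
  translation invariance of Lebesgue measure shows that almost every starting point (t, x) is
  harmless.\<close>

lemma null_source: "AE w in halfline \<Otimes>\<^sub>M l\<Omega>. (\<integral>\<^sup>+y. \<integral>\<^sup>+z. indicator N (fst w - y, z) \<partial>kap y (snd w) \<partial>U) = 0"
proof -
  define L where "L w = (\<integral>\<^sup>+z. indicator N (fst (fst w) - snd w, z) \<partial>kap (snd w) (snd (fst w)))" for w :: "(real \<times> 'a) \<times> real"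
  have L: "L \<in> borel_measurable ((borel \<Otimes>\<^sub>M borel) \<Otimes>\<^sub>M borel)"
    unfolding L_def
    by (rule nn_integral_kap_measurable[where f="\<lambda>y. indicator N (fst (fst (fst y)) - snd (fst y), snd y)", simplified]) measurable
  have [measurable]: "(\<lambda>v. L ((g v, h v), k v)) \<in> borel_measurable Q"
    if "g \<in> borel_measurable Q" "h \<in> borel_measurable Q" "k \<in> borel_measurable Q" for g h k and Q :: "'b measure"
    by (rule measurable_compose[OF _ L]) (use that in measurable)
  have "(\<lambda>v. L ((fst (fst v), snd (fst v)), snd v)) \<in> borel_measurable ((halfline \<Otimes>\<^sub>M l\<Omega>) \<Otimes>\<^sub>M U)" by measurable
  then have L': "L \<in> borel_measurable ((halfline \<Otimes>\<^sub>M l\<Omega>) \<Otimes>\<^sub>M U)" by simp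
  have "(\<integral>\<^sup>+w. \<integral>\<^sup>+y. L (w, y) \<partial>U \<partial>(halfline \<Otimes>\<^sub>M l\<Omega>)) = (\<integral>\<^sup>+t. \<integral>\<^sup>+x. \<integral>\<^sup>+y. L ((t, x), y) \<partial>U \<partial>l\<Omega> \<partial>halfline)"
    by (subst l\<Omega>.nn_integral_fst[symmetric]) (use L' in \<open>auto simp: split_beta' intro!: U.borel_measurable_nn_integral\<close>)
  also have "\<dots> = (\<integral>\<^sup>+t. \<integral>\<^sup>+y. \<integral>\<^sup>+x. L ((t, x), y) \<partial>l\<Omega> \<partial>U \<partial>halfline)"
    by (intro nn_integral_cong oU.Fubini'[symmetric]) (simp add: split_beta')
  also have "\<dots> \<le> (\<integral>\<^sup>+t. \<integral>\<^sup>+y. \<integral>\<^sup>+x. indicator N (t - y, x) \<partial>l\<Omega> \<partial>U \<partial>halfline)"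
  proof (rule nn_integral_mono, rule nn_integral_mono_AE)
    fix t
    show "AE y in U. (\<integral>\<^sup>+x. L ((t, x), y) \<partial>l\<Omega>) \<le> (\<integral>\<^sup>+x. indicator N (t - y, x) \<partial>l\<Omega>)"
      using AE_U_nonneg by eventually_elim (simp add: L_def null_kernel_bound[OF _ N])
  qed
  also have "\<dots> \<le> (\<integral>\<^sup>+t. \<integral>\<^sup>+y. \<integral>\<^sup>+x. indicator N (t - y, x) \<partial>l\<Omega> \<partial>U \<partial>lborel)"
    by (subst nn_integral_halfline, measurable) (auto intro!: nn_integral_mono split: split_indicator)
  also have "\<dots> = (\<integral>\<^sup>+y. \<integral>\<^sup>+t. \<integral>\<^sup>+x. indicator N (t - y, x) \<partial>l\<Omega> \<partial>lborel \<partial>U)"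
  proof -
    interpret lU: pair_sigma_finite lborel U ..
    show ?thesis by (rule lU.Fubini'[symmetric]) measurable
  qed
  also have "\<dots> = 0" by (simp add: null_slices_shift)
  finally have "(\<integral>\<^sup>+w. \<integral>\<^sup>+y. L (w, y) \<partial>U \<partial>(halfline \<Otimes>\<^sub>M l\<Omega>)) = 0" by simp
  moreover have "(\<lambda>w. \<integral>\<^sup>+y. L (w, y) \<partial>U) \<in> borel_measurable (halfline \<Otimes>\<^sub>M l\<Omega>)"
  proof -
    have "(\<lambda>w. \<integral>\<^sup>+y. L ((fst w, snd w), y) \<partial>U) \<in> borel_measurable (halfline \<Otimes>\<^sub>M l\<Omega>)" by measurable
    then show ?thesis by simp
  qed
  ultimately have "AE w in halfline \<Otimes>\<^sub>M l\<Omega>. (\<integral>\<^sup>+y. L (w, y) \<partial>U) = 0"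
    by (subst (asm) nn_integral_0_iff_AE) auto
  then show ?thesis by (simp add: L_def)
qed

text \<open>For a single t the law of t - D t is not controlled. Integrated over t, however, the
  compensation formula expresses it through Lebesgue measure in t for fixed jump data, and
  translation invariance applies again.\<close>

lemma null_history:
  "AE w in halfline \<Otimes>\<^sub>M l\<Omega>. (\<integral>\<^sup>+\<omega>. \<integral>\<^sup>+z. indicator N (fst w - max 0 (overshoot (fst w) \<omega>), z)
     \<partial>kap (max 0 (overshoot (fst w) \<omega>)) (snd w) \<partial>M) = 0"
proof -
  define D where "D t \<omega> = max 0 (overshoot t \<omega>)" for t \<omega>
  define L where "L w = (\<integral>\<^sup>+z. indicator N (fst (fst w) - D (fst (fst w)) (snd w), z) \<partial>kap (D (fst (fst w)) (snd w)) (snd (fst w)))" for w :: "(real \<times> 'a) \<times> 'w"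
  have [measurable]: "(\<lambda>z. D (g z) (k z)) \<in> borel_measurable Q" if [measurable]: "g \<in> borel_measurable Q" "k \<in> Q \<rightarrow>\<^sub>M M"
    for g k and Q :: "'c measure"
    unfolding D_def by measurable
  have L: "L \<in> borel_measurable ((borel \<Otimes>\<^sub>M borel) \<Otimes>\<^sub>M M)"
    unfolding L_def
    by (rule nn_integral_kap_measurable[where f="\<lambda>y. indicator N (fst (fst (fst y)) - D (fst (fst (fst y))) (snd (fst y)), snd y)", simplified]) measurable
  have [measurable]: "(\<lambda>v. L ((g v, h v), k v)) \<in> borel_measurable Q"
    if "g \<in> borel_measurable Q" "h \<in> borel_measurable Q" "k \<in> Q \<rightarrow>\<^sub>M M" for g h k and Q :: "'b measure"
    by (rule measurable_compose[OF _ L]) (use that in measurable)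
  have "(\<lambda>v. L ((fst (fst v), snd (fst v)), snd v)) \<in> borel_measurable ((halfline \<Otimes>\<^sub>M l\<Omega>) \<Otimes>\<^sub>M M)" by measurable
  then have L': "L \<in> borel_measurable ((halfline \<Otimes>\<^sub>M l\<Omega>) \<Otimes>\<^sub>M M)" by simp
  have "(\<integral>\<^sup>+w. \<integral>\<^sup>+\<omega>. L (w, \<omega>) \<partial>M \<partial>(halfline \<Otimes>\<^sub>M l\<Omega>)) = (\<integral>\<^sup>+t. \<integral>\<^sup>+x. \<integral>\<^sup>+\<omega>. L ((t, x), \<omega>) \<partial>M \<partial>l\<Omega> \<partial>halfline)"
    by (subst l\<Omega>.nn_integral_fst[symmetric]) (use L' in \<open>auto simp: split_beta' intro!: borel_measurable_nn_integral\<close>)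
  also have "\<dots> = (\<integral>\<^sup>+t. \<integral>\<^sup>+\<omega>. \<integral>\<^sup>+x. L ((t, x), \<omega>) \<partial>l\<Omega> \<partial>M \<partial>halfline)"
    by (intro nn_integral_cong oM.Fubini'[symmetric]) (simp add: split_beta')
  also have "\<dots> \<le> (\<integral>\<^sup>+t. \<integral>\<^sup>+\<omega>. \<integral>\<^sup>+x. indicator N (t - D t \<omega>, x) \<partial>l\<Omega> \<partial>M \<partial>halfline)"
    by (rule nn_integral_mono, rule nn_integral_mono) (simp add: L_def D_def null_kernel_bound[OF _ N])
  also have "\<dots> = (\<integral>\<^sup>+t. \<integral>\<^sup>+\<omega>. \<integral>\<^sup>+x. indicator N (t - overshoot t \<omega>, x) \<partial>l\<Omega> \<partial>M \<partial>halfline)"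
  proof (rule nn_integral_cong_AE)
    show "AE t in halfline. (\<integral>\<^sup>+\<omega>. \<integral>\<^sup>+x. indicator N (t - D t \<omega>, x) \<partial>l\<Omega> \<partial>M) = (\<integral>\<^sup>+\<omega>. \<integral>\<^sup>+x. indicator N (t - overshoot t \<omega>, x) \<partial>l\<Omega> \<partial>M)"
      using AE_halfline_pos
    proof eventually_elim
      case (elim t)
      show ?case
      proof (rule nn_integral_cong_AE)
        show "AE \<omega> in M. (\<integral>\<^sup>+x. indicator N (t - D t \<omega>, x) \<partial>l\<Omega>) = (\<integral>\<^sup>+x. indicator N (t - overshoot t \<omega>, x) \<partial>l\<Omega>)"
          using AE_good
        proof eventually_elim
          case (elim \<omega>)
          then have "D t \<omega> = overshoot t \<omega>" using overshoot_ge[of \<omega> t] \<open>0 < t\<close> by (simp add: D_def)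
          then show ?case by simp
        qed
      qed
    qed
  qed
  also have "\<dots> = (\<integral>\<^sup>+z. \<integral>\<^sup>+r. \<integral>\<^sup>+t. indicator {z..<z + r} t * (\<integral>\<^sup>+x. indicator N (t - (z + r), x) \<partial>l\<Omega>) \<partial>lborel \<partial>Nu \<partial>U)"
    using nn_integral_overshoot[of "\<lambda>y. \<integral>\<^sup>+x. indicator N (fst y - snd y, x) \<partial>l\<Omega>"] by simp
  also have "\<dots> \<le> (\<integral>\<^sup>+z. \<integral>\<^sup>+r. \<integral>\<^sup>+t. (\<integral>\<^sup>+x. indicator N (t - (z + r), x) \<partial>l\<Omega>) \<partial>lborel \<partial>Nu \<partial>U)"
    by (intro nn_integral_mono) (auto split: split_indicator)
  also have "\<dots> = 0" by (simp only: null_slices_shift) simp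
  finally have "(\<integral>\<^sup>+w. \<integral>\<^sup>+\<omega>. L (w, \<omega>) \<partial>M \<partial>(halfline \<Otimes>\<^sub>M l\<Omega>)) = 0" by simp
  moreover have "(\<lambda>w. \<integral>\<^sup>+\<omega>. L (w, \<omega>) \<partial>M) \<in> borel_measurable (halfline \<Otimes>\<^sub>M l\<Omega>)"
  proof -
    have "(\<lambda>w. \<integral>\<^sup>+\<omega>. L ((fst w, snd w), \<omega>) \<partial>M) \<in> borel_measurable (halfline \<Otimes>\<^sub>M l\<Omega>)" by measurable
    then show ?thesis by simp
  qed
  ultimately have "AE w in halfline \<Otimes>\<^sub>M l\<Omega>. (\<integral>\<^sup>+\<omega>. L (w, \<omega>) \<partial>M) = 0"
    by (subst (asm) nn_integral_0_iff_AE) auto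
  then show ?thesis by (simp add: L_def D_def)
qed

end

end

subsection \<open>The weak identity for test functions of product form\<close>

locale test_product = subordinate_feller M \<nu> S \<Omega> E P
  for M :: "'w measure" and \<nu> S and \<Omega> E :: "'a::euclidean_space set" and P +
  fixes T :: real and p :: "real \<Rightarrow> real" and q g :: "'a \<Rightarrow> real"
  assumes p: "p \<in> C1c T" and generator: "generator E P q g"
begin

lemma q_in: "q \<in> C_infty E" and g_in: "g \<in> C_infty E"
  using generator by (auto simp: generator_def)

lemma orbit: "test_orbit M \<nu> S T p (\<lambda>y. P (max 0 y) q x) (\<lambda>y. P y g x) (sup_norm q + sup_norm g)"
proof unfold_locales
  have nn: "0 \<le> sup_norm q" "0 \<le> sup_norm g"
    using C_infty_sup_norm[OF q_in, of x] C_infty_sup_norm[OF g_in, of x] by linarith+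
  show "\<bar>P (max 0 y) q x\<bar> \<le> sup_norm q + sup_norm g" for y
    using P_bound[OF _ q_in, of "max 0 y" x] nn by simp
  show "\<bar>P (max 0 y) q x - P (max 0 r) q x\<bar> \<le> (sup_norm q + sup_norm g) * \<bar>y - r\<bar>" for y r
  proof -
    have "sup_norm g * \<bar>y - r\<bar> \<le> (sup_norm q + sup_norm g) * \<bar>y - r\<bar>"
      using nn by (intro mult_right_mono) auto
    then show ?thesis using orbit_lipschitz[OF generator, of y x r] by linarith
  qed
  show "((\<lambda>y. P (max 0 y) q x) has_real_derivative P y g x) (at y within {0..})" if "0 \<le> y" for y
    by (rule has_field_derivative_transform_within[OF orbit_deriv[OF generator that] zero_less_one]) (use that in auto)
  show "continuous_on {0..} (\<lambda>y. P y g x)" by (rule P_time_continuous[OF g_in])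
qed (rule p)

text \<open>The kernel of the spatial semigroup applied to \<open>H_star \<nu> P \<psi> t\<close>, where \<open>\<psi> t x = p t * q x\<close>.\<close>

definition act :: "real \<Rightarrow> real \<Rightarrow> 'a \<Rightarrow> real" where
  "act t y x = (LINT r|Nu. p (t + r) * P (max 0 (y + r)) q x - p t * P (max 0 y) q x)"

lemma act_gen: "act t y x = test_orbit.gen \<nu> p (\<lambda>y. P (max 0 y) q x) t y"
  by (simp add: act_def test_orbit.gen_def[OF orbit])

lemma p_measurable[measurable]: "p \<in> borel_measurable borel"
  by (rule test_orbit.p_measurable[OF orbit])

lemma p_off: "t \<notin> {0<..<T} \<Longrightarrow> p t = 0"
  by (rule test_orbit.p_off[OF orbit])

text \<open>The constant does not depend on x: all orbits share the bound and Lipschitz constant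
  \<open>sup_norm q + sup_norm g\<close>.\<close>

lemma act_increment:
  obtains C where "0 \<le> C"
    "\<And>t y x r. 0 < r \<Longrightarrow> \<bar>p (t + r) * P (max 0 (y + r)) q x - p t * P (max 0 y) q x\<bar> \<le> C * min r 1"
proof -
  interpret o: test_orbit M \<nu> S T p "\<lambda>y. P (max 0 y) q x" "\<lambda>y. P y g x" "sup_norm q + sup_norm g" for x
    by (rule orbit)
  obtain C where C: "0 \<le> C"
    "\<And>\<theta> t y r. (\<And>y. \<bar>\<theta> y\<bar> \<le> sup_norm q + sup_norm g) \<Longrightarrow>
      (\<And>y r. \<bar>\<theta> y - \<theta> r\<bar> \<le> (sup_norm q + sup_norm g) * \<bar>y - r\<bar>) \<Longrightarrow> 0 < r \<Longrightarrow>
      \<bar>p (t + r) * \<theta> (y + r) - p t * \<theta> y\<bar> \<le> C * min r (1::real)"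
    using C1c_product_increment[OF p o.K_nonneg] by metis
  have "\<bar>p (t + r) * P (max 0 (y + r)) q x - p t * P (max 0 y) q x\<bar> \<le> C * min r 1" if "0 < r" for t y x r
    using C(2)[of "\<lambda>y. P (max 0 y) q x" r t y, OF o.\<theta>_bound o.\<theta>_lipschitz that] .
  then show thesis using that[OF C(1)] by blast
qed

lemma act_integrable: "integrable Nu (\<lambda>r. p (t + r) * P (max 0 (y + r)) q x - p t * P (max 0 y) q x)"
  by (rule test_orbit.gen_integrable[OF orbit])

lemma act_zero: "T \<le> t \<Longrightarrow> act t y x = 0"
  unfolding act_gen by (rule test_orbit.gen_zero[OF orbit])

lemma act_bound: obtains C where "0 \<le> C" "\<And>t y x. \<bar>act t y x\<bar> \<le> C"
proof -
  obtain C where C: "0 \<le> C"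
    "\<And>t y x r. 0 < r \<Longrightarrow> \<bar>p (t + r) * P (max 0 (y + r)) q x - p t * P (max 0 y) q x\<bar> \<le> C * min r 1"
    using act_increment by blast
  let ?I = "LINT r|Nu. min r 1"
  have "\<bar>act t y x\<bar> \<le> C * ?I" for t y x
  proof -
    have "\<bar>act t y x\<bar> \<le> (LINT r|Nu. \<bar>p (t + r) * P (max 0 (y + r)) q x - p t * P (max 0 y) q x\<bar>)"
      unfolding act_def by (rule integral_abs_bound)
    also have "\<dots> \<le> (LINT r|Nu. C * min r 1)"
    proof (rule integral_mono_AE)
      show "AE r in Nu. \<bar>p (t + r) * P (max 0 (y + r)) q x - p t * P (max 0 y) q x\<bar> \<le> C * min r 1"
        using AE_Nu_pos by eventually_elim (rule C(2))
    qed (auto intro!: integrable_Nu_min integrable_abs act_integrable)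
    finally show ?thesis by simp
  qed
  moreover have "0 \<le> ?I"
    by (rule integral_nonneg_AE) (use AE_Nu_pos in \<open>eventually_elim, simp\<close>)
  ultimately show thesis using that[of "C * ?I"] C(1) by simp
qed

lemma Pq_measurable[measurable (raw)]:
  "f \<in> borel_measurable N \<Longrightarrow> h \<in> borel_measurable N \<Longrightarrow> (\<lambda>w. P (max 0 (f w)) q (h w)) \<in> borel_measurable N"
  by (rule P_measurable1[OF q_in])

lemma act_measurable[measurable (raw)]:
  assumes [measurable]: "a \<in> borel_measurable N" "b \<in> borel_measurable N" "c \<in> borel_measurable N"
  shows "(\<lambda>w. act (a w) (b w) (c w)) \<in> borel_measurable N"
  unfolding act_def by measurable

text \<open>Fubini moves the kernel inside the integral over jump sizes, where the semigroup
  property turns P r q into P (y + r) q. This is what converts a spatial average of the operator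
  into a shift along the orbit.\<close>

lemma act_kernel:
  assumes y: "0 \<le> y" shows "(LINT z|kap y x. act t 0 z) = act t y x"
proof -
  interpret k: finite_measure "kap y x" by (rule finite_kap)
  interpret kN: pair_sigma_finite "kap y x" Nu ..
  obtain C where C: "0 \<le> C"
    "\<And>t y x r. 0 < r \<Longrightarrow> \<bar>p (t + r) * P (max 0 (y + r)) q x - p t * P (max 0 y) q x\<bar> \<le> C * min r 1"
    using act_increment by blast
  let ?F = "\<lambda>z r. p (t + r) * P (max 0 (0 + r)) q z - p t * P (max 0 0) q z"
  have i1: "integrable (kap y x \<Otimes>\<^sub>M Nu) (\<lambda>(z, r). C * min r 1)"
    by (rule kN.Fubini_integrable) (use integrable_Nu_min in \<open>auto intro!: k.integrable_const\<close>)
  have i2: "integrable (kap y x \<Otimes>\<^sub>M Nu) (\<lambda>(z, r). ?F z r)"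
  proof (rule Bochner_Integration.integrable_bound[OF i1])
    show "AE w in kap y x \<Otimes>\<^sub>M Nu. norm (case w of (z, r) \<Rightarrow> ?F z r) \<le> norm (case w of (z, r) \<Rightarrow> C * min r 1)"
      using kN.AE_pair_snd[OF AE_Nu_pos]
    proof eventually_elim
      case (elim w)
      then show ?case using C(2)[of "snd w" t 0 "fst w"] abs_ge_self[of "C * min (snd w) 1"] by (auto simp: split_beta')
    qed
  qed measurable
  have "(LINT z|kap y x. act t 0 z) = (LINT r|Nu. LINT z|kap y x. ?F z r)"
    unfolding act_def by (rule kN.Fubini_integral[symmetric, OF i2])
  also have "\<dots> = act t y x"
    unfolding act_def
  proof (rule integral_cong_AE)
    show "AE r in Nu. (LINT z|kap y x. ?F z r) = p (t + r) * P (max 0 (y + r)) q x - p t * P (max 0 y) q x"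
      using AE_Nu_pos
    proof eventually_elim
      case (elim r)
      have Pr: "P r q \<in> C_infty E" using elim by (intro P_in q_in) auto
      have int: "integrable (kap y x) v" if v: "v \<in> C_infty E" for v
        using C_infty_sup_norm[OF v] C_infty_borel[OF v] by (intro k.integrable_const_bound[where B="sup_norm v"]) auto
      have "(LINT z|kap y x. ?F z r) = (LINT z|kap y x. p (t + r) * P r q z - p t * q z)"
        using elim P_0[OF q_in] by (simp add: max_def)
      also have "\<dots> = p (t + r) * P y (P r q) x - p t * P y q x"
        using integral_kap[OF Pr, of y x] integral_kap[OF q_in, of y x] int[OF Pr] int[OF q_in] y by (simp add: max_def)
      finally show ?case using P_add[of y r q] q_in y elim by (simp add: max_def)
    qed
  qed measurable
  finally show ?thesis .
qed

lemma H_star_act: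
  shows "H_star \<nu> P (\<lambda>t x. p t * q x) t x = act t 0 x"
    and "set_integrable lborel {0<..} (\<lambda>r. (P r (\<lambda>x. p (t + r) * q x) x - p t * q x) * \<nu> r)"
proof -
  let ?f = "\<lambda>r. p (t + r) * P (max 0 (0 + r)) q x - p t * P (max 0 0) q x"
  have e: "P r (\<lambda>x. p (t + r) * q x) x - p t * q x = ?f r" if "0 < r" for r
    using P_lincomb[of r q q "p (t + r)" 0] q_in that P_0[OF q_in] by (simp add: max_def)
  have e': "indicator {0<..} r *\<^sub>R ((P r (\<lambda>x. p (t + r) * q x) x - p t * q x) * \<nu> r) = indicator {0<..} r *\<^sub>R (?f r * \<nu> r)" for r
    using e[of r] by (auto split: split_indicator)
  have m: "?f \<in> borel_measurable borel" by measurable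
  show "H_star \<nu> P (\<lambda>t x. p t * q x) t x = act t 0 x"
    unfolding H_star_def act_def integral_Nu[OF m] set_lebesgue_integral_def e' ..
  show "set_integrable lborel {0<..} (\<lambda>r. (P r (\<lambda>x. p (t + r) * q x) x - p t * q x) * \<nu> r)"
    using act_integrable[of t 0 x] unfolding integrable_Nu[OF m] set_integrable_def e' .
qed

end

section \<open>Measurability and bounds of the two terms of the formula\<close>

lemma halfline_Icc_finite: "emeasure halfline {a..b} < \<infinity>"
proof -
  have "emeasure halfline {a..b} = (\<integral>\<^sup>+t. indicator {a..b} t \<partial>halfline)" by simp
  also have "\<dots> = (\<integral>\<^sup>+t\<in>{0<..}. indicator {a..b} t \<partial>lborel)" by (rule nn_integral_halfline) simp
  also have "\<dots> \<le> (\<integral>\<^sup>+t. indicator {a..b} t \<partial>lborel)" by (intro nn_integral_mono) (auto split: split_indicator)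
  also have "\<dots> < \<infinity>" by (cases "a \<le> b") auto
  finally show ?thesis .
qed

lemma bound_nonneg: "(\<And>y. \<bar>v y\<bar> \<le> C) \<Longrightarrow> 0 \<le> (C :: real)"
  using abs_ge_zero order_trans by blast

context subordinate_feller
begin

lemma kernel_integral_measurable[measurable (raw)]:
  fixes f :: "real \<times> 'a \<Rightarrow> real"
  assumes [measurable]: "f \<in> borel_measurable (borel \<Otimes>\<^sub>M borel)"
    "a \<in> borel_measurable Q" "b \<in> borel_measurable Q" "c \<in> borel_measurable Q"
  shows "(\<lambda>v. LINT z|kap (b v) (a v). f (c v, z)) \<in> borel_measurable Q"
  by (rule integral_kap_measurable[where f="\<lambda>y. f (c (fst y), snd y)", simplified]) measurable

lemma hist_measurable:
  fixes \<phi> :: "real \<times> 'a \<Rightarrow> real"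
  assumes [measurable]: "\<phi> \<in> borel_measurable (borel \<Otimes>\<^sub>M borel)" "a \<in> borel_measurable Q" "b \<in> borel_measurable Q"
  shows "(\<lambda>v. hist \<phi> (a v) (b v)) \<in> borel_measurable Q"
  unfolding hist_def by measurable

lemma src_measurable:
  fixes f :: "real \<times> 'a \<Rightarrow> real"
  assumes [measurable]: "f \<in> borel_measurable (borel \<Otimes>\<^sub>M borel)" "a \<in> borel_measurable Q" "b \<in> borel_measurable Q"
  shows "(\<lambda>v. src f (a v) (b v)) \<in> borel_measurable Q"
  unfolding src_def by measurable

lemma hist_bound: assumes "\<And>y. \<bar>\<phi> y\<bar> \<le> C" shows "\<bar>hist \<phi> t x\<bar> \<le> C"
proof -
  have b: "\<bar>LINT z|kap (max 0 (overshoot t \<omega>)) x. \<phi> (t - max 0 (overshoot t \<omega>), z)\<bar> \<le> C" for \<omega>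
    by (rule integral_kap_bound) (rule assms)
  have C: "0 \<le> C" by (rule bound_nonneg[OF assms])
  show ?thesis
  proof (cases "integrable M (\<lambda>\<omega>. LINT z|kap (max 0 (overshoot t \<omega>)) x. \<phi> (t - max 0 (overshoot t \<omega>), z))")
    case True
    have "\<bar>hist \<phi> t x\<bar> \<le> (LINT \<omega>|M. \<bar>LINT z|kap (max 0 (overshoot t \<omega>)) x. \<phi> (t - max 0 (overshoot t \<omega>), z)\<bar>)"
      unfolding hist_def by (rule integral_abs_bound)
    also have "\<dots> \<le> (LINT \<omega>|M. C)" using True b by (intro integral_mono) auto
    finally show ?thesis by (simp add: prob_space)
  qed (simp add: hist_def not_integrable_integral_eq C)
qed

lemma U_integral_bound:
  fixes k :: "real \<Rightarrow> real"
  assumes k: "k \<in> borel_measurable borel" and b: "\<And>y. 0 \<le> y \<Longrightarrow> \<bar>k y\<bar> \<le> C * indicator {0..a} y"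
  shows "\<bar>LINT y|U. k y\<bar> \<le> C * measure U {0..a}"
proof -
  have "\<bar>LINT y|U. k y\<bar> \<le> (LINT y|U. \<bar>k y\<bar>)" by (rule integral_abs_bound)
  also have "\<dots> \<le> (LINT y|U. C * indicator {0..a} y)"
  proof (rule integral_mono_AE)
    show "AE y in U. \<bar>k y\<bar> \<le> C * indicator {0..a} y" using AE_U_nonneg by eventually_elim (rule b)
    show "integrable U (\<lambda>y. C * indicator {0..a} y)"
      using U_Icc_finite[of a] by (intro integrable_mult_right integrable_real_indicator) auto
  qed (use integrable_U_bounded[OF k b] in auto)
  finally show ?thesis by simp
qed

lemma src_bound:
  fixes f :: "real \<times> 'a \<Rightarrow> real"
  assumes [measurable]: "f \<in> borel_measurable (borel \<Otimes>\<^sub>M borel)" and b: "\<And>y. \<bar>f y\<bar> \<le> C"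
    and off: "\<And>t x. t \<le> 0 \<Longrightarrow> f (t, x) = 0" and t: "t \<le> T"
  shows "\<bar>src f t x\<bar> \<le> C * measure U {0..T}"
  unfolding src_def
proof (rule U_integral_bound)
  fix y :: real assume y: "0 \<le> y"
  show "\<bar>LINT z|kap y x. f (t - y, z)\<bar> \<le> C * indicator {0..T} y"
  proof (cases "y \<le> T")
    case True
    then show ?thesis using y integral_kap_bound[of "\<lambda>z. f (t - y, z)" C y x] b by simp
  next
    case False
    then have "(LINT z|kap y x. f (t - y, z)) = 0" using off t by simp
    then show ?thesis using False by simp
  qed
qed measurable

end

section \<open>The source and history identities, integrated over \<Omega>\<close>

context test_product
begin

lemma orbit_0: "P (max 0 0) q x = q x"
  using P_0[OF q_in] by simp

context
  fixes f :: "real \<times> 'a \<Rightarrow> real" and C :: real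
  assumes f[measurable]: "f \<in> borel_measurable (borel \<Otimes>\<^sub>M borel)" and fb: "\<And>y. \<bar>f y\<bar> \<le> C"
begin

text \<open>The only passage from kernels acting on the data to kernels acting on the test function:
  symmetry followed by \<open>act_kernel\<close>.\<close>

lemma slice_symmetric:
  assumes y: "0 \<le> y"
  shows "(LINT x|l\<Omega>. (LINT z|kap y x. f (s, z)) * act t 0 x) = (LINT x|l\<Omega>. f (s, x) * act t y x)"
proof -
  obtain CA where "0 \<le> CA" and CA: "\<And>t y x. \<bar>act t y x\<bar> \<le> CA" using act_bound by blast
  have "(LINT x|l\<Omega>. (LINT z|kap y x. f (s, z)) * act t 0 x) = (LINT x|l\<Omega>. f (s, x) * (LINT z|kap y x. act t 0 z))"
  proof (rule kap_symmetric[OF y, where v="\<lambda>z. f (s, z)" and w="act t 0" and C=C and D=CA])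
    show "(\<lambda>z. f (s, z)) \<in> borel_measurable borel" by measurable
    show "act t 0 \<in> borel_measurable borel" using act_measurable[of "\<lambda>_. t" borel "\<lambda>_. 0" "\<lambda>x. x"] by simp
  qed (rule fb CA)+
  then show ?thesis by (simp add: act_kernel[OF y])
qed

text \<open>Once the kernel sits on the test function, f enters only through its values at the fixed
  x, and \<open>weak_source\<close> is applied to f (t, x) as a function of t. The remaining work is
  Fubini, made possible by supports in [0, T].\<close>

lemma source_identity:
  assumes off: "\<And>y. y \<notin> {0<..<T} \<times> \<Omega> \<Longrightarrow> f y = 0"
  shows "(LINT t|halfline. LINT x|l\<Omega>. src f t x * act t 0 x) = - (LINT t|lborel. LINT x|l\<Omega>. f (t, x) * (p t * q x))"
proof -
  obtain CA where CA: "0 \<le> CA" "\<And>t y x. \<bar>act t y x\<bar> \<le> CA" using act_bound by blast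
  define m where "m t x = (LINT y|U. f (t - y, x) * act t y x)" for t x
  have m_meas[measurable]: "(\<lambda>v. m (a v) (b v)) \<in> borel_measurable Q"
    if [measurable]: "a \<in> borel_measurable Q" "b \<in> borel_measurable Q" for a b and Q :: "'c measure"
    unfolding m_def by measurable
  have bnd: "\<bar>a * act t' y' x'\<bar> \<le> C * CA" if "\<bar>a\<bar> \<le> C" for a t' y' x'
    unfolding abs_mult using that CA bound_nonneg[OF fb] by (intro mult_mono) auto
  have step1: "(LINT x|l\<Omega>. src f t x * act t 0 x) = (LINT x|l\<Omega>. m t x)" for t
  proof -
    let ?k = "\<lambda>x y. (LINT z|kap y x. f (t - y, z)) * act t 0 x"
    let ?l = "\<lambda>x y. f (t - y, x) * act t y x"
    have ik: "integrable (l\<Omega> \<Otimes>\<^sub>M U) (\<lambda>(x, y). ?k x y)"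
    proof (rule oU.integrable_rectangle[where A=UNIV and B="{0..t}" and C="C * CA"])
      show "AE z in l\<Omega> \<Otimes>\<^sub>M U. \<bar>?k (fst z) (snd z)\<bar> \<le> C * CA * indicator (UNIV \<times> {0..t}) z"
        using oU.AE_pair_snd[OF AE_U_nonneg]
      proof eventually_elim
        case (elim z)
        show ?case
        proof (cases "snd z \<le> t")
          case True
          then show ?thesis
            using elim bnd[OF integral_kap_bound[of "\<lambda>y. f (t - snd z, y)" C "snd z" "fst z"], of t 0 "fst z"] fb
            by (cases z) auto
        next
          case False
          then have "f (t - snd z, y) = 0" for y by (intro off) auto
          then show ?thesis using False by (cases z) auto
        qed
      qed
    qed (use l\<Omega>_finite U_Icc_finite[of t] in \<open>auto simp: less_top\<close>)
    have il: "integrable (l\<Omega> \<Otimes>\<^sub>M U) (\<lambda>(x, y). ?l x y)"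
    proof (rule oU.integrable_rectangle[where A=UNIV and B="{0..t}" and C="C * CA"])
      show "AE z in l\<Omega> \<Otimes>\<^sub>M U. \<bar>?l (fst z) (snd z)\<bar> \<le> C * CA * indicator (UNIV \<times> {0..t}) z"
        using oU.AE_pair_snd[OF AE_U_nonneg]
      proof eventually_elim
        case (elim z)
        show ?case
        proof (cases "snd z \<le> t")
          case True
          then show ?thesis using elim bnd[OF fb] by (cases z) auto
        next
          case False
          then have "f (t - snd z, y) = 0" for y by (intro off) auto
          then show ?thesis using False by (cases z) auto
        qed
      qed
    qed (use l\<Omega>_finite U_Icc_finite[of t] in \<open>auto simp: less_top\<close>)
    have "(LINT x|l\<Omega>. src f t x * act t 0 x) = (LINT x|l\<Omega>. LINT y|U. ?k x y)"
      by (simp add: src_def)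
    also have "\<dots> = (LINT y|U. LINT x|l\<Omega>. ?k x y)" by (rule oU.Fubini_integral[symmetric, OF ik])
    also have "\<dots> = (LINT y|U. LINT x|l\<Omega>. ?l x y)"
    proof (rule integral_cong_AE)
      show "AE y in U. (LINT x|l\<Omega>. ?k x y) = (LINT x|l\<Omega>. ?l x y)"
        using AE_U_nonneg by eventually_elim (rule slice_symmetric)
    qed measurable
    also have "\<dots> = (LINT x|l\<Omega>. m t x)" unfolding m_def by (rule oU.Fubini_integral[OF il])
    finally show ?thesis .
  qed
  have m_bound: "\<bar>m t x\<bar> \<le> C * CA * measure U {0..T}" if "t \<le> T" for t x
    unfolding m_def
  proof (rule U_integral_bound)
    fix y :: real assume y: "0 \<le> y"
    show "\<bar>f (t - y, x) * act t y x\<bar> \<le> C * CA * indicator {0..T} y"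
    proof (cases "y \<le> T")
      case True then show ?thesis using y bnd[OF fb] by simp
    next
      case False
      then have "f (t - y, x) = 0" using that by (intro off) auto
      then show ?thesis using False by simp
    qed
  qed measurable
  have m_zero: "m t x = 0" if "T \<le> t" for t x
    unfolding m_def using act_zero[OF that] by simp
  have im: "integrable (l\<Omega> \<Otimes>\<^sub>M halfline) (\<lambda>(x, t). m t x)"
  proof (rule oh.integrable_rectangle[where A=UNIV and B="{0..T}" and C="C * CA * measure U {0..T}"])
    show "AE z in l\<Omega> \<Otimes>\<^sub>M halfline. \<bar>m (snd z) (fst z)\<bar> \<le> C * CA * measure U {0..T} * indicator (UNIV \<times> {0..T}) z"
      using oh.AE_pair_snd[OF AE_halfline_pos]
    proof eventually_elim
      case (elim z)
      then show ?case using m_bound[of "snd z" "fst z"] m_zero[of "snd z" "fst z"] by (cases z; cases "snd z \<le> T") auto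
    qed
  qed (use l\<Omega>_finite halfline_Icc_finite[of 0 T] in \<open>auto simp: less_top\<close>)
  obtain Cp where Cp: "0 \<le> Cp" "\<And>t. \<bar>p t\<bar> \<le> Cp" using C1c_properties[OF p] by metis
  have iw: "integrable (l\<Omega> \<Otimes>\<^sub>M lborel) (\<lambda>(x, t). f (t, x) * (p t * q x))"
  proof (rule ol.integrable_rectangle[where A=UNIV and B="{0..T}" and C="C * (Cp * sup_norm q)"])
    show "AE z in l\<Omega> \<Otimes>\<^sub>M lborel. \<bar>f (snd z, fst z) * (p (snd z) * q (fst z))\<bar> \<le> C * (Cp * sup_norm q) * indicator (UNIV \<times> {0..T}) z"
    proof (rule AE_I2)
      fix z
      have "\<bar>f (snd z, fst z) * (p (snd z) * q (fst z))\<bar> \<le> C * (Cp * sup_norm q)"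
        unfolding abs_mult using fb Cp bound_nonneg[OF fb] C_infty_sup_norm[OF q_in] by (intro mult_mono) auto
      then show "\<bar>f (snd z, fst z) * (p (snd z) * q (fst z))\<bar> \<le> C * (Cp * sup_norm q) * indicator (UNIV \<times> {0..T}) z"
        using p_off[of "snd z"] by (cases z) (auto split: split_indicator)
    qed
    have [measurable]: "q \<in> borel_measurable borel" by (rule C_infty_borel[OF q_in])
    show "(\<lambda>(x, t). f (t, x) * (p t * q x)) \<in> borel_measurable (l\<Omega> \<Otimes>\<^sub>M lborel)" by measurable
  qed (use l\<Omega>_finite in \<open>auto simp: less_top emeasure_lborel_Icc_eq\<close>)
  have "(LINT t|halfline. LINT x|l\<Omega>. src f t x * act t 0 x) = (LINT t|halfline. LINT x|l\<Omega>. m t x)"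
    by (simp add: step1)
  also have "\<dots> = (LINT x|l\<Omega>. LINT t|halfline. m t x)" by (rule oh.Fubini_integral[OF im])
  also have "\<dots> = (LINT x|l\<Omega>. - (LINT t|lborel. f (t, x) * (p t * q x)))"
  proof (rule Bochner_Integration.integral_cong[OF refl])
    fix x
    have "(LINT t|halfline. m t x) = - (LINT t|lborel. f (t, x) * (p t * P (max 0 0) q x))"
      unfolding m_def act_gen using off by (intro test_orbit.weak_source[OF orbit, where L=C]) (auto simp: fb)
    then show "(LINT t|halfline. m t x) = - (LINT t|lborel. f (t, x) * (p t * q x))" by (simp only: orbit_0)
  qed
  also have "\<dots> = - (LINT t|lborel. LINT x|l\<Omega>. f (t, x) * (p t * q x))"
    using ol.Fubini_integral[OF iw] by simp
  finally show ?thesis .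
qed

text \<open>The past is an infinite time interval on which boundedness does not suffice. For t < 0
  the term p t drops out, so the operator is bounded by the integral of \<bar>p (t + r)\<bar> over
  jump sizes, and integrating over t leaves a multiple of min r 1.\<close>

lemma past_finite:
  assumes off: "\<And>y. y \<notin> {..<0} \<times> \<Omega> \<Longrightarrow> f y = 0"
  shows "(\<integral>\<^sup>+t. \<integral>\<^sup>+x. ennreal \<bar>f (t, x) * act t 0 x\<bar> \<partial>l\<Omega> \<partial>lborel) < \<infinity>"
proof -
  obtain Cp where Cp: "0 \<le> Cp" "\<And>t. \<bar>p t\<bar> \<le> Cp" using C1c_properties[OF p] by metis
  let ?c = "C * sup_norm q"
  have nq: "0 \<le> sup_norm q" using C_infty_sup_norm[OF q_in, of undefined] abs_ge_zero order_trans by blast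
  have c: "0 \<le> ?c" using bound_nonneg[OF fb] nq by simp
  have le: "ennreal \<bar>f (t, x) * act t 0 x\<bar> \<le> (\<integral>\<^sup>+r. ennreal (?c * \<bar>p (t + r)\<bar>) * indicator {..<0} t \<partial>Nu)" for t x
  proof (cases "t < 0")
    case True
    have "ennreal \<bar>f (t, x) * act t 0 x\<bar> \<le> ennreal C * ennreal (norm (act t 0 x))"
      using fb bound_nonneg[OF fb] by (subst ennreal_mult[symmetric]) (auto simp: abs_mult intro!: ennreal_leI mult_right_mono)
    also have "\<dots> \<le> ennreal C * (\<integral>\<^sup>+r. ennreal (norm (p (t + r) * P (max 0 (0 + r)) q x - p t * P (max 0 0) q x)) \<partial>Nu)"
      unfolding act_def by (intro mult_left_mono integral_norm_bound_ennreal act_integrable) auto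
    also have "\<dots> \<le> ennreal C * (\<integral>\<^sup>+r. ennreal (sup_norm q * \<bar>p (t + r)\<bar>) \<partial>Nu)"
    proof (intro mult_left_mono nn_integral_mono ennreal_leI)
      fix r
      have "p t = 0" using True by (intro p_off) auto
      moreover have "\<bar>P (max 0 r) q x\<bar> \<le> sup_norm q" by (rule P_bound[OF _ q_in]) simp
      ultimately show "norm (p (t + r) * P (max 0 (0 + r)) q x - p t * P (max 0 0) q x) \<le> sup_norm q * \<bar>p (t + r)\<bar>"
        using mult_left_mono[of "\<bar>P (max 0 r) q x\<bar>" "sup_norm q" "\<bar>p (t + r)\<bar>"]
        by (simp add: abs_mult mult.commute)
    qed auto
    also have "\<dots> = (\<integral>\<^sup>+r. ennreal (?c * \<bar>p (t + r)\<bar>) * indicator {..<0} t \<partial>Nu)"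
      using True bound_nonneg[OF fb] nq by (subst nn_integral_cmult[symmetric]) (auto simp: ennreal_mult[symmetric] mult.assoc)
    finally show ?thesis .
  next
    case False
    then have "f (t, x) = 0" by (intro off) auto
    then show ?thesis by simp
  qed
  have "(\<integral>\<^sup>+t. \<integral>\<^sup>+r. ennreal (?c * \<bar>p (t + r)\<bar>) * indicator {..<0} t \<partial>Nu \<partial>lborel)
    = (\<integral>\<^sup>+r. \<integral>\<^sup>+t. ennreal (?c * \<bar>p (t + r)\<bar>) * indicator {..<0} t \<partial>lborel \<partial>Nu)"
    by (rule Nl.Fubini') measurable
  also have "\<dots> \<le> (\<integral>\<^sup>+r. ennreal (?c * Cp * max 1 T) * ennreal (min r 1) \<partial>Nu)"
  proof (rule nn_integral_mono_AE)
    show "AE r in Nu. (\<integral>\<^sup>+t. ennreal (?c * \<bar>p (t + r)\<bar>) * indicator {..<0} t \<partial>lborel) \<le> ennreal (?c * Cp * max 1 T) * ennreal (min r 1)"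
      using AE_Nu_pos
    proof eventually_elim
      case (elim r)
      \<comment> \<open>If p (t + r) is nonzero and t < 0, then t lies in an interval whose length
        is at most the minimum of r and T, hence at most max 1 T * min r 1.\<close>
      have "(\<integral>\<^sup>+t. ennreal (?c * \<bar>p (t + r)\<bar>) * indicator {..<0} t \<partial>lborel)
        \<le> (\<integral>\<^sup>+t. ennreal (?c * Cp) * indicator {- r..min 0 (T - r)} t \<partial>lborel)"
      proof (intro nn_integral_mono)
        fix t
        have "?c * \<bar>p (t + r)\<bar> \<le> ?c * Cp" using c Cp(2)[of "t + r"] by (intro mult_left_mono) auto
        moreover have "p (t + r) = 0" if "t \<notin> {- r..min 0 (T - r)}" "t < 0" using that by (intro p_off) auto
        ultimately show "ennreal (?c * \<bar>p (t + r)\<bar>) * indicator {..<0} t \<le> ennreal (?c * Cp) * indicator {- r..min 0 (T - r)} t"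
          by (cases "t \<in> {- r..min 0 (T - r)}"; cases "t < 0") (auto intro: ennreal_leI)
      qed
      also have "\<dots> = ennreal (?c * Cp) * emeasure lborel {- r..min 0 (T - r)}"
        by (rule nn_integral_cmult_indicator) simp
      also have "\<dots> \<le> ennreal (?c * Cp) * ennreal (max 1 T * min r 1)"
      proof (rule mult_left_mono)
        have "min 0 (T - r) - - r \<le> max 1 T * min r 1"
        proof (cases "r \<le> 1")
          case True
          have "1 * r \<le> max 1 T * r" using elim by (intro mult_right_mono) auto
          then show ?thesis using True by (auto simp: min_def)
        next
          case False then show ?thesis by (auto simp: min_def max_def)
        qed
        then show "emeasure lborel {- r..min 0 (T - r)} \<le> ennreal (max 1 T * min r 1)"
          by (simp add: emeasure_lborel_Icc_eq ennreal_leI)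
      qed auto
      also have "\<dots> = ennreal (?c * Cp * max 1 T) * ennreal (min r 1)"
      proof -
        have e: "ennreal a * ennreal (b * d) = ennreal (a * b) * ennreal d" if "0 \<le> a" "0 \<le> b" "0 \<le> d" for a b d
          using that by (simp add: ennreal_mult mult.assoc)
        show ?thesis using c Cp(1) elim by (intro e) auto
      qed
      finally show ?case .
    qed
  qed
  also have "\<dots> = ennreal (?c * Cp * max 1 T) * (\<integral>\<^sup>+r. ennreal (min r 1) \<partial>Nu)"
    by (rule nn_integral_cmult) measurable
  also have "\<dots> < \<infinity>" using min_Nu_finite by (simp add: ennreal_mult_less_top)
  finally have fin: "(\<integral>\<^sup>+t. \<integral>\<^sup>+r. ennreal (?c * \<bar>p (t + r)\<bar>) * indicator {..<0} t \<partial>Nu \<partial>lborel) < \<infinity>" .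
  have "(\<integral>\<^sup>+t. \<integral>\<^sup>+x. ennreal \<bar>f (t, x) * act t 0 x\<bar> \<partial>l\<Omega> \<partial>lborel)
    \<le> (\<integral>\<^sup>+t. \<integral>\<^sup>+x. (\<integral>\<^sup>+r. ennreal (?c * \<bar>p (t + r)\<bar>) * indicator {..<0} t \<partial>Nu) \<partial>l\<Omega> \<partial>lborel)"
    by (rule nn_integral_mono, rule nn_integral_mono) (rule le)
  also have "\<dots> = (\<integral>\<^sup>+t. (\<integral>\<^sup>+r. ennreal (?c * \<bar>p (t + r)\<bar>) * indicator {..<0} t \<partial>Nu) * emeasure l\<Omega> UNIV \<partial>lborel)"
    by simp
  also have "\<dots> = (\<integral>\<^sup>+t. \<integral>\<^sup>+r. ennreal (?c * \<bar>p (t + r)\<bar>) * indicator {..<0} t \<partial>Nu \<partial>lborel) * emeasure l\<Omega> UNIV"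
    by (rule nn_integral_multc) measurable
  also have "\<dots> < \<infinity>" using fin l\<Omega>_finite by (simp add: ennreal_mult_less_top)
  finally show ?thesis .
qed

end

end

section \<open>The Borel version of the solution and its weak identity\<close>

context subordinate_feller
begin

text \<open>A Borel version of the function \<open>u\<close> of the theorem.\<close>

definition sol :: "real \<Rightarrow> (real \<times> 'a \<Rightarrow> real) \<Rightarrow> (real \<times> 'a \<Rightarrow> real) \<Rightarrow> real \<Rightarrow> 'a \<Rightarrow> real" where
  "sol T f \<phi> t x = \<phi> (t, x) + indicator {0<..<T} t * (hist \<phi> t x + src f t x)"

context
  fixes T C C' :: real and f \<phi> :: "real \<times> 'a \<Rightarrow> real"
  assumes f[measurable]: "f \<in> borel_measurable (borel \<Otimes>\<^sub>M borel)" and fb: "\<And>y. \<bar>f y\<bar> \<le> C'"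
    and f_off: "\<And>y. y \<notin> {0<..<T} \<times> \<Omega> \<Longrightarrow> f y = 0"
    and \<phi>[measurable]: "\<phi> \<in> borel_measurable (borel \<Otimes>\<^sub>M borel)" and \<phi>b: "\<And>y. \<bar>\<phi> y\<bar> \<le> C"
begin

lemma sol_measurable:
  assumes [measurable]: "a \<in> borel_measurable Q" "b \<in> borel_measurable Q"
  shows "(\<lambda>v. sol T f \<phi> (a v) (b v)) \<in> borel_measurable Q"
proof -
  note [measurable (raw)] = hist_measurable[OF \<phi>] src_measurable[OF f]
  show ?thesis unfolding sol_def by measurable
qed

lemma present_bound: "\<bar>indicator {0<..<T} t * (hist \<phi> t x + src f t x)\<bar> \<le> C + C' * measure U {0..T}"
proof -
  have "0 \<le> C" "0 \<le> C'" by (rule bound_nonneg[OF \<phi>b], rule bound_nonneg[OF fb])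
  moreover have "\<bar>src f t x\<bar> \<le> C' * measure U {0..T}" if "t < T"
    using that f_off by (intro src_bound[OF f fb]) auto
  ultimately show ?thesis using hist_bound[of \<phi> C t x, OF \<phi>b] by (auto split: split_indicator)
qed

lemma sol_bound: "\<bar>sol T f \<phi> t x\<bar> \<le> C + (C + C' * measure U {0..T})"
  unfolding sol_def using \<phi>b[of "(t, x)"] present_bound[of t x] by linarith

end

end

context test_product
begin

context
  fixes \<phi> :: "real \<times> 'a \<Rightarrow> real" and C :: real
  assumes \<phi>[measurable]: "\<phi> \<in> borel_measurable (borel \<Otimes>\<^sub>M borel)" and \<phi>b: "\<And>y. \<bar>\<phi> y\<bar> \<le> C"
    and off: "\<And>y. y \<notin> {..<0} \<times> \<Omega> \<Longrightarrow> \<phi> y = 0"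
begin

lemma past_integrable: "integrable (l\<Omega> \<Otimes>\<^sub>M lborel) (\<lambda>(x, t). \<phi> (t, x) * act t 0 x)"
proof (rule integrableI_bounded)
  have "(\<integral>\<^sup>+z. ennreal (norm (case z of (x, t) \<Rightarrow> \<phi> (t, x) * act t 0 x)) \<partial>(l\<Omega> \<Otimes>\<^sub>M lborel))
    = (\<integral>\<^sup>+x. \<integral>\<^sup>+t. ennreal \<bar>\<phi> (t, x) * act t 0 x\<bar> \<partial>lborel \<partial>l\<Omega>)"
    by (subst lborel.nn_integral_fst[symmetric]) (auto simp: split_beta')
  also have "\<dots> = (\<integral>\<^sup>+t. \<integral>\<^sup>+x. ennreal \<bar>\<phi> (t, x) * act t 0 x\<bar> \<partial>l\<Omega> \<partial>lborel)"
    by (rule ol.Fubini'[symmetric]) measurable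
  also have "\<dots> < \<infinity>" by (rule past_finite[OF \<phi> \<phi>b off])
  finally show "(\<integral>\<^sup>+z. ennreal (norm (case z of (x, t) \<Rightarrow> \<phi> (t, x) * act t 0 x)) \<partial>(l\<Omega> \<Otimes>\<^sub>M lborel)) < \<infinity>" .
qed measurable

text \<open>As for the source term, with the random time D t in place of integration over the
  potential measure and \<open>weak_history\<close> applied for each x. The right-hand side is an
  integral over the past, finite by \<open>past_finite\<close>.\<close>

lemma history_identity:
  "(LINT t|halfline. LINT x|l\<Omega>. hist \<phi> t x * act t 0 x) = - (LINT t|lborel. LINT x|l\<Omega>. \<phi> (t, x) * act t 0 x)"
proof -
  obtain CA where CA: "0 \<le> CA" "\<And>t y x. \<bar>act t y x\<bar> \<le> CA" using act_bound by blast
  have C0: "0 \<le> C" by (rule bound_nonneg[OF \<phi>b])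
  have bnd: "\<bar>a * act t' y' x'\<bar> \<le> C * CA" if "\<bar>a\<bar> \<le> C" for a t' y' x'
    unfolding abs_mult using that CA C0 by (intro mult_mono) auto
  define D where "D t \<omega> = max 0 (overshoot t \<omega>)" for t \<omega>
  have [measurable]: "(\<lambda>z. D (g z) (k z)) \<in> borel_measurable Q" if [measurable]: "g \<in> borel_measurable Q" "k \<in> Q \<rightarrow>\<^sub>M M"
    for g k and Q :: "'c measure"
    unfolding D_def by measurable
  define m where "m t x = (LINT \<omega>|M. \<phi> (t - D t \<omega>, x) * act t (D t \<omega>) x)" for t x
  have m_meas[measurable]: "(\<lambda>v. m (a v) (b v)) \<in> borel_measurable Q"
    if [measurable]: "a \<in> borel_measurable Q" "b \<in> borel_measurable Q" for a b and Q :: "'c measure"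
    unfolding m_def by measurable
  have step1: "(LINT x|l\<Omega>. hist \<phi> t x * act t 0 x) = (LINT x|l\<Omega>. m t x)" for t
  proof -
    let ?k = "\<lambda>x \<omega>. (LINT z|kap (D t \<omega>) x. \<phi> (t - D t \<omega>, z)) * act t 0 x"
    let ?l = "\<lambda>x \<omega>. \<phi> (t - D t \<omega>, x) * act t (D t \<omega>) x"
    have ik: "integrable (l\<Omega> \<Otimes>\<^sub>M M) (\<lambda>(x, \<omega>). ?k x \<omega>)"
    proof (rule oM.integrable_rectangle[where A=UNIV and B="space M" and C="C * CA"])
      show "AE z in l\<Omega> \<Otimes>\<^sub>M M. \<bar>?k (fst z) (snd z)\<bar> \<le> C * CA * indicator (UNIV \<times> space M) z"
      proof (rule AE_I2)
        fix z assume z: "z \<in> space (l\<Omega> \<Otimes>\<^sub>M M)"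
        have "\<bar>LINT y|kap (D t (snd z)) (fst z). \<phi> (t - D t (snd z), y)\<bar> \<le> C"
          by (rule integral_kap_bound) (rule \<phi>b)
        from bnd[OF this, of t 0 "fst z"] show "\<bar>?k (fst z) (snd z)\<bar> \<le> C * CA * indicator (UNIV \<times> space M) z"
          using z by (auto simp: space_pair_measure)
      qed
    qed (use l\<Omega>_finite in \<open>auto simp: less_top emeasure_space_1\<close>)
    have il: "integrable (l\<Omega> \<Otimes>\<^sub>M M) (\<lambda>(x, \<omega>). ?l x \<omega>)"
    proof (rule oM.integrable_rectangle[where A=UNIV and B="space M" and C="C * CA"])
      show "AE z in l\<Omega> \<Otimes>\<^sub>M M. \<bar>?l (fst z) (snd z)\<bar> \<le> C * CA * indicator (UNIV \<times> space M) z"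
        using bnd[OF \<phi>b] by (intro AE_I2) (auto simp: space_pair_measure)
    qed (use l\<Omega>_finite in \<open>auto simp: less_top emeasure_space_1\<close>)
    have "(LINT x|l\<Omega>. hist \<phi> t x * act t 0 x) = (LINT x|l\<Omega>. LINT \<omega>|M. ?k x \<omega>)"
      by (simp add: hist_def D_def)
    also have "\<dots> = (LINT \<omega>|M. LINT x|l\<Omega>. ?k x \<omega>)" by (rule oM.Fubini_integral[symmetric, OF ik])
    also have "\<dots> = (LINT \<omega>|M. LINT x|l\<Omega>. ?l x \<omega>)"
      by (intro Bochner_Integration.integral_cong[OF refl] slice_symmetric[OF \<phi> \<phi>b]) (simp add: D_def)
    also have "\<dots> = (LINT x|l\<Omega>. m t x)" unfolding m_def by (rule oM.Fubini_integral[OF il])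
    finally show ?thesis .
  qed
  have m_bound: "\<bar>m t x\<bar> \<le> C * CA" for t x
  proof -
    have "\<bar>m t x\<bar> \<le> (LINT \<omega>|M. \<bar>\<phi> (t - D t \<omega>, x) * act t (D t \<omega>) x\<bar>)"
      unfolding m_def by (rule integral_abs_bound)
    also have "\<dots> \<le> (LINT \<omega>|M. C * CA)"
    proof (rule integral_mono)
      show "integrable M (\<lambda>\<omega>. \<bar>\<phi> (t - D t \<omega>, x) * act t (D t \<omega>) x\<bar>)"
        using bnd[OF \<phi>b] by (intro integrable_const_bound[where B="C * CA"]) auto
    qed (use bnd[OF \<phi>b] in auto)
    finally show ?thesis by (simp add: prob_space)
  qed
  have m_zero: "m t x = 0" if "T \<le> t" for t x
    unfolding m_def using act_zero[OF that] by simp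
  have im: "integrable (l\<Omega> \<Otimes>\<^sub>M halfline) (\<lambda>(x, t). m t x)"
  proof (rule oh.integrable_rectangle[where A=UNIV and B="{0..T}" and C="C * CA"])
    show "AE z in l\<Omega> \<Otimes>\<^sub>M halfline. \<bar>m (snd z) (fst z)\<bar> \<le> C * CA * indicator (UNIV \<times> {0..T}) z"
      using oh.AE_pair_snd[OF AE_halfline_pos]
    proof eventually_elim
      case (elim z)
      then show ?case using m_bound[of "snd z" "fst z"] m_zero[of "snd z" "fst z"] by (cases z; cases "snd z \<le> T") auto
    qed
  qed (use l\<Omega>_finite halfline_Icc_finite[of 0 T] in \<open>auto simp: less_top\<close>)
  have "(LINT t|halfline. LINT x|l\<Omega>. hist \<phi> t x * act t 0 x) = (LINT t|halfline. LINT x|l\<Omega>. m t x)"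
    by (simp add: step1)
  also have "\<dots> = (LINT x|l\<Omega>. LINT t|halfline. m t x)" by (rule oh.Fubini_integral[OF im])
  also have "\<dots> = (LINT x|l\<Omega>. - (LINT t|lborel. \<phi> (t, x) * act t 0 x))"
  proof (rule Bochner_Integration.integral_cong[OF refl])
    fix x
    have "(LINT t|halfline. m t x) = (LINT t|halfline. LINT \<omega>|M. \<phi> (t - overshoot t \<omega>, x) * act t (overshoot t \<omega>) x)"
    proof (rule integral_cong_AE)
      show "AE t in halfline. m t x = (LINT \<omega>|M. \<phi> (t - overshoot t \<omega>, x) * act t (overshoot t \<omega>) x)"
        using AE_halfline_pos
      proof eventually_elim
        case (elim t)
        show ?case unfolding m_def
        proof (rule integral_cong_AE)
          show "AE \<omega> in M. \<phi> (t - D t \<omega>, x) * act t (D t \<omega>) x = \<phi> (t - overshoot t \<omega>, x) * act t (overshoot t \<omega>) x"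
            using AE_good
          proof eventually_elim
            case (elim \<omega>)
            then have "D t \<omega> = overshoot t \<omega>" using overshoot_ge[of \<omega> t] \<open>0 < t\<close> by (simp add: D_def)
            then show ?case by simp
          qed
        qed measurable
      qed
    qed measurable
    also have "\<dots> = - (LINT t|lborel. \<phi> (t, x) * act t 0 x)"
      unfolding act_gen using off by (intro test_orbit.weak_history[OF orbit, where L=C]) (auto simp: \<phi>b)
    finally show "(LINT t|halfline. m t x) = - (LINT t|lborel. \<phi> (t, x) * act t 0 x)" .
  qed
  also have "\<dots> = - (LINT t|lborel. LINT x|l\<Omega>. \<phi> (t, x) * act t 0 x)"
    using ol.Fubini_integral[OF past_integrable] by simp
  finally show ?thesis .
qed

context
  fixes f :: "real \<times> 'a \<Rightarrow> real" and C' :: real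
  assumes f[measurable]: "f \<in> borel_measurable (borel \<Otimes>\<^sub>M borel)" and fb: "\<And>y. \<bar>f y\<bar> \<le> C'"
    and f_off: "\<And>y. y \<notin> {0<..<T} \<times> \<Omega> \<Longrightarrow> f y = 0"
begin

lemma sol_act_finite: "(\<integral>\<^sup>+t. \<integral>\<^sup>+x. ennreal \<bar>sol T f \<phi> t x * act t 0 x\<bar> \<partial>l\<Omega> \<partial>lborel) < \<infinity>"
proof -
  note [measurable (raw)] = sol_measurable[OF f fb f_off \<phi> \<phi>b]
  obtain CA where CA: "0 \<le> CA" "\<And>t y x. \<bar>act t y x\<bar> \<le> CA" using act_bound by blast
  let ?B = "(C + C' * measure U {0..T}) * CA"
  have "(\<integral>\<^sup>+t. \<integral>\<^sup>+x. ennreal \<bar>sol T f \<phi> t x * act t 0 x\<bar> \<partial>l\<Omega> \<partial>lborel)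
    \<le> (\<integral>\<^sup>+t. \<integral>\<^sup>+x. ennreal \<bar>\<phi> (t, x) * act t 0 x\<bar> + ennreal ?B * indicator {0..T} t \<partial>l\<Omega> \<partial>lborel)"
  proof (rule nn_integral_mono, rule nn_integral_mono)
    fix t x
    let ?h = "indicator {0<..<T} t * (hist \<phi> t x + src f t x)"
    have pb: "\<bar>?h\<bar> \<le> C + C' * measure U {0..T}" by (rule present_bound[OF f fb f_off \<phi> \<phi>b])
    have "\<bar>?h * act t 0 x\<bar> \<le> ?B * indicator {0..T} t"
    proof (cases "t \<in> {0<..<T}")
      case True
      have "\<bar>?h * act t 0 x\<bar> \<le> ?B"
        unfolding abs_mult[of ?h] using pb CA abs_ge_zero[of ?h]
        by (intro mult_mono order_trans[OF abs_ge_zero pb]) auto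
      then show ?thesis using True by simp
    next
      case False
      have "0 \<le> ?B" using CA order_trans[OF abs_ge_zero pb] by (intro mult_nonneg_nonneg) auto
      then show ?thesis using False by simp
    qed
    moreover have "\<bar>sol T f \<phi> t x * act t 0 x\<bar> \<le> \<bar>\<phi> (t, x) * act t 0 x\<bar> + \<bar>?h * act t 0 x\<bar>"
      unfolding sol_def distrib_right by (rule abs_triangle_ineq)
    ultimately have "ennreal \<bar>sol T f \<phi> t x * act t 0 x\<bar> \<le> ennreal (\<bar>\<phi> (t, x) * act t 0 x\<bar> + ?B * indicator {0..T} t)"
      by (intro ennreal_leI) linarith
    also have "\<dots> = ennreal \<bar>\<phi> (t, x) * act t 0 x\<bar> + ennreal ?B * indicator {0..T} t"
      using CA order_trans[OF abs_ge_zero pb] by (cases "t \<in> {0..T}") auto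
    finally show "ennreal \<bar>sol T f \<phi> t x * act t 0 x\<bar> \<le> \<dots>" .
  qed
  also have "\<dots> = (\<integral>\<^sup>+t. (\<integral>\<^sup>+x. ennreal \<bar>\<phi> (t, x) * act t 0 x\<bar> \<partial>l\<Omega>) + ennreal ?B * indicator {0..T} t * emeasure l\<Omega> UNIV \<partial>lborel)"
    by (intro nn_integral_cong) (subst nn_integral_add, auto)
  also have "\<dots> = (\<integral>\<^sup>+t. \<integral>\<^sup>+x. ennreal \<bar>\<phi> (t, x) * act t 0 x\<bar> \<partial>l\<Omega> \<partial>lborel) + ennreal ?B * emeasure lborel {0..T} * emeasure l\<Omega> UNIV"
    by (subst nn_integral_add) (auto simp: nn_integral_multc nn_integral_cmult)
  also have "\<dots> < \<infinity>"
    using past_finite[OF \<phi> \<phi>b off] l\<Omega>_finite by (auto simp: ennreal_mult_less_top emeasure_lborel_Icc_eq)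
  finally show ?thesis .
qed

text \<open>The history term contributes exactly the negative of the integral over the past values
  of the solution, so these two cancel and only the source term is left.\<close>

lemma weak_identity:
  "(LINT t|lborel. LINT x|l\<Omega>. sol T f \<phi> t x * act t 0 x) = - (LINT t|lborel. LINT x|l\<Omega>. f (t, x) * (p t * q x))"
proof -
  note [measurable (raw)] = hist_measurable[OF \<phi>] src_measurable[OF f] sol_measurable[OF f fb f_off \<phi> \<phi>b]
  obtain CA where CA: "0 \<le> CA" "\<And>t y x. \<bar>act t y x\<bar> \<le> CA" using act_bound by blast
  have int: "integrable l\<Omega> (\<lambda>x. v x * act t 0 x)"
    if [measurable]: "v \<in> borel_measurable borel" and b: "\<And>x. \<bar>v x\<bar> \<le> B" for v t B
  proof (rule l\<Omega>.integrable_const_bound[where B="B * CA"])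
    show "AE x in l\<Omega>. norm (v x * act t 0 x) \<le> B * CA"
      using b CA abs_ge_zero[of "v undefined"] order_trans[OF abs_ge_zero b]
      by (intro AE_I2) (auto simp: abs_mult intro!: mult_mono)
  qed measurable
  let ?a = "\<lambda>t. LINT x|l\<Omega>. \<phi> (t, x) * act t 0 x"
  let ?b = "\<lambda>t. LINT x|l\<Omega>. hist \<phi> t x * act t 0 x"
  let ?c = "\<lambda>t. LINT x|l\<Omega>. src f t x * act t 0 x"
  have ih: "integrable l\<Omega> (\<lambda>x. hist \<phi> t x * act t 0 x)" for t
    by (rule int[OF _ hist_bound[OF \<phi>b]]) measurable
  have sb: "\<bar>src f t x\<bar> \<le> C' * measure U {0..T}" if "t \<le> T" for t x
    using that f_off by (intro src_bound[OF f fb]) auto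
  have isrc: "integrable l\<Omega> (\<lambda>x. src f t x * act t 0 x)" if "t \<le> T" for t
    by (rule int[OF _ sb[OF that]]) measurable
  have split: "(LINT x|l\<Omega>. sol T f \<phi> t x * act t 0 x) = ?a t + (indicator {0<..<T} t * ?b t + indicator {0<..<T} t * ?c t)" for t
  proof -
    have ip: "integrable l\<Omega> (\<lambda>x. \<phi> (t, x) * act t 0 x)" by (rule int[OF _ \<phi>b]) measurable
    show ?thesis
      using ip ih[of t] isrc[of t] by (cases "t \<in> {0<..<T}") (auto simp: sol_def distrib_right)
  qed
  have i_slab: "integrable lborel (\<lambda>t. indicator {0<..<T} t * w t)"
    if [measurable]: "w \<in> borel_measurable borel" and b: "\<And>t. t \<le> T \<Longrightarrow> \<bar>w t\<bar> \<le> B" for w :: "real \<Rightarrow> real" and B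
  proof (rule Bochner_Integration.integrable_bound[where f="\<lambda>t. B * indicator {0<..<T} t"])
    have fin: "emeasure lborel {0<..<T} < top"
      by (rule order_le_less_trans[OF emeasure_mono[of _ "{0..T}"]]) (auto simp: emeasure_lborel_Icc_eq)
    show "integrable lborel (\<lambda>t. B * indicator {0<..<T} t)"
      by (intro integrable_mult_right integrable_real_indicator) (auto simp: fin)
    show "AE t in lborel. norm (indicator {0<..<T} t * w t) \<le> norm (B * indicator {0<..<T} t)"
      using order_trans[OF b abs_ge_self] by (intro AE_I2) (auto split: split_indicator)
  qed measurable
  have sp: "\<bar>LINT x|l\<Omega>. v x * act t 0 x\<bar> \<le> B * CA * measure l\<Omega> UNIV"
    if v[measurable]: "v \<in> borel_measurable borel" and b: "\<And>x. \<bar>v x\<bar> \<le> B" for v t B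
  proof -
    have "\<bar>LINT x|l\<Omega>. v x * act t 0 x\<bar> \<le> (LINT x|l\<Omega>. \<bar>v x * act t 0 x\<bar>)" by (rule integral_abs_bound)
    also have "\<dots> \<le> (LINT x|l\<Omega>. B * CA)"
      using integrable_abs[OF int[OF v b, of t]] b CA order_trans[OF abs_ge_zero b]
      by (intro integral_mono) (auto simp: abs_mult intro!: mult_mono)
    finally show ?thesis by (simp add: ac_simps)
  qed
  have ia: "integrable lborel ?a" using ol.integrable_snd[OF past_integrable] by simp
  have ib: "integrable lborel (\<lambda>t. indicator {0<..<T} t * ?b t)"
    by (rule i_slab[OF _ sp[OF _ hist_bound[OF \<phi>b]]]) measurable
  have ic: "integrable lborel (\<lambda>t. indicator {0<..<T} t * ?c t)"
    by (rule i_slab[OF _ sp[OF _ sb]]) measurable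
  \<comment> \<open>The truncation of the solution at T costs nothing, because the operator applied
    to the test function vanishes for t \<ge> T.\<close>
  have half: "(LINT t|lborel. indicator {0<..<T} t * w t) = (LINT t|halfline. w t)"
    if [measurable]: "w \<in> borel_measurable borel" and z: "\<And>t. T \<le> t \<Longrightarrow> w t = 0" for w :: "real \<Rightarrow> real"
    using z by (subst integral_halfline)
      (auto simp: set_lebesgue_integral_def not_less split: split_indicator intro!: Bochner_Integration.integral_cong)
  have "(LINT t|lborel. LINT x|l\<Omega>. sol T f \<phi> t x * act t 0 x)
    = (LINT t|lborel. ?a t) + ((LINT t|lborel. indicator {0<..<T} t * ?b t) + (LINT t|lborel. indicator {0<..<T} t * ?c t))"
    unfolding split using ia ib ic by simp
  also have "(LINT t|lborel. indicator {0<..<T} t * ?b t) = (LINT t|halfline. ?b t)"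
    by (rule half) (measurable, simp add: act_zero)
  also have "(LINT t|lborel. indicator {0<..<T} t * ?c t) = (LINT t|halfline. ?c t)"
    by (rule half) (measurable, simp add: act_zero)
  finally show ?thesis using history_identity source_identity[OF f fb f_off] by simp
qed

end

end

end

text \<open>The version is bounded everywhere and the exceptional set is an explicit Borel null set:
  values along paths are compared point by point, so agreement almost everywhere has to be turned
  into agreement off a fixed set.\<close>

lemma L_infty_borel_version:
  fixes g :: "real \<Rightarrow> 'a::euclidean_space \<Rightarrow> real"
  assumes g: "g \<in> L_infty A" and A[measurable]: "A \<in> sets borel"
  obtains g' C N where "g' \<in> borel_measurable borel" "\<And>y. \<bar>g' y\<bar> \<le> C" "\<And>y. y \<notin> A \<Longrightarrow> g' y = 0"
    "N \<in> null_sets lborel" "\<And>s z. (s, z) \<in> A \<Longrightarrow> (s, z) \<notin> N \<Longrightarrow> g s z = g' (s, z)"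
proof -
  from g obtain C where C: "AE (t, x) in lebesgue. (t, x) \<in> A \<longrightarrow> \<bar>g t x\<bar> \<le> C"
    and m: "(\<lambda>y. indicator A y *\<^sub>R case_prod g y) \<in> borel_measurable lebesgue"
    unfolding L_infty_def set_borel_measurable_def by blast
  obtain h where h[measurable]: "h \<in> borel_measurable lborel"
    and hg: "AE y in lborel. indicator A y *\<^sub>R case_prod g y = h y"
    using completion_ex_borel_measurable_real[OF m] by blast
  define g' where "g' y = (if y \<in> A \<and> \<bar>h y\<bar> \<le> C then h y else 0)" for y
  have "AE y in lborel. y \<in> A \<longrightarrow> case_prod g y = g' y"
    using hg C[unfolded AE_completion_iff] by eventually_elim (auto simp: g'_def)
  then obtain N where N: "\<And>y. y \<notin> N \<Longrightarrow> y \<in> A \<longrightarrow> case_prod g y = g' y" "N \<in> null_sets lborel"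
    by (rule AE_E3) auto
  show thesis
  proof
    have "g' \<in> borel_measurable lborel" unfolding g'_def by measurable
    then show "g' \<in> borel_measurable borel" by simp
    show "\<bar>g' y\<bar> \<le> \<bar>C\<bar>" for y by (auto simp: g'_def)
    show "g s z = g' (s, z)" if "(s, z) \<in> A" "(s, z) \<notin> N" for s z using N(1)[OF that(2)] that(1) by simp
  qed (auto simp: g'_def N)
qed

section \<open>Lebesgue integrals of functions that agree almost everywhere with Borel ones\<close>

context feller
begin

lemma AE_halfline_l\<Omega>:
  "(AE w in halfline \<Otimes>\<^sub>M l\<Omega>. Q w) \<longleftrightarrow> (AE w in lborel. w \<in> {0<..} \<times> \<Omega> \<longrightarrow> Q w)"
proof -
  have eq: "halfline \<Otimes>\<^sub>M l\<Omega> = density (lborel \<Otimes>\<^sub>M lborel) (\<lambda>(t, x). indicator {0<..} t * indicator \<Omega> x)"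
    unfolding halfline_def l\<Omega>_def
    by (rule pair_measure_density)
      (use l\<Omega>.sigma_finite_measure_axioms in \<open>auto simp: l\<Omega>_def lborel.sigma_finite_measure_axioms\<close>)
  have "(AE w in halfline \<Otimes>\<^sub>M l\<Omega>. Q w)
    \<longleftrightarrow> (AE w in lborel \<Otimes>\<^sub>M lborel. 0 < (case w of (t, x) \<Rightarrow> (indicator {0<..} t * indicator \<Omega> x :: ennreal)) \<longrightarrow> Q w)"
    unfolding eq by (rule AE_density) measurable
  also have "\<dots> \<longleftrightarrow> (AE w in lborel \<Otimes>\<^sub>M lborel. w \<in> {0<..} \<times> \<Omega> \<longrightarrow> Q w)"
    by (rule AE_cong) (auto simp: indicator_def of_bool_def split: if_splits)
  finally show ?thesis by (simp only: lborel_prod)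
qed

lemma null_set_l\<Omega>:
  assumes N: "N \<in> null_sets (lborel :: (real \<times> 'a) measure)"
  shows "(\<integral>\<^sup>+t. \<integral>\<^sup>+x. indicator N (t, x) \<partial>l\<Omega> \<partial>lborel) = 0"
proof -
  have [measurable]: "N \<in> sets (borel \<Otimes>\<^sub>M borel)" using null_setsD2[OF N] unfolding borel_prod by simp
  have "(\<integral>\<^sup>+t. \<integral>\<^sup>+x. indicator N (t, x) \<partial>l\<Omega> \<partial>lborel) \<le> (\<integral>\<^sup>+t. \<integral>\<^sup>+x. indicator N (t, x) \<partial>lborel \<partial>lborel)"
  proof (rule nn_integral_mono)
    fix t :: real
    have "(\<integral>\<^sup>+x. indicator N (t, x) \<partial>l\<Omega>) = (\<integral>\<^sup>+x. indicator \<Omega> x * indicator N (t, x) \<partial>lborel)"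
      unfolding l\<Omega>_def by (rule nn_integral_density) measurable
    also have "\<dots> \<le> (\<integral>\<^sup>+x. indicator N (t, x) \<partial>lborel)"
      by (rule nn_integral_mono) (auto split: split_indicator)
    finally show "(\<integral>\<^sup>+x. indicator N (t, x) \<partial>l\<Omega>) \<le> (\<integral>\<^sup>+x. indicator N (t, x) \<partial>lborel)" .
  qed
  also have "\<dots> = (\<integral>\<^sup>+y. indicator N y \<partial>(lborel \<Otimes>\<^sub>M lborel))"
    by (rule lborel.nn_integral_fst) measurable
  also have "\<dots> = 0" by (simp only: lborel_prod nn_integral_indicator[OF null_setsD2[OF N]] null_setsD1[OF N])
  finally show ?thesis by simp
qed

lemma AE_lborel_slices:
  assumes "AE y in (lborel :: (real \<times> 'a) measure). Q y"
  shows "AE t in lborel. AE x in lborel. Q (t, x)"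
  using assms unfolding lborel_prod[symmetric] by (rule lborel_pair.AE_pair)

text \<open>For almost every t the slices agree almost everywhere, so the inner integrals agree for
  almost every t; at the remaining t the inner integral of v is arbitrary, but the outer one ignores
  them.\<close>

lemma iterated_integral_version:
  fixes v :: "real \<Rightarrow> 'a \<Rightarrow> real" and w :: "real \<times> 'a \<Rightarrow> real"
  assumes w[measurable]: "w \<in> borel_measurable (borel \<Otimes>\<^sub>M borel)"
    and eq: "AE y in lborel. y \<in> I \<times> \<Omega> \<longrightarrow> v (fst y) (snd y) = w y"
    and off: "\<And>t x. t \<notin> I \<Longrightarrow> w (t, x) = 0"
  shows "(LINT t:I|lebesgue. LINT x:\<Omega>|lebesgue. v t x) = (LINT t|lborel. LINT x|l\<Omega>. w (t, x))"
  unfolding set_lebesgue_integral_def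
proof (rule integral_completion_AE)
  show "AE t in lborel. indicator I t *\<^sub>R (LINT x|lebesgue. indicator \<Omega> x *\<^sub>R v t x) = (LINT x|l\<Omega>. w (t, x))"
    using AE_lborel_slices[OF eq]
  proof eventually_elim
    case (elim t)
    show ?case
    proof (cases "t \<in> I")
      case True
      have "(LINT x|lebesgue. indicator \<Omega> x *\<^sub>R v t x) = (LINT x|lborel. indicator \<Omega> x *\<^sub>R w (t, x))"
        by (rule integral_completion_AE) (use elim True in \<open>auto elim!: eventually_mono split: split_indicator\<close>)
      then show ?thesis using True integral_l\<Omega>[of "\<lambda>x. w (t, x)"] by (simp add: set_lebesgue_integral_def)
    qed (simp add: off)
  qed
qed measurable

lemma integrable_version:
  fixes v :: "real \<times> 'a \<Rightarrow> real" and w :: "real \<times> 'a \<Rightarrow> real"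
  assumes w[measurable]: "w \<in> borel_measurable (borel \<Otimes>\<^sub>M borel)"
    and eq: "AE y in lborel. y \<in> I \<times> \<Omega> \<longrightarrow> v y = w y"
    and off: "\<And>t x. t \<notin> I \<Longrightarrow> w (t, x) = 0"
    and fin: "(\<integral>\<^sup>+t. \<integral>\<^sup>+x. ennreal \<bar>w (t, x)\<bar> \<partial>l\<Omega> \<partial>lborel) < \<infinity>"
  shows "set_integrable lebesgue (I \<times> \<Omega>) v"
proof -
  let ?h = "\<lambda>y. indicator \<Omega> (snd y) * w y"
  have h: "?h \<in> borel_measurable (lborel \<Otimes>\<^sub>M lborel)" by measurable
  have "(\<integral>\<^sup>+y. ennreal (norm (?h y)) \<partial>(lborel \<Otimes>\<^sub>M lborel)) = (\<integral>\<^sup>+t. \<integral>\<^sup>+x. ennreal (norm (?h (t, x))) \<partial>lborel \<partial>lborel)"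
    by (rule lborel.nn_integral_fst[symmetric]) measurable
  also have "\<dots> = (\<integral>\<^sup>+t. \<integral>\<^sup>+x. ennreal \<bar>w (t, x)\<bar> \<partial>l\<Omega> \<partial>lborel)"
  proof (rule nn_integral_cong)
    fix t :: real
    have "(\<integral>\<^sup>+x. ennreal \<bar>w (t, x)\<bar> \<partial>l\<Omega>) = (\<integral>\<^sup>+x. indicator \<Omega> x * ennreal \<bar>w (t, x)\<bar> \<partial>lborel)"
      unfolding l\<Omega>_def by (rule nn_integral_density) measurable
    also have "\<dots> = (\<integral>\<^sup>+x. ennreal (norm (?h (t, x))) \<partial>lborel)"
      by (rule nn_integral_cong) (auto split: split_indicator)
    finally show "(\<integral>\<^sup>+x. ennreal (norm (?h (t, x))) \<partial>lborel) = (\<integral>\<^sup>+x. ennreal \<bar>w (t, x)\<bar> \<partial>l\<Omega>)" by simp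
  qed
  finally have "integrable (lborel \<Otimes>\<^sub>M lborel) ?h" using h fin by (intro integrableI_bounded) auto
  then have ih: "integrable lborel ?h" by (simp add: lborel_prod)
  have "AE y in lborel. indicator (I \<times> \<Omega>) y *\<^sub>R v y = ?h y"
    using eq
  proof eventually_elim
    case (elim y)
    then show ?case using off[of "fst y" "snd y"] by (cases y) (auto split: split_indicator)
  qed
  then show ?thesis
    unfolding set_integrable_def using ih
    by (subst integrable_completion_AE[of _ ?h lborel]) auto
qed

end

context subordinate_feller
begin

text \<open>Off a null set of starting points the kernels miss both exceptional sets, and there the
  two expectations are \<open>hist\<close> and \<open>src\<close>. The term \<phi>' of
  \<open>sol\<close> is 0 at times in (0, T).\<close>

lemma feynman_kac_version:
  fixes f \<phi> :: "real \<Rightarrow> 'a \<Rightarrow> real" and f' \<phi>' :: "real \<times> 'a \<Rightarrow> real"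
  assumes proc: "\<And>x. x \<in> E \<Longrightarrow> feller_process M E P x (B x)"
    and ind: "\<And>x. x \<in> E \<Longrightarrow> independent_processes M (borel_compactification E) (B x) borel S"
    and f': "f' \<in> borel_measurable (borel \<Otimes>\<^sub>M borel)" "\<And>y. \<bar>f' y\<bar> \<le> C'" "\<And>y. y \<notin> {0<..<T} \<times> \<Omega> \<Longrightarrow> f' y = 0"
    and F: "F \<in> null_sets lborel" "\<And>s z. (s, z) \<in> {0<..<T} \<times> \<Omega> \<Longrightarrow> (s, z) \<notin> F \<Longrightarrow> f s z = f' (s, z)"
    and \<phi>': "\<phi>' \<in> borel_measurable (borel \<Otimes>\<^sub>M borel)" "\<And>y. \<bar>\<phi>' y\<bar> \<le> C" "\<And>y. y \<notin> {..<0} \<times> \<Omega> \<Longrightarrow> \<phi>' y = 0"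
    and N: "N \<in> null_sets lborel" "\<And>s z. (s, z) \<in> {..<0} \<times> \<Omega> \<Longrightarrow> (s, z) \<notin> N \<Longrightarrow> \<phi> s z = \<phi>' (s, z)"
  shows "AE w in lborel. w \<in> {0<..<T} \<times> \<Omega> \<longrightarrow>
    feynman_kac M T \<Omega> B S f \<phi> (fst w) (snd w) = sol T f' \<phi>' (fst w) (snd w)"
proof -
  have [measurable]: "F \<in> sets (borel \<Otimes>\<^sub>M borel)" "N \<in> sets (borel \<Otimes>\<^sub>M borel)"
    using null_setsD2[OF F(1)] null_setsD2[OF N(1)] unfolding borel_prod by simp_all
  have "AE w in lborel. w \<in> {0<..} \<times> \<Omega> \<longrightarrow> (\<integral>\<^sup>+y. \<integral>\<^sup>+z. indicator F (fst w - y, z) \<partial>kap y (snd w) \<partial>U) = 0"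
    by (rule null_source[unfolded AE_halfline_l\<Omega>]) (use null_set_l\<Omega>[OF F(1)] in auto)
  moreover have "AE w in lborel. w \<in> {0<..} \<times> \<Omega> \<longrightarrow>
    (\<integral>\<^sup>+\<omega>. \<integral>\<^sup>+z. indicator N (fst w - max 0 (overshoot (fst w) \<omega>), z) \<partial>kap (max 0 (overshoot (fst w) \<omega>)) (snd w) \<partial>M) = 0"
    by (rule null_history[unfolded AE_halfline_l\<Omega>]) (use null_set_l\<Omega>[OF N(1)] in auto)
  ultimately show ?thesis
  proof eventually_elim
    case (elim w)
    show ?case
    proof
      assume w: "w \<in> {0<..<T} \<times> \<Omega>"
      then have w0: "w \<in> {0<..} \<times> \<Omega>" and x: "snd w \<in> E" and t: "0 < fst w" using \<Omega>_subset by auto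
      interpret k: killed M \<nu> S \<Omega> E P "snd w" "B (snd w)"
        by unfold_locales (use x proc ind in auto)
      note null = elim(1)[rule_format, OF w0] elim(2)[rule_format, OF w0]
      have "\<phi>' w = 0" using w by (intro \<phi>'(3)) auto
      then have "sol T f' \<phi>' (fst w) (snd w) = hist \<phi>' (fst w) (snd w) + src f' (fst w) (snd w)"
        using w by (auto simp: sol_def)
      then show "feynman_kac M T \<Omega> B S f \<phi> (fst w) (snd w) = sol T f' \<phi>' (fst w) (snd w)"
        unfolding feynman_kac_def
        using k.fk_history[OF t \<phi>' _ N(2) null(2)] k.fk_source[OF f' _ F(2) null(1)] by simp
    qed
  qed
qed

end

section \<open>From Borel versions of the data back to u\<close>

theorem theorem4p11:
  fixes T :: real
    and \<nu> :: "real \<Rightarrow> real"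
    and \<Omega> E :: "'a::euclidean_space set"
    and P :: "real \<Rightarrow> ('a \<Rightarrow> real) \<Rightarrow> ('a \<Rightarrow> real)"
    and M :: "'w measure"
    and B :: "'a \<Rightarrow> real \<Rightarrow> 'w \<Rightarrow> 'a option"
    and S :: "real \<Rightarrow> 'w \<Rightarrow> real"
    and f \<phi> u :: "real \<Rightarrow> 'a \<Rightarrow> real"
  assumes "0 < T"
    and "H0 \<nu>"
    and "H1' \<Omega> E P"
    and "prob_space M"
    and "\<And>x. x \<in> E \<Longrightarrow> feller_process M E P x (B x)"
    and "levy_subordinator M \<nu> S"
    and "\<And>x. x \<in> E \<Longrightarrow> independent_processes M (borel_compactification E) (B x) borel S"
    and "f \<in> L_infty ({0<..<T} \<times> \<Omega>)"
    and "\<phi> \<in> L_infty ({..<0} \<times> \<Omega>)"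
    and "\<And>t x. 0 < t \<Longrightarrow> t < T \<Longrightarrow> x \<in> \<Omega> \<Longrightarrow> u t x = feynman_kac M T \<Omega> B S f \<phi> t x"
    and "\<And>t x. t < 0 \<Longrightarrow> x \<in> \<Omega> \<Longrightarrow> u t x = \<phi> t x"
  shows "weak_solution T \<nu> \<Omega> E P f \<phi> u"
proof -
  interpret subordinate_feller M \<nu> S \<Omega> E P
    using assms(2-4,6) by (intro subordinate_feller.intro subordinator.intro subordinator_axioms.intro feller.intro)
  have AB: "{0<..<T} \<times> \<Omega> \<in> sets borel" "{..<0::real} \<times> \<Omega> \<in> sets borel" and AT: "{..<T} \<times> \<Omega> \<in> sets borel"
    using open_\<Omega> by (auto intro!: borel_open open_Times)
  obtain f' C' F where f'b: "f' \<in> borel_measurable borel" and f': "\<And>y. \<bar>f' y\<bar> \<le> C'" "\<And>y. y \<notin> {0<..<T} \<times> \<Omega> \<Longrightarrow> f' y = 0"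
    and F: "F \<in> null_sets lborel" "\<And>s z. (s, z) \<in> {0<..<T} \<times> \<Omega> \<Longrightarrow> (s, z) \<notin> F \<Longrightarrow> f s z = f' (s, z)"
    using L_infty_borel_version[OF assms(8) AB(1)] by blast
  obtain \<phi>' C N where \<phi>'b: "\<phi>' \<in> borel_measurable borel" and \<phi>': "\<And>y. \<bar>\<phi>' y\<bar> \<le> C" "\<And>y. y \<notin> {..<0} \<times> \<Omega> \<Longrightarrow> \<phi>' y = 0"
    and N: "N \<in> null_sets lborel" "\<And>s z. (s, z) \<in> {..<0} \<times> \<Omega> \<Longrightarrow> (s, z) \<notin> N \<Longrightarrow> \<phi> s z = \<phi>' (s, z)"
    using L_infty_borel_version[OF assms(9) AB(2)] by blast
  have f'm[measurable]: "f' \<in> borel_measurable (borel \<Otimes>\<^sub>M borel)" and \<phi>'m[measurable]: "\<phi>' \<in> borel_measurable (borel \<Otimes>\<^sub>M borel)"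
    using f'b \<phi>'b by (simp_all add: borel_prod)
  note data = f'm f' \<phi>'m \<phi>'(1)
  note sol_measurable[OF data, measurable (raw)]
  have u: "AE w in lborel. w \<in> {..<T} \<times> \<Omega> \<longrightarrow> u (fst w) (snd w) = sol T f' \<phi>' (fst w) (snd w)"
  proof -
    have "AE w in lborel. w \<in> {0<..<T} \<times> \<Omega> \<longrightarrow>
      feynman_kac M T \<Omega> B S f \<phi> (fst w) (snd w) = sol T f' \<phi>' (fst w) (snd w)"
      by (rule feynman_kac_version[OF assms(5,7) f'm f' F \<phi>'m \<phi>' N])
    moreover have "AE w in lborel. w \<notin> N" using N(1) by (rule AE_not_in)
    \<comment> \<open>The hypotheses say nothing about u at time 0, so this slice is discarded as a
      null set.\<close>
    moreover have "AE w in (lborel :: (real \<times> 'a) measure). w \<notin> {0} \<times> UNIV"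
    proof (rule AE_not_in)
      have "emeasure (lborel \<Otimes>\<^sub>M lborel) ({0::real} \<times> (UNIV :: 'a set)) = 0"
        by (subst lborel.emeasure_pair_measure_Times) auto
      moreover have "{0::real} \<times> (UNIV :: 'a set) \<in> sets (lborel \<Otimes>\<^sub>M lborel)" by (rule pair_measureI) auto
      ultimately show "{0::real} \<times> (UNIV :: 'a set) \<in> null_sets lborel" by (simp only: null_sets_def lborel_prod mem_Collect_eq)
    qed
    ultimately show ?thesis
    proof eventually_elim
      case (elim w)
      obtain t x where w: "w = (t, x)" by force
      show ?case
        using elim assms(10)[of t x] assms(11)[of t x] N(2)[of t x] by (cases "t < 0") (auto simp: w sol_def)
    qed
  qed
  have solb: "(\<lambda>w. sol T f' \<phi>' (fst w) (snd w)) \<in> borel_measurable (borel \<Otimes>\<^sub>M borel)" by measurable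
  show ?thesis
    unfolding weak_solution_def Let_def
  proof (intro conjI ballI allI impI)
    have "AE w in lborel. indicator ({..<T} \<times> \<Omega>) w *\<^sub>R case_prod u w
      = indicator ({..<T} \<times> \<Omega>) w * sol T f' \<phi>' (fst w) (snd w)"
      using u by eventually_elim (auto split: split_indicator)
    moreover have "(\<lambda>w. indicator ({..<T} \<times> \<Omega>) w * sol T f' \<phi>' (fst w) (snd w)) \<in> borel_measurable lborel"
      using solb AT by (intro borel_measurable_times) (auto simp: borel_prod)
    ultimately have "set_borel_measurable lebesgue ({..<T} \<times> \<Omega>) (case_prod u)"
      unfolding set_borel_measurable_def by (rule borel_measurable_completion_AE)
    moreover have "AE w in lebesgue. case w of (t, x) \<Rightarrow> w \<in> {..<T} \<times> \<Omega> \<longrightarrow> \<bar>u t x\<bar> \<le> C + (C + C' * measure U {0..T})"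
      unfolding AE_completion_iff using u
    proof eventually_elim
      case (elim w)
      then show ?case using sol_bound[OF data, where t="fst w" and x="snd w"] by (auto simp: split_beta')
    qed
    ultimately show "u \<in> L_infty ({..<T} \<times> \<Omega>)" unfolding L_infty_def split_beta' prod.collapse by blast
    show "AE (t, x) in lebesgue. (t, x) \<in> {..<0} \<times> \<Omega> \<longrightarrow> u t x = \<phi> t x"
      using assms(11) by auto
  next
    fix p q assume p: "p \<in> C1c T" and "q \<in> Dom E P"
    then obtain g where "generator E P q g" by (auto simp: Dom_def)
    with p interpret test_product M \<nu> S \<Omega> E P T p q g by unfold_locales
    have [measurable]: "q \<in> borel_measurable borel" by (rule C_infty_borel[OF q_in])
    have am: "(\<lambda>w. sol T f' \<phi>' (fst w) (snd w) * act (fst w) 0 (snd w)) \<in> borel_measurable (borel \<Otimes>\<^sub>M borel)"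
      by measurable
    have ueq: "AE w in lborel. w \<in> {..<T} \<times> \<Omega> \<longrightarrow>
      u (fst w) (snd w) * act (fst w) 0 (snd w) = sol T f' \<phi>' (fst w) (snd w) * act (fst w) 0 (snd w)"
      using u by eventually_elim auto
    have feq: "AE w in lborel. w \<in> {0<..<T} \<times> \<Omega> \<longrightarrow> f (fst w) (snd w) * (p (fst w) * q (snd w)) = f' w * (p (fst w) * q (snd w))"
      using AE_not_in[OF F(1)] by eventually_elim (use F(2) in auto)
    show "set_integrable lborel {0<..} (\<lambda>r. (P r (\<lambda>x. p (t + r) * q x) x - p t * q x) * \<nu> r)" for t x
      by (rule H_star_act(2))
    show "set_integrable lebesgue ({..<T} \<times> \<Omega>) (\<lambda>(t, x). u t x * H_star \<nu> P (\<lambda>t x. p t * q x) t x)"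
      \<comment> \<open>With the operator written as \<open>act\<close>, the integrand has a jointly
        Borel version, and integrability reduces to \<open>sol_act_finite\<close>.\<close>
      unfolding H_star_act(1)
      by (rule integrable_version[OF am])
        (use ueq act_zero sol_act_finite[OF \<phi>'m \<phi>' f'm f'] in \<open>auto simp: split_beta'\<close>)
    have "(LINT t:{..<T}|lebesgue. LINT x:\<Omega>|lebesgue. u t x * act t 0 x) = (LINT t|lborel. LINT x|l\<Omega>. sol T f' \<phi>' t x * act t 0 x)"
      using iterated_integral_version[OF am, of "{..<T}" "\<lambda>t x. u t x * act t 0 x"] ueq act_zero by simp
    also have "\<dots> = - (LINT t|lborel. LINT x|l\<Omega>. f' (t, x) * (p t * q x))"
      by (rule weak_identity[OF \<phi>'m \<phi>' f'm f'])
    also have "(LINT t|lborel. LINT x|l\<Omega>. f' (t, x) * (p t * q x)) = (LINT t:{0<..<T}|lebesgue. LINT x:\<Omega>|lebesgue. f t x * (p t * q x))"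
      by (rule iterated_integral_version[symmetric, where w="\<lambda>w. f' w * (p (fst w) * q (snd w))", simplified])
        (use feq f'(2) in auto)
    finally show "(LINT t:{..<T}|lebesgue. LINT x:\<Omega>|lebesgue. u t x * H_star \<nu> P (\<lambda>t x. p t * q x) t x)
      = - (LINT t:{0<..<T}|lebesgue. LINT x:\<Omega>|lebesgue. f t x * (p t * q x))"
      unfolding H_star_act(1) .
  qed
qed

end
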